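(* Let $k$ be a Noetherian ring containing a field, let $R=k[x_1,\ldots,x_n]$ and let $I\subset R$ be an ideal. Set $A=R/I$ and let $\mathfrak p\in\operatorname{Spec}(A)$ be a minimal prime of $J_r:=J_r(A)$, the $(n-r)$-th Fitting ideal of $\Omega_{A/k}$. Suppose that at least one of the following conditions holds: 1) $I=\langle f_1,\ldots,f_r\rangle$ is generated by $r$ elements; 2) $k$ is regular, $I$ is radical and $r=\max\{\operatorname{ht}(P)\mid P\in\operatorname{Min}(I)\}$. Then the set $\operatorname{Leaps}_k(A_{\mathfrak p})$ is finite, of cardinality bounded by $\dim_K\bigl(\operatorname{Der}_k(A_{\mathfrak p})/\mathfrak p^M\operatorname{Der}_k(A_{\mathfrak p})\bigr)$, where $K$ is the residue field of $\mathfrak p$ and $M$ is the smallest positive integer such that $\mathfrak p^M\operatorname{Der}_k(A_{\mathfrak p})\subset\operatorname{IDer}_k(A_{\mathfrak p})$.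
   Context: All rings are commutative with unit. For a $k$-algebra $B$, $\operatorname{Der}_k(B)$ is the $B$-module of $k$-derivations $B\to B$. For $m\in\mathbb N_{\ge1}\cup\{\infty\}$, a Hasse-Schmidt derivation of $B$ over $k$ of length $m$ is a sequence $D=(D_0,D_1,\ldots,D_m)$ (an infinite sequence if $m=\infty$) of $k$-linear maps $D_\alpha:B\to B$ with $D_0=\mathrm{Id}_B$ and $D_\alpha(xy)=\sum_{i+j=\alpha}D_i(x)D_j(y)$ for all $x,y\in B$ and all $\alpha$. $\operatorname{IDer}_k(B;m)$ is the $B$-submodule of $\operatorname{Der}_k(B)$ of $m$-integrable derivations, i.e. those $\delta$ for which there is such a $D$ of length $m$ with $D_1=\delta$; $\operatorname{IDer}_k(B):=\operatorname{IDer}_k(B;\infty)$. $B$ has a leap at an integer $s>1$ if the inclusion $\operatorname{IDer}_k(B;s-1)\supsetneq\operatorname{IDer}_k(B;s)$ is proper; $\operatorname{Leaps}_k(B)$ is the set of leaps of $B$ over $k$. The $(n-r)$-th Fitting ideal $J_r(A)$ of $\Omega_{A/k}$ is the ideal of $A$ generated by the classes of the $r\times r$ minors of the Jacobian matrix $(\partial f_i/\partial x_j)$ of a set of generators of $I$ (zero if there are no such minors). $\operatorname{Min}(I)$ is the set of minimal primes of $I$. The module $\operatorname{Der}_k(A_{\mathfrak p})/\mathfrak p^M\operatorname{Der}_k(A_{\mathfrak p})$ is viewed as a $K$-vector space via a coefficient field, i.e. an isomorphic copy of $K=A_{\mathfrak p}/\mathfrak pA_{\mathfrak p}$ inside the complete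 local ring $A_{\mathfrak p}/\mathfrak p^MA_{\mathfrak p}$ (which exists since the ring contains a field). *)

theory Defs
  imports
    "HOL-Algebra.Ideal_Product"
    "HOL-Algebra.Ring_Divisibility"
    "HOL-Algebra.Subrings"
    "HOL-Library.Poly_Mapping"
    "HOL-Library.Extended_Nat"
    "Jordan_Normal_Form.Determinant"
    "Jordan_Normal_Form.VS_Connect"
begin

hide_const (open) Multiset.mult
hide_const (open) Polynomial.smult

section \<open>Algebras and derivations\<close>

text \<open>
  A \<open>k\<close>-algebra is a record of type \<open>module\<close> (as for the locale \<^locale>\<open>algebra\<close>), with
  \<open>smult\<close> the action of \<open>k\<close>.  Maps \<open>B \<rightarrow> B\<close> are required to be extensional on
  \<open>carrier B\<close>, so that equality of HOL functions is equality of maps.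
\<close>

definition algebra_of_hom :: "('c \<Rightarrow> 'b) \<Rightarrow> ('b, 'e) ring_scheme \<Rightarrow> ('c, 'b) module" where
  "algebra_of_hom \<phi> B =
     \<lparr>carrier = carrier B, mult = mult B, one = one B, zero = zero B, add = add B,
      smult = (\<lambda>c x. \<phi> c \<otimes>\<^bsub>B\<^esub> x)\<rparr>"

definition linear_endos ::
  "('c, 'd) ring_scheme \<Rightarrow> ('c, 'b, 'e) module_scheme \<Rightarrow> ('b \<Rightarrow> 'b) set" where
  "linear_endos k B = module_hom k B B \<inter> extensional (carrier B)"

definition Der :: "('c, 'd) ring_scheme \<Rightarrow> ('c, 'b, 'e) module_scheme \<Rightarrow> ('b \<Rightarrow> 'b) set" where
  "Der k B = {\<delta> \<in> linear_endos k B. \<forall>x\<in>carrier B. \<forall>y\<in>carrier B.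
     \<delta> (x \<otimes>\<^bsub>B\<^esub> y) = x \<otimes>\<^bsub>B\<^esub> \<delta> y \<oplus>\<^bsub>B\<^esub> y \<otimes>\<^bsub>B\<^esub> \<delta> x}"

definition Der_module ::
  "('c, 'd) ring_scheme \<Rightarrow> ('c, 'b, 'e) module_scheme \<Rightarrow> ('b, 'b \<Rightarrow> 'b) module" where
  "Der_module k B = (ring.func_space B (carrier B))\<lparr>carrier := Der k B\<rparr>"

text \<open>
  A Hasse-Schmidt derivation of finite length \<open>m\<close> only constrains \<open>D 0, \<dots>, D m\<close>; the
  remaining values of \<open>D\<close> are irrelevant.
\<close>

definition hasse_schmidt ::
  "('c, 'd) ring_scheme \<Rightarrow> ('c, 'b, 'e) module_scheme \<Rightarrow> enat \<Rightarrow> (nat \<Rightarrow> 'b \<Rightarrow> 'b) \<Rightarrow> bool" where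
  "hasse_schmidt k B m D \<longleftrightarrow>
     D 0 = (\<lambda>x\<in>carrier B. x) \<and>
     (\<forall>i. enat i \<le> m \<longrightarrow> D i \<in> linear_endos k B \<and>
        (\<forall>x\<in>carrier B. \<forall>y\<in>carrier B.
           D i (x \<otimes>\<^bsub>B\<^esub> y) = (\<Oplus>\<^bsub>B\<^esub>j\<in>{..i}. D j x \<otimes>\<^bsub>B\<^esub> D (i - j) y)))"

definition IDer ::
  "('c, 'd) ring_scheme \<Rightarrow> ('c, 'b, 'e) module_scheme \<Rightarrow> enat \<Rightarrow> ('b \<Rightarrow> 'b) set" where
  "IDer k B m = {\<delta> \<in> Der k B. \<exists>D. hasse_schmidt k B m D \<and> D 1 = \<delta>}"

definition Leaps :: "('c, 'd) ring_scheme \<Rightarrow> ('c, 'b, 'e) module_scheme \<Rightarrow> nat set" where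
  "Leaps k B = {s. 1 < s \<and> IDer k B (enat s) \<subset> IDer k B (enat (s - 1))}"


section \<open>Localization\<close>

text \<open>The fraction \<open>a / s\<close>, as the class of all pairs equivalent to \<open>(a, s)\<close>.\<close>

definition fraction :: "('a, 'e) ring_scheme \<Rightarrow> 'a set \<Rightarrow> 'a \<Rightarrow> 'a \<Rightarrow> ('a \<times> 'a) set" where
  "fraction A S a s = {(b, t). b \<in> carrier A \<and> t \<in> S \<and>
     (\<exists>u\<in>S. u \<otimes>\<^bsub>A\<^esub> (t \<otimes>\<^bsub>A\<^esub> a) = u \<otimes>\<^bsub>A\<^esub> (s \<otimes>\<^bsub>A\<^esub> b))}"

text \<open>
  As in \<^const>\<open>rcoset_mult\<close>, the operations take a union over all representatives; all the
  sets in the union coincide.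
\<close>

definition localization :: "('a, 'e) ring_scheme \<Rightarrow> 'a set \<Rightarrow> ('a \<times> 'a) set ring" where
  "localization A S =
     \<lparr>carrier = {fraction A S a s |a s. a \<in> carrier A \<and> s \<in> S},
      mult = (\<lambda>X Y. \<Union>(a, s)\<in>X. \<Union>(b, t)\<in>Y. fraction A S (a \<otimes>\<^bsub>A\<^esub> b) (s \<otimes>\<^bsub>A\<^esub> t)),
      one = fraction A S \<one>\<^bsub>A\<^esub> \<one>\<^bsub>A\<^esub>,
      zero = fraction A S \<zero>\<^bsub>A\<^esub> \<one>\<^bsub>A\<^esub>,
      add = (\<lambda>X Y. \<Union>(a, s)\<in>X. \<Union>(b, t)\<in>Y.
        fraction A S (t \<otimes>\<^bsub>A\<^esub> a \<oplus>\<^bsub>A\<^esub> s \<otimes>\<^bsub>A\<^esub> b) (s \<otimes>\<^bsub>A\<^esub> t))\<rparr>"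

definition loc_max_ideal :: "('a, 'e) ring_scheme \<Rightarrow> 'a set \<Rightarrow> ('a \<times> 'a) set set" where
  "loc_max_ideal A p = {fraction A (carrier A - p) a s |a s. a \<in> p \<and> s \<in> carrier A - p}"

definition loc_algebra ::
  "('c, 'a, 'e) module_scheme \<Rightarrow> 'a set \<Rightarrow> ('c, ('a \<times> 'a) set) module" where
  "loc_algebra A p =
     algebra_of_hom (\<lambda>c. fraction A (carrier A - p) (c \<odot>\<^bsub>A\<^esub> \<one>\<^bsub>A\<^esub>) \<one>\<^bsub>A\<^esub>)
       (localization A (carrier A - p))"


section \<open>Minimal primes, height, regularity\<close>

definition min_primes :: "('a, 'e) ring_scheme \<Rightarrow> 'a set \<Rightarrow> 'a set set" where
  "min_primes R J = {P. primeideal P R \<and> J \<subseteq> P \<and>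
     (\<forall>Q. primeideal Q R \<and> J \<subseteq> Q \<and> Q \<subseteq> P \<longrightarrow> Q = P)}"

definition radical_ideal :: "'a set \<Rightarrow> ('a, 'e) ring_scheme \<Rightarrow> bool" where
  "radical_ideal J R \<longleftrightarrow> ideal J R \<and> (\<forall>a\<in>carrier R. \<forall>m::nat. a [^]\<^bsub>R\<^esub> m \<in> J \<longrightarrow> a \<in> J)"

definition height :: "('a, 'e) ring_scheme \<Rightarrow> 'a set \<Rightarrow> enat" where
  "height R P = Sup {enat l |l. \<exists>c. (\<forall>i\<le>l. primeideal (c i) R) \<and>
     (\<forall>i<l. c i \<subset> c (Suc i)) \<and> c l = P}"

definition krull_dim :: "('a, 'e) ring_scheme \<Rightarrow> enat" where
  "krull_dim R = (SUP P\<in>{P. primeideal P R}. height R P)"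

definition regular_local_ring :: "('a, 'e) ring_scheme \<Rightarrow> bool" where
  "regular_local_ring R \<longleftrightarrow> cring R \<and> noetherian_ring R \<and>
     (\<exists>m. (\<forall>J. maximalideal J R \<longleftrightarrow> J = m) \<and>
        (\<exists>X. finite X \<and> X \<subseteq> carrier R \<and> m = Idl\<^bsub>R\<^esub> X \<and> enat (card X) = krull_dim R))"

definition regular_ring :: "('a, 'e) ring_scheme \<Rightarrow> bool" where
  "regular_ring R \<longleftrightarrow> cring R \<and> noetherian_ring R \<and>
     (\<forall>P. primeideal P R \<longrightarrow> regular_local_ring (localization R (carrier R - P)))"


section \<open>Polynomial rings and Jacobian ideals\<close>

text \<open>Polynomials over \<open>k\<close>: monomials are exponent vectors indexed by the variables
  \<open>x\<^sub>0, x\<^sub>1, \<dots>\<close>; only the first \<open>n\<close> variables are allowed in \<open>mpoly_ring n\<close>.\<close>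

type_synonym 'k mpoly = "(nat \<Rightarrow>\<^sub>0 nat) \<Rightarrow>\<^sub>0 'k"

definition mpoly_ring :: "nat \<Rightarrow> 'k::comm_ring_1 mpoly ring" where
  "mpoly_ring n = class_ring\<lparr>carrier := {f. \<forall>m\<in>Poly_Mapping.keys f. Poly_Mapping.keys m \<subseteq> {..<n}}\<rparr>"

definition mpoly_quot_algebra ::
  "nat \<Rightarrow> 'k::comm_ring_1 mpoly set \<Rightarrow> ('k, 'k mpoly set) module" where
  "mpoly_quot_algebra n I =
     algebra_of_hom (\<lambda>c. I +>\<^bsub>mpoly_ring n\<^esub> Poly_Mapping.single 0 c) (mpoly_ring n Quot I)"

definition mpoly_pderiv :: "nat \<Rightarrow> 'k::comm_ring_1 mpoly \<Rightarrow> 'k mpoly" where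
  "mpoly_pderiv j f = (\<Sum>m\<in>Poly_Mapping.keys f.
     Poly_Mapping.single (m - Poly_Mapping.single j 1) (of_nat (Poly_Mapping.lookup m j) * Poly_Mapping.lookup f m))"

definition jacobian_minors :: "nat \<Rightarrow> nat \<Rightarrow> 'k::comm_ring_1 mpoly set \<Rightarrow> 'k mpoly set" where
  "jacobian_minors n r F =
     {det (mat r r (\<lambda>(i, j). mpoly_pderiv (c j) (f i))) |f c.
        inj_on f {..<r} \<and> f ` {..<r} \<subseteq> F \<and> inj_on c {..<r} \<and> c ` {..<r} \<subseteq> {..<n}}"

text \<open>The ideal \<open>J\<^sub>r\<close> of \<open>k[x] / I\<close>, computed from a set \<open>F\<close> of generators of \<open>I\<close>.  It
  is the \<open>(n - r)\<close>-th Fitting ideal of the module of differentials, hence independent of \<open>F\<close>.\<close>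

definition jacobian_ideal ::
  "nat \<Rightarrow> nat \<Rightarrow> 'k::comm_ring_1 mpoly set \<Rightarrow> 'k mpoly set \<Rightarrow> 'k mpoly set set" where
  "jacobian_ideal n r I F = Idl\<^bsub>mpoly_ring n Quot I\<^esub>
     ((\<lambda>g. I +>\<^bsub>mpoly_ring n\<^esub> g) ` jacobian_minors n r F)"


section \<open>Quotient modules over a coefficient field\<close>

definition ideal_smult ::
  "('b, 'd) ring_scheme \<Rightarrow> 'b set \<Rightarrow> ('b, 'v, 'e) module_scheme \<Rightarrow> 'v set" where
  "ideal_smult B J V =
     LinearCombinations.module.span B V {a \<odot>\<^bsub>V\<^esub> v |a v. a \<in> J \<and> v \<in> carrier V}"

text \<open>\<open>V / JV\<close> as a module over \<open>B / J\<close>.\<close>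

definition quot_module ::
  "('b, 'd) ring_scheme \<Rightarrow> 'b set \<Rightarrow> ('b, 'v, 'e) module_scheme \<Rightarrow> ('b set, 'v set) module" where
  "quot_module B J V = (let N = ideal_smult B J V in
     \<lparr>carrier = a_rcosets\<^bsub>V\<^esub> N, mult = undefined, one = undefined, zero = N, add = set_add V,
      smult = (\<lambda>X Y. \<Union>a\<in>X. \<Union>v\<in>Y. N +>\<^bsub>V\<^esub> (a \<odot>\<^bsub>V\<^esub> v))\<rparr>)"

text \<open>
  For a local ring \<open>B\<close> with maximal ideal \<open>m\<close> and an ideal \<open>J \<subseteq> m\<close>: \<open>L\<close> is a subfield of
  \<open>B / J\<close> which the canonical map \<open>B / J \<rightarrow> B / m\<close>, sending \<open>X = J + x\<close> to \<open>m + X = m + x\<close>,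
  maps isomorphically onto the residue field.
\<close>

definition coefficient_field ::
  "('b, 'd) ring_scheme \<Rightarrow> 'b set \<Rightarrow> 'b set \<Rightarrow> 'b set set \<Rightarrow> bool" where
  "coefficient_field B m J L \<longleftrightarrow> subfield L (B Quot J) \<and>
     bij_betw (\<lambda>X. m <+>\<^bsub>B\<^esub> X) L (carrier (B Quot m))"

end

theory Submission
  imports Defs "HOL-Computational_Algebra.Formal_Power_Series"
begin

text \<open>Write \<open>B\<close> for the local ring \<open>A\<^sub>p\<close>, \<open>R\<close> for the polynomial ring and \<open>\<theta>\<close> for the map \<open>R \<rightarrow> B\<close>. The
  theorem has an integrability half and a linear algebra half.

  Integrability. Let \<open>\<Delta>\<close> be an \<open>r \<times> r\<close> minor of the Jacobian matrix of \<open>g\<^sub>1, \<dots>, g\<^sub>r \<in> I\<close>. Each of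
  the two hypotheses yields a conormal inclusion \<open>\<Delta>\<^sup>N I \<subseteq> (g) + I\<^sup>2\<close>. If \<open>I\<close> has \<open>r\<close> generators,
  \<open>N = 1\<close> works, by the adjugate of the matrix that expresses \<open>g\<close> in the generators
  (\<open>conormal_complete_intersection\<close>). If \<open>k\<close> is regular, so is \<open>R\<close> at each of its primes; where
  \<open>\<Delta>\<close> is invertible the \<open>g\<^sub>i\<close> are part of a regular system of parameters, generate locally a prime
  of height at least \<open>r\<close>, and this prime has to be the minimal prime of \<open>I\<close> below
  (\<open>conormal_regular\<close>). Given the inclusion, a derivation \<open>d\<close> of \<open>R\<close> with \<open>d(I) \<subseteq> I\<close> becomes
  integrable modulo \<open>I\<close> after multiplication by a power \<open>\<Delta>\<^sup>2\<^sup>e\<close> that does not depend on \<open>d\<close>: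
  Newton's method solves \<open>g(x + \<Delta>\<^sup>e U(t)) \<in> I[[t]]\<close> for a power series \<open>U\<close> with first-order term
  \<open>\<Delta>\<^sup>e d\<close> (\<open>newton_solution\<close>), and the conormal inclusion carries this from the \<open>g\<^sub>i\<close> to all of
  \<open>I\<close> (\<open>integrate_multiple\<close>). Up to a unit each derivation of \<open>B\<close> comes from such a \<open>d\<close>, and the
  substitution passes to a ring homomorphism \<open>B \<rightarrow> B[[t]]\<close>, which is the same as a Hasse-Schmidt
  derivation of infinite length. Hence the elements \<open>b\<close> of \<open>B\<close> for which \<open>b Der(B)\<close> consists of
  integrable derivations form an ideal that contains a power of each minor. As \<open>p\<close> is minimal over
  the ideal of the minors, the maximal ideal of \<open>B\<close> is the only prime above it, and a power of the
  maximal ideal lies in it.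

  Linear algebra. All the modules \<open>IDer(B; s)\<close> lie between \<open>p\<^sup>M Der(B)\<close> and the finitely generated
  module \<open>Der(B)\<close>, and the quotient of these two has finite length. So the decreasing chain of the
  \<open>IDer(B; s)\<close> has finitely many steps (\<open>finite_jumps\<close>). Choosing at each leap \<open>s\<close> a derivation in
  \<open>IDer(B; s - 1)\<close> outside \<open>IDer(B; s)\<close> gives classes in \<open>Der(B) / p\<^sup>M Der(B)\<close> that are linearly
  independent over any coefficient field: in a nontrivial relation the term with the smallest leap
  would lie in \<open>IDer(B; s)\<close> (\<open>card_jumps_le_dim\<close>).

  The dimension theory of regular rings is carried out with chains of primes and generators up to
  denominators. Its core is \<open>prime_between_through\<close>, a form of Krull's principal ideal theorem,
  which allows one to move a given element into lower members of a chain of primes.\<close>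

hide_const (open) Multiset.mult
hide_const (open) Polynomial.smult

section \<open>Noetherian rings: maximal ideals in families, primes, radicals\<close>

lemma (in noetherian_ring) ideal_family_has_maximal:
  assumes "\<C> \<noteq> {}" and "\<And>I. I \<in> \<C> \<Longrightarrow> ideal I R"
  shows "\<exists>M\<in>\<C>. \<forall>I\<in>\<C>. M \<subseteq> I \<longrightarrow> I = M"
proof (rule subset_Zorn)
  fix C assume C: "subset.chain \<C> C"
  show "\<exists>U\<in>\<C>. \<forall>X\<in>C. X \<subseteq> U"
  proof (cases "C = {}")
    case True
    then show ?thesis using assms(1) by auto
  next
    case False
    have "subset.chain {I. ideal I R} C" using C assms(2) unfolding pred_on.chain_def by auto
    then have "\<Union>C \<in> C" using ideal_chain_is_trivial False by simp
    then show ?thesis using C unfolding pred_on.chain_def by (meson Union_upper subsetD)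
  qed
qed

locale noetherian_cring = noetherian_ring + cring

lemma (in cring) ideal_of_closed:
  assumes J: "J \<subseteq> carrier R" "\<zero> \<in> J" "\<And>a b. a \<in> J \<Longrightarrow> b \<in> J \<Longrightarrow> a \<oplus> b \<in> J"
    "\<And>r a. r \<in> carrier R \<Longrightarrow> a \<in> J \<Longrightarrow> r \<otimes> a \<in> J"
  shows "ideal J R"
proof (rule idealI)
  show "ring R" ..
  show "subgroup J (add_monoid R)"
  proof (rule group.subgroupI[OF a_group])
    fix a assume a: "a \<in> J"
    then have "(\<ominus> \<one>) \<otimes> a = \<ominus> a" using J(1) by (auto simp: l_minus)
    then show "inv\<^bsub>add_monoid R\<^esub> a \<in> J" using J(4)[OF _ a, of "\<ominus> \<one>"] by (simp add: a_inv_def[symmetric])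
  qed (use J in auto)
  fix a x assume a: "a \<in> J" and x: "x \<in> carrier R"
  show "x \<otimes> a \<in> J" by (rule J(4)[OF x a])
  then show "a \<otimes> x \<in> J" using a x J(1) m_comm[of a x] by auto
qed

definition (in ring) adjoin :: "'a set \<Rightarrow> 'a \<Rightarrow> 'a set" where
  "adjoin M a = {m \<oplus> r \<otimes> a |m r. m \<in> M \<and> r \<in> carrier R}"

lemma (in cring) adjoin_ideal:
  assumes M: "ideal M R" and a: "a \<in> carrier R"
  shows "ideal (adjoin M a) R"
proof (rule ideal_of_closed)
  interpret M: ideal M R by fact
  show "adjoin M a \<subseteq> carrier R" using a M.Icarr by (auto simp: adjoin_def)
  have "\<zero> = \<zero> \<oplus> \<zero> \<otimes> a" using a by simp
  then show "\<zero> \<in> adjoin M a" using M.zero_closed zero_closed unfolding adjoin_def by blast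
  fix x y assume "x \<in> adjoin M a" "y \<in> adjoin M a"
  then obtain m r m' r' where x: "x = m \<oplus> r \<otimes> a" "m \<in> M" "r \<in> carrier R"
    and y: "y = m' \<oplus> r' \<otimes> a" "m' \<in> M" "r' \<in> carrier R" by (auto simp: adjoin_def)
  have "x \<oplus> y = (m \<oplus> m') \<oplus> (r \<oplus> r') \<otimes> a" using x(2,3) y(2,3) a M.Icarr unfolding x(1) y(1) by algebra
  moreover have "m \<oplus> m' \<in> M" "r \<oplus> r' \<in> carrier R" using x y by auto
  ultimately show "x \<oplus> y \<in> adjoin M a" unfolding adjoin_def by auto
next
  interpret M: ideal M R by fact
  fix s x assume "x \<in> adjoin M a" and s: "s \<in> carrier R"
  then obtain m r where x: "x = m \<oplus> r \<otimes> a" "m \<in> M" "r \<in> carrier R" by (auto simp: adjoin_def)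
  have "s \<otimes> x = (s \<otimes> m) \<oplus> (s \<otimes> r) \<otimes> a" using x(2,3) s a M.Icarr unfolding x(1) by algebra
  moreover have "s \<otimes> m \<in> M" "s \<otimes> r \<in> carrier R" using x s M.I_l_closed by auto
  ultimately show "s \<otimes> x \<in> adjoin M a" unfolding adjoin_def by blast
qed

lemma (in cring) adjoin_upper:
  assumes M: "ideal M R" and a: "a \<in> carrier R"
  shows "M \<subseteq> adjoin M a" "a \<in> adjoin M a"
proof -
  interpret M: ideal M R by fact
  show "M \<subseteq> adjoin M a"
  proof
    fix m assume "m \<in> M"
    moreover from this have "m = m \<oplus> \<zero> \<otimes> a" using M.Icarr a by simp
    ultimately show "m \<in> adjoin M a" unfolding adjoin_def by blast
  qed
  have "a = \<zero> \<oplus> \<one> \<otimes> a" using a by simp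
  then show "a \<in> adjoin M a" using M.zero_closed unfolding adjoin_def by blast
qed

text \<open>An ideal that is maximal among those above \<open>J\<close> and disjoint from \<open>S\<close> is prime.\<close>

lemma (in noetherian_cring) prime_avoiding_multiplicative_set:
  assumes J: "ideal J R" and S: "S \<subseteq> carrier R" "\<one> \<in> S" "\<And>a b. a \<in> S \<Longrightarrow> b \<in> S \<Longrightarrow> a \<otimes> b \<in> S"
    and disj: "J \<inter> S = {}"
  shows "\<exists>P. primeideal P R \<and> J \<subseteq> P \<and> P \<inter> S = {}"
proof -
  define \<C> where "\<C> = {I. ideal I R \<and> J \<subseteq> I \<and> I \<inter> S = {}}"
  have "\<C> \<noteq> {}" using J disj unfolding \<C>_def by auto
  moreover have "ideal I R" if "I \<in> \<C>" for I using that by (simp add: \<C>_def)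
  ultimately have "\<exists>M\<in>\<C>. \<forall>I\<in>\<C>. M \<subseteq> I \<longrightarrow> I = M" by (rule ideal_family_has_maximal)
  then obtain M where M: "M \<in> \<C>" and max: "\<And>I. I \<in> \<C> \<Longrightarrow> M \<subseteq> I \<Longrightarrow> I = M" by blast
  interpret M: ideal M R using M by (auto simp: \<C>_def)
  have MJ: "J \<subseteq> M" and MS: "M \<inter> S = {}" using M by (auto simp: \<C>_def)
  have meets: "\<exists>s\<in>S. s \<in> adjoin M a" if a: "a \<in> carrier R" "a \<notin> M" for a
  proof (rule ccontr)
    assume "\<not> ?thesis"
    then have "adjoin M a \<in> \<C>"
      using adjoin_ideal[OF M.ideal_axioms a(1)] adjoin_upper[OF M.ideal_axioms a(1)] MJ
      unfolding \<C>_def by auto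
    then show False using max adjoin_upper[OF M.ideal_axioms a(1)] a(2) by blast
  qed
  have "primeideal M R"
  proof (rule primeidealI)
    show "ideal M R" by (rule M.ideal_axioms)
    show "cring R" ..
    show "carrier R \<noteq> M" using S(2) MS by auto
    fix a b assume a: "a \<in> carrier R" and b: "b \<in> carrier R" and ab: "a \<otimes> b \<in> M"
    show "a \<in> M \<or> b \<in> M"
    proof (rule ccontr)
      assume "\<not> ?thesis"
      then obtain s t where s: "s \<in> S" "s \<in> adjoin M a" and t: "t \<in> S" "t \<in> adjoin M b" using meets a b by meson
      obtain m r m' r' where x: "s = m \<oplus> r \<otimes> a" "m \<in> M" "r \<in> carrier R"
        and y: "t = m' \<oplus> r' \<otimes> b" "m' \<in> M" "r' \<in> carrier R" using s t by (auto simp: adjoin_def)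
      have "s \<otimes> t = m \<otimes> (m' \<oplus> r' \<otimes> b) \<oplus> ((r \<otimes> a) \<otimes> m' \<oplus> (r \<otimes> r') \<otimes> (a \<otimes> b))"
        using x(2,3) y(2,3) a b M.Icarr unfolding x(1) y(1) by algebra
      also have "\<dots> \<in> M" using x(2,3) y(2,3) a b M.Icarr ab by (simp add: M.a_closed M.I_r_closed M.I_l_closed)
      finally show False using S(3) s t MS by auto
    qed
  qed
  then show ?thesis using MJ MS by auto
qed

text \<open>Otherwise some prime above \<open>J\<close> would avoid the powers of \<open>y\<close>.\<close>

lemma (in noetherian_cring) power_mem_of_mem_all_primes:
  assumes J: "ideal J R" and y: "y \<in> carrier R"
    and all: "\<And>P. primeideal P R \<Longrightarrow> J \<subseteq> P \<Longrightarrow> y \<in> P"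
  shows "\<exists>n::nat. y [^] n \<in> J"
proof (rule ccontr)
  assume neg: "\<not> ?thesis"
  define S where "S = range (\<lambda>n::nat. y [^] n)"
  have "\<exists>P. primeideal P R \<and> J \<subseteq> P \<and> P \<inter> S = {}"
  proof (rule prime_avoiding_multiplicative_set[OF J])
    show "S \<subseteq> carrier R" using y by (auto simp: S_def)
    show "\<one> \<in> S" by (auto simp: S_def intro: range_eqI[of _ _ 0])
    show "a \<otimes> b \<in> S" if "a \<in> S" "b \<in> S" for a b using that y by (auto simp: S_def nat_pow_mult)
    show "J \<inter> S = {}" using neg by (auto simp: S_def)
  qed
  moreover have "y \<in> S" using y by (auto simp: S_def intro: range_eqI[of _ _ 1])
  ultimately show False using all by blast
qed

definition (in ring) prime_cover :: "'a set \<Rightarrow> 'a set set \<Rightarrow> bool" where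
  "prime_cover J \<P> \<longleftrightarrow> finite \<P> \<and> (\<forall>P\<in>\<P>. primeideal P R \<and> J \<subseteq> P) \<and>
     (\<forall>Q. primeideal Q R \<longrightarrow> J \<subseteq> Q \<longrightarrow> (\<exists>P\<in>\<P>. P \<subseteq> Q))"

lemma (in ring) prime_coverD:
  assumes "prime_cover J \<P>"
  shows "finite \<P>" "\<And>P. P \<in> \<P> \<Longrightarrow> primeideal P R" "\<And>P. P \<in> \<P> \<Longrightarrow> J \<subseteq> P"
    "\<And>Q. primeideal Q R \<Longrightarrow> J \<subseteq> Q \<Longrightarrow> \<exists>P\<in>\<P>. P \<subseteq> Q" using assms unfolding prime_cover_def by simp_all

text \<open>Noetherian induction. A maximal ideal without a cover is not prime, so it contains a product \<open>a
  b\<close> of two elements outside it; adjoining \<open>a\<close> or \<open>b\<close> gives larger ideals, and the union of their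
  covers is a cover.\<close>

lemma (in noetherian_cring) exists_prime_cover:
  assumes "ideal J R"
  shows "\<exists>\<P>. prime_cover J \<P>"
proof (rule ccontr)
  assume bad: "\<not> ?thesis"
  define \<C> where "\<C> = {I. ideal I R \<and> (\<nexists>\<P>. prime_cover I \<P>)}"
  have "\<C> \<noteq> {}" using assms bad unfolding \<C>_def by blast
  moreover have "ideal I R" if "I \<in> \<C>" for I using that by (simp add: \<C>_def)
  ultimately have "\<exists>M\<in>\<C>. \<forall>I\<in>\<C>. M \<subseteq> I \<longrightarrow> I = M" by (rule ideal_family_has_maximal)
  then obtain M where M: "M \<in> \<C>" and max: "\<And>I. I \<in> \<C> \<Longrightarrow> M \<subseteq> I \<Longrightarrow> I = M" by blast
  have MI: "ideal M R" and Mbad: "\<nexists>\<P>. prime_cover M \<P>" using M by (auto simp: \<C>_def)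
  interpret M: ideal M R by (rule MI)
  have "carrier R \<noteq> M"
  proof
    assume M_all: "carrier R = M"
    have "\<not> M \<subseteq> Q" if "primeideal Q R" for Q
    proof
      interpret Q: primeideal Q R by fact
      assume "M \<subseteq> Q"
      then show False using M_all Q.I_notcarr Q.Icarr by blast
    qed
    then have "prime_cover M {}" unfolding prime_cover_def by simp
    then show False using Mbad by simp
  qed
  moreover have "\<not> primeideal M R"
  proof
    assume "primeideal M R"
    then have "prime_cover M {M}" unfolding prime_cover_def by simp
    then show False using Mbad by simp
  qed
  ultimately obtain a b where ab: "a \<in> carrier R" "b \<in> carrier R" "a \<otimes> b \<in> M" "a \<notin> M" "b \<notin> M"
    using primeidealI[OF MI is_cring] by blast
  have good: "\<exists>\<P>. prime_cover (adjoin M c) \<P>" if "c \<in> carrier R" "c \<notin> M" for c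
    using max[of "adjoin M c"] adjoin_ideal[OF MI that(1)] adjoin_upper[OF MI that(1)] that(2)
    unfolding \<C>_def by blast
  obtain \<A> \<B> where \<A>: "prime_cover (adjoin M a) \<A>" and \<B>: "prime_cover (adjoin M b) \<B>" using good ab by meson
  note dA = prime_coverD[OF \<A>] and dB = prime_coverD[OF \<B>]
  have sub: "adjoin M c \<subseteq> Q" if Q: "primeideal Q R" "M \<subseteq> Q" and c: "c \<in> Q" for c Q
  proof -
    interpret Q: primeideal Q R by fact
    show ?thesis unfolding adjoin_def using Q.I_l_closed c Q(2) Q.a_closed by blast
  qed
  have "prime_cover M (\<A> \<union> \<B>)" unfolding prime_cover_def
  proof (intro conjI ballI allI impI)
    show "finite (\<A> \<union> \<B>)" using dA(1) dB(1) by simp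
  next
    fix Q assume Q: "primeideal Q R" "M \<subseteq> Q"
    then have "a \<in> Q \<or> b \<in> Q" using primeideal.I_prime[OF Q(1) ab(1,2)] ab(3) by blast
    then show "\<exists>P\<in>\<A> \<union> \<B>. P \<subseteq> Q" using sub[OF Q, of a] sub[OF Q, of b] dA(4)[OF Q(1)] dB(4)[OF Q(1)] by blast
  next
    fix P assume P: "P \<in> \<A> \<union> \<B>"
    then show "primeideal P R" using dA(2) dB(2) by blast
    show "M \<subseteq> P" using P dA(3) dB(3) adjoin_upper(1)[OF MI ab(1)] adjoin_upper(1)[OF MI ab(2)] by blast
  qed
  then show False using Mbad by blast
qed

lemma (in noetherian_cring) finite_min_primes:
  assumes "ideal J R" shows "finite (min_primes R J)"
proof -
  obtain \<P> where \<P>: "prime_cover J \<P>" using exists_prime_cover[OF assms] by blast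
  note d = prime_coverD[OF \<P>]
  have "Q \<in> \<P>" if Q: "Q \<in> min_primes R J" for Q
  proof -
    have "primeideal Q R" "J \<subseteq> Q" and min: "\<And>P. primeideal P R \<Longrightarrow> J \<subseteq> P \<Longrightarrow> P \<subseteq> Q \<Longrightarrow> P = Q"
      using Q unfolding min_primes_def by simp_all
    then obtain P where "P \<in> \<P>" "P \<subseteq> Q" using d(4) by blast
    then show ?thesis using min[of P] d(2,3) by metis
  qed
  then show ?thesis using d(1) finite_subset[of "min_primes R J" \<P>] by blast
qed

lemma (in noetherian_cring) minimal_prime_below:
  assumes J: "ideal J R" and Q: "primeideal Q R" "J \<subseteq> Q"
  shows "\<exists>P\<in>min_primes R J. P \<subseteq> Q"
proof -
  obtain \<P> where \<P>: "prime_cover J \<P>" using exists_prime_cover[OF J] by blast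
  note d = prime_coverD[OF \<P>]
  let ?S = "{P \<in> \<P>. P \<subseteq> Q}"
  have "finite ?S" "?S \<noteq> {}" using d(1) d(4)[OF Q] by auto
  then obtain P where P: "P \<in> ?S" "\<And>P'. P' \<in> ?S \<Longrightarrow> P' \<subseteq> P \<Longrightarrow> P = P'" using finite_has_minimal[of ?S] by meson
  have "Q' = P" if Q': "primeideal Q' R" "J \<subseteq> Q'" "Q' \<subseteq> P" for Q'
  proof -
    obtain P' where P': "P' \<in> \<P>" "P' \<subseteq> Q'" using d(4)[OF Q'(1,2)] by blast
    then have "P = P'" using P(2)[of P'] P(1) Q'(3) by auto
    then show ?thesis using P' Q' by auto
  qed
  moreover have "primeideal P R" "J \<subseteq> P" "P \<subseteq> Q" using P(1) d(2,3) by auto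
  ultimately show ?thesis unfolding min_primes_def by auto
qed

section \<open>Local composition series\<close>

text \<open>Submodules of the localization \<open>M\<^sub>Q\<close> correspond to submodules of \<open>M\<close> from which elements outside
  \<open>Q\<close> can be cancelled. Working with the latter avoids forming \<open>M\<^sub>Q\<close>.\<close>

locale module_at_prime = module R M + Q: primeideal Q R for R (structure) and M (structure) and Q
begin

definition local_submodule :: "'c set \<Rightarrow> bool" where
  "local_submodule N \<longleftrightarrow> N \<subseteq> carrier M \<and> \<zero>\<^bsub>M\<^esub> \<in> N \<and>
     (\<forall>v\<in>N. \<forall>w\<in>N. v \<oplus>\<^bsub>M\<^esub> w \<in> N) \<and> (\<forall>a\<in>carrier R. \<forall>v\<in>N. a \<odot>\<^bsub>M\<^esub> v \<in> N) \<and>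
     (\<forall>s\<in>carrier R - Q. \<forall>v\<in>carrier M. s \<odot>\<^bsub>M\<^esub> v \<in> N \<longrightarrow> v \<in> N)"

text \<open>The saturated submodule that corresponds to \<open>W\<^sub>Q + R\<^sub>Q w\<close>.\<close>

definition local_adjoin :: "'c set \<Rightarrow> 'c \<Rightarrow> 'c set" where
  "local_adjoin W w = {v \<in> carrier M. \<exists>s\<in>carrier R - Q. \<exists>y\<in>W. \<exists>b\<in>carrier R.
     s \<odot>\<^bsub>M\<^esub> v = y \<oplus>\<^bsub>M\<^esub> b \<odot>\<^bsub>M\<^esub> w}"

lemma compl_mult: "s \<in> carrier R - Q \<Longrightarrow> t \<in> carrier R - Q \<Longrightarrow> s \<otimes> t \<in> carrier R - Q"
  using Q.I_prime by auto

lemma one_compl: "\<one> \<in> carrier R - Q"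
  using Q.I_notcarr Q.one_imp_carrier by auto

lemma local_submoduleD:
  assumes "local_submodule N"
  shows "N \<subseteq> carrier M" "\<zero>\<^bsub>M\<^esub> \<in> N" "\<And>v w. v \<in> N \<Longrightarrow> w \<in> N \<Longrightarrow> v \<oplus>\<^bsub>M\<^esub> w \<in> N"
    "\<And>a v. a \<in> carrier R \<Longrightarrow> v \<in> N \<Longrightarrow> a \<odot>\<^bsub>M\<^esub> v \<in> N"
    "\<And>s v. s \<in> carrier R - Q \<Longrightarrow> v \<in> carrier M \<Longrightarrow> s \<odot>\<^bsub>M\<^esub> v \<in> N \<Longrightarrow> v \<in> N"
    "\<And>v w. v \<in> N \<Longrightarrow> w \<in> N \<Longrightarrow> v \<ominus>\<^bsub>M\<^esub> w \<in> N"
proof -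
  note d = assms[unfolded local_submodule_def]
  show "N \<subseteq> carrier M" "\<zero>\<^bsub>M\<^esub> \<in> N" and add: "\<And>v w. v \<in> N \<Longrightarrow> w \<in> N \<Longrightarrow> v \<oplus>\<^bsub>M\<^esub> w \<in> N"
    and sm: "\<And>a v. a \<in> carrier R \<Longrightarrow> v \<in> N \<Longrightarrow> a \<odot>\<^bsub>M\<^esub> v \<in> N"
    "\<And>s v. s \<in> carrier R - Q \<Longrightarrow> v \<in> carrier M \<Longrightarrow> s \<odot>\<^bsub>M\<^esub> v \<in> N \<Longrightarrow> v \<in> N" using d by blast+
  fix v w assume vw: "v \<in> N" "w \<in> N"
  have "\<ominus>\<^bsub>M\<^esub> w = (\<ominus> \<one>) \<odot>\<^bsub>M\<^esub> w" using vw d smult_l_minus[of \<one> w] by (auto simp: subset_iff)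
  then have "\<ominus>\<^bsub>M\<^esub> w \<in> N" using sm(1)[of "\<ominus> \<one>" w] vw by simp
  then show "v \<ominus>\<^bsub>M\<^esub> w \<in> N" using add vw unfolding a_minus_def by auto
qed

lemma local_adjoin_upper:
  assumes W: "local_submodule W" and w: "w \<in> carrier M"
  shows "W \<subseteq> local_adjoin W w" "w \<in> local_adjoin W w"
proof -
  note d = local_submoduleD[OF W]
  show "W \<subseteq> local_adjoin W w"
  proof
    fix v assume v: "v \<in> W"
    then have "\<one> \<odot>\<^bsub>M\<^esub> v = v \<oplus>\<^bsub>M\<^esub> \<zero> \<odot>\<^bsub>M\<^esub> w" using d(1) w by (auto simp: subset_iff)
    then show "v \<in> local_adjoin W w" using v one_compl d(1) unfolding local_adjoin_def by blast
  qed
  have "\<one> \<odot>\<^bsub>M\<^esub> w = \<zero>\<^bsub>M\<^esub> \<oplus>\<^bsub>M\<^esub> \<one> \<odot>\<^bsub>M\<^esub> w" using w by simp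
  then show "w \<in> local_adjoin W w" using w d(2) one_compl unfolding local_adjoin_def by blast
qed

lemma local_adjoin_submodule:
  assumes W: "local_submodule W" and w: "w \<in> carrier M"
  shows "local_submodule (local_adjoin W w)"
proof -
  note d = local_submoduleD[OF W]
  have Wc: "y \<in> carrier M" if "y \<in> W" for y using d(1) that by auto
  note up = local_adjoin_upper[OF W w]
  show ?thesis unfolding local_submodule_def
  proof (intro conjI ballI impI)
    show "local_adjoin W w \<subseteq> carrier M" unfolding local_adjoin_def by auto
    show "\<zero>\<^bsub>M\<^esub> \<in> local_adjoin W w" using up d(2) by auto
  next
    fix u v assume "u \<in> local_adjoin W w" "v \<in> local_adjoin W w"
    then obtain s y b t z c where u: "u \<in> carrier M" "s \<in> carrier R - Q" "y \<in> W" "b \<in> carrier R"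
        "s \<odot>\<^bsub>M\<^esub> u = y \<oplus>\<^bsub>M\<^esub> b \<odot>\<^bsub>M\<^esub> w"
      and v: "v \<in> carrier M" "t \<in> carrier R - Q" "z \<in> W" "c \<in> carrier R"
        "t \<odot>\<^bsub>M\<^esub> v = z \<oplus>\<^bsub>M\<^esub> c \<odot>\<^bsub>M\<^esub> w"
      unfolding local_adjoin_def by blast
    have "(s \<otimes> t) \<odot>\<^bsub>M\<^esub> (u \<oplus>\<^bsub>M\<^esub> v) = (t \<otimes> s) \<odot>\<^bsub>M\<^esub> u \<oplus>\<^bsub>M\<^esub> (s \<otimes> t) \<odot>\<^bsub>M\<^esub> v"
      using u v by (simp add: smult_r_distr R.m_comm)
    also have "\<dots> = t \<odot>\<^bsub>M\<^esub> (s \<odot>\<^bsub>M\<^esub> u) \<oplus>\<^bsub>M\<^esub> s \<odot>\<^bsub>M\<^esub> (t \<odot>\<^bsub>M\<^esub> v)" using u v by (simp add: smult_assoc1)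
    also have "\<dots> = (t \<odot>\<^bsub>M\<^esub> y \<oplus>\<^bsub>M\<^esub> t \<odot>\<^bsub>M\<^esub> (b \<odot>\<^bsub>M\<^esub> w)) \<oplus>\<^bsub>M\<^esub> (s \<odot>\<^bsub>M\<^esub> z \<oplus>\<^bsub>M\<^esub> s \<odot>\<^bsub>M\<^esub> (c \<odot>\<^bsub>M\<^esub> w))"
      unfolding u(5) v(5) using u v w Wc by (simp add: smult_r_distr)
    also have "\<dots> = (t \<odot>\<^bsub>M\<^esub> y \<oplus>\<^bsub>M\<^esub> s \<odot>\<^bsub>M\<^esub> z) \<oplus>\<^bsub>M\<^esub> (t \<odot>\<^bsub>M\<^esub> (b \<odot>\<^bsub>M\<^esub> w) \<oplus>\<^bsub>M\<^esub> s \<odot>\<^bsub>M\<^esub> (c \<odot>\<^bsub>M\<^esub> w))"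
      using u v w Wc by (simp add: M.a_ac)
    also have "\<dots> = (t \<odot>\<^bsub>M\<^esub> y \<oplus>\<^bsub>M\<^esub> s \<odot>\<^bsub>M\<^esub> z) \<oplus>\<^bsub>M\<^esub> (t \<otimes> b \<oplus> s \<otimes> c) \<odot>\<^bsub>M\<^esub> w"
      using u v w by (simp add: smult_l_distr smult_assoc1)
    finally have "(s \<otimes> t) \<odot>\<^bsub>M\<^esub> (u \<oplus>\<^bsub>M\<^esub> v) = \<dots>" .
    moreover have "t \<odot>\<^bsub>M\<^esub> y \<oplus>\<^bsub>M\<^esub> s \<odot>\<^bsub>M\<^esub> z \<in> W" using u v by (intro d(3) d(4)) auto
    moreover have "t \<otimes> b \<oplus> s \<otimes> c \<in> carrier R" using u v by auto
    ultimately show "u \<oplus>\<^bsub>M\<^esub> v \<in> local_adjoin W w"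
      using compl_mult[OF u(2) v(2)] u(1) v(1) unfolding local_adjoin_def by blast
  next
    fix a u assume a: "a \<in> carrier R" and "u \<in> local_adjoin W w"
    then obtain s y b where u: "u \<in> carrier M" "s \<in> carrier R - Q" "y \<in> W" "b \<in> carrier R"
        "s \<odot>\<^bsub>M\<^esub> u = y \<oplus>\<^bsub>M\<^esub> b \<odot>\<^bsub>M\<^esub> w"
      unfolding local_adjoin_def by blast
    have "s \<odot>\<^bsub>M\<^esub> (a \<odot>\<^bsub>M\<^esub> u) = a \<odot>\<^bsub>M\<^esub> (s \<odot>\<^bsub>M\<^esub> u)" using u(1,2) a by (simp add: smult_assoc1[symmetric] R.m_comm)
    also have "\<dots> = a \<odot>\<^bsub>M\<^esub> y \<oplus>\<^bsub>M\<^esub> (a \<otimes> b) \<odot>\<^bsub>M\<^esub> w"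
      unfolding u(5) using u w Wc a by (simp add: smult_r_distr smult_assoc1)
    finally show "a \<odot>\<^bsub>M\<^esub> u \<in> local_adjoin W w"
      using u(1,2,4) a d(4)[OF a u(3)] unfolding local_adjoin_def by blast
  next
    fix a u assume a: "a \<in> carrier R - Q" and uM: "u \<in> carrier M" and "a \<odot>\<^bsub>M\<^esub> u \<in> local_adjoin W w"
    then obtain s y b where u: "s \<in> carrier R - Q" "y \<in> W" "b \<in> carrier R"
        "s \<odot>\<^bsub>M\<^esub> (a \<odot>\<^bsub>M\<^esub> u) = y \<oplus>\<^bsub>M\<^esub> b \<odot>\<^bsub>M\<^esub> w"
      unfolding local_adjoin_def by blast
    have "(s \<otimes> a) \<odot>\<^bsub>M\<^esub> u = y \<oplus>\<^bsub>M\<^esub> b \<odot>\<^bsub>M\<^esub> w" using u a uM by (simp add: smult_assoc1)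
    then show "u \<in> local_adjoin W w" using uM u compl_mult[OF u(1) a] unfolding local_adjoin_def by blast
  qed
qed

text \<open>Each layer is generated by one element and killed by \<open>Q\<close>: after localization it is zero or a
  copy of the residue field.\<close>

definition comp_series :: "'c set \<Rightarrow> nat \<Rightarrow> (nat \<Rightarrow> 'c set) \<Rightarrow> (nat \<Rightarrow> 'c) \<Rightarrow> bool" where
  "comp_series L l W w \<longleftrightarrow> local_submodule L \<and> W 0 = L \<and>
     (\<forall>i<l. w i \<in> carrier M \<and> (\<forall>q\<in>Q. q \<odot>\<^bsub>M\<^esub> w i \<in> W i) \<and> W (Suc i) = local_adjoin (W i) (w i))"

lemma comp_series_submodule:
  assumes "comp_series L l W w" "i \<le> l" shows "local_submodule (W i)"
  using assms(2)
proof (induction i)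
  case 0 then show ?case using assms(1) by (simp add: comp_series_def)
next
  case (Suc i) then show ?case
    using assms(1) local_adjoin_submodule[of "W i" "w i"] by (auto simp: comp_series_def)
qed

lemma comp_series_mono:
  assumes "comp_series L l W w" "i \<le> j" "j \<le> l" shows "W i \<subseteq> W j"
  using assms(2,3)
proof (induction j rule: dec_induct)
  case (step j) then show ?case
    using assms(1) local_adjoin_upper(1)[of "W j" "w j"] comp_series_submodule[OF assms(1), of j]
    by (auto simp: comp_series_def)
qed simp

text \<open>The layers of the series in which \<open>N\<close> has a nonzero image. Their number plays the role of the
  length of \<open>N / L\<close>.\<close>

definition leading :: "nat \<Rightarrow> (nat \<Rightarrow> 'c set) \<Rightarrow> 'c set \<Rightarrow> nat set" where
  "leading l W N = {i. i < l \<and> \<not> N \<inter> W (Suc i) \<subseteq> W i}"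

lemma leading_mono: "N \<subseteq> N' \<Longrightarrow> leading l W N \<subseteq> leading l W N'"
  unfolding leading_def by blast

lemma finite_leading [simp]: "finite (leading l W N)"
  unfolding leading_def by simp

lemma card_leading: "card (leading l W N) \<le> l"
  using card_mono[of "{..<l}" "leading l W N"] unfolding leading_def by auto

text \<open>An element of \<open>N'\<close> in layer \<open>i\<close> is cleared, up to a multiplier outside \<open>Q\<close>, by an element of \<open>N\<close>
  with nonzero image in that layer. Descending through the layers, it ends in \<open>L \<subseteq> N\<close>.\<close>

lemma leading_determines:
  assumes cs: "comp_series L l W w" and N: "local_submodule N" "L \<subseteq> N"
    and N': "local_submodule N'" "N' \<subseteq> W l" and sub: "N \<subseteq> N'"
    and lead: "leading l W N' \<subseteq> leading l W N"
  shows "N' = N"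
proof -
  note d = local_submoduleD[OF N(1)] and d' = local_submoduleD[OF N'(1)]
  have "i \<le> l \<Longrightarrow> N' \<inter> W i \<subseteq> N" for i
  proof (induction i)
    case 0 then show ?case using cs N(2) by (auto simp: comp_series_def)
  next
    case (Suc i)
    then have i: "i < l" and IH: "N' \<inter> W i \<subseteq> N" by auto
    have w: "w i \<in> carrier M" "\<And>q. q \<in> Q \<Longrightarrow> q \<odot>\<^bsub>M\<^esub> w i \<in> W i" and WS: "W (Suc i) = local_adjoin (W i) (w i)"
      using cs i by (auto simp: comp_series_def)
    have Wi: "local_submodule (W i)" using comp_series_submodule[OF cs] i by simp
    note dW = local_submoduleD[OF Wi]
    show ?case
    proof (rule ccontr)
      assume "\<not> ?thesis"
      then obtain x where x: "x \<in> N'" "x \<in> W (Suc i)" "x \<notin> N" by auto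
      then have "x \<notin> W i" using IH by auto
      then have "i \<in> leading l W N'" using x i by (auto simp: leading_def)
      then have "i \<in> leading l W N" using lead by auto
      then obtain y where y: "y \<in> N" "y \<in> W (Suc i)" "y \<notin> W i" by (auto simp: leading_def)
      obtain s u b where sx: "x \<in> carrier M" "s \<in> carrier R - Q" "u \<in> W i" "b \<in> carrier R"
        "s \<odot>\<^bsub>M\<^esub> x = u \<oplus>\<^bsub>M\<^esub> b \<odot>\<^bsub>M\<^esub> w i" using x(2) unfolding WS local_adjoin_def by blast
      obtain t v c where ty: "y \<in> carrier M" "t \<in> carrier R - Q" "v \<in> W i" "c \<in> carrier R"
        "t \<odot>\<^bsub>M\<^esub> y = v \<oplus>\<^bsub>M\<^esub> c \<odot>\<^bsub>M\<^esub> w i" using y(2) unfolding WS local_adjoin_def by blast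
      have c: "c \<in> carrier R - Q"
      proof (rule ccontr)
        assume "c \<notin> carrier R - Q"
        then have "c \<odot>\<^bsub>M\<^esub> w i \<in> W i" using ty w(2) by blast
        then have "t \<odot>\<^bsub>M\<^esub> y \<in> W i" using ty(3,5) dW(3) by simp
        then show False using dW(5) ty y by blast
      qed
      have uv: "u \<in> carrier M" "v \<in> carrier M" using sx ty dW(1) by auto
      \<comment> \<open>eliminate the generator of the layer between \<open>x\<close> and \<open>y\<close>\<close>
      have "(c \<otimes> s) \<odot>\<^bsub>M\<^esub> x \<ominus>\<^bsub>M\<^esub> (b \<otimes> t) \<odot>\<^bsub>M\<^esub> y = c \<odot>\<^bsub>M\<^esub> (s \<odot>\<^bsub>M\<^esub> x) \<ominus>\<^bsub>M\<^esub> b \<odot>\<^bsub>M\<^esub> (t \<odot>\<^bsub>M\<^esub> y)"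
        using sx ty by (simp add: smult_assoc1)
      also have "\<dots> = (c \<odot>\<^bsub>M\<^esub> u \<oplus>\<^bsub>M\<^esub> (b \<otimes> c) \<odot>\<^bsub>M\<^esub> w i) \<ominus>\<^bsub>M\<^esub> (b \<odot>\<^bsub>M\<^esub> v \<oplus>\<^bsub>M\<^esub> (b \<otimes> c) \<odot>\<^bsub>M\<^esub> w i)"
        unfolding sx(5) ty(5) using sx(2-4) ty(2-4) w(1) uv
        by (simp add: smult_r_distr smult_assoc1[symmetric] R.m_comm)
      also have "\<dots> = c \<odot>\<^bsub>M\<^esub> u \<ominus>\<^bsub>M\<^esub> b \<odot>\<^bsub>M\<^esub> v"
      proof -
        have "(p \<oplus>\<^bsub>M\<^esub> q) \<ominus>\<^bsub>M\<^esub> (r \<oplus>\<^bsub>M\<^esub> q) = p \<ominus>\<^bsub>M\<^esub> r"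
          if "p \<in> carrier M" "q \<in> carrier M" "r \<in> carrier M" for p q r
        proof -
          have "(p \<oplus>\<^bsub>M\<^esub> q) \<ominus>\<^bsub>M\<^esub> (r \<oplus>\<^bsub>M\<^esub> q) = (p \<ominus>\<^bsub>M\<^esub> r) \<oplus>\<^bsub>M\<^esub> (q \<oplus>\<^bsub>M\<^esub> \<ominus>\<^bsub>M\<^esub> q)"
            unfolding a_minus_def using that by (simp add: M.minus_add M.a_ac)
          then show ?thesis using that M.r_neg[of q] by (simp add: a_minus_def)
        qed
        then show ?thesis using sx(2-4) ty(2-4) w(1) uv by simp
      qed
      finally have eq: "(c \<otimes> s) \<odot>\<^bsub>M\<^esub> x \<ominus>\<^bsub>M\<^esub> (b \<otimes> t) \<odot>\<^bsub>M\<^esub> y = c \<odot>\<^bsub>M\<^esub> u \<ominus>\<^bsub>M\<^esub> b \<odot>\<^bsub>M\<^esub> v" .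
      have "(c \<otimes> s) \<odot>\<^bsub>M\<^esub> x \<ominus>\<^bsub>M\<^esub> (b \<otimes> t) \<odot>\<^bsub>M\<^esub> y \<in> N'" using sx ty x(1) y(1) sub by (intro d'(6) d'(4)) auto
      moreover have "c \<odot>\<^bsub>M\<^esub> u \<ominus>\<^bsub>M\<^esub> b \<odot>\<^bsub>M\<^esub> v \<in> W i" using sx ty c by (intro dW(6) dW(4)) auto
      ultimately have in_N: "(c \<otimes> s) \<odot>\<^bsub>M\<^esub> x \<ominus>\<^bsub>M\<^esub> (b \<otimes> t) \<odot>\<^bsub>M\<^esub> y \<in> N" using IH eq by auto
      have "(b \<otimes> t) \<odot>\<^bsub>M\<^esub> y \<in> N" using y sx ty by (intro d(4)) auto
      with in_N have "((c \<otimes> s) \<odot>\<^bsub>M\<^esub> x \<ominus>\<^bsub>M\<^esub> (b \<otimes> t) \<odot>\<^bsub>M\<^esub> y) \<oplus>\<^bsub>M\<^esub> (b \<otimes> t) \<odot>\<^bsub>M\<^esub> y \<in> N" using d(3) by blast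
      moreover have "((c \<otimes> s) \<odot>\<^bsub>M\<^esub> x \<ominus>\<^bsub>M\<^esub> (b \<otimes> t) \<odot>\<^bsub>M\<^esub> y) \<oplus>\<^bsub>M\<^esub> (b \<otimes> t) \<odot>\<^bsub>M\<^esub> y = (c \<otimes> s) \<odot>\<^bsub>M\<^esub> x"
        using sx ty by (simp add: a_minus_def M.a_assoc M.l_neg)
      ultimately have "(c \<otimes> s) \<odot>\<^bsub>M\<^esub> x \<in> N" by simp
      then show False using d(5)[OF compl_mult[OF c sx(2)] sx(1)] x(3) by blast
    qed
  qed
  then show ?thesis using N'(2) sub by blast
qed

definition finite_length_over :: "'c set \<Rightarrow> 'c set \<Rightarrow> bool" where
  "finite_length_over L V \<longleftrightarrow> (\<exists>l W w. comp_series L l W w \<and> W l = V)"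

lemma finite_length_over_adjoin:
  assumes "finite_length_over L V" and v: "v \<in> carrier M" "\<And>q. q \<in> Q \<Longrightarrow> q \<odot>\<^bsub>M\<^esub> v \<in> V"
  shows "finite_length_over L (local_adjoin V v)"
proof -
  obtain l W w where cs: "comp_series L l W w" "W l = V"
    using assms(1) unfolding finite_length_over_def by blast
  have "comp_series L (Suc l) (W(Suc l := local_adjoin V v)) (w(l := v))"
    using cs v unfolding comp_series_def by (auto simp: less_Suc_eq)
  then show ?thesis unfolding finite_length_over_def by (metis fun_upd_same)
qed

lemma finite_length_overD:
  assumes "finite_length_over L V" shows "local_submodule V" "local_submodule L" "L \<subseteq> V"
proof -
  obtain l W w where cs: "comp_series L l W w" "W l = V"
    using assms(1) unfolding finite_length_over_def by blast
  show "local_submodule V" using comp_series_submodule[OF cs(1), of l] cs(2) by simp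
  show "local_submodule L" using cs(1) by (simp add: comp_series_def)
  show "L \<subseteq> V" using comp_series_mono[OF cs(1), of 0 l] cs by (simp add: comp_series_def)
qed

lemma colon_ideal:
  assumes "local_submodule V" "v \<in> carrier M"
  shows "ideal {a \<in> carrier R. a \<odot>\<^bsub>M\<^esub> v \<in> V} R" (is "ideal ?I R")
proof (rule R.ideal_of_closed)
  note d = local_submoduleD[OF assms(1)]
  show "\<zero> \<in> ?I" using assms d by auto
  show "a \<oplus> b \<in> ?I" if "a \<in> ?I" "b \<in> ?I" for a b using that assms(2) d(3) by (simp add: smult_l_distr)
  show "r \<otimes> a \<in> ?I" if "r \<in> carrier R" "a \<in> ?I" for r a using that assms(2) d(4) by (simp add: smult_assoc1)
qed blast

text \<open>Take \<open>V\<close> of finite length over \<open>L\<close> with \<open>V : v\<close> maximal. If \<open>v \<notin> V\<close>, a multiple \<open>b v \<notin> V\<close> with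
  \<open>V : b v\<close> maximal is killed by \<open>Q\<close> modulo \<open>V\<close>, because powers of every \<open>q \<in> Q\<close> kill it.
  Adjoining \<open>b v\<close> to \<open>V\<close> then enlarges \<open>V : v\<close>.\<close>

lemma finite_length_over_reach:
  assumes noeth: "noetherian_ring R" and V0: "finite_length_over L V0"
    and tors: "\<And>q v. q \<in> Q \<Longrightarrow> v \<in> carrier M \<Longrightarrow> \<exists>n::nat. (q [^] n) \<odot>\<^bsub>M\<^esub> v \<in> L"
    and v: "v \<in> carrier M"
  shows "\<exists>V. finite_length_over L V \<and> V0 \<subseteq> V \<and> v \<in> V"
proof -
  define colon where "colon V u = {a \<in> carrier R. a \<odot>\<^bsub>M\<^esub> u \<in> V}" for V u
  have colon_ideal': "ideal (colon V u) R" if "finite_length_over L V" "u \<in> carrier M" for V u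
    unfolding colon_def using colon_ideal finite_length_overD(1) that by blast
  define \<V> where "\<V> = {V. finite_length_over L V \<and> V0 \<subseteq> V}"
  have "\<exists>C\<in>(\<lambda>V. colon V v) ` \<V>. \<forall>I\<in>(\<lambda>V. colon V v) ` \<V>. C \<subseteq> I \<longrightarrow> I = C"
    by (rule noetherian_ring.ideal_family_has_maximal[OF noeth])
      (use V0 v colon_ideal' in \<open>auto simp: \<V>_def\<close>)
  then obtain V where "V \<in> \<V>" and
    max: "\<And>V'. V' \<in> \<V> \<Longrightarrow> colon V v \<subseteq> colon V' v \<Longrightarrow> colon V' v = colon V v" by auto
  then have V: "finite_length_over L V" "V0 \<subseteq> V" by (auto simp: \<V>_def)
  have maxV: "colon V' v = colon V v"
    if "finite_length_over L V'" "V0 \<subseteq> V'" "colon V v \<subseteq> colon V' v" for V'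
    using max[of V'] that by (simp add: \<V>_def)
  note d = local_submoduleD[OF finite_length_overD(1)[OF V(1)]]
  show ?thesis
  proof (cases "v \<in> V")
    case True then show ?thesis using V by blast
  next
    case False
    define T where "T = {b \<in> carrier R. b \<odot>\<^bsub>M\<^esub> v \<notin> V}"
    have "\<exists>C\<in>(\<lambda>b. colon V (b \<odot>\<^bsub>M\<^esub> v)) ` T. \<forall>I\<in>(\<lambda>b. colon V (b \<odot>\<^bsub>M\<^esub> v)) ` T. C \<subseteq> I \<longrightarrow> I = C"
    proof (rule noetherian_ring.ideal_family_has_maximal[OF noeth])
      have "\<one> \<in> T" using False v by (simp add: T_def)
      then show "(\<lambda>b. colon V (b \<odot>\<^bsub>M\<^esub> v)) ` T \<noteq> {}" by blast
      show "ideal I R" if "I \<in> (\<lambda>b. colon V (b \<odot>\<^bsub>M\<^esub> v)) ` T" for I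
        using that colon_ideal'[OF V(1)] v by (auto simp: T_def)
    qed
    then obtain b where "b \<in> T" and
      max': "\<And>c. c \<in> T \<Longrightarrow> colon V (b \<odot>\<^bsub>M\<^esub> v) \<subseteq> colon V (c \<odot>\<^bsub>M\<^esub> v) \<Longrightarrow>
        colon V (c \<odot>\<^bsub>M\<^esub> v) = colon V (b \<odot>\<^bsub>M\<^esub> v)" by auto
    then have b: "b \<in> carrier R" "b \<odot>\<^bsub>M\<^esub> v \<notin> V" by (auto simp: T_def)
    have maxb: "colon V (c \<odot>\<^bsub>M\<^esub> v) = colon V (b \<odot>\<^bsub>M\<^esub> v)"
      if "c \<in> carrier R" "c \<odot>\<^bsub>M\<^esub> v \<notin> V" "colon V (b \<odot>\<^bsub>M\<^esub> v) \<subseteq> colon V (c \<odot>\<^bsub>M\<^esub> v)" for c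
      using max'[of c] that by (simp add: T_def)
    have Qb: "q \<odot>\<^bsub>M\<^esub> (b \<odot>\<^bsub>M\<^esub> v) \<in> V" if q: "q \<in> Q" for q
    proof -
      have qR: "q \<in> carrier R" using q Q.Icarr by auto
      define n where "n = (LEAST n::nat. (q [^] n) \<odot>\<^bsub>M\<^esub> (b \<odot>\<^bsub>M\<^esub> v) \<in> V)"
      have "\<exists>n::nat. (q [^] n) \<odot>\<^bsub>M\<^esub> (b \<odot>\<^bsub>M\<^esub> v) \<in> V"
        using tors[OF q, of "b \<odot>\<^bsub>M\<^esub> v"] b v finite_length_overD(3)[OF V(1)] by auto
      then have n: "(q [^] n) \<odot>\<^bsub>M\<^esub> (b \<odot>\<^bsub>M\<^esub> v) \<in> V" unfolding n_def by (rule LeastI_ex)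
      have "n \<noteq> 0" using n b v by (metis R.nat_pow_0 smult_closed smult_one)
      then obtain m where m: "n = Suc m" by (cases n) auto
      have qm: "(q [^] m) \<odot>\<^bsub>M\<^esub> (b \<odot>\<^bsub>M\<^esub> v) \<notin> V"
        using not_less_Least[of m "\<lambda>n. (q [^] n) \<odot>\<^bsub>M\<^esub> (b \<odot>\<^bsub>M\<^esub> v) \<in> V"] m unfolding n_def by auto
      let ?c = "(q [^] m) \<otimes> b"
      have c: "?c \<in> carrier R" "?c \<odot>\<^bsub>M\<^esub> v = (q [^] m) \<odot>\<^bsub>M\<^esub> (b \<odot>\<^bsub>M\<^esub> v)" using qR b v by (auto simp: smult_assoc1)
      have "colon V (b \<odot>\<^bsub>M\<^esub> v) \<subseteq> colon V (?c \<odot>\<^bsub>M\<^esub> v)"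
      proof
        fix a assume a: "a \<in> colon V (b \<odot>\<^bsub>M\<^esub> v)"
        have "a \<odot>\<^bsub>M\<^esub> (?c \<odot>\<^bsub>M\<^esub> v) = (q [^] m) \<odot>\<^bsub>M\<^esub> (a \<odot>\<^bsub>M\<^esub> (b \<odot>\<^bsub>M\<^esub> v))"
          unfolding c(2) using a b v qR by (simp add: colon_def smult_assoc1[symmetric] R.m_ac)
        then show "a \<in> colon V (?c \<odot>\<^bsub>M\<^esub> v)" using a d(4) qR unfolding colon_def by auto
      qed
      then have eq: "colon V (?c \<odot>\<^bsub>M\<^esub> v) = colon V (b \<odot>\<^bsub>M\<^esub> v)" by (intro maxb) (use c qm in auto)
      have "q \<odot>\<^bsub>M\<^esub> (?c \<odot>\<^bsub>M\<^esub> v) \<in> V"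
        using n b v qR unfolding c(2) m by (simp add: smult_assoc1[symmetric] R.m_ac)
      then have "q \<in> colon V (?c \<odot>\<^bsub>M\<^esub> v)" using qR unfolding colon_def by auto
      then show ?thesis using eq unfolding colon_def by auto
    qed
    let ?V = "local_adjoin V (b \<odot>\<^bsub>M\<^esub> v)"
    have bv: "b \<odot>\<^bsub>M\<^esub> v \<in> carrier M" using b v by simp
    have V': "finite_length_over L ?V" using finite_length_over_adjoin[OF V(1) bv] Qb by blast
    have up: "V \<subseteq> ?V" "b \<odot>\<^bsub>M\<^esub> v \<in> ?V" using local_adjoin_upper[OF finite_length_overD(1)[OF V(1)] bv] by auto
    then have "colon ?V v = colon V v" using maxV[OF V'] V(2) unfolding colon_def by auto
    then have "b \<in> colon V v" using up b unfolding colon_def by auto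
    then show ?thesis using b unfolding colon_def by auto
  qed
qed

lemma finite_length_over_reach_finite:
  assumes noeth: "noetherian_ring R" and L: "local_submodule L"
    and tors: "\<And>q v. q \<in> Q \<Longrightarrow> v \<in> carrier M \<Longrightarrow> \<exists>n::nat. (q [^] n) \<odot>\<^bsub>M\<^esub> v \<in> L"
    and G: "finite G" "G \<subseteq> carrier M"
  shows "\<exists>V. finite_length_over L V \<and> G \<subseteq> V"
  using G
proof (induction G rule: finite_induct)
  case empty
  have "comp_series L 0 (\<lambda>_. L) (\<lambda>_. \<zero>\<^bsub>M\<^esub>)" using L by (simp add: comp_series_def)
  then show ?case unfolding finite_length_over_def by blast
next
  case (insert v G)
  then obtain V where "finite_length_over L V" "G \<subseteq> V" by auto
  then show ?case using finite_length_over_reach[OF noeth _ tors, of V v] insert.prems by blast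
qed

end

section \<open>Algebras given by a ring homomorphism\<close>

lemma algebra_of_hom_simps [simp]:
  "carrier (algebra_of_hom \<phi> B) = carrier B" "mult (algebra_of_hom \<phi> B) = mult B"
  "one (algebra_of_hom \<phi> B) = one B" "zero (algebra_of_hom \<phi> B) = zero B"
  "add (algebra_of_hom \<phi> B) = add B" "smult (algebra_of_hom \<phi> B) c x = \<phi> c \<otimes>\<^bsub>B\<^esub> x"
  by (simp_all add: algebra_of_hom_def)

lemma cring_algebra_of_hom: assumes "cring B" shows "cring (algebra_of_hom \<phi> B)"
proof -
  interpret cring B by fact
  show ?thesis
  proof (rule cringI)
    show "abelian_group (algebra_of_hom \<phi> B)"
    proof (rule abelian_groupI)
      fix x assume "x \<in> carrier (algebra_of_hom \<phi> B)"
      then show "\<exists>y\<in>carrier (algebra_of_hom \<phi> B).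
          y \<oplus>\<^bsub>algebra_of_hom \<phi> B\<^esub> x = \<zero>\<^bsub>algebra_of_hom \<phi> B\<^esub>" by (intro bexI[of _ "\<ominus>\<^bsub>B\<^esub> x"]) (auto simp: l_neg)
    qed (auto simp: a_ac)
    show "comm_monoid (algebra_of_hom \<phi> B)" by (rule comm_monoidI) (auto simp: m_ac)
  qed (auto simp: l_distr)
qed

lemma algebra_algebra_of_hom:
  assumes k: "cring k" and B: "cring B" and \<phi>: "\<phi> \<in> Ring.ring_hom k B"
  shows "algebra k (algebra_of_hom \<phi> B)"
proof -
  interpret B: cring B by fact
  show ?thesis by (rule algebraI[OF k cring_algebra_of_hom[OF B]])
      (use \<phi> in \<open>auto simp: ring_hom_closed ring_hom_add ring_hom_mult ring_hom_one
        B.l_distr B.r_distr B.m_assoc\<close>)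
qed

section \<open>Ideals and primes in subrings of a commutative ring type\<close>

text \<open>Polynomial rings in \<open>0, 1, 2, \<dots>\<close> variables are handled as subsets of one type of class
  \<open>comm_ring_1\<close>. Inside them one can calculate with the operations of the type; ideals are plain
  sets, related to those of the carrier-based theory by \<open>idl_iff_ideal\<close>, \<open>prm_iff_primeideal\<close> and
  \<open>gen_eq_genideal\<close>.\<close>

locale subring_set =
  fixes R :: "'a::comm_ring_1 set"
  assumes zero_mem [simp, intro]: "0 \<in> R" and one_mem [simp, intro]: "1 \<in> R"
    and add_mem [simp, intro]: "a \<in> R \<Longrightarrow> b \<in> R \<Longrightarrow> a + b \<in> R"
    and mult_mem [simp, intro]: "a \<in> R \<Longrightarrow> b \<in> R \<Longrightarrow> a * b \<in> R"
    and uminus_mem [simp, intro]: "a \<in> R \<Longrightarrow> - a \<in> R"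
begin

abbreviation ring_of :: "'a ring" where "ring_of \<equiv> class_ring\<lparr>carrier := R\<rparr>"

lemma diff_mem [simp, intro]: "a \<in> R \<Longrightarrow> b \<in> R \<Longrightarrow> a - b \<in> R"
  using add_mem[of a "- b"] by simp

lemma power_mem [simp, intro]: "a \<in> R \<Longrightarrow> a ^ n \<in> R"
  by (induction n) auto

lemma sum_mem [intro]: "(\<And>i. i \<in> A \<Longrightarrow> f i \<in> R) \<Longrightarrow> (\<Sum>i\<in>A. f i) \<in> R"
  by (induction A rule: infinite_finite_induct) auto

lemma prod_mem [intro]: "(\<And>i. i \<in> A \<Longrightarrow> f i \<in> R) \<Longrightarrow> (\<Prod>i\<in>A. f i) \<in> R"
  by (induction A rule: infinite_finite_induct) auto

lemma ring_of_cring: "cring ring_of"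
proof (rule cringI)
  show "abelian_group ring_of"
  proof (rule abelian_groupI)
    fix x assume "x \<in> carrier ring_of"
    then show "\<exists>y\<in>carrier ring_of. y \<oplus>\<^bsub>ring_of\<^esub> x = \<zero>\<^bsub>ring_of\<^esub>" by (intro bexI[of _ "- x"]) auto
  qed (auto simp: algebra_simps)
  show "comm_monoid ring_of" by (rule comm_monoidI) (auto simp: algebra_simps)
qed (auto simp: algebra_simps)

definition idl :: "'a set \<Rightarrow> bool" where
  "idl J \<longleftrightarrow> J \<subseteq> R \<and> 0 \<in> J \<and> (\<forall>a\<in>J. \<forall>b\<in>J. a + b \<in> J) \<and> (\<forall>r\<in>R. \<forall>a\<in>J. r * a \<in> J)"

definition prm :: "'a set \<Rightarrow> bool" where
  "prm P \<longleftrightarrow> idl P \<and> 1 \<notin> P \<and> (\<forall>a\<in>R. \<forall>b\<in>R. a * b \<in> P \<longrightarrow> a \<in> P \<or> b \<in> P)"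

lemma idlD:
  assumes "idl J"
  shows "J \<subseteq> R" "0 \<in> J" "\<And>a. a \<in> J \<Longrightarrow> a \<in> R" "\<And>a b. a \<in> J \<Longrightarrow> b \<in> J \<Longrightarrow> a + b \<in> J"
    "\<And>r a. r \<in> R \<Longrightarrow> a \<in> J \<Longrightarrow> r * a \<in> J" "\<And>r a. r \<in> R \<Longrightarrow> a \<in> J \<Longrightarrow> a * r \<in> J"
    "\<And>a. a \<in> J \<Longrightarrow> - a \<in> J" "\<And>a b. a \<in> J \<Longrightarrow> b \<in> J \<Longrightarrow> a - b \<in> J"
proof -
  note d = assms[unfolded idl_def]
  show "J \<subseteq> R" "0 \<in> J" "\<And>a. a \<in> J \<Longrightarrow> a \<in> R" using d by auto
  show add: "\<And>a b. a \<in> J \<Longrightarrow> b \<in> J \<Longrightarrow> a + b \<in> J" using d by auto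
  show mul: "\<And>r a. r \<in> R \<Longrightarrow> a \<in> J \<Longrightarrow> r * a \<in> J" using d by auto
  then show "\<And>r a. r \<in> R \<Longrightarrow> a \<in> J \<Longrightarrow> a * r \<in> J" by (simp add: mult.commute)
  have "- a = (- 1) * a" for a :: 'a by simp
  then show neg: "\<And>a. a \<in> J \<Longrightarrow> - a \<in> J" using mul[of "- 1"] by fastforce
  show "\<And>a b. a \<in> J \<Longrightarrow> b \<in> J \<Longrightarrow> a - b \<in> J" using add[OF _ neg] by (metis diff_conv_add_uminus)
qed

lemma idl_sum: "idl J \<Longrightarrow> (\<And>i. i \<in> A \<Longrightarrow> f i \<in> J) \<Longrightarrow> (\<Sum>i\<in>A. f i) \<in> J"
  by (induction A rule: infinite_finite_induct) (auto dest: idlD)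

lemma prmD:
  assumes "prm P"
  shows "idl P" "1 \<notin> P" "P \<subseteq> R" "\<And>a b. a \<in> R \<Longrightarrow> b \<in> R \<Longrightarrow> a * b \<in> P \<Longrightarrow> a \<in> P \<or> b \<in> P"
  using assms unfolding prm_def idl_def by auto

lemma idl_iff_ideal: "idl J \<longleftrightarrow> ideal J ring_of"
proof
  assume J: "idl J"
  interpret cring ring_of by (rule ring_of_cring)
  show "ideal J ring_of" by (rule ideal_of_closed) (use idlD[OF J] in auto)
next
  assume J: "ideal J ring_of"
  interpret ideal J ring_of by (rule J)
  show "idl J" unfolding idl_def
  proof (intro conjI ballI subsetI)
    show "a \<in> R" if "a \<in> J" for a using Icarr[OF that] by simp
    show "0 \<in> J" using additive_subgroup.zero_closed[OF is_additive_subgroup] by simp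
    show "a + b \<in> J" if "a \<in> J" "b \<in> J" for a b
      using additive_subgroup.a_closed[OF is_additive_subgroup that] by simp
    show "r * a \<in> J" if "r \<in> R" "a \<in> J" for r a using I_l_closed[of a r] that by simp
  qed
qed

lemma prm_iff_primeideal: "prm P \<longleftrightarrow> primeideal P ring_of"
proof
  assume P: "prm P"
  show "primeideal P ring_of"
  proof (rule primeidealI)
    show "ideal P ring_of" using prmD(1)[OF P] by (simp add: idl_iff_ideal)
    show "carrier ring_of \<noteq> P" using prmD(2)[OF P] by auto
  qed (use ring_of_cring prmD(4)[OF P] in auto)
next
  assume P: "primeideal P ring_of"
  interpret primeideal P ring_of by (rule P)
  show "prm P" unfolding prm_def idl_iff_ideal using I_prime I_notcarr one_imp_carrier is_ideal by auto
qed

lemma prm_power: "prm P \<Longrightarrow> a \<in> R \<Longrightarrow> a ^ n \<in> P \<Longrightarrow> a \<in> P"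
  by (induction n) (auto dest: prmD)

lemma prm_mult_compl: "prm P \<Longrightarrow> s \<in> R - P \<Longrightarrow> t \<in> R - P \<Longrightarrow> s * t \<in> R - P"
  using prmD(4) by auto

lemma prm_one_compl: "prm P \<Longrightarrow> 1 \<in> R - P"
  using prmD(2) by auto

definition gen :: "'a set \<Rightarrow> 'a set" where
  "gen X = {y. \<forall>J. idl J \<longrightarrow> X \<subseteq> J \<longrightarrow> y \<in> J}"

lemma idl_R: "idl R" unfolding idl_def by auto

lemma gen_idl: assumes "X \<subseteq> R" shows "idl (gen X)"
proof -
  have "gen X \<subseteq> R" unfolding gen_def using idl_R assms by auto
  then show ?thesis unfolding idl_def gen_def by auto
qed

lemma gen_upper: "X \<subseteq> gen X" unfolding gen_def by auto

lemma gen_least: "idl J \<Longrightarrow> X \<subseteq> J \<Longrightarrow> gen X \<subseteq> J" unfolding gen_def by auto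

lemma gen_mono: "X \<subseteq> Y \<Longrightarrow> gen X \<subseteq> gen Y" unfolding gen_def by auto

lemma gen_eq_genideal: assumes "X \<subseteq> R" shows "gen X = Idl\<^bsub>ring_of\<^esub> X"
proof -
  interpret cring ring_of by (rule ring_of_cring)
  show ?thesis using gen_idl[OF assms] gen_upper[of X] genideal_minimal[of "gen X" X]
      genideal_ideal[of X] genideal_self[of X] gen_least[of "Idl\<^bsub>ring_of\<^esub> X" X] assms
    unfolding idl_iff_ideal by auto
qed

lemma adjoin_idl: assumes J: "idl J" and x: "x \<in> R" shows "idl {j + a * x |j a. j \<in> J \<and> a \<in> R}"
  unfolding idl_def
proof (intro conjI ballI)
  note d = idlD[OF J]
  show "{j + a * x |j a. j \<in> J \<and> a \<in> R} \<subseteq> R" using d x by auto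
  have "0 = 0 + 0 * x" by simp
  then show "0 \<in> {j + a * x |j a. j \<in> J \<and> a \<in> R}" using d(2) by blast
  fix u assume "u \<in> {j + a * x |j a. j \<in> J \<and> a \<in> R}"
  then obtain j a where u: "u = j + a * x" "j \<in> J" "a \<in> R" by auto
  {
    fix v assume "v \<in> {j + a * x |j a. j \<in> J \<and> a \<in> R}"
    then obtain k b where v: "v = k + b * x" "k \<in> J" "b \<in> R" by auto
    have "u + v = (j + k) + (a + b) * x" by (simp add: u v algebra_simps)
    then show "u + v \<in> {j + a * x |j a. j \<in> J \<and> a \<in> R}" using d(4) u v by blast
  }
  fix r assume r: "r \<in> R"
  have "r * u = r * j + (r * a) * x" by (simp add: u algebra_simps)
  then show "r * u \<in> {j + a * x |j a. j \<in> J \<and> a \<in> R}" using d(5) u r by blast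
qed

lemma gen_insertE:
  assumes "y \<in> gen (insert x X)" "insert x X \<subseteq> R"
  obtains j a where "j \<in> gen X" "a \<in> R" "y = j + a * x"
proof -
  have X: "idl (gen X)" using gen_idl assms by auto
  let ?J = "{j + a * x |j a. j \<in> gen X \<and> a \<in> R}"
  have "idl ?J" using adjoin_idl X assms by auto
  moreover have "insert x X \<subseteq> ?J"
  proof
    fix z assume "z \<in> insert x X"
    moreover have "x = 0 + 1 * x" "z = z + 0 * x" by auto
    ultimately show "z \<in> ?J" using gen_upper[of X] idlD(2)[OF X] by blast
  qed
  ultimately have "gen (insert x X) \<subseteq> ?J" by (rule gen_least)
  then show ?thesis using assms that by blast
qed

lemma gen_finiteE:
  assumes "finite X" "y \<in> gen (J \<union> X)" "J \<union> X \<subseteq> R"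
  shows "\<exists>a j. (\<forall>x\<in>X. a x \<in> R) \<and> j \<in> gen J \<and> y = j + (\<Sum>x\<in>X. a x * x)"
  using assms
proof (induction X arbitrary: y rule: finite_induct)
  case (insert x X)
  then have "y \<in> gen (insert x (J \<union> X))" by simp
  then obtain i b where i: "i \<in> gen (J \<union> X)" "b \<in> R" "y = i + b * x"
    using insert.prems by (elim gen_insertE) auto
  then obtain a j where a: "\<forall>x\<in>X. a x \<in> R" "j \<in> gen J" "i = j + (\<Sum>x\<in>X. a x * x)"
    using insert.IH[of i] insert.prems by auto
  have "(\<Sum>z\<in>X. (a(x := b)) z * z) = (\<Sum>z\<in>X. a z * z)" using insert.hyps by (intro sum.cong) auto
  then show ?case using i a insert.hyps by (intro exI[of _ "a(x := b)"] exI[of _ j]) auto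
qed auto

lemma gen_imageE:
  assumes "y \<in> gen (f ` {..<r::nat})" "f ` {..<r} \<subseteq> R"
  shows "\<exists>a. (\<forall>i<r. a i \<in> R) \<and> y = (\<Sum>i<r. a i * f i)"
  using assms
proof (induction r arbitrary: y)
  case 0
  have "idl {0}" unfolding idl_def by auto
  then show ?case using 0 gen_least[of "{0}" "{}"] by auto
next
  case (Suc r)
  then have "y \<in> gen (insert (f r) (f ` {..<r}))" by (simp add: lessThan_Suc)
  then obtain i b where i: "i \<in> gen (f ` {..<r})" "b \<in> R" "y = i + b * f r"
    using Suc.prems by (elim gen_insertE) (auto simp: lessThan_Suc)
  then obtain a where a: "\<forall>k<r. a k \<in> R" "i = (\<Sum>k<r. a k * f k)"
    using Suc.IH[of i] Suc.prems by (auto simp: lessThan_Suc)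
  then show ?case using i by (intro exI[of _ "a(r := b)"]) (auto simp: less_Suc_eq)
qed

end

section \<open>Chains of primes in a Noetherian ring\<close>

locale noetherian_subring = subring_set +
  assumes noetherian: "noetherian_ring ring_of"
begin

lemma noetherian_cring_ring_of: "noetherian_cring ring_of"
  using noetherian ring_of_cring unfolding noetherian_cring_def by simp

lemma idl_family_has_maximal:
  assumes "\<C> \<noteq> {}" "\<And>I. I \<in> \<C> \<Longrightarrow> idl I"
  shows "\<exists>M\<in>\<C>. \<forall>I\<in>\<C>. M \<subseteq> I \<longrightarrow> I = M"
  using noetherian_ring.ideal_family_has_maximal[OF noetherian] assms by (simp add: idl_iff_ideal)

lemma prm_avoiding:
  assumes "idl J" "S \<subseteq> R" "1 \<in> S" "\<And>a b. a \<in> S \<Longrightarrow> b \<in> S \<Longrightarrow> a * b \<in> S" "J \<inter> S = {}"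
  shows "\<exists>P. prm P \<and> J \<subseteq> P \<and> P \<inter> S = {}"
  using noetherian_cring.prime_avoiding_multiplicative_set[OF noetherian_cring_ring_of, of J S] assms
  by (simp add: idl_iff_ideal prm_iff_primeideal)

definition local_idl :: "'a set \<Rightarrow> 'a set \<Rightarrow> bool" where
  "local_idl Q J \<longleftrightarrow> idl J \<and> (\<forall>s\<in>R - Q. \<forall>v\<in>R. s * v \<in> J \<longrightarrow> v \<in> J)"

definition local_gen :: "'a set \<Rightarrow> 'a set \<Rightarrow> 'a set" where
  "local_gen Q X = {y \<in> R. \<exists>s\<in>R - Q. s * y \<in> gen X}"

lemma local_gen_local_idl:
  assumes Q: "prm Q" and X: "X \<subseteq> R" shows "local_idl Q (local_gen Q X)"
proof -
  note d = idlD[OF gen_idl[OF X]]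
  show ?thesis unfolding local_idl_def idl_def
  proof (intro conjI ballI impI)
    show "local_gen Q X \<subseteq> R" by (auto simp: local_gen_def)
    have "1 * 0 \<in> gen X" using d(2) by simp
    then show "0 \<in> local_gen Q X" using prm_one_compl[OF Q] unfolding local_gen_def by blast
  next
    fix a b assume "a \<in> local_gen Q X" "b \<in> local_gen Q X"
    then obtain s t where a: "a \<in> R" "s \<in> R - Q" "s * a \<in> gen X"
      and b: "b \<in> R" "t \<in> R - Q" "t * b \<in> gen X" unfolding local_gen_def by blast
    have "(s * t) * (a + b) = t * (s * a) + s * (t * b)" by (simp add: algebra_simps)
    also have "\<dots> \<in> gen X" using a(2) b(2) by (intro d(4) d(5)[OF _ a(3)] d(5)[OF _ b(3)]) auto
    finally show "a + b \<in> local_gen Q X"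
      using prm_mult_compl[OF Q a(2) b(2)] a(1) b(1) unfolding local_gen_def by blast
  next
    fix r a assume r: "r \<in> R" and "a \<in> local_gen Q X"
    then obtain s where a: "a \<in> R" "s \<in> R - Q" "s * a \<in> gen X" unfolding local_gen_def by blast
    have "s * (r * a) \<in> gen X" using d(5)[OF r a(3)] by (simp add: mult.left_commute)
    then show "r * a \<in> local_gen Q X" using a r unfolding local_gen_def by blast
  next
    fix s v assume s: "s \<in> R - Q" and v: "v \<in> R" and "s * v \<in> local_gen Q X"
    then obtain t where t: "t \<in> R - Q" "t * (s * v) \<in> gen X" unfolding local_gen_def by blast
    then have "(t * s) * v \<in> gen X" by (simp add: mult.assoc)
    then show "v \<in> local_gen Q X" using prm_mult_compl[OF Q t(1) s] v unfolding local_gen_def by blast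
  qed
qed

lemma local_gen_upper: assumes "prm Q" "X \<subseteq> R" shows "gen X \<subseteq> local_gen Q X"
proof
  fix y assume y: "y \<in> gen X"
  then have "1 * y \<in> gen X" "y \<in> R" using idlD(3)[OF gen_idl[OF assms(2)]] by auto
  then show "y \<in> local_gen Q X" using prm_one_compl[OF assms(1)] unfolding local_gen_def by blast
qed

lemma local_gen_least:
  assumes "local_idl Q J" "X \<subseteq> J" shows "local_gen Q X \<subseteq> J"
  using assms gen_least[of J X] unfolding local_idl_def local_gen_def by blast

text \<open>Nakayama's lemma \<open>N \<subseteq> x N + J \<Longrightarrow> N \<subseteq> J\<close> at the prime \<open>Q\<close>. In place of finite generation of \<open>N\<close> it
  uses an element \<open>y \<in> N - J\<close> with \<open>J + (y)\<close> maximal: from \<open>y = x a\<close> modulo \<open>J\<close> and the maximality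
  one gets \<open>a = b y\<close> modulo \<open>J\<close>, up to a multiplier outside \<open>Q\<close>, so \<open>(1 - b x) a \<in> J\<close>.\<close>

lemma local_nakayama:
  assumes Q: "prm Q" and J: "local_idl Q J" and x: "x \<in> Q" and N: "N \<subseteq> R"
    and step: "\<And>y. y \<in> N \<Longrightarrow> \<exists>s\<in>R - Q. \<exists>a\<in>N. s * y - x * a \<in> J"
  shows "N \<subseteq> J"
proof (rule ccontr)
  assume "\<not> N \<subseteq> J"
  have JI: "idl J" and Jsat: "\<And>s v. s \<in> R - Q \<Longrightarrow> v \<in> R \<Longrightarrow> s * v \<in> J \<Longrightarrow> v \<in> J" using J by (auto simp: local_idl_def)
  note d = idlD[OF JI] and dQ = prmD[OF Q]
  let ?F = "\<lambda>y. local_gen Q (insert y J)"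
  have sub: "insert y J \<subseteq> R" if "y \<in> R" for y using that d(1) by auto
  have "\<exists>M\<in>?F ` (N - J). \<forall>I\<in>?F ` (N - J). M \<subseteq> I \<longrightarrow> I = M"
  proof (rule idl_family_has_maximal)
    show "?F ` (N - J) \<noteq> {}" using \<open>\<not> N \<subseteq> J\<close> by auto
    fix I assume "I \<in> ?F ` (N - J)"
    then show "idl I" using local_gen_local_idl[OF Q sub] N unfolding local_idl_def by auto
  qed
  then obtain y where y: "y \<in> N" "y \<notin> J" and max: "\<And>a. a \<in> N \<Longrightarrow> a \<notin> J \<Longrightarrow> ?F y \<subseteq> ?F a \<Longrightarrow> ?F a = ?F y" by auto
  obtain s a where s: "s \<in> R - Q" "a \<in> N" "s * y - x * a \<in> J" using step[OF y(1)] by blast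
  have R: "y \<in> R" "a \<in> R" "x \<in> R" using y s N x dQ(3) by auto
  have "a \<notin> J"
  proof
    assume "a \<in> J"
    then have "(s * y - x * a) + x * a \<in> J" using s R d by blast
    then show False using Jsat[OF s(1) R(1)] y by simp
  qed
  moreover have "?F y \<subseteq> ?F a"
  proof (rule local_gen_least[OF local_gen_local_idl[OF Q sub[OF R(2)]]])
    note dg = idlD[OF gen_idl[OF sub[OF R(2)]]]
    have "(s * y - x * a) + x * a \<in> gen (insert a J)"
      using s(3) R gen_upper[of "insert a J"] by (intro dg(4) dg(5)) auto
    then have "y \<in> ?F a" using R s(1) unfolding local_gen_def by auto
    moreover have "J \<subseteq> ?F a" using gen_upper[of "insert a J"] local_gen_upper[OF Q sub[OF R(2)]] by blast
    ultimately show "insert y J \<subseteq> ?F a" by simp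
  qed
  ultimately have "?F a = ?F y" using max s by blast
  moreover have "a \<in> ?F a" using gen_upper[of "insert a J"] local_gen_upper[OF Q sub[OF R(2)]] by blast
  ultimately obtain t where t: "t \<in> R - Q" "t * a \<in> gen (insert y J)" unfolding local_gen_def by blast
  then obtain j b where j: "j \<in> gen J" "b \<in> R" "t * a = j + b * y"
    using gen_insertE[of "t * a" y J] sub[OF R(1)] by metis
  have jJ: "j \<in> J" using j(1) gen_least[OF JI] by blast
  have "(s * t - b * x) * a = s * j + b * (s * y - x * a)"
  proof -
    have "s * (t * a) = s * (j + b * y)" using j(3) by simp
    then show ?thesis by (simp add: algebra_simps)
  qed
  also have "\<dots> \<in> J" using s j(2) jJ by (intro d(4) d(5)) auto
  finally have "(s * t - b * x) * a \<in> J" .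
  moreover have "s * t - b * x \<in> R - Q"
  proof -
    have "s * t - b * x \<notin> Q"
    proof
      assume "s * t - b * x \<in> Q"
      then have "(s * t - b * x) + b * x \<in> Q" using idlD(4)[OF dQ(1)] idlD(5)[OF dQ(1) j(2) x] by blast
      then show False using prm_mult_compl[OF Q s(1) t(1)] by simp
    qed
    then show ?thesis using s t j R by auto
  qed
  ultimately show False using Jsat R(2) \<open>a \<notin> J\<close> by blast
qed

text \<open>A form of Krull's principal ideal theorem. If there were no such \<open>P\<close>, the ring modulo \<open>p0 + (x)\<close>
  would have finite length at \<open>Q\<close>. For \<open>y \<in> p1 - p0\<close> the decreasing ideals \<open>q i = ((y\<^sup>i) + p0) :
  x\<^sup>\<infinity>\<close> become stationary modulo \<open>x\<close>, and by Nakayama's lemma stationary: \<open>y\<^sup>i\<close> is, up to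
  multiplication by a power of \<open>x\<close> and modulo \<open>p0\<close>, a multiple of \<open>y\<^sup>i\<^sup>+\<^sup>1\<close>. Cancelling \<open>y\<^sup>i\<close>, a
  power of \<open>x\<close> lies in \<open>(y) + p0 \<subseteq> p1\<close>.\<close>

lemma prime_between_through:
  assumes p0: "prm p0" and p1: "prm p1" and Q: "prm Q" and sub: "p0 \<subset> p1" "p1 \<subset> Q"
    and x: "x \<in> Q" "x \<notin> p0"
  shows "\<exists>P. prm P \<and> p0 \<subset> P \<and> P \<subset> Q \<and> x \<in> P"
proof (rule ccontr)
  assume none: "\<not> ?thesis"
  note d0 = prmD[OF p0] and d1 = prmD[OF p1] and dQ = prmD[OF Q]
  note i0 = idlD[OF d0(1)] and i1 = idlD[OF d1(1)]
  have xR: "x \<in> R" using x dQ by auto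
  have "x \<notin> p1" using none p1 sub by blast
  obtain y where y: "y \<in> p1" "y \<notin> p0" using sub by blast
  have yR: "y \<in> R" using y d1 by auto
  let ?M = "algebra_of_hom (\<lambda>x. x) ring_of :: ('a, 'a) module"
  interpret self: algebra ring_of ?M
    by (rule algebra_algebra_of_hom[OF ring_of_cring ring_of_cring]) (auto simp: Ring.ring_hom_def)
  interpret self: module_at_prime ring_of ?M Q
    unfolding module_at_prime_def using self.module_axioms Q by (simp add: prm_iff_primeideal)
  have subm: "self.local_submodule N \<longleftrightarrow> local_idl Q N" for N
    unfolding self.local_submodule_def local_idl_def idl_def by (auto simp: algebra_of_hom_def)
  have adj: "self.local_adjoin W w = {v \<in> R. \<exists>s\<in>R - Q. \<exists>z\<in>W. \<exists>b\<in>R. s * v = z + b * w}" for W w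
    unfolding self.local_adjoin_def by (auto simp: algebra_of_hom_def)
  have p0_local: "local_idl Q p0" unfolding local_idl_def using d0 sub by blast
  define L where "L = self.local_adjoin p0 x"
  have L: "self.local_submodule L"
    unfolding L_def using self.local_adjoin_submodule p0_local subm xR by (simp add: algebra_of_hom_def)
  have Lup: "p0 \<subseteq> L" "x \<in> L"
    unfolding L_def using self.local_adjoin_upper[of p0 x] p0_local subm xR by (auto simp: algebra_of_hom_def)
  have tors: "\<exists>n::nat. q ^ n * v \<in> L" if q: "q \<in> Q" and v: "v \<in> R" for q v
  proof -
    have qR: "q \<in> R" using q dQ by auto
    \<comment> \<open>a prime above \<open>L\<close> disjoint from this set would be a prime strictly between \<open>p0\<close> and \<open>Q\<close> through \<open>x\<close>\<close>
    define S where "S = {s * q ^ n |s n. s \<in> R - Q}"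
    have "L \<inter> S \<noteq> {}"
    proof
      assume disj: "L \<inter> S = {}"
      have "\<exists>P. prm P \<and> L \<subseteq> P \<and> P \<inter> S = {}"
      proof (rule prm_avoiding[OF _ _ _ _ disj])
        show "idl L" using L subm by (auto simp: local_idl_def)
        show "S \<subseteq> R" using qR by (auto simp: S_def)
        have "1 = 1 * q ^ 0" by simp
        then show "1 \<in> S" using prm_one_compl[OF Q] unfolding S_def by blast
        fix a b assume "a \<in> S" "b \<in> S"
        then obtain s n t m where "a = s * q ^ n" "b = t * q ^ m" "s \<in> R - Q" "t \<in> R - Q"
          unfolding S_def by blast
        then have "a * b = (s * t) * q ^ (n + m)" "s * t \<in> R - Q"
          using prm_mult_compl[OF Q] by (auto simp: power_add algebra_simps)
        then show "a * b \<in> S" unfolding S_def by blast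
      qed
      then obtain P where P: "prm P" "L \<subseteq> P" "P \<inter> S = {}" by blast
      have mem: "s * q ^ n \<in> S" if "s \<in> R - Q" for s n using that unfolding S_def by blast
      have "P \<subseteq> Q" using mem[of _ 0] P(3) prmD(3)[OF P(1)] by auto
      moreover have "q \<notin> P" using mem[of 1 1] prm_one_compl[OF Q] P(3) by auto
      ultimately have "P \<subset> Q" using q by auto
      moreover have "p0 \<subset> P" "x \<in> P" using Lup P(2) x by auto
      ultimately show False using none P(1) by blast
    qed
    then obtain s n where s: "s \<in> R - Q" "s * q ^ n \<in> L" unfolding S_def by auto
    have Ll: "local_idl Q L" using L subm by simp
    then have "q ^ n \<in> L" using s qR unfolding local_idl_def by blast
    then show ?thesis using v idlD(6)[of L] Ll unfolding local_idl_def by blast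
  qed
  have pow: "q [^]\<^bsub>ring_of\<^esub> (n::nat) = q ^ n" for q n by (induction n) (simp_all add: nat_pow_def mult.commute)
  have "\<exists>V. self.finite_length_over L V \<and> {1} \<subseteq> V"
    by (rule self.finite_length_over_reach_finite[OF noetherian L])
      (use tors pow in \<open>auto simp: algebra_of_hom_def\<close>)
  then obtain V where V: "self.finite_length_over L V" "1 \<in> V" by blast
  have "local_idl Q V" using self.finite_length_overD(1)[OF V(1)] subm by simp
  then have VI: "idl V" by (simp add: local_idl_def)
  have "r \<in> V" if "r \<in> R" for r using idlD(5)[OF VI that V(2)] by simp
  then have "V = R" using idlD(1)[OF VI] by blast
  then obtain l W w where cs: "self.comp_series L l W w" "W l = R"
    using V(1) unfolding self.finite_length_over_def by blast
  \<comment> \<open>the ideals \<open>((y ^ i) + p0) : x ^ \<infinity>\<close>, localized at \<open>Q\<close>\<close>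
  define q where "q i = {b \<in> R. \<exists>s\<in>R - Q. \<exists>k. \<exists>c\<in>R. s * x ^ k * b - c * y ^ i \<in> p0}" for i
  have q_local: "local_idl Q (q i)" for i
    unfolding local_idl_def idl_def
  proof (intro conjI ballI impI)
    show "q i \<subseteq> R" by (auto simp: q_def)
    have "1 * x ^ 0 * 0 - 0 * y ^ i \<in> p0" using i0 by simp
    then show "0 \<in> q i" using prm_one_compl[OF Q] unfolding q_def by blast
  next
    fix a b assume "a \<in> q i" "b \<in> q i"
    then obtain s k c t m e where a: "a \<in> R" "s \<in> R - Q" "c \<in> R" "s * x ^ k * a - c * y ^ i \<in> p0"
      and b: "b \<in> R" "t \<in> R - Q" "e \<in> R" "t * x ^ m * b - e * y ^ i \<in> p0" unfolding q_def by blast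
    have "(s * t) * x ^ (k + m) * (a + b) - (t * x ^ m * c + s * x ^ k * e) * y ^ i
      = t * x ^ m * (s * x ^ k * a - c * y ^ i) + s * x ^ k * (t * x ^ m * b - e * y ^ i)"
      by (simp add: algebra_simps power_add)
    also have "\<dots> \<in> p0" using a b xR by (intro i0(4) i0(5)) auto
    finally have "(s * t) * x ^ (k + m) * (a + b) - (t * x ^ m * c + s * x ^ k * e) * y ^ i \<in> p0" .
    moreover have "t * x ^ m * c + s * x ^ k * e \<in> R" "a + b \<in> R" using a b xR by auto
    ultimately show "a + b \<in> q i" using prm_mult_compl[OF Q a(2) b(2)] unfolding q_def by blast
  next
    fix r a assume r: "r \<in> R" and "a \<in> q i"
    then obtain s k c where a: "a \<in> R" "s \<in> R - Q" "c \<in> R" "s * x ^ k * a - c * y ^ i \<in> p0"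
      unfolding q_def by blast
    have "s * x ^ k * (r * a) - (r * c) * y ^ i = r * (s * x ^ k * a - c * y ^ i)" by (simp add: algebra_simps)
    also have "\<dots> \<in> p0" using a r by (intro i0(5)) auto
    finally show "r * a \<in> q i" using a r unfolding q_def by blast
  next
    fix r a assume r: "r \<in> R - Q" and aR: "a \<in> R" and "r * a \<in> q i"
    then obtain s k c where a: "s \<in> R - Q" "c \<in> R" "s * x ^ k * (r * a) - c * y ^ i \<in> p0"
      unfolding q_def by blast
    then have "(s * r) * x ^ k * a - c * y ^ i \<in> p0" by (simp add: algebra_simps)
    then show "a \<in> q i" using a(2) aR prm_mult_compl[OF Q a(1) r] unfolding q_def by blast
  qed
  have q_anti: "q (Suc i) \<subseteq> q i" for i
  proof
    fix a assume "a \<in> q (Suc i)"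
    then obtain s k c where a: "a \<in> R" "s \<in> R - Q" "c \<in> R" "s * x ^ k * a - c * y ^ Suc i \<in> p0"
      unfolding q_def by blast
    then have "s * x ^ k * a - (c * y) * y ^ i \<in> p0" by (simp add: algebra_simps)
    then show "a \<in> q i" using a yR unfolding q_def by blast
  qed
  have p0_q: "p0 \<subseteq> q i" for i
  proof
    fix a assume "a \<in> p0"
    then have "1 * x ^ 0 * a - 0 * y ^ i \<in> p0" "a \<in> R" using i0 by auto
    then show "a \<in> q i" using prm_one_compl[OF Q] unfolding q_def by blast
  qed
  define N where "N i = self.local_adjoin (q i) x" for i
  have N: "self.local_submodule (N i)" for i
    unfolding N_def using self.local_adjoin_submodule q_local subm xR by (simp add: algebra_of_hom_def)
  have N_anti: "N (Suc i) \<subseteq> N i" for i unfolding N_def adj using q_anti[of i] by blast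
  have LN: "L \<subseteq> N i" for i unfolding N_def L_def adj using p0_q[of i] by blast
  have "\<exists>i. card (self.leading l W (N i)) \<le> card (self.leading l W (N (Suc i)))"
  proof (rule ccontr)
    assume "\<not> ?thesis"
    then have dec: "card (self.leading l W (N (Suc i))) < card (self.leading l W (N i))" for i
      by (simp add: not_le)
    have "card (self.leading l W (N i)) + i \<le> card (self.leading l W (N 0))" for i
    proof (induction i)
      case (Suc i) then show ?case using dec[of i] by simp
    qed simp
    from this[of "Suc (card (self.leading l W (N 0)))"] show False by simp
  qed
  then obtain i where i: "card (self.leading l W (N i)) \<le> card (self.leading l W (N (Suc i)))" by blast
  have "self.leading l W (N (Suc i)) \<subseteq> self.leading l W (N i)" using self.leading_mono[OF N_anti] .
  then have "self.leading l W (N (Suc i)) = self.leading l W (N i)"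
    using i card_seteq by (metis self.finite_leading)
  then have Ni: "N i = N (Suc i)" using self.leading_determines[OF cs(1) N LN N _ N_anti] cs(2) N[of i]
    unfolding self.local_submodule_def by (simp add: algebra_of_hom_def)
  have "q i \<subseteq> q (Suc i)"
  proof (rule local_nakayama[OF Q q_local x(1)])
    show "q i \<subseteq> R" by (auto simp: q_def)
    fix b assume b: "b \<in> q i"
    then have "b \<in> N i"
      unfolding N_def using self.local_adjoin_upper(1)[of "q i" x] q_local subm xR
      by (auto simp: algebra_of_hom_def)
    then have "b \<in> N (Suc i)" using Ni by simp
    then obtain s z a where s: "s \<in> R - Q" "z \<in> q (Suc i)" "a \<in> R" "s * b = z + a * x"
      unfolding N_def adj by blast
    have "z \<in> q i" using s q_anti by blast
    moreover have qi: "idl (q i)" using q_local[of i] by (simp add: local_idl_def)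
    ultimately have "s * b - z \<in> q i" using idlD(8)[OF qi idlD(5)[OF qi _ b]] s(1) by blast
    then have "a * x \<in> q i" using s(4) by simp
    then obtain t k c where t: "t \<in> R - Q" "c \<in> R" "t * x ^ k * (a * x) - c * y ^ i \<in> p0"
      unfolding q_def by blast
    then have "t * x ^ Suc k * a - c * y ^ i \<in> p0" by (simp add: algebra_simps)
    then have "a \<in> q i" using t s(3) unfolding q_def by blast
    moreover have "s * b - x * a \<in> q (Suc i)" using s(2,4) by (simp add: algebra_simps)
    ultimately show "\<exists>s\<in>R - Q. \<exists>a\<in>q i. s * b - x * a \<in> q (Suc i)" using s(1) by blast
  qed
  moreover have "y ^ i \<in> q i"
  proof -
    have "1 * x ^ 0 * y ^ i - 1 * y ^ i \<in> p0" using i0(2) by simp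
    then show ?thesis using yR prm_one_compl[OF Q] one_mem unfolding q_def by blast
  qed
  ultimately obtain s k c where s: "s \<in> R - Q" "c \<in> R" "s * x ^ k * y ^ i - c * y ^ Suc i \<in> p0"
    unfolding q_def by blast
  then have "(s * x ^ k - c * y) * y ^ i \<in> p0" by (simp add: algebra_simps)
  then have "s * x ^ k - c * y \<in> p0 \<or> y ^ i \<in> p0" using d0(4) s xR yR by auto
  then have "s * x ^ k - c * y \<in> p1" using prm_power[OF p0 yR] y(2) sub(1) by blast
  then have "(s * x ^ k - c * y) + c * y \<in> p1" using i1(4,5) s(2) y(1) by blast
  then have "s * x ^ k \<in> p1" by simp
  then have "s \<in> p1 \<or> x ^ k \<in> p1" using d1(4) s xR by auto
  then show False using s(1) sub prm_power[OF p1 xR] \<open>x \<notin> p1\<close> by blast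
qed

definition prime_chain :: "(nat \<Rightarrow> 'a set) \<Rightarrow> nat \<Rightarrow> bool" where
  "prime_chain c l \<longleftrightarrow> (\<forall>i\<le>l. prm (c i)) \<and> (\<forall>i<l. c i \<subset> c (Suc i))"

lemma prime_chain_mono:
  assumes "prime_chain c l" "i \<le> j" "j \<le> l" shows "c i \<subseteq> c j"
  using assms(2,3)
proof (induction j rule: dec_induct)
  case (step m)
  then have "c m \<subset> c (Suc m)" using assms(1) by (auto simp: prime_chain_def)
  then show ?case using step by auto
qed simp

lemma prime_chain_shift: "prime_chain c (k + l) \<Longrightarrow> prime_chain (\<lambda>i. c (k + i)) l"
  unfolding prime_chain_def by auto

text \<open>Starting from the top, each member of the chain above the second is used to move \<open>x\<close> one step
  down, by \<open>prime_between_through\<close>.\<close>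

lemma prime_chain_through:
  assumes "prime_chain c (Suc l)" "x \<in> c (Suc l)"
  shows "\<exists>c'. prime_chain c' (Suc l) \<and> c' 0 = c 0 \<and> c' (Suc l) = c (Suc l) \<and> x \<in> c' 1"
  using assms
proof (induction l arbitrary: c)
  case 0 then show ?case by auto
next
  case (Suc l)
  have "\<exists>c''. prime_chain c'' (Suc l) \<and> c'' 0 = c 0 \<and> c'' (Suc l) \<subset> c (Suc (Suc l)) \<and> x \<in> c'' (Suc l)"
  proof (cases "x \<in> c (Suc l)")
    case True
    then show ?thesis using Suc.prems(1) by (intro exI[of _ c]) (auto simp: prime_chain_def)
  next
    case False
    have sub: "c l \<subset> c (Suc l)" "c (Suc l) \<subset> c (Suc (Suc l))"
      and pr: "prm (c l)" "prm (c (Suc l))" "prm (c (Suc (Suc l)))"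
      using Suc.prems(1) by (auto simp: prime_chain_def)
    obtain P where P: "prm P" "c l \<subset> P" "P \<subset> c (Suc (Suc l))" "x \<in> P"
      using prime_between_through[OF pr sub Suc.prems(2)] False sub by blast
    have "prime_chain (c(Suc l := P)) (Suc l)"
      using Suc.prems(1) P(1,2) by (auto simp: prime_chain_def less_Suc_eq)
    then show ?thesis using P by (intro exI[of _ "c(Suc l := P)"]) auto
  qed
  then obtain c'' where c'': "prime_chain c'' (Suc l)" "c'' 0 = c 0"
    "c'' (Suc l) \<subset> c (Suc (Suc l))" "x \<in> c'' (Suc l)" by blast
  obtain c' where c': "prime_chain c' (Suc l)" "c' 0 = c 0" "c' (Suc l) = c'' (Suc l)" "x \<in> c' 1"
    using Suc.IH[OF c''(1,4)] c''(2) by auto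
  define d where "d = c'(Suc (Suc l) := c (Suc (Suc l)))"
  have "prime_chain d (Suc (Suc l))"
    using c'(1,3) c''(3) Suc.prems(1) by (auto simp: d_def prime_chain_def less_Suc_eq le_Suc_eq)
  moreover have "d 0 = c 0" "d (Suc (Suc l)) = c (Suc (Suc l))" "x \<in> d 1" using c' by (auto simp: d_def)
  ultimately show ?case by blast
qed

definition locally_generates :: "'a set \<Rightarrow> 'a set \<Rightarrow> bool" where
  "locally_generates Q X \<longleftrightarrow> (\<forall>y\<in>Q. \<exists>s\<in>R - Q. s * y \<in> gen X)"

text \<open>Krull's height theorem. One generator \<open>x\<close> after the other is moved into the second prime of the
  chain and from \<open>X\<close> to \<open>J\<close>, while the chain loses its first member.\<close>

lemma chain_length_le_card_generators:
  assumes "finite X" "X \<subseteq> Q" "prime_chain c l" "c l = Q" "J \<subseteq> c 0" "locally_generates Q (J \<union> X)"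
  shows "l \<le> card X"
  using assms
proof (induction X arbitrary: c l J rule: finite_induct)
  case empty
  show ?case
  proof (rule ccontr)
    assume "\<not> ?thesis"
    then have l: "0 < l" by simp
    have "prm (c 0)" "c 0 \<subset> c 1" using empty.prems(2) l by (auto simp: prime_chain_def)
    moreover have "c 1 \<subseteq> Q" using prime_chain_mono[of c l 1 l] empty.prems l by auto
    ultimately have p: "prm (c 0)" "c 0 \<subset> Q" by auto
    then obtain y where y: "y \<in> Q" "y \<notin> c 0" by blast
    obtain s where s: "s \<in> R - Q" "s * y \<in> gen J" using empty.prems(5) y unfolding locally_generates_def by auto
    have "gen J \<subseteq> c 0" using gen_least prmD(1)[OF p(1)] empty.prems by blast
    moreover have "y \<in> R" using y empty.prems(2,3) prmD(3) by (auto simp: prime_chain_def)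
    ultimately have "s \<in> c 0" using prmD(4)[OF p(1), of s y] s y by blast
    then show False using s p by blast
  qed
next
  case (insert x X)
  show ?case
  proof (cases l)
    case (Suc m)
    obtain c' where c': "prime_chain c' (Suc m)" "c' 0 = c 0" "c' (Suc m) = Q" "x \<in> c' 1"
      using prime_chain_through[of c m x] insert.prems Suc by auto
    have "m \<le> card X"
    proof (rule insert.IH)
      show "prime_chain (\<lambda>i. c' (1 + i)) m" using prime_chain_shift[of c' 1 m] c'(1) by simp
      show "insert x J \<subseteq> c' (1 + 0)" using c' insert.prems(4) prime_chain_mono[OF c'(1), of 0 1] by auto
      show "locally_generates Q (insert x J \<union> X)" using insert.prems(5) by simp
    qed (use c' insert.prems in auto)
    then show ?thesis using Suc insert.hyps by simp
  qed simp
qed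

text \<open>By induction the second prime of a chain through a generator \<open>x\<close> is \<open>J + (x)\<close> locally, and \<open>x \<notin>
  c 0\<close> by the height theorem. So \<open>y \<in> c 0\<close>, written as \<open>j + a x\<close>, has \<open>a \<in> c 0\<close>, and Nakayama's
  lemma removes the term with \<open>x\<close>.\<close>

lemma regular_chain_bottom:
  assumes "finite X" "X \<subseteq> Q" "prime_chain c l" "c l = Q" "J \<subseteq> c 0" "card X \<le> l"
    "locally_generates Q (J \<union> X)"
  shows "c 0 \<subseteq> local_gen Q J"
  using assms
proof (induction X arbitrary: c l J rule: finite_induct)
  case empty
  have "c 0 \<subseteq> Q" using prime_chain_mono[OF empty.prems(2), of 0 l] empty.prems(3) by auto
  moreover have "c 0 \<subseteq> R" using empty.prems(2) prmD(3) by (auto simp: prime_chain_def)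
  ultimately show ?case using empty.prems(6) unfolding locally_generates_def local_gen_def by auto
next
  case (insert x X)
  then obtain m where m: "l = Suc m" by (cases l) auto
  have xX: "x \<in> Q" "X \<subseteq> Q" using insert.prems by auto
  have Q: "prm Q" and p: "prm (c 0)" using insert.prems by (auto simp: prime_chain_def)
  have x0: "x \<notin> c 0"
  proof
    assume "x \<in> c 0"
    then have "l \<le> card X"
      using chain_length_le_card_generators[OF insert.hyps(1) xX(2) insert.prems(2,3), of "insert x J"]
        insert.prems by auto
    then show False using insert.prems insert.hyps by auto
  qed
  obtain c' where c': "prime_chain c' (Suc m)" "c' 0 = c 0" "c' (Suc m) = Q" "x \<in> c' 1"
    using prime_chain_through[of c m x] insert.prems m by auto
  have sub: "c 0 \<subseteq> c' 1" using prime_chain_mono[OF c'(1), of 0 1] c'(2) by auto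
  have "c' (1 + 0) \<subseteq> local_gen Q (insert x J)"
  proof (rule insert.IH)
    show "prime_chain (\<lambda>i. c' (1 + i)) m" using prime_chain_shift[of c' 1 m] c'(1) by simp
    show "insert x J \<subseteq> c' (1 + 0)" using c' insert.prems(4) sub by auto
    show "locally_generates Q (insert x J \<union> X)" using insert.prems(6) by simp
    show "card X \<le> m" using insert.prems insert.hyps m by simp
  qed (use c' insert.prems in auto)
  then have 1: "c 0 \<subseteq> local_gen Q (insert x J)" using sub by auto
  have xR: "x \<in> R" using xX prmD(3)[OF Q] by auto
  have JR: "J \<subseteq> R" using insert.prems(4) prmD(3)[OF p] by auto
  note d = idlD[OF prmD(1)[OF p]]
  show ?case
  proof (rule local_nakayama[OF Q local_gen_local_idl[OF Q JR] xX(1)])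
    show "c 0 \<subseteq> R" using prmD(3)[OF p] .
    fix y assume y: "y \<in> c 0"
    then obtain s where s: "s \<in> R - Q" "s * y \<in> gen (insert x J)" using 1 unfolding local_gen_def by blast
    then obtain j a where j: "j \<in> gen J" "a \<in> R" "s * y = j + a * x"
      using gen_insertE[of "s * y" x J] xR JR by (metis insert_subset)
    have jc: "j \<in> c 0" using j gen_least[OF prmD(1)[OF p] insert.prems(4)] by blast
    have "s * y - j \<in> c 0" using d(8)[OF d(5)[OF _ y] jc] s by blast
    then have "a * x \<in> c 0" using j by simp
    then have "a \<in> c 0" using prmD(4)[OF p j(2) xR] x0 by blast
    moreover have "s * y - x * a \<in> local_gen Q J" using j local_gen_upper[OF Q JR] by (auto simp: algebra_simps)
    ultimately show "\<exists>s\<in>R - Q. \<exists>a\<in>c 0. s * y - x * a \<in> local_gen Q J" using s(1) by blast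
  qed
qed

text \<open>Since \<open>f\<close> is not in \<open>J + Q\<^sup>2\<close>, even up to a multiplier outside \<open>Q\<close>, some generator \<open>x\<close> occurs in
  it with a coefficient outside \<open>Q\<close>.\<close>

lemma generator_exchange:
  assumes Q: "prm Q" and X: "finite X" "X \<subseteq> Q" and J: "J \<subseteq> Q" and f: "f \<in> Q"
    and gen: "locally_generates Q (J \<union> X)"
    and indep: "\<And>s. s \<in> R - Q \<Longrightarrow> s * f \<notin> gen (J \<union> {a * b |a b. a \<in> Q \<and> b \<in> Q})"
  shows "\<exists>x\<in>X. locally_generates Q (insert f J \<union> (X - {x}))"
proof -
  note dQ = prmD[OF Q]
  let ?QQ = "{a * b |a b. a \<in> Q \<and> b \<in> Q}"
  have QR: "q \<in> R" if "q \<in> Q" for q using that dQ(3) by auto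
  have R: "J \<union> X \<subseteq> R" "f \<in> R" "J \<union> ?QQ \<subseteq> R" using X J f QR by blast+
  obtain s where s: "s \<in> R - Q" "s * f \<in> gen (J \<union> X)" using gen f unfolding locally_generates_def by blast
  obtain a j where a: "\<forall>x\<in>X. a x \<in> R" "j \<in> gen J" "s * f = j + (\<Sum>x\<in>X. a x * x)"
    using gen_finiteE[OF X(1) s(2) R(1)] by blast
  have "\<exists>x\<in>X. a x \<notin> Q"
  proof (rule ccontr)
    assume "\<not> ?thesis"
    then have "(\<Sum>x\<in>X. a x * x) \<in> gen (J \<union> ?QQ)"
      using X(2) gen_upper[of "J \<union> ?QQ"] by (intro idl_sum[OF gen_idl[OF R(3)]]) blast
    moreover have "j \<in> gen (J \<union> ?QQ)" using a(2) gen_mono[of J "J \<union> ?QQ"] by blast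
    ultimately have "s * f \<in> gen (J \<union> ?QQ)" using a(3) idlD(4)[OF gen_idl[OF R(3)]] by simp
    then show False using indep s by blast
  qed
  then obtain x where x: "x \<in> X" "a x \<notin> Q" by blast
  let ?Y = "insert f J \<union> (X - {x})"
  have YR: "?Y \<subseteq> R" using R by auto
  note d = idlD[OF gen_idl[OF YR]]
  have axR: "a x \<in> R - Q" using x a by auto
  have JY: "gen (J \<union> (X - {x})) \<subseteq> gen ?Y" "gen J \<subseteq> gen ?Y" by (auto intro!: gen_mono)
  have "a x * x = s * f - j - (\<Sum>z\<in>X - {x}. a z * z)" using a(3) by (simp add: sum.remove[OF X(1) x(1)])
  also have "\<dots> \<in> gen ?Y"
  proof (intro d(8))
    show "s * f \<in> gen ?Y" using gen_upper[of ?Y] s by (intro d(5)) auto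
    show "j \<in> gen ?Y" using a JY by blast
    show "(\<Sum>z\<in>X - {x}. a z * z) \<in> gen ?Y"
      using gen_upper[of ?Y] a(1) by (intro idl_sum[OF gen_idl[OF YR]] d(5)) auto
  qed
  finally have ax: "a x * x \<in> gen ?Y" .
  have "locally_generates Q ?Y" unfolding locally_generates_def
  proof
    fix z assume z: "z \<in> Q"
    obtain t where t: "t \<in> R - Q" "t * z \<in> gen (J \<union> X)" using gen z unfolding locally_generates_def by blast
    have ins: "insert x (J \<union> (X - {x})) = J \<union> X" using x by auto
    then obtain k b where k: "k \<in> gen (J \<union> (X - {x}))" "b \<in> R" "t * z = k + b * x"
      using gen_insertE[of "t * z" x "J \<union> (X - {x})"] t R by metis
    have "(a x * t) * z = a x * k + b * (a x * x)"
      using arg_cong[OF k(3), of "\<lambda>u. a x * u"] by (simp add: algebra_simps)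
    also have "\<dots> \<in> gen ?Y" using k axR JY by (intro d(4) d(5)[OF _ ax] d(5)[of "a x" k]) auto
    finally show "\<exists>s\<in>R - Q. s * z \<in> gen ?Y" using prm_mult_compl[OF Q axR t(1)] by blast
  qed
  then show ?thesis using x by blast
qed

text \<open>Regularity of the local ring at \<open>Q\<close> without mention of its dimension: by the height theorem a
  chain is never longer than a set of local generators, so \<open>card X \<le> l\<close> forces both numbers to be
  the dimension.\<close>

definition regular_at :: "'a set \<Rightarrow> bool" where
  "regular_at Q \<longleftrightarrow> (\<exists>c l X. prime_chain c l \<and> c l = Q \<and> finite X \<and> X \<subseteq> Q \<and> card X \<le> l \<and> locally_generates Q X)"

text \<open>Elements that are independent modulo \<open>Q\<^sup>2\<close> are part of a system of at most \<open>l\<close> generators, by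
  exchange; and a chain of length \<open>l\<close> that ends in \<open>Q\<close> can be made to pass through them one at a
  time. Then \<open>regular_chain_bottom\<close> applies to the part of the chain above \<open>c r\<close>.\<close>

lemma regular_parameters_generate_prime:
  assumes reg: "regular_at Q" and f: "\<And>i. i < r \<Longrightarrow> f i \<in> Q"
    and indep: "\<And>i s. i < r \<Longrightarrow> s \<in> R - Q \<Longrightarrow> s * f i \<notin> gen (f ` {..<i} \<union> {a * b |a b. a \<in> Q \<and> b \<in> Q})"
  shows "\<exists>c. prime_chain c r \<and> c r \<subseteq> Q \<and> f ` {..<r} \<subseteq> c r \<and> c r \<subseteq> local_gen Q (f ` {..<r})"
proof -
  obtain c0 l X0 where c0: "prime_chain c0 l" "c0 l = Q" "finite X0" "X0 \<subseteq> Q" "card X0 \<le> l"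
    "locally_generates Q X0" using reg unfolding regular_at_def by (elim exE conjE) (rule that; assumption)
  have Q: "prm Q" using c0 by (auto simp: prime_chain_def)
  have gens: "k \<le> r \<Longrightarrow> \<exists>X. finite X \<and> X \<subseteq> Q \<and> card X + k = card X0 \<and> locally_generates Q (f ` {..<k} \<union> X)" for k
  proof (induction k)
    case 0 then show ?case using c0 by auto
  next
    case (Suc k)
    then obtain X where X: "finite X" "X \<subseteq> Q" "card X + k = card X0" "locally_generates Q (f ` {..<k} \<union> X)"
      by auto
    have "f ` {..<k} \<subseteq> Q" "f k \<in> Q" using f Suc.prems by auto
    then obtain x where x: "x \<in> X" "locally_generates Q (insert (f k) (f ` {..<k}) \<union> (X - {x}))"
      using generator_exchange[OF Q X(1,2) _ _ X(4), of "f k"] indep[of k] Suc.prems by auto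
    have "card X = Suc (card (X - {x}))" using x X(1) by (metis card.remove)
    moreover have "insert (f k) (f ` {..<k}) \<union> (X - {x}) = f ` {..<Suc k} \<union> (X - {x})"
      by (auto simp: lessThan_Suc)
    ultimately show ?case using x X by (intro exI[of _ "X - {x}"]) auto
  qed
  obtain X where X: "finite X" "X \<subseteq> Q" "card X + r = card X0" "locally_generates Q (f ` {..<r} \<union> X)"
    using gens[of r] by auto
  have rl: "r \<le> l" using X c0 by simp
  have chains: "k \<le> r \<Longrightarrow> \<exists>c. prime_chain c l \<and> c l = Q \<and> f ` {..<k} \<subseteq> c k" for k
  proof (induction k)
    case 0 then show ?case using c0 by auto
  next
    case (Suc k)
    then obtain c where c: "prime_chain c l" "c l = Q" "f ` {..<k} \<subseteq> c k" by auto
    obtain m where m: "l = k + Suc m" using Suc.prems rl by (metis Suc_le_D add_Suc_right le_Suc_ex le_trans add_Suc)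
    obtain c' where c': "prime_chain c' (Suc m)" "c' 0 = c k" "c' (Suc m) = Q" "f k \<in> c' 1"
      using prime_chain_through[of "\<lambda>i. c (k + i)" m "f k"] prime_chain_shift[of c k "Suc m"] c m f[of k] Suc.prems
      by auto
    define c'' where "c'' i = (if i \<le> k then c i else c' (i - k))" for i
    have "prime_chain c'' l" unfolding prime_chain_def
    proof (intro conjI allI impI)
      fix i assume "i \<le> l"
      then show "prm (c'' i)" using c(1) c'(1) m by (auto simp: c''_def prime_chain_def)
    next
      fix i assume i: "i < l"
      consider "i < k" | "i = k" | "k < i" by linarith
      then show "c'' i \<subset> c'' (Suc i)"
      proof cases
        case 1 then show ?thesis using c(1) i by (auto simp: c''_def prime_chain_def)
      next
        case 2 then show ?thesis using c'(1,2) by (auto simp: c''_def prime_chain_def)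
      next
        case 3
        then have "Suc i - k = Suc (i - k)" "i - k < Suc m" using i m by auto
        then show ?thesis using c'(1) 3 by (auto simp: c''_def prime_chain_def)
      qed
    qed
    moreover have "c'' l = Q" using c'(3) m by (simp add: c''_def)
    moreover have "f ` {..<Suc k} \<subseteq> c'' (Suc k)"
      using c'(2,4) c(3) prime_chain_mono[OF c'(1), of 0 1] by (auto simp: c''_def lessThan_Suc)
    ultimately show ?case by blast
  qed
  obtain c where c: "prime_chain c l" "c l = Q" "f ` {..<r} \<subseteq> c r" using chains[of r] by auto
  have "prime_chain (\<lambda>i. c (r + i)) (l - r)" using prime_chain_shift[of c r "l - r"] c(1) rl by simp
  then have "c (r + 0) \<subseteq> local_gen Q (f ` {..<r})"
    using X c0 rl c by (intro regular_chain_bottom[of X Q "\<lambda>i. c (r + i)" "l - r"]) auto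
  moreover have "prime_chain c r" using c(1) rl by (auto simp: prime_chain_def)
  moreover have "c r \<subseteq> Q" using prime_chain_mono[OF c(1), of r l] rl c by simp
  ultimately show ?thesis using c by auto
qed

end

section \<open>Adjoining one element: Hilbert's basis theorem and regularity\<close>

definition polys_over :: "'a::comm_ring_1 set \<Rightarrow> 'a poly set" where
  "polys_over B = {p. \<forall>i. coeff p i \<in> B}"

context subring_set begin

lemma polys_over_subring: "subring_set (polys_over R)"
proof
  fix p q assume "p \<in> polys_over R" "q \<in> polys_over R"
  then show "p * q \<in> polys_over R" by (auto simp: polys_over_def coeff_mult intro!: sum_mem)
qed (auto simp: polys_over_def coeff_1)

lemma noetherian_iff: "noetherian_ring ring_of \<longleftrightarrow> (\<forall>J. idl J \<longrightarrow> (\<exists>X\<subseteq>R. finite X \<and> J = gen X))"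
proof -
  interpret cring ring_of by (rule ring_of_cring)
  show ?thesis
  proof
    assume "noetherian_ring ring_of"
    then interpret N: noetherian_ring ring_of .
    show "\<forall>J. idl J \<longrightarrow> (\<exists>X\<subseteq>R. finite X \<and> J = gen X)"
      using N.finetely_gen gen_eq_genideal by (auto simp: idl_iff_ideal) metis
  next
    assume fg: "\<forall>J. idl J \<longrightarrow> (\<exists>X\<subseteq>R. finite X \<and> J = gen X)"
    show "noetherian_ring ring_of"
      by (rule noetherian_ringI) (use fg gen_eq_genideal in \<open>auto simp: idl_iff_ideal, metis\<close>)
  qed
qed

end

context noetherian_subring begin

interpretation P: subring_set "polys_over R" by (rule polys_over_subring)

text \<open>Hilbert's argument: if elements of least degree are picked successively outside the ideal
  generated by the earlier ones, one of the leading coefficients depends on the earlier ones, and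
  a combination of lower degree contradicts the choice.\<close>

lemma hilbert_basis_polys: "noetherian_ring P.ring_of"
  unfolding P.noetherian_iff
proof (intro allI impI, rule ccontr)
  fix J assume J: "P.idl J" and not_fg: "\<not> (\<exists>X\<subseteq>polys_over R. finite X \<and> J = P.gen X)"
  note dJ = P.idlD[OF J]
  define pick where "pick X = (ARG_MIN degree p. p \<in> J \<and> p \<notin> P.gen X)" for X
  have ex: "\<exists>p. p \<in> J \<and> p \<notin> P.gen X" if "finite X" "X \<subseteq> J" for X
    using not_fg that dJ(1) P.gen_least[OF J that(2)] by blast
  have pick: "pick X \<in> J \<and> pick X \<notin> P.gen X" if "finite X" "X \<subseteq> J" for X
    unfolding pick_def using ex[OF that] arg_min_natI by (metis (no_types, lifting))
  have pick_min: "degree (pick X) \<le> degree p" if "p \<in> J" "p \<notin> P.gen X" for X p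
    unfolding pick_def using that by (intro arg_min_nat_le) auto
  define S where "S = rec_nat {} (\<lambda>_ X. insert (pick X) X)"
  have S: "S 0 = {}" "S (Suc n) = insert (pick (S n)) (S n)" for n by (simp_all add: S_def)
  define p where "p n = pick (S n)" for n
  have S_fin: "finite (S n) \<and> S n \<subseteq> J" for n by (induction n) (use S pick in auto)
  have S_eq: "S n = p ` {..<n}" for n by (induction n) (auto simp: S p_def lessThan_Suc)
  have p: "p n \<in> J" "p n \<notin> P.gen (S n)" for n using pick S_fin by (auto simp: p_def)
  have S_mono: "P.gen (S n) \<subseteq> P.gen (S m)" if "n \<le> m" for n m using that by (intro P.gen_mono) (auto simp: S_eq)
  have p_min: "degree (p n) \<le> degree q" if "q \<in> J" "q \<notin> P.gen (S n)" for n q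
    using pick_min that by (simp add: p_def)
  have deg_mono: "degree (p n) \<le> degree (p m)" if "n \<le> m" for n m
    using p_min[of "p m" n] p S_mono[OF that] by blast
  define a where "a n = lead_coeff (p n)" for n
  have aR: "a n \<in> R" for n using p(1)[of n] dJ(1) by (auto simp: a_def polys_over_def)
  have asub: "a ` {..<n} \<subseteq> R" for n using aR by auto
  have "\<exists>M\<in>range (\<lambda>n. gen (a ` {..<n::nat})). \<forall>I\<in>range (\<lambda>n. gen (a ` {..<n})). M \<subseteq> I \<longrightarrow> I = M"
    by (rule idl_family_has_maximal) (use gen_idl[OF asub] in auto)
  then obtain n where n: "\<And>m. gen (a ` {..<n}) \<subseteq> gen (a ` {..<m}) \<Longrightarrow> gen (a ` {..<m}) = gen (a ` {..<n})" by auto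
  have "gen (a ` {..<n}) \<subseteq> gen (a ` {..<Suc n})" by (intro gen_mono) auto
  then have "gen (a ` {..<Suc n}) = gen (a ` {..<n})" by (rule n)
  moreover have "a n \<in> gen (a ` {..<Suc n})" using gen_upper[of "a ` {..<Suc n}"] by auto
  ultimately have "a n \<in> gen (a ` {..<n})" by simp
  then obtain c where c: "\<forall>i<n. c i \<in> R" "a n = (\<Sum>i<n. c i * a i)" using gen_imageE asub by blast
  define d where "d = degree (p n)"
  define q where "q = (\<Sum>i<n. monom (c i) (d - degree (p i)) * p i)"
  have SP: "S n \<subseteq> polys_over R" using S_fin dJ(1) by blast
  note dS = P.idlD[OF P.gen_idl[OF SP]]
  have q: "q \<in> P.gen (S n)" unfolding q_def
  proof (rule P.idl_sum[OF P.gen_idl[OF SP]])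
    fix i assume i: "i \<in> {..<n}"
    have "p i \<in> P.gen (S n)" using i P.gen_upper[of "S n"] by (auto simp: S_eq)
    moreover have "monom (c i) (d - degree (p i)) \<in> polys_over R" using c i by (auto simp: polys_over_def)
    ultimately show "monom (c i) (d - degree (p i)) * p i \<in> P.gen (S n)" using dS(5) by blast
  qed
  have "P.gen (S n) \<subseteq> J" using P.gen_least[OF J] S_fin by blast
  then have pq: "p n - q \<in> J" using q p dJ(8) by blast
  have "p n - q \<notin> P.gen (S n)"
  proof
    assume "p n - q \<in> P.gen (S n)"
    then have "(p n - q) + q \<in> P.gen (S n)" using q dS(4) by blast
    then show False using p by simp
  qed
  then have min: "d \<le> degree (p n - q)" using p_min[OF pq] by (simp add: d_def)
  have deg_i: "degree (p i) \<le> d" if "i < n" for i using deg_mono[of i n] that by (simp add: d_def)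
  have cq: "coeff (monom (c i) (d - degree (p i)) * p i) d = c i * a i" if "i < n" for i
    using deg_i[OF that] by (simp add: coeff_monom_mult a_def)
  have "degree q \<le> d" unfolding q_def
  proof (rule degree_sum_le)
    fix i assume "i \<in> {..<n}"
    then have "degree (p i) \<le> d" using deg_i by simp
    have "degree (monom (c i) (d - degree (p i)) * p i) \<le> degree (monom (c i) (d - degree (p i))) + degree (p i)"
      by (rule degree_mult_le)
    also have "\<dots> \<le> d" using degree_monom_le[of "c i" "d - degree (p i)"] \<open>degree (p i) \<le> d\<close> by linarith
    finally show "degree (monom (c i) (d - degree (p i)) * p i) \<le> d" .
  qed simp
  then have "degree (p n - q) \<le> d" by (intro degree_diff_le) (auto simp: d_def)
  then have deg: "degree (p n - q) = d" using min by simp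
  have "coeff q d = (\<Sum>i<n. c i * a i)" unfolding q_def coeff_sum using cq by (intro sum.cong) auto
  then have "coeff (p n - q) d = 0" using c(2) by (simp add: a_def d_def)
  then have "p n - q = 0" using deg by (metis leading_coeff_0_iff)
  then show False using \<open>p n - q \<notin> P.gen (S n)\<close> dS(2) by simp
qed

end

locale poly_extension = B: noetherian_subring B + C: subring_set C
  for B C :: "'a::comm_ring_1 set" +
  fixes x :: 'a
  assumes C_eq: "C = (\<lambda>p. poly p x) ` polys_over B"
begin

sublocale P: subring_set "polys_over B" by (rule B.polys_over_subring)

lemma poly_mem: "p \<in> polys_over B \<Longrightarrow> poly p x \<in> C" using C_eq by auto

lemma x_mem: "x \<in> C"
proof -
  have "[:0, 1:] \<in> polys_over B" by (auto simp: polys_over_def coeff_pCons split: nat.splits)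
  then show ?thesis using poly_mem[of "[:0, 1:]"] by simp
qed

lemma base_sub: "B \<subseteq> C"
proof
  fix b assume "b \<in> B"
  then have "[:b:] \<in> polys_over B" by (auto simp: polys_over_def coeff_pCons split: nat.splits)
  then show "b \<in> C" using poly_mem[of "[:b:]"] by simp
qed

lemma extension_noetherian: "noetherian_subring C"
proof -
  have "noetherian_ring C.ring_of"
    unfolding C.noetherian_iff
  proof (intro allI impI)
    fix J assume J: "C.idl J"
    note d = C.idlD[OF J]
    define J' where "J' = {p \<in> polys_over B. poly p x \<in> J}"
    have "P.idl J'" unfolding P.idl_def J'_def using d poly_mem by (auto simp: P.add_mem P.mult_mem)
    then obtain X where X: "X \<subseteq> polys_over B" "finite X" "J' = P.gen X"
      using B.hilbert_basis_polys P.noetherian_iff by blast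
    let ?Y = "(\<lambda>p. poly p x) ` X"
    have YC: "?Y \<subseteq> C" using X poly_mem by auto
    note dg = C.idlD[OF C.gen_idl[OF YC]]
    have "J = C.gen ?Y"
    proof
      have "?Y \<subseteq> J" using X P.gen_upper[of X] by (auto simp: J'_def)
      then show "C.gen ?Y \<subseteq> J" by (rule C.gen_least[OF J])
      have "P.idl {p \<in> polys_over B. poly p x \<in> C.gen ?Y}"
        unfolding P.idl_def using dg poly_mem by auto
      then have "P.gen X \<subseteq> {p \<in> polys_over B. poly p x \<in> C.gen ?Y}"
        using X C.gen_upper[of ?Y] by (intro P.gen_least) auto
      then have sub: "J' \<subseteq> {p \<in> polys_over B. poly p x \<in> C.gen ?Y}" using X(3) by simp
      show "J \<subseteq> C.gen ?Y"
      proof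
        fix y assume y: "y \<in> J"
        then obtain p where "p \<in> polys_over B" "y = poly p x" using d(1) C_eq by blast
        then show "y \<in> C.gen ?Y" using sub y unfolding J'_def by blast
      qed
    qed
    then show "\<exists>X\<subseteq>C. finite X \<and> J = C.gen X" using YC X by blast
  qed
  then show ?thesis
    using C.subring_set_axioms unfolding noetherian_subring_def noetherian_subring_axioms_def by simp
qed

end

locale free_poly_extension = poly_extension +
  assumes free: "\<And>p. p \<in> polys_over B \<Longrightarrow> poly p x = 0 \<Longrightarrow> p = 0"
begin

sublocale C: noetherian_subring C by (rule extension_noetherian)

lemma free_eq: assumes "p \<in> polys_over B" "q \<in> polys_over B" "poly p x = poly q x" shows "p = q"
  using free[of "p - q"] assms by simp

text \<open>For an ideal \<open>q\<close> of \<open>B\<close> this is the extended ideal \<open>q C = q[x]\<close>.\<close>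

definition ext :: "'a set \<Rightarrow> 'a set" where
  "ext q = {poly p x |p. \<forall>i. coeff p i \<in> q}"

lemma poly_mem_ext_iff:
  assumes q: "B.idl q" and p: "p \<in> polys_over B"
  shows "poly p x \<in> ext q \<longleftrightarrow> (\<forall>i. coeff p i \<in> q)"
proof
  assume "poly p x \<in> ext q"
  then obtain r where r: "poly p x = poly r x" "\<forall>i. coeff r i \<in> q" unfolding ext_def by auto
  then have "r \<in> polys_over B" using B.idlD(1)[OF q] by (auto simp: polys_over_def)
  then have "p = r" using free_eq p r by blast
  then show "\<forall>i. coeff p i \<in> q" using r by simp
qed (auto simp: ext_def)

lemma ext_inter: assumes "B.idl q" shows "ext q \<inter> B = q"
proof -
  have "b \<in> ext q \<longleftrightarrow> b \<in> q" if b: "b \<in> B" for b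
  proof -
    have "[:b:] \<in> polys_over B" using b by (auto simp: polys_over_def coeff_pCons split: nat.splits)
    then have "poly [:b:] x \<in> ext q \<longleftrightarrow> (\<forall>i. coeff [:b:] i \<in> q)" by (rule poly_mem_ext_iff[OF assms])
    also have "\<dots> \<longleftrightarrow> b \<in> q" using B.idlD(2)[OF assms] by (auto simp: coeff_pCons split: nat.splits)
    finally show ?thesis by simp
  qed
  then show ?thesis using B.idlD(1)[OF assms] by blast
qed

lemma ext_idl: assumes q: "B.idl q" shows "C.idl (ext q)"
  unfolding C.idl_def
proof (intro conjI ballI)
  note d = B.idlD[OF q]
  show "ext q \<subseteq> C" unfolding ext_def using d(1) poly_mem by (auto simp: polys_over_def)
  have "0 = poly 0 x" by simp
  then show "0 \<in> ext q" unfolding ext_def using d(2) by (intro CollectI exI[of _ 0]) simp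
  fix a assume "a \<in> ext q"
  then obtain p where p: "a = poly p x" "\<forall>i. coeff p i \<in> q" unfolding ext_def by auto
  {
    fix b assume "b \<in> ext q"
    then obtain r where r: "b = poly r x" "\<forall>i. coeff r i \<in> q" unfolding ext_def by auto
    then have "a + b = poly (p + r) x" "\<forall>i. coeff (p + r) i \<in> q" using p d(4) by auto
    then show "a + b \<in> ext q" unfolding ext_def by blast
  }
  fix r assume "r \<in> C"
  then obtain s where s: "r = poly s x" "s \<in> polys_over B" using C_eq by auto
  have "\<forall>i. coeff (s * p) i \<in> q"
    unfolding coeff_mult using p s(2) by (intro allI B.idl_sum[OF q] d(5)) (auto simp: polys_over_def)
  moreover have "r * a = poly (s * p) x" using p s by simp
  ultimately show "r * a \<in> ext q" unfolding ext_def by blast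
qed

lemma ext_prm: assumes q: "B.prm q" shows "C.prm (ext q)"
proof -
  note qi = B.prmD(1)[OF q] note d = B.idlD[OF qi]
  show ?thesis unfolding C.prm_def
  proof (intro conjI ballI impI)
    show "C.idl (ext q)" using ext_idl[OF qi] .
    show "1 \<notin> ext q" using ext_inter[OF qi] B.prmD(2)[OF q] B.one_mem by blast
    fix a b assume "a \<in> C" "b \<in> C" and ab: "a * b \<in> ext q"
    then obtain p r where p: "a = poly p x" "p \<in> polys_over B" and r: "b = poly r x" "r \<in> polys_over B"
      using C_eq by auto
    have pB: "coeff p i \<in> B" "coeff r i \<in> B" for i using p r by (auto simp: polys_over_def)
    have pr: "\<forall>i. coeff (p * r) i \<in> q"
      using poly_mem_ext_iff[OF qi, of "p * r"] P.mult_mem[OF p(2) r(2)] ab p r by simp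
    show "a \<in> ext q \<or> b \<in> ext q"
    proof (rule ccontr)
      assume "\<not> ?thesis"
      then have ex: "\<exists>i. coeff p i \<notin> q" "\<exists>i. coeff r i \<notin> q" using poly_mem_ext_iff[OF qi] p r by auto
      define i where "i = (LEAST i. coeff p i \<notin> q)"
      define j where "j = (LEAST i. coeff r i \<notin> q)"
      have i: "coeff p i \<notin> q" "\<And>k. k < i \<Longrightarrow> coeff p k \<in> q"
        unfolding i_def using LeastI_ex[OF ex(1)] not_less_Least by blast+
      have j: "coeff r j \<notin> q" "\<And>k. k < j \<Longrightarrow> coeff r k \<in> q"
        unfolding j_def using LeastI_ex[OF ex(2)] not_less_Least by blast+
      have "coeff (p * r) (i + j) = coeff p i * coeff r j + (\<Sum>k\<in>{..i + j} - {i}. coeff p k * coeff r (i + j - k))"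
        unfolding coeff_mult by (subst sum.remove[of _ i]) auto
      moreover have "(\<Sum>k\<in>{..i + j} - {i}. coeff p k * coeff r (i + j - k)) \<in> q"
      proof (rule B.idl_sum[OF qi])
        fix k assume k: "k \<in> {..i + j} - {i}"
        show "coeff p k * coeff r (i + j - k) \<in> q"
        proof (cases "k < i")
          case True then show ?thesis using i(2) d(6) pB by blast
        next
          case False
          then have "i + j - k < j" using k by auto
          then show ?thesis using j(2) d(5) pB by blast
        qed
      qed
      ultimately have "coeff p i * coeff r j \<in> q" using pr d(8) by (metis add_diff_cancel_right')
      then show False using B.prmD(4)[OF q] pB i(1) j(1) by blast
    qed
  qed
qed

lemma ext_mono: "q \<subseteq> q' \<Longrightarrow> ext q \<subseteq> ext q'" unfolding ext_def by blast

lemma contract_prm: assumes "C.prm Q" shows "B.prm (Q \<inter> B)"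
proof -
  note d = C.prmD[OF assms] note i = C.idlD[OF d(1)]
  show ?thesis unfolding B.prm_def B.idl_def
  proof (intro conjI ballI impI)
    show "0 \<in> Q \<inter> B" "1 \<notin> Q \<inter> B" "Q \<inter> B \<subseteq> B" using i(2) d(2) by auto
    show "a + b \<in> Q \<inter> B" if "a \<in> Q \<inter> B" "b \<in> Q \<inter> B" for a b using i(4) that by auto
    show "r * a \<in> Q \<inter> B" if "r \<in> B" "a \<in> Q \<inter> B" for r a using i(5)[of r a] base_sub that by auto
    show "a \<in> Q \<inter> B \<or> b \<in> Q \<inter> B" if "a \<in> B" "b \<in> B" "a * b \<in> Q \<inter> B" for a b
      using d(4)[of a b] base_sub that by auto
  qed
qed

lemma gen_ext: assumes "X \<subseteq> B" shows "B.gen X \<subseteq> C.gen X"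
proof -
  have XC: "X \<subseteq> C" using assms base_sub by auto
  note i = C.idlD[OF C.gen_idl[OF XC]]
  have "B.idl (C.gen X \<inter> B)" unfolding B.idl_def
  proof (intro conjI ballI)
    show "0 \<in> C.gen X \<inter> B" "C.gen X \<inter> B \<subseteq> B" using i(2) by auto
    show "a + b \<in> C.gen X \<inter> B" if "a \<in> C.gen X \<inter> B" "b \<in> C.gen X \<inter> B" for a b using i(4) that by auto
    show "r * a \<in> C.gen X \<inter> B" if "r \<in> B" "a \<in> C.gen X \<inter> B" for r a using i(5)[of r a] base_sub that by auto
  qed
  then have "B.gen X \<subseteq> C.gen X \<inter> B" using C.gen_upper[of X] assms by (intro B.gen_least) auto
  then show ?thesis by auto
qed

lemma ext_locally_generated:
  assumes q: "B.prm q" and X: "X \<subseteq> q" "B.locally_generates q X" and y: "y \<in> ext q"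
  shows "\<exists>s\<in>B - q. s * y \<in> C.gen X"
proof -
  note qi = B.prmD(1)[OF q]
  have XB: "X \<subseteq> B" using X B.prmD(3)[OF q] by auto
  then have XC: "X \<subseteq> C" using base_sub by auto
  note d = C.idlD[OF C.gen_idl[OF XC]]
  obtain p where p: "y = poly p x" "\<forall>i. coeff p i \<in> q" using y unfolding ext_def by auto
  have "\<forall>i. \<exists>t. t \<in> B - q \<and> t * coeff p i \<in> B.gen X" using X(2) p(2) unfolding B.locally_generates_def by blast
  from choice[OF this] obtain t where t: "\<And>i. t i \<in> B - q" "\<And>i. t i * coeff p i \<in> B.gen X" by blast
  define s where "s = (\<Prod>i\<le>degree p. t i)"
  have s: "(\<Prod>i\<in>A. t i) \<in> B - q" if "finite A" for A using that
  proof (induction A rule: finite_induct)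
    case (insert i A)
    then show ?case using B.prm_mult_compl[OF q t(1)[of i] insert.IH] by simp
  qed (use B.prm_one_compl[OF q] in simp)
  have "s * y = (\<Sum>i\<le>degree p. s * coeff p i * x ^ i)"
    unfolding p poly_altdef by (simp add: sum_distrib_left mult.assoc)
  also have "\<dots> \<in> C.gen X"
  proof (rule C.idl_sum[OF C.gen_idl[OF XC]])
    fix i assume i: "i \<in> {..degree p}"
    have "s = (\<Prod>j\<in>{..degree p} - {i}. t j) * t i"
      unfolding s_def using i by (subst prod.remove[of _ i]) (auto simp: mult.commute)
    then have "s * coeff p i = (\<Prod>j\<in>{..degree p} - {i}. t j) * (t i * coeff p i)" by (simp add: mult.assoc)
    moreover have "(\<Prod>j\<in>{..degree p} - {i}. t j) \<in> C" using s[of "{..degree p} - {i}"] base_sub by auto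
    moreover have "t i * coeff p i \<in> C.gen X" using t(2) gen_ext[OF XB] by blast
    ultimately have "s * coeff p i \<in> C.gen X" using d(5) by simp
    then show "s * coeff p i * x ^ i \<in> C.gen X" using d(6) x_mem C.power_mem by blast
  qed
  finally show ?thesis using s[of "{..degree p}"] unfolding s_def by auto
qed

text \<open>Division by \<open>h\<close> up to powers of its leading coefficient. Remainders of smaller degree than \<open>h\<close>
  lie in the extension of \<open>Q \<inter> B\<close> by the choice of \<open>h\<close>.\<close>

lemma pseudo_division:
  assumes Q: "C.prm Q" and h: "h \<in> polys_over B" "poly h x \<in> Q"
    and min: "\<And>r. r \<in> polys_over B \<Longrightarrow> poly r x \<in> Q \<Longrightarrow> poly r x \<notin> ext (Q \<inter> B) \<Longrightarrow> degree h \<le> degree r"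
    and p: "p \<in> polys_over B" "poly p x \<in> Q"
  shows "\<exists>n. lead_coeff h ^ n * poly p x \<in> C.gen (insert (poly h x) (ext (Q \<inter> B)))"
  using p
proof (induction "degree p" arbitrary: p rule: less_induct)
  case less
  let ?E = "ext (Q \<inter> B)" and ?G = "C.gen (insert (poly h x) (ext (Q \<inter> B)))"
  have qi: "B.idl (Q \<inter> B)" using contract_prm[OF Q] B.prmD by blast
  have EC: "insert (poly h x) ?E \<subseteq> C" using C.idlD(1)[OF ext_idl[OF qi]] poly_mem[OF h(1)] by auto
  note d = C.idlD[OF C.gen_idl[OF EC]] and dQ = C.idlD[OF C.prmD(1)[OF Q]]
  show ?case
  proof (cases "poly p x \<in> ?E")
    case True
    then have "lead_coeff h ^ 0 * poly p x \<in> ?G" using C.gen_upper[of "insert (poly h x) ?E"] by auto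
    then show ?thesis by blast
  next
    case False
    then have dle: "degree h \<le> degree p" using min less.prems by blast
    define m where "m = monom (lead_coeff p) (degree p - degree h)"
    define p' where "p' = Polynomial.smult (lead_coeff h) p - m * h"
    have lB: "lead_coeff h \<in> B" "lead_coeff p \<in> B" using h less.prems by (auto simp: polys_over_def)
    have mP: "m \<in> polys_over B" using lB by (auto simp: m_def polys_over_def)
    have "Polynomial.smult (lead_coeff h) p \<in> polys_over B" using lB less.prems by (auto simp: polys_over_def)
    then have p'P: "p' \<in> polys_over B" unfolding p'_def using mP h by (intro P.diff_mem P.mult_mem)
    have ev: "poly p' x = lead_coeff h * poly p x - poly m x * poly h x" by (simp add: p'_def)
    have p'Q: "poly p' x \<in> Q" unfolding ev
      using less.prems h lB base_sub poly_mem[OF mP] by (intro dQ(8) dQ(5)) auto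
    have "\<exists>n. lead_coeff h ^ n * poly p' x \<in> ?G"
    proof (cases "p' = 0")
      case True
      then have "lead_coeff h ^ 0 * poly p' x \<in> ?G" using d(2) by simp
      then show ?thesis by blast
    next
      case False
      have "coeff (m * h) (degree p) = lead_coeff p * lead_coeff h"
        using dle by (simp add: m_def coeff_monom_mult)
      then have c0: "coeff p' (degree p) = 0" by (simp add: p'_def mult.commute)
      have "degree (m * h) \<le> degree m + degree h" by (rule degree_mult_le)
      also have "\<dots> \<le> degree p"
        using degree_monom_le[of "lead_coeff p" "degree p - degree h"] dle unfolding m_def by linarith
      finally have "degree p' \<le> degree p"
        unfolding p'_def by (intro degree_diff_le) (auto simp: degree_smult_le)
      then have "degree p' < degree p" using c0 False by (metis le_neq_implies_less leading_coeff_0_iff)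
      then show ?thesis using less.hyps p'P p'Q by blast
    qed
    then obtain n where n: "lead_coeff h ^ n * poly p' x \<in> ?G" by blast
    have "lead_coeff h ^ Suc n * poly p x
      = lead_coeff h ^ n * poly p' x + (lead_coeff h ^ n * poly m x) * poly h x" by (simp add: ev algebra_simps)
    also have "\<dots> \<in> ?G"
    proof (intro d(4) n)
      have "poly h x \<in> ?G" using C.gen_upper[of "insert (poly h x) ?E"] by auto
      moreover have "lead_coeff h ^ n * poly m x \<in> C" using lB base_sub poly_mem[OF mP] by auto
      ultimately show "(lead_coeff h ^ n * poly m x) * poly h x \<in> ?G" using d(5) by blast
    qed
    finally show ?thesis by blast
  qed
qed

text \<open>Let \<open>q = Q \<inter> B\<close>. Either \<open>Q = q C\<close>, and a chain and generators for \<open>q\<close> serve for \<open>Q\<close>; or \<open>Q\<close> is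
  up to denominators generated by \<open>q\<close> and one polynomial \<open>h\<close> of least degree outside \<open>q C\<close>, and
  there is one more generator as well as one more step in the chain, from \<open>q C\<close> to \<open>Q\<close>.\<close>

lemma regular_extension:
  assumes reg: "\<And>q. B.prm q \<Longrightarrow> B.regular_at q" and Q: "C.prm Q"
  shows "C.regular_at Q"
proof -
  define q where "q = Q \<inter> B"
  have q: "B.prm q" unfolding q_def by (rule contract_prm[OF Q])
  note qi = B.prmD(1)[OF q]
  note dQ = C.idlD[OF C.prmD(1)[OF Q]]
  from reg[OF q] obtain c l X where c: "B.prime_chain c l" "c l = q" and X: "finite X" "X \<subseteq> q" "card X \<le> l"
    "B.locally_generates q X" unfolding B.regular_at_def by (elim exE conjE) (rule that; assumption)
  have XC: "X \<subseteq> C" using X(2) B.prmD(3)[OF q] base_sub by auto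
  have chain: "C.prime_chain (\<lambda>i. ext (c i)) l" unfolding C.prime_chain_def
  proof (intro conjI allI impI)
    fix i assume "i \<le> l" then show "C.prm (ext (c i))" using c(1) ext_prm unfolding B.prime_chain_def by blast
  next
    fix i assume i: "i < l"
    then have s: "c i \<subset> c (Suc i)" and id: "B.idl (c i)" "B.idl (c (Suc i))"
      using c(1) B.prmD(1) unfolding B.prime_chain_def by auto
    have "ext (c i) \<noteq> ext (c (Suc i))" using ext_inter[OF id(1)] ext_inter[OF id(2)] s by auto
    then show "ext (c i) \<subset> ext (c (Suc i))" using ext_mono[of "c i" "c (Suc i)"] s by blast
  qed
  have extQ: "ext q \<subseteq> Q"
  proof
    fix y assume "y \<in> ext q"
    then obtain p where p: "y = poly p x" "\<forall>i. coeff p i \<in> q" unfolding ext_def by auto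
    show "y \<in> Q" unfolding p(1) poly_altdef
      using p(2) x_mem by (intro C.idl_sum[OF C.prmD(1)[OF Q]] dQ(6)) (auto simp: q_def)
  qed
  have comp: "B - q \<subseteq> C - Q" using base_sub by (auto simp: q_def)
  show ?thesis
  proof (cases "Q = ext q")
    case True
    have "C.locally_generates Q X"
      unfolding C.locally_generates_def using ext_locally_generated[OF q X(2,4)] True comp by blast
    moreover have "X \<subseteq> Q" using X(2) by (auto simp: q_def)
    ultimately show ?thesis unfolding C.regular_at_def
      using chain X(1,3) True c(2) by (intro exI[of _ "\<lambda>i. ext (c i)"] exI[of _ l] exI[of _ X]) simp
  next
    case False
    define Sh where "Sh p \<longleftrightarrow> p \<in> polys_over B \<and> poly p x \<in> Q \<and> poly p x \<notin> ext q" for p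
    obtain y where "y \<in> Q" "y \<notin> ext q" using False extQ by blast
    moreover then obtain p0 where "p0 \<in> polys_over B" "y = poly p0 x" using dQ(1) C_eq by blast
    ultimately have "Sh p0" by (simp add: Sh_def)
    define h where "h = (ARG_MIN degree p. Sh p)"
    have h: "Sh h" unfolding h_def using \<open>Sh p0\<close> by (rule arg_min_natI)
    have min: "degree h \<le> degree r" if "Sh r" for r unfolding h_def using that by (rule arg_min_nat_le)
    have hP: "h \<in> polys_over B" "poly h x \<in> Q" "poly h x \<notin> ext q" using h by (auto simp: Sh_def)
    have lB: "lead_coeff h \<in> B" using hP by (auto simp: polys_over_def)
    have lq: "lead_coeff h \<notin> q"
    proof
      assume lq: "lead_coeff h \<in> q"
      let ?m = "monom (lead_coeff h) (degree h)"
      have me: "poly ?m x \<in> ext q"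
        unfolding ext_def using lq B.idlD(2)[OF qi] by (auto intro!: exI[of _ ?m])
      have "poly (h - ?m) x \<notin> ext q"
      proof
        assume "poly (h - ?m) x \<in> ext q"
        then have "poly (h - ?m) x + poly ?m x \<in> ext q" using me C.idlD(4)[OF ext_idl[OF qi]] by blast
        then show False using hP by simp
      qed
      moreover have "h - ?m \<in> polys_over B" using hP lB by (intro P.diff_mem) (auto simp: polys_over_def)
      moreover have "poly (h - ?m) x \<in> Q" using hP me extQ dQ(8) by auto
      ultimately have S: "Sh (h - ?m)" by (simp add: Sh_def)
      have "degree (h - ?m) \<le> degree h" by (intro degree_diff_le) (auto simp: degree_monom_le)
      then have "degree (h - ?m) = degree h" using min[OF S] by simp
      moreover have "coeff (h - ?m) (degree h) = 0" by simp
      ultimately have "h - ?m = 0" by (metis leading_coeff_0_iff)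
      then show False using S C.idlD(2)[OF ext_idl[OF qi]] by (simp add: Sh_def)
    qed
    let ?Y = "insert (poly h x) X"
    have YC: "?Y \<subseteq> C" using XC poly_mem[OF hP(1)] by simp
    note dY = C.idlD[OF C.gen_idl[OF YC]]
    have "C.locally_generates Q ?Y" unfolding C.locally_generates_def
    proof
      fix y assume y: "y \<in> Q"
      then obtain p where p: "p \<in> polys_over B" "y = poly p x" using dQ(1) C_eq by blast
      obtain n where n: "lead_coeff h ^ n * y \<in> C.gen (insert (poly h x) (ext q))"
        using pseudo_division[OF Q hP(1,2) _ p(1)] min y p(2) by (auto simp: Sh_def q_def)
      have eC: "insert (poly h x) (ext q) \<subseteq> C" using C.idlD(1)[OF ext_idl[OF qi]] YC by auto
      obtain k a where k: "k \<in> C.gen (ext q)" "a \<in> C" "lead_coeff h ^ n * y = k + a * poly h x"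
        using C.gen_insertE[OF n eC] by metis
      have "k \<in> ext q" using k(1) C.gen_least[OF ext_idl[OF qi], of "ext q"] by blast
      then obtain s where s: "s \<in> B - q" "s * k \<in> C.gen X" using ext_locally_generated[OF q X(2,4)] by blast
      have "(s * lead_coeff h ^ n) * y = s * k + (s * a) * poly h x"
        using arg_cong[OF k(3), of "\<lambda>u. s * u"] by (simp add: algebra_simps)
      also have "\<dots> \<in> C.gen ?Y"
      proof (intro dY(4))
        show "s * k \<in> C.gen ?Y" using s(2) C.gen_mono[of X ?Y] by blast
        have "poly h x \<in> C.gen ?Y" using C.gen_upper[of ?Y] by auto
        then show "(s * a) * poly h x \<in> C.gen ?Y" using s(1) k(2) base_sub by (intro dY(5)) auto
      qed
      finally have 1: "(s * lead_coeff h ^ n) * y \<in> C.gen ?Y" .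
      have "lead_coeff h ^ n \<in> B - q" using lB lq B.prm_power[OF q lB] by auto
      then have "s * lead_coeff h ^ n \<in> C - Q" using B.prm_mult_compl[OF q s(1)] comp by blast
      then show "\<exists>s\<in>C - Q. s * y \<in> C.gen ?Y" using 1 by blast
    qed
    moreover have "C.prime_chain ((\<lambda>i. ext (c i))(Suc l := Q)) (Suc l)"
      using chain Q False extQ c(2) by (auto simp: C.prime_chain_def less_Suc_eq le_Suc_eq)
    moreover have "card ?Y \<le> Suc l" using X(1,3) by (simp add: card_insert_if)
    moreover have "?Y \<subseteq> Q" using X(2) hP(2) by (auto simp: q_def)
    moreover have "finite ?Y" using X(1) by simp
    moreover have "((\<lambda>i. ext (c i))(Suc l := Q)) (Suc l) = Q" by simp
    ultimately show ?thesis unfolding C.regular_at_def by blast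
  qed
qed

end

section \<open>Transport along an injective ring homomorphism\<close>

text \<open>The induction on the number of variables starts with the constants, which are the image of \<open>k\<close>
  and not \<open>k\<close> itself.\<close>

locale ring_embedding = K: noetherian_subring "UNIV :: 'k set"
  for \<phi> :: "'k::comm_ring_1 \<Rightarrow> 'a::comm_ring_1" +
  assumes hom_add: "\<phi> (a + b) = \<phi> a + \<phi> b" and hom_mult: "\<phi> (a * b) = \<phi> a * \<phi> b"
    and hom_one: "\<phi> 1 = 1" and inj: "inj \<phi>"
begin

lemma hom_zero: "\<phi> 0 = 0" using hom_add[of 0 0] by simp
lemma hom_uminus: "\<phi> (- a) = - \<phi> a" using hom_add[of a "- a"] hom_zero by (simp add: eq_neg_iff_add_eq_0 add.commute)
lemma hom_eq: "\<phi> a = \<phi> b \<longleftrightarrow> a = b" using inj by (simp add: inj_eq)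

sublocale R: subring_set "range \<phi>"
proof
  show "0 \<in> range \<phi>" "1 \<in> range \<phi>" by (metis hom_zero rangeI, metis hom_one rangeI)
  fix a b assume "a \<in> range \<phi>" "b \<in> range \<phi>"
  then show "a + b \<in> range \<phi>" "a * b \<in> range \<phi>" "- a \<in> range \<phi>"
    by (auto simp: hom_add[symmetric] hom_mult[symmetric] hom_uminus[symmetric])
qed

lemma vimage_idl: assumes "R.idl J" shows "K.idl (\<phi> -` J)"
  using R.idlD[OF assms] unfolding K.idl_def by (auto simp: hom_zero hom_add hom_mult)

lemma image_idl: assumes "K.idl I" shows "R.idl (\<phi> ` I)"
  unfolding R.idl_def
proof (intro conjI ballI)
  note d = K.idlD[OF assms]
  show "0 \<in> \<phi> ` I" using d(2) hom_zero by (metis image_eqI)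
  fix a assume "a \<in> \<phi> ` I"
  then obtain u where u: "a = \<phi> u" "u \<in> I" by auto
  show "a + b \<in> \<phi> ` I" if "b \<in> \<phi> ` I" for b using that u d(4) by (auto simp: hom_add[symmetric])
  show "r * a \<in> \<phi> ` I" if "r \<in> range \<phi>" for r using that u d(5) by (auto simp: hom_mult[symmetric])
qed auto

lemma vimage_prm: assumes "R.prm P" shows "K.prm (\<phi> -` P)"
  using R.prmD[OF assms] vimage_idl unfolding K.prm_def by (auto simp: hom_one hom_mult)

lemma image_prm: assumes "K.prm P" shows "R.prm (\<phi> ` P)"
  unfolding R.prm_def
proof (intro conjI ballI impI)
  note d = K.prmD[OF assms]
  show "R.idl (\<phi> ` P)" using image_idl d by blast
  show "1 \<notin> \<phi> ` P" using d(2) hom_one hom_eq by (metis imageE)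
  fix a b assume "a \<in> range \<phi>" "b \<in> range \<phi>" "a * b \<in> \<phi> ` P"
  then obtain u v w where "a = \<phi> u" "b = \<phi> v" "a * b = \<phi> w" "w \<in> P" by blast
  moreover from this have "w = u * v" by (metis hom_eq hom_mult)
  ultimately show "a \<in> \<phi> ` P \<or> b \<in> \<phi> ` P" using d(4)[of u v] by auto
qed

lemma image_vimage: assumes "J \<subseteq> range \<phi>" shows "\<phi> ` (\<phi> -` J) = J"
  using assms by auto

lemma image_gen: "\<phi> ` K.gen X \<subseteq> R.gen (\<phi> ` X)"
proof -
  have "R.idl (R.gen (\<phi> ` X))" by (rule R.gen_idl) auto
  then have "K.gen X \<subseteq> \<phi> -` R.gen (\<phi> ` X)" using R.gen_upper[of "\<phi> ` X"] by (intro K.gen_least vimage_idl) auto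
  then show ?thesis by auto
qed

sublocale R: noetherian_subring "range \<phi>"
proof -
  have "noetherian_ring R.ring_of"
    unfolding R.noetherian_iff
  proof (intro allI impI)
    fix J assume J: "R.idl J"
    obtain X where X: "finite X" "\<phi> -` J = K.gen X"
      using vimage_idl[OF J] K.noetherian K.noetherian_iff by blast
    have "J \<subseteq> R.gen (\<phi> ` X)" using image_gen[of X] image_vimage[OF R.idlD(1)[OF J]] X(2) by auto
    moreover have "R.gen (\<phi> ` X) \<subseteq> J" using K.gen_upper[of X] X(2) by (intro R.gen_least[OF J]) auto
    ultimately show "\<exists>X\<subseteq>range \<phi>. finite X \<and> J = R.gen X" using X(1) by (intro exI[of _ "\<phi> ` X"]) auto
  qed
  then show "noetherian_subring (range \<phi>)"
    using R.subring_set_axioms unfolding noetherian_subring_def noetherian_subring_axioms_def by simp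
qed

lemma regular_image:
  assumes reg: "\<And>q. K.prm q \<Longrightarrow> K.regular_at q" and Q: "R.prm Q"
  shows "R.regular_at Q"
proof -
  have q: "K.prm (\<phi> -` Q)" by (rule vimage_prm[OF Q])
  from reg[OF q] obtain c l X where c: "K.prime_chain c l" "c l = \<phi> -` Q" and
    X: "finite X" "X \<subseteq> \<phi> -` Q" "card X \<le> l" "K.locally_generates (\<phi> -` Q) X"
    unfolding K.regular_at_def by (elim exE conjE) (rule that; assumption)
  have "R.prime_chain (\<lambda>i. \<phi> ` c i) l" unfolding R.prime_chain_def
  proof (intro conjI allI impI)
    show "R.prm (\<phi> ` c i)" if "i \<le> l" for i using c(1) that image_prm unfolding K.prime_chain_def by blast
    show "\<phi> ` c i \<subset> \<phi> ` c (Suc i)" if "i < l" for i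
      using c(1) that inj unfolding K.prime_chain_def by (metis image_strict_mono inj_on_subset subset_UNIV)
  qed
  moreover have "\<phi> ` c l = Q" using c(2) image_vimage[OF R.prmD(3)[OF Q]] by simp
  moreover have "R.locally_generates Q (\<phi> ` X)" unfolding R.locally_generates_def
  proof
    fix y assume y: "y \<in> Q"
    then obtain u where u: "y = \<phi> u" using R.prmD(3)[OF Q] by blast
    then obtain s where s: "s \<notin> \<phi> -` Q" "s * u \<in> K.gen X"
      using X(4) y unfolding K.locally_generates_def by blast
    then have "\<phi> s * y \<in> R.gen (\<phi> ` X)" using image_gen[of X] u by (auto simp: hom_mult)
    then show "\<exists>s\<in>range \<phi> - Q. s * y \<in> R.gen (\<phi> ` X)" using s(1) by auto
  qed
  moreover have "card (\<phi> ` X) \<le> l" using X(1,3) card_image_le le_trans by blast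
  moreover have "finite (\<phi> ` X)" "\<phi> ` X \<subseteq> Q" using X by auto
  ultimately show ?thesis unfolding R.regular_at_def
    by (intro exI[of _ "\<lambda>i. \<phi> ` c i"] exI[of _ l] exI[of _ "\<phi> ` X"]) simp
qed

end

section \<open>Polynomials in finitely many variables\<close>

abbreviation cst :: "'k::comm_ring_1 \<Rightarrow> 'k mpoly" where "cst c \<equiv> Poly_Mapping.single 0 c"

definition Xvar :: "nat \<Rightarrow> 'k::comm_ring_1 mpoly" where
  "Xvar j = Poly_Mapping.single (Poly_Mapping.single j 1) 1"

definition mpolys :: "nat \<Rightarrow> 'k::comm_ring_1 mpoly set" where
  "mpolys n = {f. \<forall>m\<in>Poly_Mapping.keys f. Poly_Mapping.keys m \<subseteq> {..<n}}"

lemma mpoly_ring_eq: "mpoly_ring n = class_ring\<lparr>carrier := mpolys n\<rparr>"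
  unfolding mpoly_ring_def mpolys_def by simp

lemma mpolys_subring: "subring_set (mpolys n :: 'k::comm_ring_1 mpoly set)"
proof
  fix a b :: "'k mpoly" assume a: "a \<in> mpolys n" and b: "b \<in> mpolys n"
  show "a + b \<in> mpolys n" using a b Poly_Mapping.keys_add[of a b] unfolding mpolys_def by blast
  show "a * b \<in> mpolys n" unfolding mpolys_def
  proof (intro CollectI ballI)
    fix m assume "m \<in> Poly_Mapping.keys (a * b)"
    then obtain u v where "m = u + v" "u \<in> Poly_Mapping.keys a" "v \<in> Poly_Mapping.keys b"
      using Poly_Mapping.keys_mult[of a b] by blast
    then show "Poly_Mapping.keys m \<subseteq> {..<n}"
      using a b Poly_Mapping.keys_add[of u v] unfolding mpolys_def by blast
  qed
  show "- a \<in> mpolys n" using a by (simp add: mpolys_def)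
qed (auto simp: mpolys_def)

interpretation mpolys: subring_set "mpolys n :: 'k::comm_ring_1 mpoly set" for n by (rule mpolys_subring)

lemma mpolys_mono: "n \<le> n' \<Longrightarrow> mpolys n \<subseteq> mpolys n'"
  unfolding mpolys_def by (auto simp: subset_iff) (meson less_le_trans)

lemma cst_mem [simp]: "cst c \<in> mpolys n" by (simp add: mpolys_def)

lemma Xvar_mem [simp]: "j < n \<Longrightarrow> Xvar j \<in> mpolys n" by (simp add: mpolys_def Xvar_def)

lemma Xvar_power: "Xvar j ^ i = Poly_Mapping.single (Poly_Mapping.single j i) 1"
  by (induction i) (simp_all add: Xvar_def mult_single single_add[symmetric] flip: single_one)

lemma mpoly_sum_monomials:
  "f = (\<Sum>m\<in>Poly_Mapping.keys f. Poly_Mapping.single m (Poly_Mapping.lookup f m))" by (rule poly_mapping_eqI)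
    (auto simp: lookup_sum lookup_single when_def in_keys_iff sum.delta'[OF finite_keys]
      cong: if_cong intro: sum.delta')

lemma monomial_split:
  "Poly_Mapping.single m c = Poly_Mapping.single (Poly_Mapping.update j 0 m) c * Xvar j ^ Poly_Mapping.lookup m j"
proof -
  have "m = Poly_Mapping.update j 0 m + Poly_Mapping.single j (Poly_Mapping.lookup m j)"
    by (rule poly_mapping_eqI) (auto simp: lookup_add lookup_update lookup_single when_def)
  then show ?thesis unfolding Xvar_power mult_single by simp
qed

lemma mpolys_0: "mpolys 0 = range cst"
proof
  show "mpolys 0 \<subseteq> range (cst :: 'a \<Rightarrow> _)"
  proof
    fix f :: "'a mpoly" assume f: "f \<in> mpolys 0"
    then have k: "Poly_Mapping.keys f \<subseteq> {0}" by (auto simp: mpolys_def)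
    have "f = cst (Poly_Mapping.lookup f 0)"
      by (rule poly_mapping_eqI) (use k in \<open>auto simp: lookup_single when_def in_keys_iff\<close>)
    then show "f \<in> range cst" by blast
  qed
qed auto

lemma mpolys_Suc: "mpolys (Suc n) = (\<lambda>p. poly p (Xvar n)) ` polys_over (mpolys n :: 'k::comm_ring_1 mpoly set)"
  (is "_ = ?C")
proof
  have sub: "mpolys n \<subseteq> (mpolys (Suc n) :: 'k mpoly set)" by (rule mpolys_mono) simp
  show "?C \<subseteq> mpolys (Suc n)"
  proof
    fix f assume "f \<in> ?C"
    then obtain p where p: "f = poly p (Xvar n)" "p \<in> polys_over (mpolys n)" by auto
    show "f \<in> mpolys (Suc n)" unfolding p poly_altdef
      using p(2) sub by (intro mpolys.sum_mem mpolys.mult_mem mpolys.power_mem) (auto simp: polys_over_def)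
  qed
  show "mpolys (Suc n) \<subseteq> ?C"
  proof
    fix f :: "'k mpoly" assume f: "f \<in> mpolys (Suc n)"
    interpret P: subring_set "polys_over (mpolys n :: 'k mpoly set)" by (rule mpolys.polys_over_subring)
    let ?p = "\<Sum>m\<in>Poly_Mapping.keys f.
      monom (Poly_Mapping.single (Poly_Mapping.update n 0 m) (Poly_Mapping.lookup f m)) (Poly_Mapping.lookup m n)"
    have "f = (\<Sum>m\<in>Poly_Mapping.keys f. Poly_Mapping.single m (Poly_Mapping.lookup f m))"
      by (rule mpoly_sum_monomials)
    also have "\<dots> = poly ?p (Xvar n)"
      unfolding poly_sum poly_monom by (intro sum.cong refl) (rule monomial_split)
    finally have "f = poly ?p (Xvar n)" .
    moreover have "?p \<in> polys_over (mpolys n)"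
    proof (rule P.sum_mem)
      fix m assume m: "m \<in> Poly_Mapping.keys f"
      then have "Poly_Mapping.keys m \<subseteq> {..<Suc n}" using f by (auto simp: mpolys_def)
      then have "Poly_Mapping.keys (Poly_Mapping.update n 0 m) \<subseteq> {..<n}"
        by (auto simp: keys_update less_Suc_eq subset_iff)
      then show "monom (Poly_Mapping.single (Poly_Mapping.update n 0 m) (Poly_Mapping.lookup f m)) (Poly_Mapping.lookup m n)
        \<in> polys_over (mpolys n)" by (auto simp: polys_over_def mpolys_def)
    qed
    ultimately show "f \<in> ?C" by blast
  qed
qed

lemma lookup_mult_single:
  fixes b :: "'k::comm_ring_1 mpoly"
  shows "Poly_Mapping.lookup (b * Poly_Mapping.single t 1) k
    = (\<Sum>u\<in>Poly_Mapping.keys b. Poly_Mapping.lookup b u when u + t = k)"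
proof -
  have "b * Poly_Mapping.single t 1
    = (\<Sum>u\<in>Poly_Mapping.keys b. Poly_Mapping.single u (Poly_Mapping.lookup b u)) * Poly_Mapping.single t 1"
    using mpoly_sum_monomials[of b] by simp
  also have "\<dots> = (\<Sum>u\<in>Poly_Mapping.keys b. Poly_Mapping.single (u + t) (Poly_Mapping.lookup b u))"
    by (simp add: sum_distrib_right mult_single)
  finally show ?thesis by (simp add: lookup_sum lookup_single)
qed

lemma Xvar_free:
  assumes p: "p \<in> polys_over (mpolys n :: 'k::comm_ring_1 mpoly set)" and zero: "poly p (Xvar n) = 0"
  shows "p = 0"
proof (rule poly_eqI)
  fix i
  have keys: "Poly_Mapping.lookup m n = 0" if "m \<in> Poly_Mapping.keys (coeff p j)" for m j
  proof -
    have "Poly_Mapping.keys m \<subseteq> {..<n}" using that p by (auto simp: polys_over_def mpolys_def)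
    then show ?thesis by (auto simp: in_keys_iff)
  qed
  have "Poly_Mapping.lookup (coeff p i) m = 0" for m
  proof (cases "Poly_Mapping.lookup m n = 0")
    case False then show ?thesis using keys[of m i] by (metis in_keys_iff)
  next
    case True
    let ?k = "m + Poly_Mapping.single n i"
    have tm: "Poly_Mapping.lookup (coeff p j * Xvar n ^ j) ?k = (if j = i then Poly_Mapping.lookup (coeff p i) m else 0)" for j
    proof -
      have iff: "u + Poly_Mapping.single n j = ?k \<longleftrightarrow> j = i \<and> u = m" if u: "u \<in> Poly_Mapping.keys (coeff p j)" for u
      proof
        assume eq: "u + Poly_Mapping.single n j = ?k"
        from arg_cong[OF eq, of "\<lambda>v. Poly_Mapping.lookup v n"] have "j = i"
          using keys[OF u] True by (simp add: lookup_add)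
        moreover from this eq have "u = m" by (simp only: add_right_cancel)
        ultimately show "j = i \<and> u = m" ..
      qed simp
      have "Poly_Mapping.lookup (coeff p j * Xvar n ^ j) ?k
        = (\<Sum>u\<in>Poly_Mapping.keys (coeff p j). Poly_Mapping.lookup (coeff p j) u when (j = i \<and> u = m))"
        unfolding Xvar_power lookup_mult_single using iff by (intro sum.cong) (auto simp: when_def)
      also have "\<dots> = (if j = i then Poly_Mapping.lookup (coeff p i) m else 0)"
        by (auto simp: when_def in_keys_iff sum.delta)
      finally show ?thesis .
    qed
    have "0 = Poly_Mapping.lookup (poly p (Xvar n)) ?k" using zero by simp
    also have "\<dots> = (\<Sum>j\<le>degree p. if j = i then Poly_Mapping.lookup (coeff p i) m else 0)"
      unfolding poly_altdef lookup_sum tm by simp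
    also have "\<dots> = Poly_Mapping.lookup (coeff p i) m" by (auto simp: sum.delta coeff_eq_0)
    finally show ?thesis by simp
  qed
  then show "coeff p i = coeff 0 i" by (intro poly_mapping_eqI) simp
qed

lemma mpolys_noetherian_step:
  assumes "noetherian_subring (mpolys n :: 'k::comm_ring_1 mpoly set)"
  shows "free_poly_extension (mpolys n) (mpolys (Suc n) :: 'k mpoly set) (Xvar n)"
proof -
  interpret B: noetherian_subring "mpolys n :: 'k mpoly set" by fact
  interpret poly_extension "mpolys n" "mpolys (Suc n) :: 'k mpoly set" "Xvar n"
    by unfold_locales (rule mpolys_Suc)
  show ?thesis by unfold_locales (rule Xvar_free)
qed

lemma noetherian_subring_UNIV:
  assumes "noetherian_ring (class_ring :: 'k::comm_ring_1 ring)"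
  shows "noetherian_subring (UNIV :: 'k set)"
  by (intro noetherian_subring.intro noetherian_subring_axioms.intro subring_set.intro) (use assms in simp_all)

lemma cst_embedding:
  assumes "noetherian_ring (class_ring :: 'k::comm_ring_1 ring)"
  shows "ring_embedding (cst :: 'k \<Rightarrow> 'k mpoly)"
proof (intro ring_embedding.intro ring_embedding_axioms.intro noetherian_subring_UNIV[OF assms])
  show "inj (cst :: 'k \<Rightarrow> 'k mpoly)" by (rule inj_single)
qed (simp_all add: single_add mult_single)

lemma noetherian_mpolys:
  assumes k: "noetherian_ring (class_ring :: 'k::comm_ring_1 ring)"
  shows "noetherian_subring (mpolys n :: 'k mpoly set)"
proof (induction n)
  case 0
  interpret ring_embedding "cst :: 'k \<Rightarrow> 'k mpoly" by (rule cst_embedding[OF k])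
  show ?case unfolding mpolys_0 by (rule R.noetherian_subring_axioms)
next
  case (Suc n)
  interpret free_poly_extension "mpolys n" "mpolys (Suc n) :: 'k mpoly set" "Xvar n"
    by (rule mpolys_noetherian_step[OF Suc])
  show ?case by (rule C.noetherian_subring_axioms)
qed

lemma regular_mpolys:
  assumes k: "noetherian_ring (class_ring :: 'k::comm_ring_1 ring)"
    and reg: "\<And>q. subring_set.prm (UNIV :: 'k set) q \<Longrightarrow> noetherian_subring.regular_at (UNIV :: 'k set) q"
    and Q: "subring_set.prm (mpolys n :: 'k mpoly set) Q"
  shows "noetherian_subring.regular_at (mpolys n) Q"
  using Q
proof (induction n arbitrary: Q)
  case 0
  interpret ring_embedding "cst :: 'k \<Rightarrow> 'k mpoly" by (rule cst_embedding[OF k])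
  show ?case using regular_image[OF reg] 0 unfolding mpolys_0 by blast
next
  case (Suc n)
  interpret free_poly_extension "mpolys n" "mpolys (Suc n) :: 'k mpoly set" "Xvar n"
    by (rule mpolys_noetherian_step[OF noetherian_mpolys[OF k]])
  show ?case using regular_extension Suc by blast
qed

section \<open>Partial derivatives and evaluation of polynomials\<close>

lemma mpoly_induct_in [consumes 1, case_names cst Xvar add mult]:
  assumes f: "f \<in> mpolys n"
    and cst: "\<And>c. P (cst c)" and var: "\<And>j. j < n \<Longrightarrow> P (Xvar j)"
    and add: "\<And>f g. f \<in> mpolys n \<Longrightarrow> g \<in> mpolys n \<Longrightarrow> P f \<Longrightarrow> P g \<Longrightarrow> P (f + g)"
    and mult: "\<And>f g. f \<in> mpolys n \<Longrightarrow> g \<in> mpolys n \<Longrightarrow> P f \<Longrightarrow> P g \<Longrightarrow> P (f * g)"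
  shows "P (f :: 'k::comm_ring_1 mpoly)"
proof -
  have "k \<le> n \<Longrightarrow> f \<in> mpolys k \<Longrightarrow> P f" for k f
  proof (induction k arbitrary: f)
    case 0 then show ?case using cst by (auto simp: mpolys_0)
  next
    case (Suc k)
    then obtain p where p: "f = poly p (Xvar k)" "p \<in> polys_over (mpolys k)" by (auto simp: mpolys_Suc)
    have c: "coeff p i \<in> mpolys n \<and> P (coeff p i)" for i
      using p(2) Suc mpolys_mono[of k n] by (auto simp: polys_over_def)
    have x: "Xvar k \<in> mpolys n" "P (Xvar k)" using Suc.prems var by auto
    have pw: "P (Xvar k ^ i)" for i
    proof (induction i)
      case 0 then show ?case using cst[of 1] by simp
    next
      case (Suc i) then show ?case using mult x by auto
    qed
    have "(\<Sum>i\<in>S. coeff p i * Xvar k ^ i) \<in> mpolys n \<and> P (\<Sum>i\<in>S. coeff p i * Xvar k ^ i)" if "finite S" for S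
      using that
    proof (induction S rule: finite_induct)
      case empty then show ?case using cst[of 0] by simp
    next
      case (insert i S)
      have ci: "coeff p i \<in> mpolys n" "P (coeff p i)" using c[of i] by auto
      have xi: "Xvar k ^ i \<in> mpolys n" by (rule mpolys.power_mem[OF x(1)])
      have "coeff p i * Xvar k ^ i \<in> mpolys n" by (rule mpolys.mult_mem[OF ci(1) xi])
      moreover have "P (coeff p i * Xvar k ^ i)" by (rule mult[OF ci(1) xi ci(2) pw])
      ultimately have "coeff p i * Xvar k ^ i \<in> mpolys n" "P (coeff p i * Xvar k ^ i)" by blast+
      then show ?case using insert add by auto
    qed
    then show ?case unfolding p(1) poly_altdef by simp
  qed
  then show ?thesis using f by blast
qed

lemma mpoly_additive_induct [case_names single add]:
  assumes "\<And>m c. P (Poly_Mapping.single m c)" "\<And>f g. P f \<Longrightarrow> P g \<Longrightarrow> P (f + g)"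
  shows "P (f :: 'k::comm_ring_1 mpoly)"
proof -
  have "P (\<Sum>m\<in>S. Poly_Mapping.single m (Poly_Mapping.lookup f m))" if "finite S" for S using that
  proof (induction S rule: finite_induct)
    case empty then show ?case using assms(1)[of 0 0] by simp
  qed (use assms in auto)
  then show ?thesis using mpoly_sum_monomials[of f] by (metis finite_keys)
qed

lemma mpoly_sum_superset:
  assumes "finite S" "Poly_Mapping.keys f \<subseteq> S" "\<And>m. F m 0 = (0::'b::comm_monoid_add)"
  shows "(\<Sum>m\<in>Poly_Mapping.keys f. F m (Poly_Mapping.lookup f m)) = (\<Sum>m\<in>S. F m (Poly_Mapping.lookup f m))"
  using assms by (intro sum.mono_neutral_left) (auto simp: in_keys_iff)

lemma mpoly_sum_additive:
  assumes "\<And>m. F m 0 = (0::'b::comm_monoid_add)" "\<And>m c d. F m (c + d) = F m c + F m d"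
  shows "(\<Sum>m\<in>Poly_Mapping.keys (f + g). F m (Poly_Mapping.lookup (f + g) m))
    = (\<Sum>m\<in>Poly_Mapping.keys f. F m (Poly_Mapping.lookup f m)) + (\<Sum>m\<in>Poly_Mapping.keys g. F m (Poly_Mapping.lookup g m))"
proof -
  let ?S = "Poly_Mapping.keys f \<union> Poly_Mapping.keys g"
  have S: "finite ?S" "Poly_Mapping.keys f \<subseteq> ?S" "Poly_Mapping.keys g \<subseteq> ?S" "Poly_Mapping.keys (f + g) \<subseteq> ?S"
    using Poly_Mapping.keys_add[of f g] by auto
  show ?thesis
    unfolding mpoly_sum_superset[OF S(1,2), of F, OF assms(1)] mpoly_sum_superset[OF S(1,3), of F, OF assms(1)]
      mpoly_sum_superset[OF S(1,4), of F, OF assms(1)] by (simp add: lookup_add assms(2) sum.distrib)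
qed

lemma pderiv_add: "mpoly_pderiv j (f + g) = mpoly_pderiv j f + mpoly_pderiv j g"
  unfolding mpoly_pderiv_def
  by (rule mpoly_sum_additive[where F = "\<lambda>m c. Poly_Mapping.single (m - Poly_Mapping.single j 1) (of_nat (Poly_Mapping.lookup m j) * c)"])
    (simp_all add: distrib_left single_add)

lemma pderiv_single:
  "mpoly_pderiv j (Poly_Mapping.single m c) = Poly_Mapping.single (m - Poly_Mapping.single j 1) (of_nat (Poly_Mapping.lookup m j) * c)"
  by (cases "c = 0") (simp_all add: mpoly_pderiv_def)

lemma pderiv_mult: "mpoly_pderiv j (f * g) = f * mpoly_pderiv j g + g * mpoly_pderiv j (f :: 'k::comm_ring_1 mpoly)"
proof -
  have shift: "Poly_Mapping.single (m + (m' - Poly_Mapping.single j 1)) (of_nat (Poly_Mapping.lookup m' j) * c)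
    = Poly_Mapping.single (m + m' - Poly_Mapping.single j 1) (of_nat (Poly_Mapping.lookup m' j) * c)"
    for m m' :: "nat \<Rightarrow>\<^sub>0 nat" and c :: 'k
  proof (cases "Poly_Mapping.lookup m' j = 0")
    case False
    have "m + (m' - Poly_Mapping.single j 1) = m + m' - Poly_Mapping.single j 1"
      by (rule poly_mapping_eqI) (use False in \<open>auto simp: lookup_add lookup_minus lookup_single when_def\<close>)
    then show ?thesis by simp
  qed simp
  show ?thesis
  proof (induction f arbitrary: g rule: mpoly_additive_induct)
    case (single m c)
    show ?case
    proof (induction g rule: mpoly_additive_induct)
      case (single m' c')
      show ?case
        unfolding mult_single pderiv_single lookup_add using shift[of m m' "c * c'"] shift[of m' m "c * c'"]
        by (simp add: mult_single single_add[symmetric] algebra_simps)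
    next
      case (add f g) then show ?case by (simp add: pderiv_add algebra_simps)
    qed
  next
    case (add f h) then show ?case by (simp add: pderiv_add distrib_left distrib_right add_ac)
  qed
qed

lemma pderiv_cst [simp]: "mpoly_pderiv j (cst c) = 0"
  by (simp add: pderiv_single)

lemma pderiv_Xvar: "mpoly_pderiv j (Xvar i :: 'k::comm_ring_1 mpoly) = (if i = j then 1 else 0)"
  by (auto simp: Xvar_def pderiv_single lookup_single when_def)

lemma pderiv_mem: "f \<in> mpolys n \<Longrightarrow> mpoly_pderiv j f \<in> (mpolys n :: 'k::comm_ring_1 mpoly set)"
  by (induction f rule: mpoly_induct_in) (auto simp: pderiv_add pderiv_mult pderiv_Xvar)

definition mpoly_eval :: "('k::comm_ring_1 \<Rightarrow> 'b::comm_ring_1) \<Rightarrow> (nat \<Rightarrow> 'b) \<Rightarrow> 'k mpoly \<Rightarrow> 'b" where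
  "mpoly_eval \<phi> y f = (\<Sum>m\<in>Poly_Mapping.keys f. \<phi> (Poly_Mapping.lookup f m) *
     (\<Prod>j\<in>Poly_Mapping.keys m. y j ^ Poly_Mapping.lookup m j))"

context
  fixes \<phi> :: "'k::comm_ring_1 \<Rightarrow> 'b::comm_ring_1"
  assumes hom: "\<phi> 0 = 0" "\<phi> 1 = 1" "\<And>c d. \<phi> (c + d) = \<phi> c + \<phi> d" "\<And>c d. \<phi> (c * d) = \<phi> c * \<phi> d"
begin

lemma mpoly_eval_add: "mpoly_eval \<phi> y (f + g) = mpoly_eval \<phi> y f + mpoly_eval \<phi> y g"
  unfolding mpoly_eval_def
  by (rule mpoly_sum_additive[where F = "\<lambda>m c. \<phi> c * (\<Prod>j\<in>Poly_Mapping.keys m. y j ^ Poly_Mapping.lookup m j)"])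
    (simp_all add: hom distrib_right)

lemma mpoly_eval_single:
  "mpoly_eval \<phi> y (Poly_Mapping.single m c) = \<phi> c * (\<Prod>j\<in>Poly_Mapping.keys m. y j ^ Poly_Mapping.lookup m j)"
  by (cases "c = 0") (simp_all add: mpoly_eval_def hom)

lemma monomial_eval_add:
  fixes y :: "nat \<Rightarrow> 'b"
  shows "(\<Prod>j\<in>Poly_Mapping.keys (m + m'). y j ^ Poly_Mapping.lookup (m + m') j)
    = (\<Prod>j\<in>Poly_Mapping.keys m. y j ^ Poly_Mapping.lookup m j) * (\<Prod>j\<in>Poly_Mapping.keys m'. y j ^ Poly_Mapping.lookup m' j)"
proof -
  let ?S = "Poly_Mapping.keys m \<union> Poly_Mapping.keys m'"
  have sup: "(\<Prod>j\<in>Poly_Mapping.keys u. y j ^ Poly_Mapping.lookup u j) = (\<Prod>j\<in>?S. y j ^ Poly_Mapping.lookup u j)"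
    if "Poly_Mapping.keys u \<subseteq> ?S" for u :: "nat \<Rightarrow>\<^sub>0 nat"
    using that by (intro prod.mono_neutral_left) (auto simp: in_keys_iff)
  show ?thesis using sup[of m] sup[of m'] sup[of "m + m'"] Poly_Mapping.keys_add[of m m']
    by (simp add: lookup_add power_add prod.distrib)
qed

lemma mpoly_eval_mult: "mpoly_eval \<phi> y (f * g) = mpoly_eval \<phi> y f * mpoly_eval \<phi> y g"
proof (induction f arbitrary: g rule: mpoly_additive_induct)
  case (single m c)
  show ?case
  proof (induction g rule: mpoly_additive_induct)
    case (single m' c')
    show ?case by (simp add: mult_single mpoly_eval_single monomial_eval_add hom algebra_simps)
  next
    case (add f g) then show ?case by (simp add: mpoly_eval_add algebra_simps)
  qed
next
  case (add f h) then show ?case by (simp add: mpoly_eval_add distrib_right)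
qed

lemma mpoly_eval_cst: "mpoly_eval \<phi> y (cst c) = \<phi> c"
  by (simp add: mpoly_eval_single)

lemma mpoly_eval_Xvar: "mpoly_eval \<phi> y (Xvar j) = y j"
  by (simp add: Xvar_def mpoly_eval_single hom)

end

section \<open>Minors and adjugates over a subring\<close>

lemma (in subring_set) det_mem:
  assumes "\<And>i j. i < r \<Longrightarrow> j < r \<Longrightarrow> M i j \<in> R"
  shows "det (mat r r (\<lambda>(i, j). M i j)) \<in> R"
proof -
  have sg: "signof p \<in> R" for p :: "nat \<Rightarrow> nat" by (simp add: sign_def)
  have "det (mat r r (\<lambda>(i, j). M i j)) = (\<Sum>p\<in>{p. p permutes {0..<r}}. signof p * (\<Prod>i = 0..<r. mat r r (\<lambda>(i, j). M i j) $$ (i, p i)))"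
    by (rule det_def') simp
  also have "\<dots> \<in> R"
  proof (intro sum_mem mult_mem prod_mem sg)
    fix p i assume "p \<in> {p. p permutes {0..<r}}" "i \<in> {0..<r}"
    then have "p i < r" "i < r" using permutes_in_image by fastforce+
    then show "mat r r (\<lambda>(i, j). M i j) $$ (i, p i) \<in> R" using assms by simp
  qed
  finally show ?thesis .
qed

lemma (in subring_set) exists_adjugate:
  assumes "\<And>i j. i < r \<Longrightarrow> j < r \<Longrightarrow> M i j \<in> R"
  shows "\<exists>a. (\<forall>l i. a l i \<in> R) \<and>
    (\<forall>i<r. \<forall>i'<r. (\<Sum>l<r. M i l * a l i') = (if i = i' then det (mat r r (\<lambda>(i, j). M i j)) else 0)) \<and>
    (\<forall>i<r. \<forall>i'<r. (\<Sum>l<r. a i l * M l i') = (if i = i' then det (mat r r (\<lambda>(i, j). M i j)) else 0))"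
proof -
  let ?M = "mat r r (\<lambda>(i, j). M i j)"
  have M: "?M \<in> carrier_mat r r" by simp
  define a where "a l i = (if l < r \<and> i < r then adj_mat ?M $$ (l, i) else 0)" for l i
  have "a l i \<in> R" for l i
  proof (cases "l < r \<and> i < r")
    case True
    let ?N = "mat (r - 1) (r - 1) (\<lambda>(i', j'). M (if i' < i then i' else Suc i') (if j' < l then j' else Suc j'))"
    have "mat_delete ?M i l = ?N" using True unfolding mat_delete_def by (intro eq_matI) auto
    moreover have "det ?N \<in> R" using True by (intro det_mem assms) auto
    ultimately have "det (mat_delete ?M i l) \<in> R" by simp
    then show ?thesis using True by (auto simp: a_def adj_mat_def cofactor_def)
  qed (auto simp: a_def)
  moreover have "(\<Sum>l<r. M i l * a l i') = (if i = i' then det ?M else 0)" if "i < r" "i' < r" for i i'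
  proof -
    have "(?M * adj_mat ?M) $$ (i, i') = (\<Sum>l<r. M i l * a l i')"
      using that adj_mat(1)[OF M] by (auto simp: scalar_prod_def a_def atLeast0LessThan intro!: sum.cong)
    then show ?thesis using that unfolding adj_mat(2)[OF M] by (cases "i = i'") auto
  qed
  moreover have "(\<Sum>l<r. a i l * M l i') = (if i = i' then det ?M else 0)" if "i < r" "i' < r" for i i'
  proof -
    have "(adj_mat ?M * ?M) $$ (i, i') = (\<Sum>l<r. a i l * M l i')"
      using that adj_mat(1)[OF M] by (auto simp: scalar_prod_def a_def atLeast0LessThan intro!: sum.cong)
    then show ?thesis using that unfolding adj_mat(3)[OF M] by (cases "i = i'") auto
  qed
  ultimately show ?thesis by blast
qed

section \<open>Power series: congruences and fixed points\<close>

definition agree :: "nat \<Rightarrow> 'a::comm_ring_1 fps \<Rightarrow> 'a fps \<Rightarrow> bool" where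
  "agree m a b \<longleftrightarrow> (\<forall>i<m. fps_nth a i = fps_nth b i)"

lemma agree_refl [simp]: "agree m a a" by (simp add: agree_def)

lemma agree_sym: "agree m a b \<Longrightarrow> agree m b a" by (simp add: agree_def)

lemma agree_trans: "agree m a b \<Longrightarrow> agree m b c \<Longrightarrow> agree m a c" by (simp add: agree_def)

lemma agree_mono: "agree m a b \<Longrightarrow> k \<le> m \<Longrightarrow> agree k a b" by (simp add: agree_def)

lemma agree_add: "agree m a b \<Longrightarrow> agree m c d \<Longrightarrow> agree m (a + c) (b + d)" by (simp add: agree_def)

lemma agree_mult: "agree m a b \<Longrightarrow> agree m c d \<Longrightarrow> agree m (a * c) (b * d)"
  by (simp add: agree_def fps_mult_nth)

lemma agree_sum: "(\<And>i. i \<in> A \<Longrightarrow> agree m (f i) (g i)) \<Longrightarrow> agree m (\<Sum>i\<in>A. f i) (\<Sum>i\<in>A. g i)"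
  by (simp add: agree_def fps_sum_nth)

lemma agree_mult_Suc:
  assumes "agree m a b" "agree m c d" "fps_nth a 0 = 0" "fps_nth b 0 = 0" "fps_nth c 0 = 0" "fps_nth d 0 = 0"
  shows "agree (Suc m) (a * c) (b * d)"
  unfolding agree_def fps_mult_nth
proof (intro allI impI sum.cong refl)
  fix i j assume "i < Suc m" "j \<in> {0..i}"
  then consider "j = 0" | "j = i" | "j < m" "i - j < m" by fastforce
  then show "fps_nth a j * fps_nth c (i - j) = fps_nth b j * fps_nth d (i - j)"
    using assms by cases (auto simp: agree_def)
qed

text \<open>The iterates of \<open>F\<close> from \<open>0\<close> agree up to higher and higher order; the fixed point has the
  diagonal of their coefficients.\<close>

lemma fps_contraction_fixed_point:
  fixes F :: "('i \<Rightarrow> 'a::comm_ring_1 fps) \<Rightarrow> 'i \<Rightarrow> 'a fps"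
  assumes contr: "\<And>z w m. (\<And>i. fps_nth (z i) 0 = 0) \<Longrightarrow> (\<And>i. fps_nth (w i) 0 = 0) \<Longrightarrow>
      (\<And>i. agree m (z i) (w i)) \<Longrightarrow> (\<forall>i. agree (Suc m) (F z i) (F w i))"
    and zero: "\<And>z. (\<And>i. fps_nth (z i) 0 = 0) \<Longrightarrow> (\<forall>i. fps_nth (F z i) 0 = 0)"
    and closed: "\<And>z. (\<And>i k. fps_nth (z i) k \<in> R) \<Longrightarrow> (\<forall>i k. fps_nth (F z i) k \<in> R)" and "0 \<in> R"
  shows "\<exists>z. F z = z \<and> (\<forall>i. fps_nth (z i) 0 = 0) \<and> (\<forall>i k. fps_nth (z i) k \<in> R)"
proof -
  define it where "it k = (F ^^ k) (\<lambda>_. 0)" for k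
  have it_Suc: "it (Suc k) = F (it k)" for k by (simp add: it_def)
  have it0: "\<forall>i. fps_nth (it k i) 0 = 0" for k
  proof (induction k)
    case (Suc k) then show ?case unfolding it_Suc using zero by blast
  qed (simp add: it_def)
  have itR: "\<forall>i j. fps_nth (it k i) j \<in> R" for k
  proof (induction k)
    case (Suc k) then show ?case unfolding it_Suc using closed by blast
  qed (simp add: it_def \<open>0 \<in> R\<close>)
  \<comment> \<open>each application of \<open>F\<close> gains one order of agreement\<close>
  have step: "\<forall>i. agree k (it k i) (it (Suc k) i)" for k
  proof (induction k)
    case 0 then show ?case by (simp add: agree_def)
  next
    case (Suc k)
    then show ?case unfolding it_Suc[of k] it_Suc[of "Suc k"] using contr[of "it k" "it (Suc k)" k] it0 it_Suc
      by metis
  qed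
  have steps: "agree k (it k i) (it (k + l) i)" for k l i
  proof (induction l)
    case (Suc l)
    then show ?case using agree_trans agree_mono[OF step[rule_format, of "k + l" i], of k] by auto
  qed simp
  define z where "z i = Abs_fps (\<lambda>m. fps_nth (it (Suc m) i) m)" for i
  have z_it: "agree k (z i) (it k i)" for k i
    unfolding agree_def
  proof (intro allI impI)
    fix j assume "j < k"
    then have "agree (Suc j) (it (Suc j) i) (it k i)" using steps[of "Suc j" i "k - Suc j"] by simp
    then show "fps_nth (z i) j = fps_nth (it k i) j" by (simp add: z_def agree_def)
  qed
  have z0: "fps_nth (z i) 0 = 0" for i using it0 by (simp add: z_def)
  have "F z i = z i" for i
  proof (rule fps_ext)
    fix m
    have "agree (Suc m) (F z i) (F (it m) i)" using contr[of z "it m" m] z0 it0 z_it by blast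
    then have "agree (Suc m) (F z i) (z i)"
      using agree_trans agree_sym z_it[of "Suc m" i] unfolding it_Suc by blast
    then show "fps_nth (F z i) m = fps_nth (z i) m" by (simp add: agree_def)
  qed
  moreover have "fps_nth (z i) k \<in> R" for i k using itR by (simp add: z_def)
  ultimately show ?thesis using z0 by blast
qed

section \<open>Taylor expansion to second order\<close>

text \<open>The substitution \<open>x\<^sub>j \<mapsto> x\<^sub>j + u\<^sub>j(t)\<close>, a ring homomorphism from the polynomials to power series
  over them. If the \<open>u\<^sub>j\<close> vanish at \<open>t = 0\<close>, it integrates the derivation \<open>x\<^sub>j \<mapsto> u\<^sub>j'(0)\<close>.\<close>

definition shift_eval :: "(nat \<Rightarrow> 'k::comm_ring_1 mpoly fps) \<Rightarrow> 'k mpoly \<Rightarrow> 'k mpoly fps" where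
  "shift_eval u = mpoly_eval (\<lambda>c. fps_const (cst c)) (\<lambda>j. fps_const (Xvar j) + u j)"

lemma const_series_hom:
  "fps_const (cst 0) = 0" "fps_const (cst 1) = 1"
  "fps_const (cst (c + d)) = fps_const (cst c) + fps_const (cst d)"
  "fps_const (cst (c * d)) = fps_const (cst c) * fps_const (cst d)" by (simp_all add: single_add mult_single)

lemma shift_eval_simps:
  "shift_eval u (f + g) = shift_eval u f + shift_eval u g"
  "shift_eval u (f * g) = shift_eval u f * shift_eval u g"
  "shift_eval u (cst c) = fps_const (cst c)" "shift_eval u (Xvar j) = fps_const (Xvar j) + u j"
  unfolding shift_eval_def using mpoly_eval_add[of "\<lambda>c. fps_const (cst c)", OF const_series_hom]
    mpoly_eval_mult[of "\<lambda>c. fps_const (cst c)", OF const_series_hom]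
    mpoly_eval_cst[of "\<lambda>c. fps_const (cst c)", OF const_series_hom]
    mpoly_eval_Xvar[of "\<lambda>c. fps_const (cst c)", OF const_series_hom] by blast+

lemma shift_eval_0_1 [simp]: "shift_eval u 0 = 0" "shift_eval u 1 = 1"
  using shift_eval_simps(3)[of u 0] shift_eval_simps(3)[of u 1] by simp_all

lemma shift_eval_power: "shift_eval u (f ^ n) = shift_eval u f ^ n"
  by (induction n) (simp_all add: shift_eval_simps)

definition coeffs_in :: "'a set \<Rightarrow> 'a::comm_ring_1 fps set" where
  "coeffs_in S = {X. \<forall>i. fps_nth X i \<in> S}"

context subring_set begin

lemma coeffs_in_subring: "subring_set (coeffs_in R)"
proof
  fix X Y assume "X \<in> coeffs_in R" "Y \<in> coeffs_in R"
  then show "X * Y \<in> coeffs_in R" by (auto simp: coeffs_in_def fps_mult_nth intro!: sum_mem)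
qed (auto simp: coeffs_in_def fps_one_nth)

lemma const_coeffs_in [simp]: "a \<in> R \<Longrightarrow> fps_const a \<in> coeffs_in R"
  by (auto simp: coeffs_in_def fps_nth_fps_const)

end

interpretation mseries: subring_set "coeffs_in (mpolys n) :: 'k::comm_ring_1 mpoly fps set" for n
  by (rule mpolys.coeffs_in_subring)

definition first_order :: "nat \<Rightarrow> 'k::comm_ring_1 mpoly \<Rightarrow> (nat \<Rightarrow> 'k mpoly fps) \<Rightarrow> 'k mpoly fps" where
  "first_order n f v = (\<Sum>j<n. fps_const (mpoly_pderiv j f) * v j)"

text \<open>\<open>Q v\<close> stands for \<open>(f(x + a v) - f(x) - a f'(x) v) / a\<^sup>2\<close>. Being quadratic in \<open>v\<close>, it gains one
  order of agreement when the arguments have no constant term; this makes fixed-point equations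
  for it contractions.\<close>

definition second_order_remainder ::
  "nat \<Rightarrow> 'k::comm_ring_1 mpoly \<Rightarrow> 'k mpoly \<Rightarrow> ((nat \<Rightarrow> 'k mpoly fps) \<Rightarrow> 'k mpoly fps) \<Rightarrow> bool" where
  "second_order_remainder n a f Q \<longleftrightarrow>
     (\<forall>v. shift_eval (\<lambda>j. fps_const a * v j) f
        = fps_const f + fps_const a * first_order n f v + fps_const a ^ 2 * Q v) \<and>
     (\<forall>v. (\<forall>j<n. v j \<in> coeffs_in (mpolys n)) \<longrightarrow> Q v \<in> coeffs_in (mpolys n)) \<and>
     (\<forall>v w m. (\<forall>j<n. fps_nth (v j) 0 = 0) \<longrightarrow> (\<forall>j<n. fps_nth (w j) 0 = 0) \<longrightarrow>
        (\<forall>j<n. agree m (v j) (w j)) \<longrightarrow> agree (Suc m) (Q v) (Q w)) \<and>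
     Q (\<lambda>_. 0) = 0"

lemma second_order_remainderD:
  assumes "second_order_remainder n a f Q"
  shows "shift_eval (\<lambda>j. fps_const a * v j) f
        = fps_const f + fps_const a * first_order n f v + fps_const a ^ 2 * Q v"
    "\<forall>j<n. v j \<in> coeffs_in (mpolys n) \<Longrightarrow> Q v \<in> coeffs_in (mpolys n)"
    "\<forall>j<n. fps_nth (v j) 0 = 0 \<Longrightarrow> \<forall>j<n. fps_nth (w j) 0 = 0 \<Longrightarrow>
        \<forall>j<n. agree m (v j) (w j) \<Longrightarrow> agree (Suc m) (Q v) (Q w)"
    "Q (\<lambda>_. 0) = 0" using assms unfolding second_order_remainder_def by simp_all

lemma second_order_remainder_nth_0:
  assumes "second_order_remainder n a f Q" "\<forall>j<n. fps_nth (v j) 0 = 0"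
  shows "fps_nth (Q v) 0 = 0" "fps_nth (Q v) 1 = 0"
proof -
  have "agree (Suc 1) (Q v) (Q (\<lambda>_. 0))"
    using second_order_remainderD(3)[OF assms(1), of v "\<lambda>_. 0" 1] assms(2) by (simp add: agree_def)
  then show "fps_nth (Q v) 0 = 0" "fps_nth (Q v) 1 = 0"
    unfolding second_order_remainderD(4)[OF assms(1)] agree_def by simp_all
qed

lemma first_order_nth_0: "\<forall>j<n. fps_nth (v j) 0 = 0 \<Longrightarrow> fps_nth (first_order n f v) 0 = 0"
  by (simp add: first_order_def fps_sum_nth)

lemma first_order_agree: "\<forall>j<n. agree m (v j) (w j) \<Longrightarrow> agree m (first_order n f v) (first_order n f w)"
  unfolding first_order_def by (intro agree_sum agree_mult) auto

lemma first_order_mem: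
  "f \<in> mpolys n \<Longrightarrow> \<forall>j<n. v j \<in> coeffs_in (mpolys n) \<Longrightarrow> first_order n f v \<in> coeffs_in (mpolys n)"
  unfolding first_order_def by (intro mseries.sum_mem mseries.mult_mem mpolys.const_coeffs_in pderiv_mem) auto

lemma quadratic_product:
  fixes a :: "'a::comm_ring_1"
  shows "(f + a * x + a\<^sup>2 * p) * (g + a * y + a\<^sup>2 * q) = f * g + a * (f * y + g * x)
    + a\<^sup>2 * (f * q + g * p + x * y + a * (x * q + y * p) + a\<^sup>2 * (p * q))"
  by (simp add: algebra_simps power2_eq_square)

text \<open>Remainders for sums and products are built from those for the factors, by \<open>quadratic_product\<close>.\<close>

lemma exists_second_order_remainder:
  assumes "f \<in> mpolys n" and a: "a \<in> mpolys n"
  shows "\<exists>Q. second_order_remainder n a f (Q :: _ \<Rightarrow> 'k::comm_ring_1 mpoly fps)"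
  using assms(1)
proof (induction f rule: mpoly_induct_in)
  case (cst c)
  show ?case by (intro exI[of _ "\<lambda>_. 0"])
      (simp add: second_order_remainder_def shift_eval_simps first_order_def coeffs_in_def)
next
  case (Xvar j)
  have "(\<Sum>i<n. fps_const (mpoly_pderiv i (Xvar j)) * v i) = v j" for v :: "nat \<Rightarrow> 'k mpoly fps"
  proof -
    have "(\<Sum>i<n. fps_const (mpoly_pderiv i (Xvar j)) * v i) = (\<Sum>i<n. if j = i then v i else 0)"
      by (intro sum.cong) (auto simp: pderiv_Xvar)
    then show ?thesis using Xvar by simp
  qed
  then show ?case by (intro exI[of _ "\<lambda>_. 0"])
      (simp add: second_order_remainder_def shift_eval_simps first_order_def coeffs_in_def)
next
  case (add f g)
  obtain Q Q' where Q: "second_order_remainder n a f Q" and Q': "second_order_remainder n a g Q'"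
    using add by blast
  have fo: "first_order n (f + g) v = first_order n f v + first_order n g v" for v
    by (simp add: first_order_def pderiv_add distrib_right sum.distrib flip: fps_const_add)
  note d = second_order_remainderD[OF Q] and d' = second_order_remainderD[OF Q']
  show ?case
  proof (intro exI[of _ "\<lambda>v. Q v + Q' v"], unfold second_order_remainder_def, intro conjI allI impI)
    fix v
    show "shift_eval (\<lambda>j. fps_const a * v j) (f + g)
      = fps_const (f + g) + fps_const a * first_order n (f + g) v + (fps_const a)\<^sup>2 * (Q v + Q' v)"
      unfolding shift_eval_simps d(1) d'(1) fo by (simp add: distrib_left add_ac flip: fps_const_add)
  next
    fix v w :: "nat \<Rightarrow> 'k mpoly fps" and m
    assume "\<forall>j<n. fps_nth (v j) 0 = 0" "\<forall>j<n. fps_nth (w j) 0 = 0" "\<forall>j<n. agree m (v j) (w j)"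
    then show "agree (Suc m) (Q v + Q' v) (Q w + Q' w)" by (intro agree_add d(3) d'(3)) auto
  qed (use d(2,4) d'(2,4) in auto)
next
  case (mult f g)
  obtain Q Q' where Q: "second_order_remainder n a f Q" and Q': "second_order_remainder n a g Q'"
    using mult by blast
  note d = second_order_remainderD[OF Q] and d' = second_order_remainderD[OF Q']
  have fo: "first_order n (f * g) v = fps_const f * first_order n g v + fps_const g * first_order n f v" for v
    by (simp add: first_order_def pderiv_mult distrib_right sum.distrib sum_distrib_left mult.assoc
        flip: fps_const_add fps_const_mult)
  define T where "T v = fps_const f * Q' v + fps_const g * Q v + first_order n f v * first_order n g v
    + fps_const a * (first_order n f v * Q' v + first_order n g v * Q v) + fps_const a ^ 2 * (Q v * Q' v)" for v
  show ?case
  proof (intro exI[of _ T], unfold second_order_remainder_def, intro conjI allI impI)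
    fix v
    show "shift_eval (\<lambda>j. fps_const a * v j) (f * g)
      = fps_const (f * g) + fps_const a * first_order n (f * g) v + (fps_const a)\<^sup>2 * T v"
    proof -
      have "shift_eval (\<lambda>j. fps_const a * v j) (f * g)
        = (fps_const f + fps_const a * first_order n f v + fps_const a ^ 2 * Q v)
          * (fps_const g + fps_const a * first_order n g v + fps_const a ^ 2 * Q' v)"
        by (simp only: shift_eval_simps d(1) d'(1))
      also have "\<dots> = fps_const f * fps_const g + fps_const a * first_order n (f * g) v + (fps_const a)\<^sup>2 * T v"
        unfolding fo T_def by (rule quadratic_product)
      finally show ?thesis by simp
    qed
  next
    fix v :: "nat \<Rightarrow> 'k mpoly fps" assume v: "\<forall>j<n. v j \<in> coeffs_in (mpolys n)"
    then have "Q v \<in> coeffs_in (mpolys n)" "Q' v \<in> coeffs_in (mpolys n)" using d(2) d'(2) by blast+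
    then show "T v \<in> coeffs_in (mpolys n)"
      unfolding T_def using mult.hyps v a first_order_mem
      by (intro mseries.add_mem mseries.mult_mem mseries.power_mem) auto
  next
    fix v w :: "nat \<Rightarrow> 'k mpoly fps" and m
    assume v: "\<forall>j<n. fps_nth (v j) 0 = 0" and w: "\<forall>j<n. fps_nth (w j) 0 = 0" and vw: "\<forall>j<n. agree m (v j) (w j)"
    have q: "agree (Suc m) (Q v) (Q w)" "agree (Suc m) (Q' v) (Q' w)"
      using d(3)[OF v w vw] d'(3)[OF v w vw] by blast+
    note q0 = second_order_remainder_nth_0(1)[OF Q v] second_order_remainder_nth_0(1)[OF Q w]
      second_order_remainder_nth_0(1)[OF Q' v] second_order_remainder_nth_0(1)[OF Q' w]
    note f0 = first_order_nth_0[OF v] first_order_nth_0[OF w]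
    note fa = first_order_agree[OF vw]
    show "agree (Suc m) (T v) (T w)" unfolding T_def
      by (intro agree_add agree_mult[OF agree_refl] agree_mult[OF q] agree_mult_Suc q agree_mono[OF q(1)] agree_mono[OF q(2)])
        (auto simp: q0 f0 fa)
  next
    show "T (\<lambda>_. 0) = 0" using d(4) d'(4) by (simp add: T_def first_order_def)
  qed
qed

section \<open>Newton's method: integrating multiples of a derivation\<close>

lemma fps_const_sum: "fps_const (\<Sum>i\<in>A. f i) = (\<Sum>i\<in>A. fps_const (f i :: 'a::comm_ring_1))"
  by (induction A rule: infinite_finite_induct) (simp_all flip: fps_const_add)

lemma sum_over_fibres:
  fixes p :: "nat \<Rightarrow> 'a::comm_ring_1"
  assumes "\<And>l. l < r \<Longrightarrow> c l < n"
  shows "(\<Sum>j<n. p j * (\<Sum>l<r. if c l = j then S l else 0)) = (\<Sum>l<r::nat. p (c l) * S l)"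
proof -
  have "(\<Sum>j<n. p j * (\<Sum>l<r. if c l = j then S l else 0)) = (\<Sum>j<n. \<Sum>l<r. if j = c l then p j * S l else 0)"
    unfolding sum_distrib_left by (intro sum.cong) auto
  also have "\<dots> = (\<Sum>l<r. \<Sum>j<n. if j = c l then p j * S l else 0)" by (rule sum.swap)
  also have "\<dots> = (\<Sum>l<r. p (c l) * S l)"
  proof (rule sum.cong[OF refl])
    fix l assume "l \<in> {..<r}"
    then have "c l \<in> {..<n}" using assms by simp
    then show "(\<Sum>j<n. if j = c l then p j * S l else 0) = p (c l) * S l" by (simp add: sum.delta)
  qed
  finally show ?thesis .
qed

text \<open>Put \<open>U = \<Delta>\<^sup>e d t + adj z\<close>, with \<open>adj\<close> the adjugate of the submatrix of columns \<open>c\<close>. The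
  first-order term of \<open>g\<^sub>i\<close> at \<open>U\<close> is \<open>\<Delta>\<^sup>e d(g\<^sub>i) t + \<Delta> z\<^sub>i\<close>. Hence the second-order remainder
  \<open>\<Delta>\<^sup>2\<^sup>e Q\<^sub>i(U)\<close> is cancelled exactly when \<open>z\<^sub>i = - \<Delta>\<^sup>e\<^sup>-\<^sup>1 Q\<^sub>i(U)\<close>, a fixed-point equation for
  \<open>z\<close>, and \<open>g\<^sub>i + \<Delta>\<^sup>2\<^sup>e d(g\<^sub>i) t\<close> remains, which has coefficients in \<open>I\<close>.\<close>

lemma newton_solution:
  fixes g :: "nat \<Rightarrow> 'k::comm_ring_1 mpoly" and d :: "nat \<Rightarrow> 'k mpoly"
  assumes I: "mpolys.idl n I" and g: "\<And>i. i < r \<Longrightarrow> g i \<in> I"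
    and c: "\<And>l. l < r \<Longrightarrow> c l < n" and d: "\<And>j. d j \<in> mpolys n"
    and tangent: "\<And>i. i < r \<Longrightarrow> (\<Sum>j<n. d j * mpoly_pderiv j (g i)) \<in> I"
    and e: "0 < e" and \<Delta>: "\<Delta> = det (mat r r (\<lambda>(i, l). mpoly_pderiv (c l) (g i)))"
  shows "\<exists>U. (\<forall>j. U j \<in> coeffs_in (mpolys n)) \<and> (\<forall>j. fps_nth (U j) 0 = 0) \<and>
    (\<forall>j. fps_nth (U j) 1 = \<Delta> ^ e * d j) \<and>
    (\<forall>i<r. shift_eval (\<lambda>j. fps_const (\<Delta> ^ e) * U j) (g i) \<in> coeffs_in I)"
proof -
  note dI = mpolys.idlD[OF I]
  have gR: "g i \<in> mpolys n" if "i < r" for i using g[OF that] dI(3) by blast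
  have M: "mpoly_pderiv (c l) (g i) \<in> mpolys n" if "i < r" "l < r" for i l using pderiv_mem gR that by blast
  have \<Delta>R: "\<Delta> \<in> mpolys n" unfolding \<Delta> by (rule mpolys.det_mem) (use M in auto)
  obtain a where aR: "\<And>l i. a l i \<in> mpolys n" and adj: "\<And>i i'. i < r \<Longrightarrow> i' < r \<Longrightarrow>
      (\<Sum>l<r. mpoly_pderiv (c l) (g i) * a l i') = (if i = i' then \<Delta> else 0)"
    using mpolys.exists_adjugate[of r "\<lambda>i l. mpoly_pderiv (c l) (g i)" n] M unfolding \<Delta> by blast
  have "\<forall>i. \<exists>Q. i < r \<longrightarrow> second_order_remainder n (\<Delta> ^ e) (g i) Q"
    using exists_second_order_remainder[OF gR mpolys.power_mem[OF \<Delta>R]] by blast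
  from choice[OF this] obtain Q where Q: "\<And>i. i < r \<Longrightarrow> second_order_remainder n (\<Delta> ^ e) (g i) (Q i)" by blast
  define U where "U z j = fps_const (\<Delta> ^ e * d j) * fps_X
    + (\<Sum>l<r. if c l = j then \<Sum>i<r. fps_const (a l i) * z i else 0)" for z :: "nat \<Rightarrow> 'k mpoly fps" and j
  define F where "F z i = (if i < r then - (fps_const (\<Delta> ^ (e - 1)) * Q i (U z)) else 0)" for z i
  have U0: "fps_nth (U z j) 0 = 0" if "\<And>i. fps_nth (z i) 0 = 0" for z j
    using that by (simp add: U_def fps_sum_nth if_distrib[of "\<lambda>x. fps_nth x 0"] cong: if_cong)
  have UR: "U z j \<in> coeffs_in (mpolys n)" if "\<And>i. z i \<in> coeffs_in (mpolys n)" for z j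
  proof -
    have "fps_X \<in> coeffs_in (mpolys n)" by (auto simp: coeffs_in_def fps_X_def)
    moreover have "(\<Sum>l<r. if c l = j then \<Sum>i<r. fps_const (a l i) * z i else 0) \<in> coeffs_in (mpolys n)"
      by (rule mseries.sum_mem) (use aR that in \<open>auto intro!: mseries.sum_mem mseries.mult_mem\<close>)
    ultimately show ?thesis unfolding U_def using d \<Delta>R by (intro mseries.add_mem mseries.mult_mem) auto
  qed
  have Uagree: "agree m (U z j) (U w j)" if "\<And>i. agree m (z i) (w i)" for m z w j
    unfolding U_def by (intro agree_add agree_refl agree_sum) (use that in \<open>auto intro!: agree_sum agree_mult\<close>)
  have "\<exists>z. F z = z \<and> (\<forall>i. fps_nth (z i) 0 = 0) \<and> (\<forall>i k. fps_nth (z i) k \<in> mpolys n)"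
  proof (rule fps_contraction_fixed_point)
    fix z w :: "nat \<Rightarrow> 'k mpoly fps" and m
    assume z: "\<And>i. fps_nth (z i) 0 = 0" and w: "\<And>i. fps_nth (w i) 0 = 0" and zw: "\<And>i. agree m (z i) (w i)"
    show "\<forall>i. agree (Suc m) (F z i) (F w i)"
    proof
      fix i
      show "agree (Suc m) (F z i) (F w i)"
      proof (cases "i < r")
        case True
        have "agree (Suc m) (Q i (U z)) (Q i (U w))"
          using U0[of z, OF z] U0[of w, OF w] Uagree[of m z w, OF zw] second_order_remainderD(3)[OF Q[OF True]] by blast
        then have "agree (Suc m) (fps_const (\<Delta> ^ (e - 1)) * Q i (U z)) (fps_const (\<Delta> ^ (e - 1)) * Q i (U w))"
          by (intro agree_mult agree_refl)
        then show ?thesis using True by (simp add: F_def agree_def)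
      qed (simp add: F_def)
    qed
  next
    fix z :: "nat \<Rightarrow> 'k mpoly fps" assume z: "\<And>i. fps_nth (z i) 0 = 0"
    show "\<forall>i. fps_nth (F z i) 0 = 0"
      using second_order_remainder_nth_0(1)[OF Q] U0[of z, OF z] by (auto simp: F_def)
  next
    fix z :: "nat \<Rightarrow> 'k mpoly fps" assume "\<And>i k. fps_nth (z i) k \<in> mpolys n"
    then have z: "z i \<in> coeffs_in (mpolys n)" for i by (simp add: coeffs_in_def)
    have "F z i \<in> coeffs_in (mpolys n)" for i
    proof (cases "i < r")
      case True
      then have "Q i (U z) \<in> coeffs_in (mpolys n)"
        using UR[of z, OF z] second_order_remainderD(2)[OF Q[OF True]] by blast
      then show ?thesis using True \<Delta>R by (auto simp: F_def intro!: mseries.uminus_mem mseries.mult_mem)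
    qed (simp add: F_def)
    then show "\<forall>i k. fps_nth (F z i) k \<in> mpolys n" by (simp add: coeffs_in_def)
  qed simp
  then obtain z where z: "F z = z" "\<And>i. fps_nth (z i) 0 = 0" and "\<And>i k. fps_nth (z i) k \<in> mpolys n" by blast
  then have zR: "z i \<in> coeffs_in (mpolys n)" for i by (simp add: coeffs_in_def)
  have z1: "fps_nth (z i) 1 = 0" for i
  proof -
    have "fps_nth (F z i) 1 = 0"
      using second_order_remainder_nth_0(2)[OF Q, of i "U z"] U0[of z, OF z(2)] by (auto simp: F_def)
    then show ?thesis using z(1) by simp
  qed
  let ?U = "U z"
  have U1: "fps_nth (?U j) 1 = \<Delta> ^ e * d j" for j
    using z1 by (simp add: U_def fps_sum_nth if_distrib[of "\<lambda>x. fps_nth x (Suc 0)"] cong: if_cong)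
  have main: "shift_eval (\<lambda>j. fps_const (\<Delta> ^ e) * ?U j) (g i) \<in> coeffs_in I" if i: "i < r" for i
  proof -
    have lin: "first_order n (g i) ?U = fps_const (\<Delta> ^ e * (\<Sum>j<n. d j * mpoly_pderiv j (g i))) * fps_X + fps_const \<Delta> * z i"
    proof -
      have "first_order n (g i) ?U = (\<Sum>j<n. fps_const (\<Delta> ^ e) * (fps_const (d j * mpoly_pderiv j (g i))) * fps_X)
        + (\<Sum>j<n. fps_const (mpoly_pderiv j (g i)) * (\<Sum>l<r. if c l = j then \<Sum>i<r. fps_const (a l i) * z i else 0))"
        unfolding first_order_def U_def by (simp add: distrib_left sum.distrib mult_ac)
      also have "(\<Sum>j<n. fps_const (\<Delta> ^ e) * (fps_const (d j * mpoly_pderiv j (g i))) * fps_X)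
        = fps_const (\<Delta> ^ e * (\<Sum>j<n. d j * mpoly_pderiv j (g i))) * fps_X"
        by (simp add: sum_distrib_left sum_distrib_right fps_const_sum flip: fps_const_mult)
      also have "(\<Sum>j<n. fps_const (mpoly_pderiv j (g i)) * (\<Sum>l<r. if c l = j then \<Sum>i<r. fps_const (a l i) * z i else 0))
        = (\<Sum>l<r. fps_const (mpoly_pderiv (c l) (g i)) * (\<Sum>i<r. fps_const (a l i) * z i))"
        by (rule sum_over_fibres) (rule c)
      also have "\<dots> = (\<Sum>i'<r. fps_const (\<Sum>l<r. mpoly_pderiv (c l) (g i) * a l i') * z i')"
        unfolding sum_distrib_left by (subst sum.swap)
          (simp add: sum_distrib_right fps_const_sum mult.assoc flip: fps_const_mult)
      also have "\<dots> = (\<Sum>i'<r. if i' = i then fps_const \<Delta> * z i' else 0)" using adj i by (intro sum.cong) auto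
      also have "\<dots> = fps_const \<Delta> * z i" using i by simp
      finally show ?thesis .
    qed
    have zi: "z i = - (fps_const (\<Delta> ^ (e - 1)) * Q i ?U)" using z(1) i by (metis F_def)
    have pe: "fps_const (\<Delta> ^ e) = fps_const \<Delta> * fps_const (\<Delta> ^ (e - 1))" using e by (cases e) (simp_all)
    have "fps_const (\<Delta> ^ e) * (fps_const \<Delta> * z i) + fps_const (\<Delta> ^ e) ^ 2 * Q i ?U = 0"
      unfolding zi power2_eq_square by (subst (3) pe) (simp add: mult_ac del: fps_const_mult)
    then have eq: "shift_eval (\<lambda>j. fps_const (\<Delta> ^ e) * ?U j) (g i)
      = fps_const (g i) + fps_const (\<Delta> ^ e * (\<Delta> ^ e * (\<Sum>j<n. d j * mpoly_pderiv j (g i)))) * fps_X"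
      unfolding second_order_remainderD(1)[OF Q[OF i]] lin
      by (simp add: distrib_left mult.assoc del: fps_const_mult flip: fps_const_mult)
    have "\<Delta> ^ e * (\<Delta> ^ e * (\<Sum>j<n. d j * mpoly_pderiv j (g i))) \<in> I" using tangent[OF i] \<Delta>R by (intro dI(5)) auto
    then show ?thesis unfolding eq coeffs_in_def using g[OF i] dI(2,4)
      by (auto simp: fps_X_mult_right_nth fps_nth_fps_const)
  qed
  show ?thesis using UR[of z, OF zR] U0[of z, OF z(2)] U1 main by blast
qed

text \<open>These ideals decrease to \<open>I[[t]]\<close>: membership of a series in \<open>I[[t]]\<close> is approached by induction
  on \<open>m\<close>.\<close>

definition low_coeffs_in :: "nat \<Rightarrow> 'k::comm_ring_1 mpoly set \<Rightarrow> nat \<Rightarrow> 'k mpoly fps set" where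
  "low_coeffs_in n I m = {X \<in> coeffs_in (mpolys n). \<forall>i<m. fps_nth X i \<in> I}"

context
  fixes n :: nat and I :: "'k::comm_ring_1 mpoly set"
  assumes I: "mpolys.idl n I"
begin

lemma low_coeffs_idl: "mseries.idl n (low_coeffs_in n I m)"
proof -
  note d = mpolys.idlD[OF I]
  show ?thesis unfolding mseries.idl_def
  proof (intro conjI ballI)
    show "low_coeffs_in n I m \<subseteq> coeffs_in (mpolys n)" by (auto simp: low_coeffs_in_def)
    show "0 \<in> low_coeffs_in n I m" using d(2) by (simp add: low_coeffs_in_def)
    show "X + Y \<in> low_coeffs_in n I m" if "X \<in> low_coeffs_in n I m" "Y \<in> low_coeffs_in n I m" for X Y
      using that d(4) by (simp add: low_coeffs_in_def)
    show "X * Y \<in> low_coeffs_in n I m" if "X \<in> coeffs_in (mpolys n)" "Y \<in> low_coeffs_in n I m" for X Y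
      using that unfolding low_coeffs_in_def
      by (auto simp: fps_mult_nth coeffs_in_def intro!: mpolys.idl_sum[OF I] d(5))
  qed
qed

lemma low_coeffs_mult_Suc:
  assumes X: "X \<in> coeffs_in (mpolys n)" "fps_nth X 0 = 0" and Y: "Y \<in> low_coeffs_in n I m"
  shows "X * Y \<in> low_coeffs_in n I (Suc m)"
proof -
  note d = mpolys.idlD[OF I]
  have "fps_nth (X * Y) i \<in> I" if "i < Suc m" for i
    unfolding fps_mult_nth
  proof (rule mpolys.idl_sum[OF I])
    fix j assume "j \<in> {0..i}"
    show "fps_nth X j * fps_nth Y (i - j) \<in> I"
    proof (cases "j = 0")
      case False
      then have "i - j < m" using that \<open>j \<in> {0..i}\<close> by auto
      then show ?thesis using X Y d(5) by (auto simp: low_coeffs_in_def coeffs_in_def)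
    qed (use X d(2) in simp)
  qed
  then show ?thesis using X Y by (auto simp: low_coeffs_in_def)
qed

lemma low_coeffs_cancel_unit:
  assumes W: "W \<in> coeffs_in (mpolys n)" "fps_nth W 0 = 1" and X: "X \<in> coeffs_in (mpolys n)"
    and WX: "W * X \<in> low_coeffs_in n I m"
  shows "X \<in> low_coeffs_in n I m"
proof -
  note d = mpolys.idlD[OF I]
  have "i < m \<Longrightarrow> fps_nth X i \<in> I" for i
  proof (induction i rule: less_induct)
    case (less i)
    have "fps_nth (W * X) i = fps_nth X i + (\<Sum>j\<in>{1..i}. fps_nth W j * fps_nth X (i - j))"
      unfolding fps_mult_nth using W(2) by (simp add: sum.atLeast_Suc_atMost)
    then have "fps_nth X i = fps_nth (W * X) i - (\<Sum>j\<in>{1..i}. fps_nth W j * fps_nth X (i - j))" by simp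
    also have "\<dots> \<in> I"
    proof (intro d(8) mpolys.idl_sum[OF I] d(5))
      show "fps_nth (W * X) i \<in> I" using WX less.prems by (simp add: low_coeffs_in_def)
    qed (use W less in \<open>auto simp: coeffs_in_def\<close>)
    finally show ?case .
  qed
  then show ?thesis using X by (simp add: low_coeffs_in_def)
qed

text \<open>For the substitution \<open>\<Phi>\<close> given by \<open>\<Delta>\<^sup>e U\<close>, with \<open>U\<close> from \<open>newton_solution\<close>, one shows by
  induction on \<open>m\<close> that \<open>\<Delta>\<^sup>N \<Phi>(f)\<close> has its first \<open>m\<close> coefficients in \<open>I\<close> for \<open>f \<in> I\<close>. This is
  clear for \<open>f = g\<^sub>i\<close>. For a product \<open>a b\<close> of elements of \<open>I\<close> write \<open>\<Phi>(a) = a + \<Delta>\<^sup>e h\<close> with \<open>h(0)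
  = 0\<close>: multiplication of \<open>\<Delta>\<^sup>N \<Phi>(b)\<close> by \<open>h\<close> gains one coefficient. The conormal inclusion then
  gives the claim for \<open>\<Phi>(\<Delta>\<^sup>N f)\<close>, which is \<open>\<Delta>\<^sup>N \<Phi>(f)\<close> up to a unit. Finally \<open>\<Phi>(f) - f\<close> is
  divisible by \<open>\<Delta>\<^sup>e\<close>, so the factor \<open>\<Delta>\<^sup>N\<close> can be removed by the hypothesis on the torsion.\<close>

lemma integrate_multiple:
  fixes g :: "nat \<Rightarrow> 'k mpoly" and d :: "nat \<Rightarrow> 'k mpoly"
  assumes g: "\<And>i. i < r \<Longrightarrow> g i \<in> I"
    and c: "\<And>l. l < r \<Longrightarrow> c l < n" and dR: "\<And>j. d j \<in> mpolys n"
    and log: "\<And>f. f \<in> I \<Longrightarrow> (\<Sum>j<n. d j * mpoly_pderiv j f) \<in> I"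
    and \<Delta>: "\<Delta> = det (mat r r (\<lambda>(i, l). mpoly_pderiv (c l) (g i)))"
    and conormal: "\<And>f. f \<in> I \<Longrightarrow> \<Delta> ^ N * f \<in> mpolys.gen n (g ` {..<r} \<union> {a * b |a b. a \<in> I \<and> b \<in> I})"
    and e: "0 < e" "N \<le> e"
    and tors: "\<And>f m. f \<in> mpolys n \<Longrightarrow> \<Delta> ^ m * f \<in> I \<Longrightarrow> \<Delta> ^ e * f \<in> I"
  shows "\<exists>u. (\<forall>f\<in>mpolys n. shift_eval u f \<in> coeffs_in (mpolys n) \<and> fps_nth (shift_eval u f) 0 = f) \<and>
    (\<forall>f\<in>I. shift_eval u f \<in> coeffs_in I) \<and> (\<forall>j. fps_nth (shift_eval u (Xvar j)) 1 = \<Delta> ^ (2 * e) * d j)"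
proof -
  note dI = mpolys.idlD[OF I]
  have gR: "g i \<in> mpolys n" if "i < r" for i using g[OF that] dI(3) by blast
  have M: "mpoly_pderiv (c l) (g i) \<in> mpolys n" if "i < r" "l < r" for i l using pderiv_mem gR that by blast
  have \<Delta>R: "\<Delta> \<in> mpolys n" unfolding \<Delta> by (rule mpolys.det_mem) (use M in auto)
  have "(\<Sum>j<n. d j * mpoly_pderiv j (g i)) \<in> I" if "i < r" for i using log g that by blast
  from newton_solution[OF I g c dR this e(1) \<Delta>]
  obtain U where UR: "\<forall>j. U j \<in> coeffs_in (mpolys n)" and U0: "\<forall>j. fps_nth (U j) 0 = 0"
    and U1: "\<forall>j. fps_nth (U j) 1 = \<Delta> ^ e * d j"
    and Ug: "\<forall>i<r. shift_eval (\<lambda>j. fps_const (\<Delta> ^ e) * U j) (g i) \<in> coeffs_in I" by blast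
  define u where "u j = fps_const (\<Delta> ^ e) * U j" for j
  let ?\<Phi> = "shift_eval u"
  have expand: "\<exists>h\<in>coeffs_in (mpolys n). fps_nth h 0 = 0 \<and> ?\<Phi> f = fps_const f + fps_const (\<Delta> ^ e) * h"
    if f: "f \<in> mpolys n" for f
  proof -
    obtain Q where Q: "second_order_remainder n (\<Delta> ^ e) f Q"
      using exists_second_order_remainder[OF f mpolys.power_mem[OF \<Delta>R]] by blast
    let ?h = "first_order n f U + fps_const (\<Delta> ^ e) * Q U"
    have "?\<Phi> f = fps_const f + fps_const (\<Delta> ^ e) * ?h"
      unfolding u_def second_order_remainderD(1)[OF Q] by (simp add: distrib_left power2_eq_square mult.assoc del: fps_const_mult)
    moreover have "?h \<in> coeffs_in (mpolys n)"
      using UR f \<Delta>R second_order_remainderD(2)[OF Q] first_order_mem[OF f]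
      by (intro mseries.add_mem mseries.mult_mem) auto
    moreover have "fps_nth ?h 0 = 0"
      using U0 second_order_remainder_nth_0(1)[OF Q] first_order_nth_0[of n U f] by simp
    ultimately show ?thesis by blast
  qed
  have \<Phi>R: "?\<Phi> f \<in> coeffs_in (mpolys n)" if "f \<in> mpolys n" for f
    using expand[OF that] that \<Delta>R by (auto intro!: mseries.add_mem mseries.mult_mem)
  have \<Phi>0: "fps_nth (?\<Phi> f) 0 = f" if "f \<in> mpolys n" for f using expand[OF that] by auto
  have const_I: "fps_const b \<in> low_coeffs_in n I m" if "b \<in> I" for b m
    using that dI by (auto simp: low_coeffs_in_def coeffs_in_def fps_nth_fps_const)
  have II: "X \<in> low_coeffs_in n I m" if "X \<in> coeffs_in I" for X m
    using that dI by (auto simp: low_coeffs_in_def coeffs_in_def)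
  note low = mseries.idlD[OF low_coeffs_idl]
  \<comment> \<open>\<open>\<Phi> \<Delta>\<close> is \<open>\<Delta>\<close> times a series with constant coefficient \<open>1\<close>\<close>
  obtain h\<Delta> where h\<Delta>: "h\<Delta> \<in> coeffs_in (mpolys n)" "fps_nth h\<Delta> 0 = 0"
    "?\<Phi> \<Delta> = fps_const \<Delta> + fps_const (\<Delta> ^ e) * h\<Delta>" using expand[OF \<Delta>R] by blast
  define W where "W = 1 + fps_const (\<Delta> ^ (e - 1)) * h\<Delta>"
  have WR: "W \<in> coeffs_in (mpolys n)" "fps_nth W 0 = 1"
    using h\<Delta> \<Delta>R by (auto simp: W_def intro!: mseries.add_mem mseries.mult_mem)
  have "fps_const (\<Delta> ^ e) = fps_const \<Delta> * fps_const (\<Delta> ^ (e - 1))" using e by (cases e) simp_all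
  then have \<Phi>\<Delta>: "?\<Phi> \<Delta> = fps_const \<Delta> * W"
    unfolding h\<Delta>(3) W_def by (simp add: distrib_left mult.assoc del: fps_const_mult)
  have WN: "W ^ N \<in> coeffs_in (mpolys n)" "fps_nth (W ^ N) 0 = 1" using WR by (auto simp: fps_power_zeroth)
  have approx: "fps_const (\<Delta> ^ N) * ?\<Phi> f \<in> low_coeffs_in n I m" if "f \<in> I" for f m using that
  proof (induction m arbitrary: f)
    case 0
    then show ?case using \<Phi>R \<Delta>R dI by (auto simp: low_coeffs_in_def)
  next
    case (Suc m)
    let ?H = "{h \<in> mpolys n. ?\<Phi> h \<in> low_coeffs_in n I (Suc m)}"
    have "mpolys.idl n ?H" unfolding mpolys.idl_def
      using mseries.idlD[OF low_coeffs_idl[of "Suc m"]] \<Phi>R by (auto simp: shift_eval_simps)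
    moreover have "g ` {..<r} \<union> {a * b |a b. a \<in> I \<and> b \<in> I} \<subseteq> ?H"
    proof -
      have "g i \<in> ?H" if "i < r" for i using II Ug gR that by (auto simp: u_def[abs_def])
      moreover have "a * b \<in> ?H" if ab: "a \<in> I" "b \<in> I" for a b
      proof -
        have R: "a \<in> mpolys n" "b \<in> mpolys n" using ab dI(3) by auto
        obtain h where h: "h \<in> coeffs_in (mpolys n)" "fps_nth h 0 = 0"
          "?\<Phi> a = fps_const a + fps_const (\<Delta> ^ e) * h" using expand[OF R(1)] by blast
        have "\<Delta> ^ e = \<Delta> ^ (e - N) * \<Delta> ^ N" using e(2) by (simp flip: power_add)
        then have "fps_const (\<Delta> ^ e) = fps_const (\<Delta> ^ (e - N)) * fps_const (\<Delta> ^ N)" by simp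
        then have "?\<Phi> (a * b) = fps_const a * ?\<Phi> b + fps_const (\<Delta> ^ (e - N)) * (h * (fps_const (\<Delta> ^ N) * ?\<Phi> b))"
          unfolding shift_eval_simps h(3) by (simp add: distrib_right distrib_left mult_ac del: fps_const_mult)
        also have "\<dots> \<in> low_coeffs_in n I (Suc m)"
        proof (intro low(4))
          show "fps_const a * ?\<Phi> b \<in> low_coeffs_in n I (Suc m)" using low(6)[OF \<Phi>R[OF R(2)] const_I[OF ab(1)]] .
          show "fps_const (\<Delta> ^ (e - N)) * (h * (fps_const (\<Delta> ^ N) * ?\<Phi> b)) \<in> low_coeffs_in n I (Suc m)"
            using low(5) low_coeffs_mult_Suc[OF h(1,2) Suc.IH[OF ab(2)]] \<Delta>R by auto
        qed
        finally show ?thesis using R by auto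
      qed
      ultimately show ?thesis by auto
    qed
    ultimately have "mpolys.gen n (g ` {..<r} \<union> {a * b |a b. a \<in> I \<and> b \<in> I}) \<subseteq> ?H" by (rule mpolys.gen_least)
    then have "?\<Phi> (\<Delta> ^ N * f) \<in> low_coeffs_in n I (Suc m)" using conormal[OF Suc.prems] by blast
    moreover have "?\<Phi> (\<Delta> ^ N * f) = W ^ N * (fps_const (\<Delta> ^ N) * ?\<Phi> f)"
      by (simp add: shift_eval_simps shift_eval_power \<Phi>\<Delta> power_mult_distrib mult_ac)
    moreover have "fps_const (\<Delta> ^ N) * ?\<Phi> f \<in> coeffs_in (mpolys n)" using \<Phi>R dI(3)[OF Suc.prems] \<Delta>R by auto
    ultimately show ?case using low_coeffs_cancel_unit[OF WN] by metis
  qed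
  have "?\<Phi> f \<in> coeffs_in I" if f: "f \<in> I" for f
  proof -
    obtain h where h: "h \<in> coeffs_in (mpolys n)" "?\<Phi> f = fps_const f + fps_const (\<Delta> ^ e) * h"
      using expand[OF dI(3)[OF f]] by blast
    have "fps_nth (?\<Phi> f) i \<in> I" for i
    proof -
      have hi: "fps_nth h i \<in> mpolys n" using h by (auto simp: coeffs_in_def)
      let ?f = "if i = 0 then f else 0"
      have fI: "?f \<in> I" using f dI(2) by auto
      have nth: "fps_nth (?\<Phi> f) i = ?f + \<Delta> ^ e * fps_nth h i" unfolding h(2) by (simp add: fps_nth_fps_const)
      have "fps_nth (fps_const (\<Delta> ^ N) * ?\<Phi> f) i \<in> I"
        using approx[OF f, of "Suc i"] by (auto simp: low_coeffs_in_def)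
      then have "\<Delta> ^ N * ?f + \<Delta> ^ (N + e) * fps_nth h i \<in> I"
        unfolding fps_mult_left_const_nth nth by (simp add: distrib_left power_add mult.assoc)
      then have "(\<Delta> ^ N * ?f + \<Delta> ^ (N + e) * fps_nth h i) - \<Delta> ^ N * ?f \<in> I"
        using dI(8) dI(5)[OF mpolys.power_mem[OF \<Delta>R] fI] by blast
      then have "\<Delta> ^ (N + e) * fps_nth h i \<in> I" by simp
      then have "\<Delta> ^ e * fps_nth h i \<in> I" using tors[OF hi] by blast
      then show ?thesis unfolding nth using dI(4)[OF fI] by blast
    qed
    then show ?thesis by (simp add: coeffs_in_def)
  qed
  moreover have "fps_nth (?\<Phi> (Xvar j)) 1 = \<Delta> ^ (2 * e) * d j" for j
    using U1 by (simp add: shift_eval_simps u_def mult_2 power_add mult.assoc)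
  ultimately show ?thesis using \<Phi>R \<Phi>0 by blast
qed

end

section \<open>Localization\<close>

locale multiplicative_set = cring A for A (structure) +
  fixes S :: "'a set"
  assumes S_sub: "S \<subseteq> carrier A" and S_one: "\<one> \<in> S" and S_mult: "\<And>a b. a \<in> S \<Longrightarrow> b \<in> S \<Longrightarrow> a \<otimes> b \<in> S"
begin

lemma S_carr [simp]: "s \<in> S \<Longrightarrow> s \<in> carrier A" using S_sub by auto

lemma fraction_mem:
  "(b, t) \<in> fraction A S a s \<longleftrightarrow> b \<in> carrier A \<and> t \<in> S \<and> (\<exists>u\<in>S. u \<otimes> (t \<otimes> a) = u \<otimes> (s \<otimes> b))"
  by (auto simp: fraction_def)

lemma fraction_self: "a \<in> carrier A \<Longrightarrow> s \<in> S \<Longrightarrow> (a, s) \<in> fraction A S a s"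
  using S_one by (auto simp: fraction_mem)

lemma fraction_trans:
  assumes R: "a \<in> carrier A" "b \<in> carrier A" "c \<in> carrier A" "s \<in> S" "t \<in> S" "w \<in> S"
    and u: "u \<in> S" "u \<otimes> (t \<otimes> a) = u \<otimes> (s \<otimes> b)" and v: "v \<in> S" "v \<otimes> (w \<otimes> b) = v \<otimes> (t \<otimes> c)"
  shows "\<exists>x\<in>S. x \<otimes> (w \<otimes> a) = x \<otimes> (s \<otimes> c)"
proof
  show "u \<otimes> v \<otimes> t \<in> S" using u v R S_mult by auto
  have "(u \<otimes> v \<otimes> t) \<otimes> (w \<otimes> a) = (v \<otimes> w) \<otimes> (u \<otimes> (t \<otimes> a))" using R u(1) v(1) by (simp add: m_ac)
  also have "\<dots> = (u \<otimes> s) \<otimes> (v \<otimes> (w \<otimes> b))" unfolding u(2) using R u(1) v(1) by (simp add: m_ac)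
  also have "\<dots> = (u \<otimes> v \<otimes> t) \<otimes> (s \<otimes> c)" unfolding v(2) using R u(1) v(1) by (simp add: m_ac)
  finally show "(u \<otimes> v \<otimes> t) \<otimes> (w \<otimes> a) = (u \<otimes> v \<otimes> t) \<otimes> (s \<otimes> c)" .
qed

lemma fraction_eq_iff:
  assumes "a \<in> carrier A" "b \<in> carrier A" "s \<in> S" "t \<in> S"
  shows "fraction A S a s = fraction A S b t \<longleftrightarrow> (\<exists>u\<in>S. u \<otimes> (t \<otimes> a) = u \<otimes> (s \<otimes> b))"
proof
  assume "fraction A S a s = fraction A S b t"
  then have "(b, t) \<in> fraction A S a s" using fraction_self assms by simp
  then show "\<exists>u\<in>S. u \<otimes> (t \<otimes> a) = u \<otimes> (s \<otimes> b)" by (simp add: fraction_mem)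
next
  assume "\<exists>u\<in>S. u \<otimes> (t \<otimes> a) = u \<otimes> (s \<otimes> b)"
  then obtain u where u: "u \<in> S" "u \<otimes> (t \<otimes> a) = u \<otimes> (s \<otimes> b)" by blast
  show "fraction A S a s = fraction A S b t"
  proof (rule Set.set_eqI)
    fix z :: "'a \<times> 'a"
    obtain c w where z: "z = (c, w)" by (cases z)
    show "z \<in> fraction A S a s \<longleftrightarrow> z \<in> fraction A S b t"
      unfolding z
    proof
      assume "(c, w) \<in> fraction A S a s"
      then obtain v where "c \<in> carrier A" "w \<in> S" "v \<in> S" "v \<otimes> (w \<otimes> a) = v \<otimes> (s \<otimes> c)" by (auto simp: fraction_mem)
      then show "(c, w) \<in> fraction A S b t"
        using fraction_trans[of b a c t s w u v] assms u by (auto simp: fraction_mem)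
    next
      assume "(c, w) \<in> fraction A S b t"
      then obtain v where "c \<in> carrier A" "w \<in> S" "v \<in> S" "v \<otimes> (w \<otimes> b) = v \<otimes> (t \<otimes> c)" by (auto simp: fraction_mem)
      then show "(c, w) \<in> fraction A S a s"
        using fraction_trans[of a b c s t w u v] assms u by (auto simp: fraction_mem)
    qed
  qed
qed

lemma fraction_eqI:
  assumes "a \<in> carrier A" "b \<in> carrier A" "s \<in> S" "t \<in> S" "t \<otimes> a = s \<otimes> b"
  shows "fraction A S a s = fraction A S b t"
  using fraction_eq_iff[OF assms(1-4)] assms(5) S_one by auto

lemma fraction_memE:
  assumes "(b, t) \<in> fraction A S a s" "a \<in> carrier A" "s \<in> S"
  shows "b \<in> carrier A" "t \<in> S" "\<exists>u\<in>S. u \<otimes> (t \<otimes> a) = u \<otimes> (s \<otimes> b)"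
  using assms by (auto simp: fraction_mem)

abbreviation L where "L \<equiv> localization A S"

lemma UN_constant_value: assumes "\<And>z. z \<in> Z \<Longrightarrow> g z = c" "Z \<noteq> {}" shows "(\<Union>z\<in>Z. g z) = c"
proof -
  have "g ` Z = {c}" using assms by auto
  then show ?thesis by simp
qed

lemma UN_pairs_const:
  assumes const: "\<And>a s b t. (a, s) \<in> X \<Longrightarrow> (b, t) \<in> Y \<Longrightarrow> f a s b t = c" and "X \<noteq> {}" "Y \<noteq> {}"
  shows "(\<Union>(a, s)\<in>X. \<Union>(b, t)\<in>Y. f a s b t) = c"
proof (rule UN_constant_value[OF _ assms(2)])
  fix z assume z: "z \<in> X"
  obtain a s where as: "z = (a, s)" by (cases z)
  have "(\<Union>(b, t)\<in>Y. f a s b t) = c"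
  proof (rule UN_constant_value[OF _ assms(3)])
    fix y assume y: "y \<in> Y"
    obtain b t where "y = (b, t)" by (cases y)
    then show "(case y of (b, t) \<Rightarrow> f a s b t) = c" using const z y as by simp
  qed
  then show "(case z of (a, s) \<Rightarrow> \<Union>(b, t)\<in>Y. f a s b t) = c" using as by simp
qed

lemma L_carrier: "x \<in> carrier L \<longleftrightarrow> (\<exists>a\<in>carrier A. \<exists>s\<in>S. x = fraction A S a s)"
  by (auto simp: localization_def)

lemma fraction_closed [simp, intro]: "a \<in> carrier A \<Longrightarrow> s \<in> S \<Longrightarrow> fraction A S a s \<in> carrier L"
  by (auto simp: L_carrier)

lemma L_mult:
  assumes "a \<in> carrier A" "s \<in> S" "b \<in> carrier A" "t \<in> S"
  shows "fraction A S a s \<otimes>\<^bsub>L\<^esub> fraction A S b t = fraction A S (a \<otimes> b) (s \<otimes> t)"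
proof -
  have "fraction A S a s \<otimes>\<^bsub>L\<^esub> fraction A S b t
    = (\<Union>(a', s')\<in>fraction A S a s. \<Union>(b', t')\<in>fraction A S b t. fraction A S (a' \<otimes> b') (s' \<otimes> t'))"
    by (simp add: localization_def)
  also have "\<dots> = fraction A S (a \<otimes> b) (s \<otimes> t)"
  proof (rule UN_pairs_const)
    fix a' s' b' t' assume 1: "(a', s') \<in> fraction A S a s" and 2: "(b', t') \<in> fraction A S b t"
    obtain u where u: "u \<in> S" "u \<otimes> (s' \<otimes> a) = u \<otimes> (s \<otimes> a')" using fraction_memE[OF 1 assms(1,2)] by blast
    obtain v where v: "v \<in> S" "v \<otimes> (t' \<otimes> b) = v \<otimes> (t \<otimes> b')" using fraction_memE[OF 2 assms(3,4)] by blast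
    have R: "a' \<in> carrier A" "s' \<in> S" "b' \<in> carrier A" "t' \<in> S"
      using fraction_memE[OF 1 assms(1,2)] fraction_memE[OF 2 assms(3,4)] by auto
    have "(u \<otimes> v) \<otimes> ((s' \<otimes> t') \<otimes> (a \<otimes> b)) = (u \<otimes> (s' \<otimes> a)) \<otimes> (v \<otimes> (t' \<otimes> b))"
      using R u(1) v(1) assms by (simp add: m_ac)
    also have "\<dots> = (u \<otimes> v) \<otimes> ((s \<otimes> t) \<otimes> (a' \<otimes> b'))"
      unfolding u(2) v(2) using R u(1) v(1) assms by (simp add: m_ac)
    finally have "fraction A S (a \<otimes> b) (s \<otimes> t) = fraction A S (a' \<otimes> b') (s' \<otimes> t')"
      using R u v assms S_mult by (subst fraction_eq_iff) auto
    then show "fraction A S (a' \<otimes> b') (s' \<otimes> t') = fraction A S (a \<otimes> b) (s \<otimes> t)" by simp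
  qed (use fraction_self assms in blast)+
  finally show ?thesis .
qed

lemma L_add:
  assumes "a \<in> carrier A" "s \<in> S" "b \<in> carrier A" "t \<in> S"
  shows "fraction A S a s \<oplus>\<^bsub>L\<^esub> fraction A S b t = fraction A S (t \<otimes> a \<oplus> s \<otimes> b) (s \<otimes> t)"
proof -
  have "fraction A S a s \<oplus>\<^bsub>L\<^esub> fraction A S b t
    = (\<Union>(a', s')\<in>fraction A S a s. \<Union>(b', t')\<in>fraction A S b t. fraction A S (t' \<otimes> a' \<oplus> s' \<otimes> b') (s' \<otimes> t'))"
    by (simp add: localization_def)
  also have "\<dots> = fraction A S (t \<otimes> a \<oplus> s \<otimes> b) (s \<otimes> t)"
  proof (rule UN_pairs_const)
    fix a' s' b' t' assume 1: "(a', s') \<in> fraction A S a s" and 2: "(b', t') \<in> fraction A S b t"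
    obtain u where u: "u \<in> S" "u \<otimes> (s' \<otimes> a) = u \<otimes> (s \<otimes> a')" using fraction_memE[OF 1 assms(1,2)] by blast
    obtain v where v: "v \<in> S" "v \<otimes> (t' \<otimes> b) = v \<otimes> (t \<otimes> b')" using fraction_memE[OF 2 assms(3,4)] by blast
    have R: "a' \<in> carrier A" "s' \<in> S" "b' \<in> carrier A" "t' \<in> S"
      using fraction_memE[OF 1 assms(1,2)] fraction_memE[OF 2 assms(3,4)] by auto
    have "(u \<otimes> v) \<otimes> ((s' \<otimes> t') \<otimes> (t \<otimes> a \<oplus> s \<otimes> b))
      = (v \<otimes> t' \<otimes> t) \<otimes> (u \<otimes> (s' \<otimes> a)) \<oplus> (u \<otimes> s' \<otimes> s) \<otimes> (v \<otimes> (t' \<otimes> b))"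
      using R u(1) v(1) assms by (simp add: m_ac r_distr)
    also have "\<dots> = (u \<otimes> v) \<otimes> ((s \<otimes> t) \<otimes> (t' \<otimes> a' \<oplus> s' \<otimes> b'))"
      unfolding u(2) v(2) using R u(1) v(1) assms by (simp add: m_ac r_distr)
    finally have "fraction A S (t \<otimes> a \<oplus> s \<otimes> b) (s \<otimes> t) = fraction A S (t' \<otimes> a' \<oplus> s' \<otimes> b') (s' \<otimes> t')"
      using R u v assms S_mult by (subst fraction_eq_iff) auto
    then show "fraction A S (t' \<otimes> a' \<oplus> s' \<otimes> b') (s' \<otimes> t') = fraction A S (t \<otimes> a \<oplus> s \<otimes> b) (s \<otimes> t)" by simp
  qed (use fraction_self assms in blast)+
  finally show ?thesis .
qed

lemma L_zero_one: "\<zero>\<^bsub>L\<^esub> = fraction A S \<zero> \<one>" "\<one>\<^bsub>L\<^esub> = fraction A S \<one> \<one>"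
  by (simp_all add: localization_def)

lemma localization_cring: "cring L"
proof (rule cringI)
  show "abelian_group L"
  proof (rule abelian_groupI)
    fix x y assume "x \<in> carrier L" "y \<in> carrier L"
    then obtain a s b t where x: "a \<in> carrier A" "s \<in> S" "x = fraction A S a s"
      and y: "b \<in> carrier A" "t \<in> S" "y = fraction A S b t" by (auto simp: L_carrier)
    show "x \<oplus>\<^bsub>L\<^esub> y \<in> carrier L" using x y by (auto simp: L_add S_mult)
    show "x \<oplus>\<^bsub>L\<^esub> y = y \<oplus>\<^bsub>L\<^esub> x" using x y by (simp add: L_add m_comm a_comm)
    fix z assume "z \<in> carrier L"
    then obtain c w where z: "c \<in> carrier A" "w \<in> S" "z = fraction A S c w" by (auto simp: L_carrier)
    show "x \<oplus>\<^bsub>L\<^esub> y \<oplus>\<^bsub>L\<^esub> z = x \<oplus>\<^bsub>L\<^esub> (y \<oplus>\<^bsub>L\<^esub> z)"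
      unfolding x(3) y(3) z(3) using x(1,2) y(1,2) z(1,2)
      by (simp add: L_add S_mult) (rule fraction_eqI; simp add: S_mult m_ac r_distr a_ac)
  next
    fix x assume "x \<in> carrier L"
    then obtain a s where x: "a \<in> carrier A" "s \<in> S" "x = fraction A S a s" by (auto simp: L_carrier)
    show "\<zero>\<^bsub>L\<^esub> \<oplus>\<^bsub>L\<^esub> x = x" unfolding L_zero_one x(3) using x(1,2) S_one by (simp add: L_add)
    have "fraction A S (\<ominus> a) s \<oplus>\<^bsub>L\<^esub> x = \<zero>\<^bsub>L\<^esub>"
      unfolding L_zero_one x(3) using x(1,2) S_one
      by (simp add: L_add) (rule fraction_eqI; simp add: S_mult r_minus l_neg)
    then show "\<exists>y\<in>carrier L. y \<oplus>\<^bsub>L\<^esub> x = \<zero>\<^bsub>L\<^esub>" using x by auto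
  qed (use S_one L_zero_one in auto)
  show "comm_monoid L"
  proof (rule comm_monoidI)
    fix x y assume "x \<in> carrier L" "y \<in> carrier L"
    then obtain a s b t where x: "a \<in> carrier A" "s \<in> S" "x = fraction A S a s"
      and y: "b \<in> carrier A" "t \<in> S" "y = fraction A S b t" by (auto simp: L_carrier)
    show "x \<otimes>\<^bsub>L\<^esub> y \<in> carrier L" using x y by (auto simp: L_mult S_mult)
    show "x \<otimes>\<^bsub>L\<^esub> y = y \<otimes>\<^bsub>L\<^esub> x" using x y by (simp add: L_mult m_comm)
    fix z assume "z \<in> carrier L"
    then obtain c w where z: "c \<in> carrier A" "w \<in> S" "z = fraction A S c w" by (auto simp: L_carrier)
    show "x \<otimes>\<^bsub>L\<^esub> y \<otimes>\<^bsub>L\<^esub> z = x \<otimes>\<^bsub>L\<^esub> (y \<otimes>\<^bsub>L\<^esub> z)"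
      unfolding x(3) y(3) z(3) using x(1,2) y(1,2) z(1,2) by (simp add: L_mult S_mult m_assoc)
  next
    fix x assume "x \<in> carrier L"
    then obtain a s where x: "a \<in> carrier A" "s \<in> S" "x = fraction A S a s" by (auto simp: L_carrier)
    show "\<one>\<^bsub>L\<^esub> \<otimes>\<^bsub>L\<^esub> x = x" unfolding L_zero_one x(3) using x(1,2) S_one by (simp add: L_mult)
  qed (use S_one L_zero_one in auto)
  fix x y z assume "x \<in> carrier L" "y \<in> carrier L" "z \<in> carrier L"
  then obtain a s b t c w where x: "a \<in> carrier A" "s \<in> S" "x = fraction A S a s"
    and y: "b \<in> carrier A" "t \<in> S" "y = fraction A S b t" and z: "c \<in> carrier A" "w \<in> S" "z = fraction A S c w"
    by (auto simp: L_carrier)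
  show "(x \<oplus>\<^bsub>L\<^esub> y) \<otimes>\<^bsub>L\<^esub> z = x \<otimes>\<^bsub>L\<^esub> z \<oplus>\<^bsub>L\<^esub> y \<otimes>\<^bsub>L\<^esub> z"
    unfolding x(3) y(3) z(3) using x(1,2) y(1,2) z(1,2)
    by (simp add: L_add L_mult S_mult) (rule fraction_eqI; simp add: S_mult m_ac r_distr l_distr)
qed

end

lemma ring_hom_cringI2:
  assumes "cring A" "cring B" "h \<in> Ring.ring_hom A B" shows "ring_hom_cring A B h"
  using assms by (intro ring_hom_cring.intro ring_hom_cring_axioms.intro)

section \<open>Maps with the properties of a localization\<close>

text \<open>These properties characterize the composite \<open>A \<rightarrow> A/I \<rightarrow> S\<^sup>-\<^sup>1(A/I)\<close> up to isomorphism. Working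
  with them gives one treatment of \<open>A\<^sub>P\<close> (with \<open>I = 0\<close>) and of the localization of \<open>k[x]/I\<close> seen
  from \<open>k[x]\<close>, and hides the set-theoretic fractions.\<close>

locale fraction_map = A: cring A + B: cring B
  for A :: "('a, 'n) ring_scheme" (structure) and B :: "('b, 'm) ring_scheme" (structure) +
  fixes I S :: "'a set" and \<theta> :: "'a \<Rightarrow> 'b"
  assumes hom: "\<theta> \<in> Ring.ring_hom A B" and S_sub: "S \<subseteq> carrier A"
    and units: "\<And>s. s \<in> S \<Longrightarrow> \<theta> s \<in> Units B"
    and surj: "\<And>b. b \<in> carrier B \<Longrightarrow> \<exists>a\<in>carrier A. \<exists>s\<in>S. \<theta> s \<otimes>\<^bsub>B\<^esub> b = \<theta> a"
    and kernel: "\<And>a. a \<in> carrier A \<Longrightarrow> \<theta> a = \<zero>\<^bsub>B\<^esub> \<longleftrightarrow> (\<exists>s\<in>S. s \<otimes> a \<in> I)"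
    and S_mult: "\<And>s t. s \<in> S \<Longrightarrow> t \<in> S \<Longrightarrow> s \<otimes> t \<in> S" and S_one: "\<one> \<in> S"
begin

lemma S_carr [simp]: "s \<in> S \<Longrightarrow> s \<in> carrier A" using S_sub by auto

lemma hom_closed [simp]: "a \<in> carrier A \<Longrightarrow> \<theta> a \<in> carrier B"
  using ring_hom_closed[OF hom] by auto

lemma hom_simps:
  "a \<in> carrier A \<Longrightarrow> b \<in> carrier A \<Longrightarrow> \<theta> (a \<otimes> b) = \<theta> a \<otimes>\<^bsub>B\<^esub> \<theta> b"
  "a \<in> carrier A \<Longrightarrow> b \<in> carrier A \<Longrightarrow> \<theta> (a \<oplus> b) = \<theta> a \<oplus>\<^bsub>B\<^esub> \<theta> b"
  "\<theta> \<one> = \<one>\<^bsub>B\<^esub>" "\<theta> \<zero> = \<zero>\<^bsub>B\<^esub>"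
  "a \<in> carrier A \<Longrightarrow> \<theta> (\<ominus> a) = \<ominus>\<^bsub>B\<^esub> \<theta> a"
  "a \<in> carrier A \<Longrightarrow> b \<in> carrier A \<Longrightarrow> \<theta> (a \<ominus> b) = \<theta> a \<ominus>\<^bsub>B\<^esub> \<theta> b"
proof -
  interpret h: ring_hom_cring A B \<theta> by (intro ring_hom_cringI2 A.is_cring B.is_cring hom)
  show "a \<in> carrier A \<Longrightarrow> b \<in> carrier A \<Longrightarrow> \<theta> (a \<otimes> b) = \<theta> a \<otimes>\<^bsub>B\<^esub> \<theta> b"
    and "a \<in> carrier A \<Longrightarrow> b \<in> carrier A \<Longrightarrow> \<theta> (a \<oplus> b) = \<theta> a \<oplus>\<^bsub>B\<^esub> \<theta> b"
    and "\<theta> \<one> = \<one>\<^bsub>B\<^esub>" and "\<theta> \<zero> = \<zero>\<^bsub>B\<^esub>"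
    and "a \<in> carrier A \<Longrightarrow> \<theta> (\<ominus> a) = \<ominus>\<^bsub>B\<^esub> \<theta> a"
    and "a \<in> carrier A \<Longrightarrow> b \<in> carrier A \<Longrightarrow> \<theta> (a \<ominus> b) = \<theta> a \<ominus>\<^bsub>B\<^esub> \<theta> b"
    by (simp_all add: a_minus_def)
qed

definition extend :: "'a set \<Rightarrow> 'b set" where
  "extend J = {b \<in> carrier B. \<exists>a\<in>J. \<exists>s\<in>S. \<theta> s \<otimes>\<^bsub>B\<^esub> b = \<theta> a}"

lemma extend_ideal: assumes J: "ideal J A" shows "ideal (extend J) B"
proof -
  interpret J: ideal J A by fact
  have ext_mult: "x \<otimes>\<^bsub>B\<^esub> b \<in> extend J" if b: "b \<in> extend J" and x: "x \<in> carrier B" for x b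
  proof -
    obtain a s where a: "b \<in> carrier B" "a \<in> J" "s \<in> S" "\<theta> s \<otimes>\<^bsub>B\<^esub> b = \<theta> a" using b unfolding extend_def by blast
    obtain c t where c: "c \<in> carrier A" "t \<in> S" "\<theta> t \<otimes>\<^bsub>B\<^esub> x = \<theta> c" using surj[OF x] by blast
    have "\<theta> (t \<otimes> s) \<otimes>\<^bsub>B\<^esub> (x \<otimes>\<^bsub>B\<^esub> b) = (\<theta> t \<otimes>\<^bsub>B\<^esub> x) \<otimes>\<^bsub>B\<^esub> (\<theta> s \<otimes>\<^bsub>B\<^esub> b)"
      using a(1,3) c(1,2) x by (simp add: hom_simps B.m_ac)
    also have "\<dots> = \<theta> (c \<otimes> a)" unfolding a(4) c(3) using a(2) c(1) J.Icarr by (simp add: hom_simps)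
    finally show ?thesis using a c x S_mult J.I_l_closed unfolding extend_def by blast
  qed
  show ?thesis
  proof (rule B.ideal_of_closed)
    show "extend J \<subseteq> carrier B" by (auto simp: extend_def)
    have "\<theta> \<one> \<otimes>\<^bsub>B\<^esub> \<zero>\<^bsub>B\<^esub> = \<theta> \<zero>" by (simp add: hom_simps)
    moreover have "\<zero> \<in> J" using additive_subgroup.zero_closed[OF J.is_additive_subgroup] .
    ultimately show "\<zero>\<^bsub>B\<^esub> \<in> extend J" using S_one unfolding extend_def by blast
    fix b c assume "b \<in> extend J" "c \<in> extend J"
    then obtain a s a' t where b: "b \<in> carrier B" "a \<in> J" "s \<in> S" "\<theta> s \<otimes>\<^bsub>B\<^esub> b = \<theta> a"
      and c: "c \<in> carrier B" "a' \<in> J" "t \<in> S" "\<theta> t \<otimes>\<^bsub>B\<^esub> c = \<theta> a'" unfolding extend_def by blast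
    have "\<theta> (s \<otimes> t) \<otimes>\<^bsub>B\<^esub> (b \<oplus>\<^bsub>B\<^esub> c) = \<theta> t \<otimes>\<^bsub>B\<^esub> (\<theta> s \<otimes>\<^bsub>B\<^esub> b) \<oplus>\<^bsub>B\<^esub> \<theta> s \<otimes>\<^bsub>B\<^esub> (\<theta> t \<otimes>\<^bsub>B\<^esub> c)"
      using b(1,3) c(1,3) by (simp add: hom_simps B.m_ac B.r_distr)
    also have "\<dots> = \<theta> (t \<otimes> a \<oplus> s \<otimes> a')"
      unfolding b(4) c(4) using b(2,3) c(2,3) J.Icarr by (simp add: hom_simps)
    finally have "\<theta> (s \<otimes> t) \<otimes>\<^bsub>B\<^esub> (b \<oplus>\<^bsub>B\<^esub> c) = \<theta> (t \<otimes> a \<oplus> s \<otimes> a')" .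
    moreover have "t \<otimes> a \<oplus> s \<otimes> a' \<in> J"
      using b c J.I_l_closed additive_subgroup.a_closed[OF J.is_additive_subgroup] by simp
    ultimately show "b \<oplus>\<^bsub>B\<^esub> c \<in> extend J" using b c S_mult unfolding extend_def by auto
  qed (rule ext_mult)
qed

definition contract :: "'b set \<Rightarrow> 'a set" where
  "contract Q = {a \<in> carrier A. \<theta> a \<in> Q}"

lemma contract_ideal: assumes Q: "ideal Q B" shows "ideal (contract Q) A"
  using ring_hom_ring.ideal_vimage[OF ring_hom_ringI2[OF A.ring_axioms B.ring_axioms hom] Q] by (simp add: contract_def)

lemma mem_iff_contract:
  assumes Q: "ideal Q B" and b: "b \<in> carrier B" "\<theta> s \<otimes>\<^bsub>B\<^esub> b = \<theta> a" "s \<in> S" "a \<in> carrier A"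
  shows "b \<in> Q \<longleftrightarrow> a \<in> contract Q"
proof -
  interpret Q: ideal Q B by fact
  have u: "inv\<^bsub>B\<^esub> \<theta> s \<in> carrier B" "inv\<^bsub>B\<^esub> \<theta> s \<otimes>\<^bsub>B\<^esub> \<theta> s = \<one>\<^bsub>B\<^esub>" using units[OF b(3)] by auto
  have "b = inv\<^bsub>B\<^esub> \<theta> s \<otimes>\<^bsub>B\<^esub> (\<theta> s \<otimes>\<^bsub>B\<^esub> b)" using u b(1,3) by (simp add: B.m_assoc[symmetric])
  then have "b = inv\<^bsub>B\<^esub> \<theta> s \<otimes>\<^bsub>B\<^esub> \<theta> a" by (simp add: b(2))
  then show ?thesis using b u Q.I_l_closed[of "\<theta> a" "inv\<^bsub>B\<^esub> \<theta> s"] Q.I_l_closed[of b "\<theta> s"] unfolding contract_def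
    by (metis (mono_tags, lifting) S_carr hom_closed mem_Collect_eq)
qed

lemma contract_inj:
  assumes "ideal Q B" "ideal Q' B" "contract Q \<subseteq> contract Q'" shows "Q \<subseteq> Q'"
proof
  fix b assume b: "b \<in> Q"
  then have bB: "b \<in> carrier B" using ideal.Icarr[OF assms(1)] by auto
  obtain a s where a: "a \<in> carrier A" "s \<in> S" "\<theta> s \<otimes>\<^bsub>B\<^esub> b = \<theta> a" using surj[OF bB] by blast
  show "b \<in> Q'" using mem_iff_contract[OF assms(1) bB a(3,2,1)] mem_iff_contract[OF assms(2) bB a(3,2,1)] b assms(3)
    by blast
qed

lemma noetherian_fractions: assumes "noetherian_ring A" shows "noetherian_ring B"
proof (rule B.noetherian_ringI)
  fix Q assume Q: "ideal Q B"
  interpret Q: ideal Q B by fact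
  obtain X where X: "X \<subseteq> carrier A" "finite X" "contract Q = Idl X"
    using noetherian_ring.finetely_gen[OF assms contract_ideal[OF Q]] by blast
  have XQ: "\<theta> ` X \<subseteq> Q" using A.genideal_self[OF X(1)] X(3) by (auto simp: contract_def)
  have XB: "\<theta> ` X \<subseteq> carrier B" using X(1) by auto
  have "Idl\<^bsub>B\<^esub> (\<theta> ` X) \<subseteq> Q" using B.genideal_minimal[OF Q XQ] .
  moreover have "Q \<subseteq> Idl\<^bsub>B\<^esub> (\<theta> ` X)"
  proof (rule contract_inj[OF Q B.genideal_ideal[OF XB]])
    have "X \<subseteq> contract (Idl\<^bsub>B\<^esub> (\<theta> ` X))" using X(1) B.genideal_self[OF XB] by (auto simp: contract_def)
    then show "contract Q \<subseteq> contract (Idl\<^bsub>B\<^esub> (\<theta> ` X))"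
      unfolding X(3) by (rule A.genideal_minimal[OF contract_ideal[OF B.genideal_ideal[OF XB]]])
  qed
  ultimately show "\<exists>A\<subseteq>carrier B. finite A \<and> Q = Idl\<^bsub>B\<^esub> A" using XB X(2) by (intro exI[of _ "\<theta> ` X"]) auto
qed

lemma contract_prime: assumes Q: "primeideal Q B" shows "primeideal (contract Q) A" "contract Q \<inter> S = {}"
proof -
  interpret Q: primeideal Q B by fact
  have "\<one>\<^bsub>B\<^esub> \<notin> Q" using Q.I_notcarr Q.one_imp_carrier by auto
  show "primeideal (contract Q) A"
    using ring_hom_ring.primeideal_vimage[OF ring_hom_ringI2[OF A.ring_axioms B.ring_axioms hom] A.is_cring Q]
    by (simp add: contract_def)
  show "contract Q \<inter> S = {}"
  proof (rule ccontr)
    assume "contract Q \<inter> S \<noteq> {}"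
    then obtain s where s: "s \<in> S" "\<theta> s \<in> Q" by (auto simp: contract_def)
    have "inv\<^bsub>B\<^esub> \<theta> s \<otimes>\<^bsub>B\<^esub> \<theta> s \<in> Q" using s units[OF s(1)] by (intro Q.I_l_closed) auto
    then show False using units[OF s(1)] \<open>\<one>\<^bsub>B\<^esub> \<notin> Q\<close> by simp
  qed
qed

lemma universal_property:
  assumes C: "cring C" and \<Theta>: "\<Theta> \<in> Ring.ring_hom A C" and I0: "\<And>a. a \<in> carrier A \<Longrightarrow> a \<in> I \<Longrightarrow> \<Theta> a = \<zero>\<^bsub>C\<^esub>"
    and U: "\<And>s. s \<in> S \<Longrightarrow> \<Theta> s \<in> Units C"
  shows "\<exists>\<Psi>\<in>Ring.ring_hom B C. \<forall>a\<in>carrier A. \<Psi> (\<theta> a) = \<Theta> a"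
proof -
  interpret C: cring C by fact
  interpret h: ring_hom_cring A C \<Theta> by (intro ring_hom_cringI2 A.is_cring C \<Theta>)
  have ker: "\<Theta> a = \<zero>\<^bsub>C\<^esub>" if a: "a \<in> carrier A" "\<theta> a = \<zero>\<^bsub>B\<^esub>" for a
  proof -
    obtain s where s: "s \<in> S" "s \<otimes> a \<in> I" using kernel[OF a(1)] a(2) by blast
    then have "\<Theta> s \<otimes>\<^bsub>C\<^esub> \<Theta> a = \<Theta> s \<otimes>\<^bsub>C\<^esub> \<zero>\<^bsub>C\<^esub>" using I0[of "s \<otimes> a"] a(1) by simp
    then show ?thesis using C.Units_l_cancel[OF U[OF s(1)], of "\<Theta> a" "\<zero>\<^bsub>C\<^esub>"] a(1) by simp
  qed
  have wd: "\<Theta> a = \<Theta> b" if "a \<in> carrier A" "b \<in> carrier A" "\<theta> a = \<theta> b" for a b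
  proof -
    have "\<theta> (a \<ominus> b) = \<zero>\<^bsub>B\<^esub>" using that by (simp add: hom_simps B.r_right_minus_eq)
    then have "\<Theta> a \<ominus>\<^bsub>C\<^esub> \<Theta> b = \<zero>\<^bsub>C\<^esub>" using ker[of "a \<ominus> b"] that by (simp add: a_minus_def)
    then show ?thesis using that C.r_right_minus_eq by simp
  qed
  define char where "char b x \<longleftrightarrow> x \<in> carrier C \<and>
    (\<forall>a\<in>carrier A. \<forall>s\<in>S. \<theta> s \<otimes>\<^bsub>B\<^esub> b = \<theta> a \<longrightarrow> \<Theta> s \<otimes>\<^bsub>C\<^esub> x = \<Theta> a)" for b x
  have ex: "\<exists>x. char b x" if b: "b \<in> carrier B" for b
  proof -
    obtain a s where a: "a \<in> carrier A" "s \<in> S" "\<theta> s \<otimes>\<^bsub>B\<^esub> b = \<theta> a" using surj[OF b] by blast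
    have u: "inv\<^bsub>C\<^esub> \<Theta> s \<in> carrier C" "\<Theta> s \<otimes>\<^bsub>C\<^esub> inv\<^bsub>C\<^esub> \<Theta> s = \<one>\<^bsub>C\<^esub>" using U[OF a(2)] by auto
    let ?x = "inv\<^bsub>C\<^esub> \<Theta> s \<otimes>\<^bsub>C\<^esub> \<Theta> a"
    have x: "?x \<in> carrier C" using u a by simp
    have sx: "\<Theta> s \<otimes>\<^bsub>C\<^esub> ?x = \<Theta> a" using u a by (simp add: C.m_assoc[symmetric])
    have "\<Theta> t \<otimes>\<^bsub>C\<^esub> ?x = \<Theta> c" if c: "c \<in> carrier A" "t \<in> S" "\<theta> t \<otimes>\<^bsub>B\<^esub> b = \<theta> c" for c t
    proof -
      have "\<theta> (t \<otimes> a) = \<theta> t \<otimes>\<^bsub>B\<^esub> (\<theta> s \<otimes>\<^bsub>B\<^esub> b)" using a c by (simp add: hom_simps)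
      also have "\<dots> = \<theta> s \<otimes>\<^bsub>B\<^esub> (\<theta> t \<otimes>\<^bsub>B\<^esub> b)" using a(2) c(2) b by (simp add: B.m_ac)
      also have "\<dots> = \<theta> (s \<otimes> c)" using a c by (simp add: hom_simps)
      finally have "\<Theta> (t \<otimes> a) = \<Theta> (s \<otimes> c)" using a c by (intro wd) auto
      then have "\<Theta> t \<otimes>\<^bsub>C\<^esub> (\<Theta> s \<otimes>\<^bsub>C\<^esub> ?x) = \<Theta> s \<otimes>\<^bsub>C\<^esub> \<Theta> c" unfolding sx using a c by simp
      then have "\<Theta> s \<otimes>\<^bsub>C\<^esub> (\<Theta> t \<otimes>\<^bsub>C\<^esub> ?x) = \<Theta> s \<otimes>\<^bsub>C\<^esub> \<Theta> c" using a(2) c(2) x by (simp add: C.m_lcomm)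
      then show ?thesis using C.Units_l_cancel[OF U[OF a(2)]] c x by simp
    qed
    then show ?thesis using x unfolding char_def by blast
  qed
  have uniq: "x = y" if b: "b \<in> carrier B" and "char b x" and y: "y \<in> carrier C" "\<theta> s \<otimes>\<^bsub>B\<^esub> b = \<theta> a" "\<Theta> s \<otimes>\<^bsub>C\<^esub> y = \<Theta> a"
    "a \<in> carrier A" "s \<in> S" for b x y a s
  proof -
    have "x \<in> carrier C" "\<Theta> s \<otimes>\<^bsub>C\<^esub> x = \<Theta> s \<otimes>\<^bsub>C\<^esub> y" using that unfolding char_def by auto
    then show ?thesis using C.Units_l_cancel[OF U[OF y(5)] _ y(1)] by blast
  qed
  define \<Psi> where "\<Psi> b = (SOME x. char b x)" for b
  have \<Psi>: "char b (\<Psi> b)" if "b \<in> carrier B" for b unfolding \<Psi>_def using someI_ex[OF ex[OF that]] .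
  have \<Psi>C: "\<Psi> b \<in> carrier C" if "b \<in> carrier B" for b using \<Psi>[OF that] by (simp add: char_def)
  have \<Psi>\<theta>: "\<Psi> (\<theta> a) = \<Theta> a" if a: "a \<in> carrier A" for a
    by (rule uniq[of "\<theta> a" "\<Psi> (\<theta> a)" "\<Theta> a" "\<one>" a]) (use a \<Psi> S_one in \<open>auto simp: hom_simps\<close>)
  have "\<Psi> \<in> Ring.ring_hom B C"
  proof (rule ring_hom_memI)
    show "\<Psi> b \<in> carrier C" if "b \<in> carrier B" for b using \<Psi>C[OF that] .
    show "\<Psi> \<one>\<^bsub>B\<^esub> = \<one>\<^bsub>C\<^esub>" using \<Psi>\<theta>[of "\<one>"] by (simp add: hom_simps)
    fix b c assume b: "b \<in> carrier B" and c: "c \<in> carrier B"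
    obtain a s where a: "a \<in> carrier A" "s \<in> S" "\<theta> s \<otimes>\<^bsub>B\<^esub> b = \<theta> a" using surj[OF b] by blast
    obtain a' t where a': "a' \<in> carrier A" "t \<in> S" "\<theta> t \<otimes>\<^bsub>B\<^esub> c = \<theta> a'" using surj[OF c] by blast
    have sb: "\<Theta> s \<otimes>\<^bsub>C\<^esub> \<Psi> b = \<Theta> a" using \<Psi>[OF b] a unfolding char_def by blast
    have tc: "\<Theta> t \<otimes>\<^bsub>C\<^esub> \<Psi> c = \<Theta> a'" using \<Psi>[OF c] a' unfolding char_def by blast
    show "\<Psi> (b \<otimes>\<^bsub>B\<^esub> c) = \<Psi> b \<otimes>\<^bsub>C\<^esub> \<Psi> c"
    proof (rule uniq[of "b \<otimes>\<^bsub>B\<^esub> c" _ _ "s \<otimes> t" "a \<otimes> a'"])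
      have "\<theta> (s \<otimes> t) \<otimes>\<^bsub>B\<^esub> (b \<otimes>\<^bsub>B\<^esub> c) = (\<theta> s \<otimes>\<^bsub>B\<^esub> b) \<otimes>\<^bsub>B\<^esub> (\<theta> t \<otimes>\<^bsub>B\<^esub> c)"
        using a(2) a'(2) b c by (simp add: hom_simps B.m_ac)
      then show "\<theta> (s \<otimes> t) \<otimes>\<^bsub>B\<^esub> (b \<otimes>\<^bsub>B\<^esub> c) = \<theta> (a \<otimes> a')" unfolding a(3) a'(3) using a(1) a'(1) by (simp add: hom_simps)
      have "\<Theta> (s \<otimes> t) \<otimes>\<^bsub>C\<^esub> (\<Psi> b \<otimes>\<^bsub>C\<^esub> \<Psi> c) = (\<Theta> s \<otimes>\<^bsub>C\<^esub> \<Psi> b) \<otimes>\<^bsub>C\<^esub> (\<Theta> t \<otimes>\<^bsub>C\<^esub> \<Psi> c)"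
        using a(2) a'(2) \<Psi>C[OF b] \<Psi>C[OF c] by (simp add: C.m_ac)
      then show "\<Theta> (s \<otimes> t) \<otimes>\<^bsub>C\<^esub> (\<Psi> b \<otimes>\<^bsub>C\<^esub> \<Psi> c) = \<Theta> (a \<otimes> a')" unfolding sb tc using a(1) a'(1) by simp
    qed (use a a' b c \<Psi> \<Psi>C S_mult in auto)
    show "\<Psi> (b \<oplus>\<^bsub>B\<^esub> c) = \<Psi> b \<oplus>\<^bsub>C\<^esub> \<Psi> c"
    proof (rule uniq[of "b \<oplus>\<^bsub>B\<^esub> c" _ _ "s \<otimes> t" "t \<otimes> a \<oplus> s \<otimes> a'"])
      have "\<theta> (s \<otimes> t) \<otimes>\<^bsub>B\<^esub> (b \<oplus>\<^bsub>B\<^esub> c) = \<theta> t \<otimes>\<^bsub>B\<^esub> (\<theta> s \<otimes>\<^bsub>B\<^esub> b) \<oplus>\<^bsub>B\<^esub> \<theta> s \<otimes>\<^bsub>B\<^esub> (\<theta> t \<otimes>\<^bsub>B\<^esub> c)"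
        using a(2) a'(2) b c by (simp add: hom_simps B.m_ac B.r_distr)
      then show "\<theta> (s \<otimes> t) \<otimes>\<^bsub>B\<^esub> (b \<oplus>\<^bsub>B\<^esub> c) = \<theta> (t \<otimes> a \<oplus> s \<otimes> a')"
        unfolding a(3) a'(3) using a(1,2) a'(1,2) by (simp add: hom_simps)
      have "\<Theta> (s \<otimes> t) \<otimes>\<^bsub>C\<^esub> (\<Psi> b \<oplus>\<^bsub>C\<^esub> \<Psi> c) = \<Theta> t \<otimes>\<^bsub>C\<^esub> (\<Theta> s \<otimes>\<^bsub>C\<^esub> \<Psi> b) \<oplus>\<^bsub>C\<^esub> \<Theta> s \<otimes>\<^bsub>C\<^esub> (\<Theta> t \<otimes>\<^bsub>C\<^esub> \<Psi> c)"
        using a(2) a'(2) \<Psi>C[OF b] \<Psi>C[OF c] by (simp add: C.m_ac C.r_distr)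
      then show "\<Theta> (s \<otimes> t) \<otimes>\<^bsub>C\<^esub> (\<Psi> b \<oplus>\<^bsub>C\<^esub> \<Psi> c) = \<Theta> (t \<otimes> a \<oplus> s \<otimes> a')"
        unfolding sb tc using a(1,2) a'(1,2) by simp
    qed (use a a' b c \<Psi> \<Psi>C S_mult in auto)
  qed
  then show ?thesis using \<Psi>\<theta> by blast
qed

end

text \<open>When \<open>S\<close> is the complement of a prime \<open>P\<close> containing \<open>I\<close>, the target is local.\<close>

locale prime_fraction_map = fraction_map A B I "carrier A - P" \<theta> + P: primeideal P A
  for A :: "('a, 'n) ring_scheme" (structure) and B :: "('b, 'm) ring_scheme" (structure) and I P \<theta> +
  assumes I_sub: "I \<subseteq> P"
begin

abbreviation \<mm> :: "'b set" where "\<mm> \<equiv> extend P"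

lemma mm_iff:
  assumes "b \<in> carrier B" "\<theta> s \<otimes>\<^bsub>B\<^esub> b = \<theta> a" "s \<in> carrier A - P" "a \<in> carrier A"
  shows "b \<in> \<mm> \<longleftrightarrow> a \<in> P"
proof
  assume "b \<in> \<mm>"
  then obtain c t where c: "c \<in> P" "t \<in> carrier A - P" "\<theta> t \<otimes>\<^bsub>B\<^esub> b = \<theta> c" unfolding extend_def by blast
  have cA: "c \<in> carrier A" using c P.Icarr by auto
  have "\<theta> (t \<otimes> a) = \<theta> t \<otimes>\<^bsub>B\<^esub> (\<theta> s \<otimes>\<^bsub>B\<^esub> b)" using assms c by (simp add: hom_simps)
  also have "\<dots> = \<theta> s \<otimes>\<^bsub>B\<^esub> (\<theta> t \<otimes>\<^bsub>B\<^esub> b)" using assms(1,3) c(2) by (simp add: B.m_ac)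
  also have "\<dots> = \<theta> (s \<otimes> c)" using assms c cA by (simp add: hom_simps)
  finally have "\<theta> (t \<otimes> a \<ominus> s \<otimes> c) = \<zero>\<^bsub>B\<^esub>" using assms c cA by (simp add: hom_simps B.r_right_minus_eq)
  then obtain u where u: "u \<in> carrier A - P" "u \<otimes> (t \<otimes> a \<ominus> s \<otimes> c) \<in> P"
    using kernel[of "t \<otimes> a \<ominus> s \<otimes> c"] assms c cA I_sub by auto
  have R: "t \<otimes> a \<ominus> s \<otimes> c \<in> carrier A" using assms(3,4) c(2) cA by simp
  then have d: "t \<otimes> a \<ominus> s \<otimes> c \<in> P" using P.I_prime[OF _ R u(2)] u(1) by blast
  have sc: "s \<otimes> c \<in> P" using P.I_l_closed[OF c(1)] assms(3) by blast
  have "(t \<otimes> a \<ominus> s \<otimes> c) \<oplus> s \<otimes> c \<in> P" by (rule additive_subgroup.a_closed[OF P.is_additive_subgroup d sc])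
  moreover have "(t \<otimes> a \<ominus> s \<otimes> c) \<oplus> s \<otimes> c = t \<otimes> a"
    using assms(3,4) c(2) cA by (simp add: a_minus_def A.a_assoc A.l_neg)
  ultimately have "t \<otimes> a \<in> P" by simp
  then show "a \<in> P" using P.I_prime[of t a] assms(4) c(2) by blast
qed (use assms in \<open>auto simp: extend_def\<close>)

lemma unit_of_not_mm: assumes "b \<in> carrier B" "b \<notin> \<mm>" shows "b \<in> Units B"
proof -
  obtain a s where a: "a \<in> carrier A" "s \<in> carrier A - P" "\<theta> s \<otimes>\<^bsub>B\<^esub> b = \<theta> a" using surj[OF assms(1)] by blast
  then have "a \<in> carrier A - P" using mm_iff[of b s a] assms by auto
  then have "b \<otimes>\<^bsub>B\<^esub> \<theta> s \<in> Units B" using units[of a] a assms(1) by (simp add: B.m_comm)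
  then show ?thesis using B.unit_factor[of b "\<theta> s"] assms(1) a by auto
qed

lemma mm_hom_iff: "a \<in> carrier A \<Longrightarrow> \<theta> a \<in> \<mm> \<longleftrightarrow> a \<in> P"
  using mm_iff[of "\<theta> a" "\<one>" a] S_one by (simp add: hom_simps)

lemma mm_ideal: "ideal \<mm> B" by (rule extend_ideal[OF P.is_ideal])

lemma one_not_mm: "\<one>\<^bsub>B\<^esub> \<notin> \<mm>"
  using mm_hom_iff[of "\<one>"] S_one by (simp add: hom_simps)

lemma ideal_sub_mm: assumes "ideal Q B" "\<one>\<^bsub>B\<^esub> \<notin> Q" shows "Q \<subseteq> \<mm>"
proof
  interpret Q: ideal Q B by fact
  fix b assume b: "b \<in> Q"
  show "b \<in> \<mm>"
  proof (rule ccontr)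
    assume "b \<notin> \<mm>"
    then have u: "b \<in> Units B" using unit_of_not_mm[OF Q.Icarr[OF b]] by blast
    then have "inv\<^bsub>B\<^esub> b \<otimes>\<^bsub>B\<^esub> b \<in> Q" using b by (intro Q.I_l_closed) auto
    then show False using u assms by simp
  qed
qed

lemma prime_sub_mm: assumes "primeideal Q B" shows "Q \<subseteq> \<mm>"
proof -
  interpret Q: primeideal Q B by fact
  show ?thesis using ideal_sub_mm[OF Q.is_ideal] Q.I_notcarr Q.one_imp_carrier by blast
qed

lemma mm_prime: "primeideal \<mm> B"
proof (rule primeidealI[OF mm_ideal B.is_cring])
  show "carrier B \<noteq> \<mm>" using one_not_mm by auto
  fix b c assume bc: "b \<in> carrier B" "c \<in> carrier B" "b \<otimes>\<^bsub>B\<^esub> c \<in> \<mm>"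
  show "b \<in> \<mm> \<or> c \<in> \<mm>"
  proof (rule ccontr)
    assume "\<not> ?thesis"
    then have "b \<otimes>\<^bsub>B\<^esub> c \<in> Units B" using unit_of_not_mm bc by auto
    then have "inv\<^bsub>B\<^esub> (b \<otimes>\<^bsub>B\<^esub> c) \<otimes>\<^bsub>B\<^esub> (b \<otimes>\<^bsub>B\<^esub> c) \<in> \<mm>" using ideal.I_l_closed[OF mm_ideal bc(3)] by blast
    then show False using \<open>b \<otimes>\<^bsub>B\<^esub> c \<in> Units B\<close> one_not_mm by simp
  qed
qed

lemma mm_maximal: "maximalideal \<mm> B"
proof (rule maximalidealI[OF mm_ideal])
  show "carrier B \<noteq> \<mm>" using one_not_mm by auto
  fix J assume J: "ideal J B" "\<mm> \<subseteq> J" "J \<subseteq> carrier B"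
  show "J = \<mm> \<or> J = carrier B" using ideal_sub_mm[OF J(1)] ideal.one_imp_carrier[OF J(1)] J by blast
qed

end

section \<open>The localization map\<close>

lemma (in multiplicative_set) localization_fraction_map:
  "fraction_map A L {\<zero>} S (\<lambda>a. fraction A S a \<one>)"
proof (intro fraction_map.intro fraction_map_axioms.intro is_cring localization_cring)
  show "(\<lambda>a. fraction A S a \<one>) \<in> Ring.ring_hom A L"
    by (rule ring_hom_memI) (use S_one in \<open>simp_all add: L_mult L_add L_zero_one\<close>)
  show "fraction A S s \<one> \<in> Units L" if "s \<in> S" for s
  proof -
    have "fraction A S s \<one> \<otimes>\<^bsub>L\<^esub> fraction A S \<one> s = \<one>\<^bsub>L\<^esub>" "fraction A S \<one> s \<otimes>\<^bsub>L\<^esub> fraction A S s \<one> = \<one>\<^bsub>L\<^esub>"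
      using that S_one unfolding L_zero_one by (simp_all add: L_mult) (rule fraction_eqI; simp)+
    then show ?thesis using that S_one unfolding Units_def by auto
  qed
  show "\<exists>a\<in>carrier A. \<exists>s\<in>S. fraction A S s \<one> \<otimes>\<^bsub>L\<^esub> b = fraction A S a \<one>" if b: "b \<in> carrier L" for b
  proof -
    obtain a s where a: "a \<in> carrier A" "s \<in> S" "b = fraction A S a s" using b unfolding L_carrier by blast
    have "fraction A S s \<one> \<otimes>\<^bsub>L\<^esub> b = fraction A S a \<one>"
      unfolding a(3) using a(1,2) S_one by (simp add: L_mult) (rule fraction_eqI; simp add: m_comm)
    then show ?thesis using a by blast
  qed
  show "fraction A S a \<one> = \<zero>\<^bsub>L\<^esub> \<longleftrightarrow> (\<exists>s\<in>S. s \<otimes> a \<in> {\<zero>})" if "a \<in> carrier A" for a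
    unfolding L_zero_one using that S_one by (subst fraction_eq_iff) auto
qed (use S_sub S_mult S_one in auto)

lemma multiplicative_set_compl:
  assumes "primeideal P A" shows "multiplicative_set A (carrier A - P)"
proof -
  interpret P: primeideal P A by fact
  show ?thesis by (intro multiplicative_set.intro multiplicative_set_axioms.intro P.is_cring)
      (use P.I_prime P.I_notcarr P.one_imp_carrier in \<open>auto simp: cring.cring_simprules[OF P.is_cring]\<close>)
qed

lemma localization_prime_fraction_map:
  assumes "primeideal P A"
  shows "prime_fraction_map A (localization A (carrier A - P)) {\<zero>\<^bsub>A\<^esub>} P (\<lambda>a. fraction A (carrier A - P) a \<one>\<^bsub>A\<^esub>)"
proof -
  interpret P: primeideal P A by fact
  interpret multiplicative_set A "carrier A - P" by (rule multiplicative_set_compl[OF assms])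
  show ?thesis
    by (intro prime_fraction_map.intro localization_fraction_map assms prime_fraction_map_axioms.intro)
      (use additive_subgroup.zero_closed[OF P.is_additive_subgroup] in auto)
qed

section \<open>Regular coefficient rings\<close>

text \<open>A longest chain of primes of the localization contracts to a chain below \<open>Q\<close>, and generators of
  its maximal ideal become elements of \<open>Q\<close> after multiplication by units.\<close>

lemma (in noetherian_subring) regular_at_of_regular_localization:
  assumes Q: "prm Q" and reg: "regular_local_ring (localization ring_of (R - Q))"
  shows "regular_at Q"
proof -
  have Qp: "primeideal Q ring_of" using Q by (simp add: prm_iff_primeideal)
  let ?\<theta> = "\<lambda>a. fraction ring_of (R - Q) a 1"
  let ?B = "localization ring_of (R - Q)"
  interpret F: prime_fraction_map ring_of ?B "{0}" Q ?\<theta> using localization_prime_fraction_map[OF Qp] by simp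
  obtain m X where m: "\<And>J. maximalideal J ?B \<longleftrightarrow> J = m" and X: "finite X" "X \<subseteq> carrier ?B" "m = Idl\<^bsub>?B\<^esub> X"
    "enat (card X) = krull_dim ?B" using reg unfolding regular_local_ring_def by blast
  have mm: "m = F.\<mm>" using m F.mm_maximal by blast
  define d where "d = card X"
  have ht: "height ?B P \<le> enat d" if "primeideal P ?B" for P
    unfolding d_def X(4) krull_dim_def using that by (intro SUP_upper) auto
  have ht_chain: "l \<le> d" if "\<And>i. i \<le> l \<Longrightarrow> primeideal (c i) ?B" "\<And>i. i < l \<Longrightarrow> c i \<subset> c (Suc i)" for c l
  proof -
    have "enat l \<le> height ?B (c l)" unfolding height_def using that by (intro Sup_upper) auto
    also have "\<dots> \<le> enat d" using ht that by auto
    finally show ?thesis by simp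
  qed
  have "\<exists>c. (\<forall>i\<le>d. primeideal (c i) ?B) \<and> (\<forall>i<d. c i \<subset> c (Suc i)) \<and> c d = F.\<mm>"
  proof (cases d)
    case 0
    then show ?thesis using F.mm_prime by (intro exI[of _ "\<lambda>_. F.\<mm>"]) auto
  next
    case (Suc e)
    have "enat e < krull_dim ?B" unfolding X(4)[symmetric] using Suc d_def by simp
    then obtain P where P: "primeideal P ?B" "enat e < height ?B P"
      unfolding krull_dim_def less_SUP_iff by blast
    then obtain l c where c: "e < l" "\<forall>i\<le>l. primeideal (c i) ?B" "\<forall>i<l. c i \<subset> c (Suc i)" "c l = P"
      unfolding height_def less_Sup_iff by auto
    have ld: "l = d" using ht_chain[of l c] c Suc by auto
    have "P = F.\<mm>"
    proof (rule ccontr)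
      assume "P \<noteq> F.\<mm>"
      then have "P \<subset> F.\<mm>" using F.prime_sub_mm[OF P(1)] by blast
      define c' where "c' = c(Suc l := F.\<mm>)"
      have "primeideal (c' i) ?B" if "i \<le> Suc l" for i using that c F.mm_prime by (auto simp: c'_def le_Suc_eq)
      moreover have "c' i \<subset> c' (Suc i)" if "i < Suc l" for i
        using that c \<open>P \<subset> F.\<mm>\<close> by (auto simp: c'_def less_Suc_eq)
      ultimately have "Suc l \<le> d" by (rule ht_chain)
      then show False using ld by simp
    qed
    then show ?thesis using c ld by auto
  qed
  then obtain c where c: "\<And>i. i \<le> d \<Longrightarrow> primeideal (c i) ?B" "\<And>i. i < d \<Longrightarrow> c i \<subset> c (Suc i)" "c d = F.\<mm>" by auto
  define c' where "c' i = F.contract (c i)" for i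
  have "prime_chain c' d" unfolding prime_chain_def
  proof (intro conjI allI impI)
    fix i assume "i \<le> d"
    then show "prm (c' i)" unfolding c'_def prm_iff_primeideal using F.contract_prime(1)[OF c(1)] by simp
  next
    fix i assume i: "i < d"
    then have id: "ideal (c i) ?B" "ideal (c (Suc i)) ?B" using primeideal.axioms(1)[OF c(1)] by auto
    have "c' i \<subseteq> c' (Suc i)" using c(2)[OF i] unfolding c'_def F.contract_def by blast
    moreover have "\<not> c' (Suc i) \<subseteq> c' i" using F.contract_inj[OF id(2,1)] c(2)[OF i] unfolding c'_def by blast
    ultimately show "c' i \<subset> c' (Suc i)" by blast
  qed
  moreover have "c' d = Q" unfolding c'_def c(3) F.contract_def using F.mm_hom_iff prmD(3)[OF Q] by auto
  moreover have "\<exists>a s. a \<in> Q \<and> s \<in> R - Q \<and> ?\<theta> s \<otimes>\<^bsub>?B\<^esub> x = ?\<theta> a" if "x \<in> X" for x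
  proof -
    have "x \<in> F.\<mm>" using F.B.genideal_self[OF X(2)] that X(3) mm by blast
    then have "\<exists>a\<in>Q. \<exists>s\<in>carrier ring_of - Q. ?\<theta> s \<otimes>\<^bsub>?B\<^esub> x = ?\<theta> a" unfolding F.extend_def by blast
    then show ?thesis by auto
  qed
  then have "\<forall>x. \<exists>a. x \<in> X \<longrightarrow> a \<in> Q \<and> (\<exists>s. s \<in> R - Q \<and> ?\<theta> s \<otimes>\<^bsub>?B\<^esub> x = ?\<theta> a)" by blast
  from choice[OF this] obtain a where a: "\<And>x. x \<in> X \<Longrightarrow> a x \<in> Q"
    "\<And>x. x \<in> X \<Longrightarrow> \<exists>s. s \<in> R - Q \<and> ?\<theta> s \<otimes>\<^bsub>?B\<^esub> x = ?\<theta> (a x)" by blast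
  have aR: "a ` X \<subseteq> R" using a(1) prmD(3)[OF Q] by blast
  have ideal_gen: "ideal (gen (a ` X)) ring_of" using gen_idl[OF aR] by (simp add: idl_iff_ideal)
  have sub: "Idl\<^bsub>?B\<^esub> X \<subseteq> F.extend (gen (a ` X))"
  proof (rule F.B.genideal_minimal[OF F.extend_ideal[OF ideal_gen]])
    show "X \<subseteq> F.extend (gen (a ` X))"
    proof
      fix x assume x: "x \<in> X"
      have "a x \<in> gen (a ` X)" using gen_upper[of "a ` X"] x by blast
      moreover obtain s where "s \<in> R - Q" "?\<theta> s \<otimes>\<^bsub>?B\<^esub> x = ?\<theta> (a x)" using a(2)[OF x] by blast
      moreover have "x \<in> carrier ?B" using X(2) x by blast
      ultimately show "x \<in> F.extend (gen (a ` X))" unfolding F.extend_def by auto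
    qed
  qed
  have "locally_generates Q (a ` X)" unfolding locally_generates_def
  proof
    fix y assume y: "y \<in> Q"
    then have yR: "y \<in> R" using prmD(3)[OF Q] by blast
    then have "?\<theta> y \<in> F.\<mm>" using F.mm_hom_iff y by simp
    then have "?\<theta> y \<in> F.extend (gen (a ` X))" using sub mm X(3) by blast
    then obtain b s where b: "b \<in> gen (a ` X)" "s \<in> R - Q" "?\<theta> s \<otimes>\<^bsub>?B\<^esub> ?\<theta> y = ?\<theta> b"
      unfolding F.extend_def by auto
    have bR: "b \<in> R" using b(1) idlD(3)[OF gen_idl[OF aR]] by blast
    have "?\<theta> (s * y) = ?\<theta> b" using F.hom_simps(1)[of s y] b(2,3) yR by simp
    then have "\<exists>u\<in>R - Q. u * (1 * (s * y)) = u * (1 * b)"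
      using multiplicative_set.fraction_eq_iff[OF multiplicative_set_compl[OF Qp], of "s * y" b 1 1] b(2) yR bR
        prm_one_compl[OF Q] by simp
    then obtain u where u: "u \<in> R - Q" "u * (s * y) = u * b" by auto
    then have "(u * s) * y \<in> gen (a ` X)" using b(1) idlD(5)[OF gen_idl[OF aR]] by (simp add: mult.assoc)
    then show "\<exists>s\<in>R - Q. s * y \<in> gen (a ` X)" using prm_mult_compl[OF Q u(1) b(2)] by blast
  qed
  moreover have "card (a ` X) \<le> d" unfolding d_def using X(1) by (rule card_image_le)
  ultimately show ?thesis unfolding regular_at_def using X(1) a(1)
    by (intro exI[of _ c'] exI[of _ d] exI[of _ "a ` X"]) auto
qed

section \<open>The conormal condition\<close>

context subring_set begin

lemma gen_union_imageE:
  assumes "y \<in> gen (f ` {..<r::nat} \<union> J)" "f ` {..<r} \<union> J \<subseteq> R"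
  shows "\<exists>a j. (\<forall>i<r. a i \<in> R) \<and> j \<in> gen J \<and> y = j + (\<Sum>i<r. a i * f i)"
  using assms
proof (induction r arbitrary: y)
  case (Suc r)
  then have "y \<in> gen (insert (f r) (f ` {..<r} \<union> J))" by (simp add: lessThan_Suc)
  then obtain i b where i: "i \<in> gen (f ` {..<r} \<union> J)" "b \<in> R" "y = i + b * f r"
    using Suc.prems by (elim gen_insertE) (auto simp: lessThan_Suc)
  then obtain a j where a: "\<forall>k<r. a k \<in> R" "j \<in> gen J" "i = j + (\<Sum>k<r. a k * f k)"
    using Suc.IH[of i] Suc.prems by (auto simp: lessThan_Suc)
  then show ?case using i by (intro exI[of _ "a(r := b)"] exI[of _ j]) (auto simp: less_Suc_eq add.assoc)
qed auto

lemma prod_cong_mod: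
  assumes I: "idl I" and "\<And>i. i \<in> A \<Longrightarrow> x i \<in> R" "\<And>i. i \<in> A \<Longrightarrow> y i \<in> R" "\<And>i. i \<in> A \<Longrightarrow> x i - y i \<in> I"
  shows "(\<Prod>i\<in>A. x i) - (\<Prod>i\<in>A. y i) \<in> I"
  using assms(2-)
proof (induction A rule: infinite_finite_induct)
  case (insert i A)
  have "x i * prod x A - y i * prod y A = (x i - y i) * prod x A + y i * (prod x A - prod y A)"
    by (simp add: algebra_simps)
  also have "\<dots> \<in> I" using insert by (intro idlD(4)[OF I] idlD(5)[OF I] idlD(6)[OF I]) auto
  finally show ?case using insert.hyps by simp
qed (use idlD(2)[OF I] in auto)

lemma det_cong_mod:
  assumes I: "idl I" and M: "\<And>i j. i < r \<Longrightarrow> j < r \<Longrightarrow> M i j \<in> R" and N: "\<And>i j. i < r \<Longrightarrow> j < r \<Longrightarrow> N i j \<in> R"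
    and MN: "\<And>i j. i < r \<Longrightarrow> j < r \<Longrightarrow> M i j - N i j \<in> I"
  shows "det (mat r r (\<lambda>(i, j). M i j)) - det (mat r r (\<lambda>(i, j). N i j)) \<in> I"
proof -
  have sg: "signof p \<in> R" for p :: "nat \<Rightarrow> nat" by (simp add: sign_def)
  have det: "det (mat r r (\<lambda>(i, j). M i j)) = (\<Sum>p\<in>{p. p permutes {0..<r}}. signof p * (\<Prod>i = 0..<r. M i (p i)))" for M
  proof -
    have "det (mat r r (\<lambda>(i, j). M i j)) = (\<Sum>p\<in>{p. p permutes {0..<r}}. signof p * (\<Prod>i = 0..<r. mat r r (\<lambda>(i, j). M i j) $$ (i, p i)))"
      by (rule det_def') simp
    also have "\<dots> = (\<Sum>p\<in>{p. p permutes {0..<r}}. signof p * (\<Prod>i = 0..<r. M i (p i)))"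
    proof (intro sum.cong prod.cong arg_cong2[where f = "(*)"] refl)
      fix p i assume "p \<in> {p. p permutes {0..<r}}" "i \<in> {0..<r}"
      then have "p i < r" "i < r" using permutes_in_image by fastforce+
      then show "mat r r (\<lambda>(i, j). M i j) $$ (i, p i) = M i (p i)" by simp
    qed
    finally show ?thesis .
  qed
  have "det (mat r r (\<lambda>(i, j). M i j)) - det (mat r r (\<lambda>(i, j). N i j))
    = (\<Sum>p\<in>{p. p permutes {0..<r}}. signof p * ((\<Prod>i = 0..<r. M i (p i)) - (\<Prod>i = 0..<r. N i (p i))))"
    unfolding det by (simp add: sum_subtractf right_diff_distrib)
  also have "\<dots> \<in> I"
  proof (intro idl_sum[OF I] idlD(5)[OF I] sg prod_cong_mod[OF I])
    fix p i assume "p \<in> {p. p permutes {0..<r}}" "i \<in> {0..<r}"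
    then have "p i < r" "i < r" using permutes_in_image by fastforce+
    then show "M i (p i) \<in> R" "N i (p i) \<in> R" "M i (p i) - N i (p i) \<in> I" using M N MN by auto
  qed
  finally show ?thesis .
qed

end

lemma pderiv_zero [simp]: "mpoly_pderiv j 0 = 0"
  by (simp add: mpoly_pderiv_def)

lemma pderiv_sum: "mpoly_pderiv j (\<Sum>i\<in>A. f i) = (\<Sum>i\<in>A. mpoly_pderiv j (f i :: 'k::comm_ring_1 mpoly))"
proof -
  show ?thesis by (induction A rule: infinite_finite_induct) (simp_all add: pderiv_add)
qed

text \<open>Write \<open>g = a f\<close> with a square matrix \<open>a\<close>. Differentiating, \<open>\<Delta>\<close> is \<open>det a\<close> times a minor of \<open>f\<close>
  modulo \<open>I\<close>; and \<open>det a\<close> times \<open>I\<close> lies in \<open>(g)\<close>, by the adjugate of \<open>a\<close>.\<close>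

lemma conormal_complete_intersection:
  fixes f g :: "nat \<Rightarrow> 'k::comm_ring_1 mpoly"
  assumes f: "\<And>i. i < r \<Longrightarrow> f i \<in> mpolys n" and I: "I = mpolys.gen n (f ` {..<r})"
    and g: "\<And>i. i < r \<Longrightarrow> g i \<in> I" and h: "h \<in> I"
    and \<Delta>: "\<Delta> = det (mat r r (\<lambda>(i, l). mpoly_pderiv (c l) (g i)))"
  shows "\<Delta> * h \<in> mpolys.gen n (g ` {..<r} \<union> {a * b |a b. a \<in> I \<and> b \<in> I})"
proof -
  have fR: "f ` {..<r} \<subseteq> mpolys n" using f by auto
  have Ii: "mpolys.idl n I" unfolding I by (rule mpolys.gen_idl[OF fR])
  note d = mpolys.idlD[OF Ii]
  have fI: "f i \<in> I" if "i < r" for i using that mpolys.gen_upper[of "f ` {..<r}" n] I by auto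
  have "\<forall>i. \<exists>a. i < r \<longrightarrow> (\<forall>j<r. a j \<in> mpolys n) \<and> g i = (\<Sum>j<r. a j * f j)"
    using mpolys.gen_imageE[OF _ fR] g I by blast
  from choice[OF this] obtain a where aR: "\<And>i j. i < r \<Longrightarrow> j < r \<Longrightarrow> a i j \<in> mpolys n"
    and ga: "\<And>i. i < r \<Longrightarrow> g i = (\<Sum>j<r. a i j * f j)" by blast
  let ?A = "mat r r (\<lambda>(i, j). a i j)"
  let ?F = "mat r r (\<lambda>(j, l). mpoly_pderiv (c l) (f j))"
  let ?af = "\<lambda>i l. \<Sum>j<r. a i j * mpoly_pderiv (c l) (f j)"
  have AR: "det ?A \<in> mpolys n" by (rule mpolys.det_mem[OF aR])
  have FR: "det ?F \<in> mpolys n" by (rule mpolys.det_mem) (use f pderiv_mem in auto)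
  have "?A * ?F = mat r r (\<lambda>(i, l). ?af i l)"
    by (rule eq_matI) (auto simp: scalar_prod_def atLeast0LessThan intro!: sum.cong)
  then have detAF: "det (mat r r (\<lambda>(i, l). ?af i l)) = det ?A * det ?F" using det_mult[of ?A r ?F] by simp
  have diff: "\<Delta> - det ?A * det ?F \<in> I" unfolding \<Delta> detAF[symmetric]
  proof (rule mpolys.det_cong_mod[OF Ii])
    fix i l assume il: "i < r" "l < r"
    show "mpoly_pderiv (c l) (g i) \<in> mpolys n" using g[OF il(1)] d(3) pderiv_mem by blast
    show "?af i l \<in> mpolys n" using aR f il by (intro mpolys.sum_mem mpolys.mult_mem pderiv_mem) auto
    have "mpoly_pderiv (c l) (g i) - ?af i l = (\<Sum>j<r. f j * mpoly_pderiv (c l) (a i j))"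
      unfolding ga[OF il(1)] pderiv_sum pderiv_mult by (simp add: sum.distrib)
    also have "\<dots> \<in> I" using aR fI il by (intro mpolys.idl_sum[OF Ii] d(6) pderiv_mem) auto
    finally show "mpoly_pderiv (c l) (g i) - ?af i l \<in> I" .
  qed
  have gR: "g ` {..<r} \<union> {a * b |a b. a \<in> I \<and> b \<in> I} \<subseteq> mpolys n" (is "?G \<subseteq> _") using g d(3) by blast
  note dG = mpolys.idlD[OF mpolys.gen_idl[OF gR]]
  obtain b where bR: "\<And>l i. b l i \<in> mpolys n" and
    badj: "\<And>j k. j < r \<Longrightarrow> k < r \<Longrightarrow> (\<Sum>i<r. b j i * a i k) = (if j = k then det ?A else 0)"
    using mpolys.exists_adjugate[of r a n] aR by blast
  have detf: "det ?A * f j \<in> mpolys.gen n ?G" if j: "j < r" for j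
  proof -
    have "(\<Sum>i<r. b j i * g i) = (\<Sum>i<r. \<Sum>k<r. b j i * a i k * f k)"
      using ga by (intro sum.cong) (auto simp: sum_distrib_left mult.assoc)
    also have "\<dots> = (\<Sum>k<r. (\<Sum>i<r. b j i * a i k) * f k)" by (subst sum.swap) (simp add: sum_distrib_right)
    also have "\<dots> = (\<Sum>k<r. if j = k then det ?A * f k else 0)" using badj j by (intro sum.cong) auto
    also have "\<dots> = det ?A * f j" using j by simp
    finally have "det ?A * f j = (\<Sum>i<r. b j i * g i)" by simp
    also have "\<dots> \<in> mpolys.gen n ?G"
      using bR mpolys.gen_upper[of ?G n] by (intro mpolys.idl_sum[OF mpolys.gen_idl[OF gR]] dG(5)) auto
    finally show ?thesis .
  qed
  obtain e where e: "\<forall>j<r. e j \<in> mpolys n" "h = (\<Sum>j<r. e j * f j)" using mpolys.gen_imageE[OF _ fR] h I by blast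
  have "det ?A * h = (\<Sum>j<r. e j * (det ?A * f j))" unfolding e(2) by (simp add: sum_distrib_left mult_ac)
  also have "\<dots> \<in> mpolys.gen n ?G" using e(1) by (intro mpolys.idl_sum[OF mpolys.gen_idl[OF gR]] dG(5)[OF _ detf]) auto
  finally have "det ?A * h \<in> mpolys.gen n ?G" .
  then have "det ?F * (det ?A * h) \<in> mpolys.gen n ?G" by (rule dG(5)[OF FR])
  moreover have "(\<Delta> - det ?A * det ?F) * h \<in> mpolys.gen n ?G" using diff h mpolys.gen_upper[of ?G n] by blast
  ultimately have "det ?F * (det ?A * h) + (\<Delta> - det ?A * det ?F) * h \<in> mpolys.gen n ?G" by (intro dG(4))
  then show ?thesis by (simp add: algebra_simps)
qed

text \<open>A relation between the \<open>g\<^sub>i\<close> modulo \<open>Q\<^sup>2\<close> with a coefficient \<open>s \<notin> Q\<close> may be differentiated: it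
  becomes a relation between the rows of the Jacobian matrix modulo \<open>Q\<close>. Multiplying by the
  adjugate gives \<open>s \<Delta> \<in> Q\<close>. So the \<open>g\<^sub>i\<close> are independent modulo \<open>Q\<^sup>2\<close>, and
  \<open>regular_parameters_generate_prime\<close> applies.\<close>

lemma minor_outside_prime_local_generators:
  fixes g :: "nat \<Rightarrow> 'k::comm_ring_1 mpoly"
  assumes noeth: "noetherian_subring (mpolys n :: 'k mpoly set)"
    and reg: "noetherian_subring.regular_at (mpolys n) Q" and Q: "mpolys.prm n Q"
    and gQ: "\<And>i. i < r \<Longrightarrow> g i \<in> Q" and \<Delta>: "det (mat r r (\<lambda>(i, l). mpoly_pderiv (c l) (g i))) \<notin> Q"
  shows "\<exists>p. noetherian_subring.prime_chain (mpolys n) p r \<and> p r \<subseteq> Q \<and> g ` {..<r} \<subseteq> p r \<and>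
    p r \<subseteq> noetherian_subring.local_gen (mpolys n) Q (g ` {..<r})"
proof -
  let ?D = "det (mat r r (\<lambda>(i, l). mpoly_pderiv (c l) (g i)))"
  interpret N: noetherian_subring "mpolys n :: 'k mpoly set" by fact
  note dQ = mpolys.idlD[OF mpolys.prmD(1)[OF Q]]
  let ?QQ = "{a * b |a b. a \<in> Q \<and> b \<in> Q}"
  have gR: "g i \<in> mpolys n" if "i < r" for i using gQ[OF that] dQ(3) by blast
  have M: "mpoly_pderiv (c l) (g i) \<in> mpolys n" if "i < r" "l < r" for i l using pderiv_mem gR that by blast
  obtain b where bR: "\<And>l i. b l i \<in> mpolys n" and
    badj: "\<And>i i'. i < r \<Longrightarrow> i' < r \<Longrightarrow> (\<Sum>l<r. mpoly_pderiv (c l) (g i) * b l i')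
      = (if i = i' then ?D else 0)"
    using mpolys.exists_adjugate[of r "\<lambda>i l. mpoly_pderiv (c l) (g i)" n] M by blast
  show ?thesis
  proof (rule N.regular_parameters_generate_prime[OF reg gQ])
    fix i s assume i: "i < r" and s: "s \<in> mpolys n - Q"
    show "s * g i \<notin> mpolys.gen n (g ` {..<i} \<union> ?QQ)"
    proof
      assume mem: "s * g i \<in> mpolys.gen n (g ` {..<i} \<union> ?QQ)"
      have QQR: "?QQ \<subseteq> mpolys n" using dQ(3) by blast
      have "g ` {..<i} \<union> ?QQ \<subseteq> mpolys n" using QQR gR i by auto
      then obtain a j where a: "\<forall>k<i. a k \<in> mpolys n" "j \<in> mpolys.gen n ?QQ" "s * g i = j + (\<Sum>k<i. a k * g k)"
        using mpolys.gen_union_imageE[OF mem] by blast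
      have dj: "mpoly_pderiv l j \<in> Q" for l
      proof -
        let ?J = "{y \<in> Q. mpoly_pderiv l y \<in> Q}"
        have "mpolys.idl n ?J" unfolding mpolys.idl_def
        proof (intro conjI ballI)
          show "0 \<in> ?J" using dQ(2) by simp
          show "r * y \<in> ?J" if "r \<in> mpolys n" "y \<in> ?J" for r y
            using that dQ(5) dQ(4)[OF dQ(5)[of r "mpoly_pderiv l y"] dQ(6)[of "mpoly_pderiv l r" y]]
            by (simp add: pderiv_mult pderiv_mem)
        qed (use dQ in \<open>auto simp: pderiv_add\<close>)
        moreover have "?QQ \<subseteq> ?J"
        proof
          fix y assume "y \<in> ?QQ"
          then obtain u v where y: "y = u * v" "u \<in> Q" "v \<in> Q" by blast
          have "u * mpoly_pderiv l v + v * mpoly_pderiv l u \<in> Q"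
            using y dQ(3) pderiv_mem by (intro dQ(4) dQ(6)) auto
          then show "y \<in> ?J" using y dQ(3,5) by (simp add: pderiv_mult)
        qed
        ultimately show ?thesis using mpolys.gen_least a(2) by blast
      qed
      define v where "v k = (if k = i then s else if k < i then - a k else 0)" for k
      have vR: "v k \<in> mpolys n" for k using a(1) s by (auto simp: v_def)
      have row: "(\<Sum>k<r. v k * mpoly_pderiv (c l) (g k)) \<in> Q" for l
      proof -
        have "(\<Sum>k<r. v k * mpoly_pderiv (c l) (g k)) = (\<Sum>k\<le>i. v k * mpoly_pderiv (c l) (g k))"
          using i by (intro sum.mono_neutral_right) (auto simp: v_def)
        also have "\<dots> = s * mpoly_pderiv (c l) (g i) + (\<Sum>k<i. - (a k * mpoly_pderiv (c l) (g k)))"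
          unfolding lessThan_Suc_atMost[symmetric] sum.lessThan_Suc by (simp add: v_def)
        also have "\<dots> = s * mpoly_pderiv (c l) (g i) - (\<Sum>k<i. a k * mpoly_pderiv (c l) (g k))"
          by (simp add: sum_negf)
        also have "\<dots> = mpoly_pderiv (c l) j + (\<Sum>k<i. g k * mpoly_pderiv (c l) (a k)) - g i * mpoly_pderiv (c l) s"
          using arg_cong[OF a(3), of "mpoly_pderiv (c l)"]
          by (simp add: pderiv_add pderiv_sum pderiv_mult sum.distrib algebra_simps)
        also have "\<dots> \<in> Q" using a(1) s i gQ dj
          by (intro dQ(8) dQ(4) dQ(6) mpolys.idl_sum[OF mpolys.prmD(1)[OF Q]] pderiv_mem) auto
        finally show ?thesis .
      qed
      have "(\<Sum>l<r. (\<Sum>k<r. v k * mpoly_pderiv (c l) (g k)) * b l i)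
        = (\<Sum>k<r. v k * (\<Sum>l<r. mpoly_pderiv (c l) (g k) * b l i))"
        unfolding sum_distrib_left sum_distrib_right by (subst sum.swap) (simp add: mult.assoc)
      also have "\<dots> = (\<Sum>k<r. if k = i then v k * ?D else 0)" using badj i by (intro sum.cong) auto
      also have "\<dots> = s * ?D" using i by (simp add: v_def)
      finally have "s * ?D = (\<Sum>l<r. (\<Sum>k<r. v k * mpoly_pderiv (c l) (g k)) * b l i)" ..
      also have "\<dots> \<in> Q" by (rule mpolys.idl_sum[OF mpolys.prmD(1)[OF Q]]) (rule dQ(6)[OF bR row])
      finally have "s * ?D \<in> Q" .
      moreover have "?D \<in> mpolys n" by (rule mpolys.det_mem[OF M])
      ultimately show False using mpolys.prmD(4)[OF Q] s \<Delta> by blast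
    qed
  qed
qed

text \<open>At a prime \<open>Q \<supseteq> I\<close> without \<open>\<Delta>\<close> the \<open>g\<^sub>i\<close> generate a prime that ends a chain of length \<open>r\<close> and
  lies below a minimal prime of \<open>I\<close>; by the bound on heights the two agree, so \<open>(g)\<close> and \<open>I\<close> agree
  at \<open>Q\<close>. Therefore no prime that contains both \<open>I\<close> and the ideal \<open>(g) : I\<close> avoids \<open>\<Delta>\<close>, and a
  power of \<open>\<Delta>\<close> lies in \<open>((g) : I) + I\<close>.\<close>

lemma conormal_regular:
  fixes g :: "nat \<Rightarrow> 'k::comm_ring_1 mpoly"
  assumes noeth: "noetherian_subring (mpolys n :: 'k mpoly set)"
    and reg: "\<And>Q :: 'k mpoly set. mpolys.prm n Q \<Longrightarrow> noetherian_subring.regular_at (mpolys n) Q"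
    and I: "mpolys.idl n I" and ht: "\<And>P. P \<in> min_primes (mpoly_ring n) I \<Longrightarrow> height (mpoly_ring n) P \<le> enat r"
    and g: "\<And>i. i < r \<Longrightarrow> g i \<in> I"
    and \<Delta>: "\<Delta> = det (mat r r (\<lambda>(i, l). mpoly_pderiv (c l) (g i)))"
  shows "\<exists>N. \<forall>h\<in>I. \<Delta> ^ N * h \<in> mpolys.gen n (g ` {..<r} \<union> {a * b |a b. a \<in> I \<and> b \<in> I})"
proof -
  interpret N: noetherian_subring "mpolys n :: 'k mpoly set" by fact
  have R_eq: "mpoly_ring n = (mpolys.ring_of n :: 'k mpoly ring)" by (rule mpoly_ring_eq)
  interpret NC: noetherian_cring "mpolys.ring_of n :: 'k mpoly ring" by (rule N.noetherian_cring_ring_of)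
  note d = mpolys.idlD[OF I]
  have gR: "g ` {..<r} \<subseteq> mpolys n" using g d(3) by auto
  have \<Delta>R: "\<Delta> \<in> mpolys n" unfolding \<Delta> by (rule mpolys.det_mem) (use g d(3) pderiv_mem in blast)
  note dg = mpolys.idlD[OF mpolys.gen_idl[OF gR]]
  have local: "\<exists>s\<in>mpolys n - Q. s * h \<in> mpolys.gen n (g ` {..<r})"
    if Q: "mpolys.prm n Q" "I \<subseteq> Q" "\<Delta> \<notin> Q" and h: "h \<in> I" for Q h
  proof -
    obtain p where p: "N.prime_chain p r" "p r \<subseteq> Q" "g ` {..<r} \<subseteq> p r" "p r \<subseteq> N.local_gen Q (g ` {..<r})"
    proof -
      have "g i \<in> Q" if "i < r" for i using g[OF that] Q(2) by blast
      from minor_outside_prime_local_generators[OF noeth reg[OF Q(1)] Q(1) this Q(3)[unfolded \<Delta>]]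
      show thesis using that by blast
    qed
    obtain P where P: "P \<in> min_primes (mpolys.ring_of n) I" "P \<subseteq> Q"
      using NC.minimal_prime_below[of I Q] I Q by (auto simp: mpolys.idl_iff_ideal mpolys.prm_iff_primeideal)
    have Pp: "mpolys.prm n P" and IP: "I \<subseteq> P" using P(1) by (auto simp: min_primes_def mpolys.prm_iff_primeideal)
    have "p r \<subseteq> P"
    proof
      fix y assume "y \<in> p r"
      then obtain s where s: "y \<in> mpolys n" "s \<in> mpolys n - Q" "s * y \<in> mpolys.gen n (g ` {..<r})"
        using p(4) unfolding N.local_gen_def by blast
      have "mpolys.gen n (g ` {..<r}) \<subseteq> P"
        by (rule mpolys.gen_least[OF mpolys.prmD(1)[OF Pp]]) (use g IP in auto)
      then show "y \<in> P" using mpolys.prmD(4)[OF Pp, of s y] s P(2) by blast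
    qed
    have "p r = P"
    proof (rule ccontr)
      assume "p r \<noteq> P"
      define p' where "p' = p(Suc r := P)"
      have "primeideal (p' i) (mpolys.ring_of n)" if "i \<le> Suc r" for i
        using that p(1) Pp by (auto simp: p'_def le_Suc_eq N.prime_chain_def mpolys.prm_iff_primeideal)
      moreover have "p' i \<subset> p' (Suc i)" if "i < Suc r" for i
        using that p(1) \<open>p r \<noteq> P\<close> \<open>p r \<subseteq> P\<close> by (auto simp: p'_def less_Suc_eq N.prime_chain_def)
      moreover have "p' (Suc r) = P" by (simp add: p'_def)
      ultimately have "enat (Suc r) \<le> height (mpolys.ring_of n) P"
        unfolding height_def by (intro Sup_upper CollectI exI[of _ "Suc r"] exI[of _ p'] conjI) auto
      also have "\<dots> \<le> enat r" using ht P(1) R_eq by simp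
      finally show False by simp
    qed
    then show ?thesis using p(4) IP h unfolding N.local_gen_def by blast
  qed
  define K where "K = {s \<in> mpolys n. \<forall>h\<in>I. s * h \<in> mpolys.gen n (g ` {..<r})}"
  have K: "mpolys.idl n K" unfolding mpolys.idl_def K_def using dg by (auto simp: distrib_right mult.assoc)
  have KI: "K \<union> I \<subseteq> mpolys n" using d(1) by (auto simp: K_def)
  obtain X where X: "X \<subseteq> mpolys n" "finite X" "I = mpolys.gen n X"
    using N.noetherian mpolys.noetherian_iff I by blast
  have "\<exists>N::nat. \<Delta> [^]\<^bsub>mpolys.ring_of n\<^esub> N \<in> mpolys.gen n (K \<union> I)"
  proof (rule NC.power_mem_of_mem_all_primes)
    show "ideal (mpolys.gen n (K \<union> I)) (mpolys.ring_of n)"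
      using mpolys.gen_idl[OF KI] by (simp add: mpolys.idl_iff_ideal)
    show "\<Delta> \<in> carrier (mpolys.ring_of n)" using \<Delta>R by simp
    fix Q assume "primeideal Q (mpolys.ring_of n)" and sub: "mpolys.gen n (K \<union> I) \<subseteq> Q"
    then have Q: "mpolys.prm n Q" by (simp add: mpolys.prm_iff_primeideal)
    have KQ: "K \<subseteq> Q" "I \<subseteq> Q" using sub mpolys.gen_upper[of "K \<union> I" n] by auto
    show "\<Delta> \<in> Q"
    proof (rule ccontr)
      assume \<Delta>Q: "\<Delta> \<notin> Q"
      have XI: "X \<subseteq> I" using mpolys.gen_upper X(3) by blast
      have "\<exists>s\<in>mpolys n - Q. \<forall>x\<in>Y. s * x \<in> mpolys.gen n (g ` {..<r})" if "finite Y" "Y \<subseteq> X" for Y using that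
      proof (induction Y rule: finite_induct)
        case empty then show ?case using mpolys.prm_one_compl[OF Q] by blast
      next
        case (insert x Y)
        then obtain s where s: "s \<in> mpolys n - Q" "\<forall>x\<in>Y. s * x \<in> mpolys.gen n (g ` {..<r})" by blast
        obtain t where t: "t \<in> mpolys n - Q" "t * x \<in> mpolys.gen n (g ` {..<r})"
          using local[OF Q KQ(2) \<Delta>Q, of x] insert.prems XI by blast
        have "(s * t) * y \<in> mpolys.gen n (g ` {..<r})" if "y \<in> insert x Y" for y
        proof (cases "y = x")
          case True then show ?thesis using dg(5)[of s "t * x"] s t by (simp add: mult.assoc)
        next
          case False
          then have "t * (s * y) \<in> mpolys.gen n (g ` {..<r})" using dg(5)[of t "s * y"] s t that by blast
          then show ?thesis by (simp add: mult_ac)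
        qed
        then show ?case using mpolys.prm_mult_compl[OF Q s(1) t(1)] by blast
      qed
      from this[of X] obtain s where s: "s \<in> mpolys n - Q" "\<forall>x\<in>X. s * x \<in> mpolys.gen n (g ` {..<r})" using X(2) by blast
      have "mpolys.idl n {h \<in> mpolys n. s * h \<in> mpolys.gen n (g ` {..<r})}"
        unfolding mpolys.idl_def using dg s by (auto simp: distrib_left mult.left_commute)
      then have "I \<subseteq> {h \<in> mpolys n. s * h \<in> mpolys.gen n (g ` {..<r})}"
        unfolding X(3) using s(2) X(1) by (intro mpolys.gen_least) auto
      then have "s \<in> K" using s(1) unfolding K_def by blast
      then show False using s(1) KQ by blast
    qed
  qed
  then obtain N where "\<Delta> [^]\<^bsub>mpolys.ring_of n\<^esub> (N::nat) \<in> mpolys.gen n (K \<union> I)" by blast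
  moreover have "\<Delta> [^]\<^bsub>mpolys.ring_of n\<^esub> N = \<Delta> ^ N" for N :: nat
    by (induction N) (simp_all add: nat_pow_def mult.commute)
  ultimately have mem: "\<Delta> ^ N \<in> mpolys.gen n (K \<union> I)" by simp
  let ?G = "g ` {..<r} \<union> {a * b |a b. a \<in> I \<and> b \<in> I}"
  have GR: "?G \<subseteq> mpolys n" using gR d(3) by blast
  note dG = mpolys.idlD[OF mpolys.gen_idl[OF GR]]
  have "\<Delta> ^ N * h \<in> mpolys.gen n ?G" if h: "h \<in> I" for h
  proof -
    have "mpolys.idl n {y \<in> mpolys n. y * h \<in> mpolys.gen n ?G}"
      unfolding mpolys.idl_def using dG by (auto simp: distrib_right mult.assoc)
    moreover have "K \<union> I \<subseteq> {y \<in> mpolys n. y * h \<in> mpolys.gen n ?G}"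
    proof -
      have "y * h \<in> mpolys.gen n ?G" if "y \<in> K" for y
        using that h mpolys.gen_mono[of "g ` {..<r}" ?G n] unfolding K_def by blast
      moreover have "y * h \<in> mpolys.gen n ?G" if "y \<in> I" for y using that h mpolys.gen_upper[of ?G n] by blast
      ultimately show ?thesis using KI by blast
    qed
    ultimately show ?thesis using mpolys.gen_least mem by blast
  qed
  then show ?thesis by blast
qed

section \<open>Power series over a commutative ring\<close>

context abelian_monoid begin

lemma finsum_triangle:
  assumes h: "\<And>i j. h i j \<in> carrier G"
  shows "(\<Oplus>k\<in>{..n::nat}. \<Oplus>i\<in>{..k}. h i (k - i)) = (\<Oplus>i\<in>{..n}. \<Oplus>j\<in>{..n - i}. h i j)"
proof (induction n)
  case 0 then show ?case using h by simp
next
  case (Suc n)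
  have "(\<Oplus>i\<in>{..n}. \<Oplus>j\<in>{..Suc n - i}. h i j)
    = (\<Oplus>i\<in>{..n}. h i (Suc n - i) \<oplus> (\<Oplus>j\<in>{..n - i}. h i j))"
  proof (rule finsum_cong')
    fix i assume "i \<in> {..n}"
    then have "Suc n - i = Suc (n - i)" by auto
    then show "(\<Oplus>j\<in>{..Suc n - i}. h i j) = h i (Suc n - i) \<oplus> (\<Oplus>j\<in>{..n - i}. h i j)"
      using h by (simp add: finsum_Suc)
  qed (use h in auto)
  also have "\<dots> = (\<Oplus>i\<in>{..n}. h i (Suc n - i)) \<oplus> (\<Oplus>i\<in>{..n}. \<Oplus>j\<in>{..n - i}. h i j)"
    using h by (intro finsum_addf) auto
  finally have "(\<Oplus>i\<in>{..n}. \<Oplus>j\<in>{..Suc n - i}. h i j)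
    = (\<Oplus>i\<in>{..n}. h i (Suc n - i)) \<oplus> (\<Oplus>i\<in>{..n}. \<Oplus>j\<in>{..n - i}. h i j)" .
  then show ?case using h Suc by (simp add: finsum_Suc a_ac)
qed

lemma finsum_reverse:
  assumes f: "\<And>i. f i \<in> carrier G"
  shows "(\<Oplus>i\<in>{..k::nat}. f (k - i)) = (\<Oplus>i\<in>{..k}. f i)"
proof (induction k)
  case 0 then show ?case using f by simp
next
  case (Suc k)
  have "(\<Oplus>i\<in>{..Suc k}. f (Suc k - i)) = (\<Oplus>i\<in>{..k}. f (Suc k - Suc i)) \<oplus> f (Suc k - 0)"
    using f by (intro finsum_Suc2) auto
  then show ?case using Suc f by (simp add: finsum_Suc a_comm)
qed

lemma finsum_triangle_swap:
  assumes h: "\<And>i j. h i j \<in> carrier G"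
  shows "(\<Oplus>i\<in>{..n::nat}. \<Oplus>j\<in>{..n - i}. h i j) = (\<Oplus>j\<in>{..n}. \<Oplus>i\<in>{..n - j}. h i j)"
proof -
  have "(\<Oplus>k\<in>{..n}. \<Oplus>i\<in>{..k}. h i (k - i)) = (\<Oplus>k\<in>{..n}. \<Oplus>i\<in>{..k}. h (k - i) i)"
  proof (rule finsum_cong')
    fix k assume "k \<in> {..n}"
    have "(\<Oplus>i\<in>{..k}. h (k - i) i) = (\<Oplus>i\<in>{..k}. h (k - i) (k - (k - i)))" using h by (intro finsum_cong') auto
    then show "(\<Oplus>i\<in>{..k}. h i (k - i)) = (\<Oplus>i\<in>{..k}. h (k - i) i)"
      using finsum_reverse[of "\<lambda>i. h i (k - i)" k] h by simp
  qed (use h in auto)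
  then show ?thesis using finsum_triangle[of h n] finsum_triangle[of "\<lambda>i j. h j i" n] h by simp
qed

end

definition series_ring :: "('b, 'e) ring_scheme \<Rightarrow> (nat \<Rightarrow> 'b) ring" where
  "series_ring B = \<lparr>carrier = {f. \<forall>i. f i \<in> carrier B},
     mult = (\<lambda>f g i. \<Oplus>\<^bsub>B\<^esub>j\<in>{..i}. f j \<otimes>\<^bsub>B\<^esub> g (i - j)), one = (\<lambda>i. if i = 0 then \<one>\<^bsub>B\<^esub> else \<zero>\<^bsub>B\<^esub>),
     zero = (\<lambda>i. \<zero>\<^bsub>B\<^esub>), add = (\<lambda>f g i. f i \<oplus>\<^bsub>B\<^esub> g i)\<rparr>"

lemma series_ring_simps [simp]:
  "f \<in> carrier (series_ring B) \<longleftrightarrow> (\<forall>i. f i \<in> carrier B)"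
  "(f \<otimes>\<^bsub>series_ring B\<^esub> g) i = (\<Oplus>\<^bsub>B\<^esub>j\<in>{..i}. f j \<otimes>\<^bsub>B\<^esub> g (i - j))"
  "\<one>\<^bsub>series_ring B\<^esub> i = (if i = 0 then \<one>\<^bsub>B\<^esub> else \<zero>\<^bsub>B\<^esub>)" "\<zero>\<^bsub>series_ring B\<^esub> i = \<zero>\<^bsub>B\<^esub>"
  "(f \<oplus>\<^bsub>series_ring B\<^esub> g) i = f i \<oplus>\<^bsub>B\<^esub> g i" by (simp_all add: series_ring_def)

fun series_inverse :: "('b, 'e) ring_scheme \<Rightarrow> (nat \<Rightarrow> 'b) \<Rightarrow> nat \<Rightarrow> 'b" where
  "series_inverse B f 0 = inv\<^bsub>B\<^esub> (f 0)"
| "series_inverse B f (Suc n) = \<ominus>\<^bsub>B\<^esub> (inv\<^bsub>B\<^esub> (f 0) \<otimes>\<^bsub>B\<^esub> (\<Oplus>\<^bsub>B\<^esub>j\<in>{..n}. f (Suc j) \<otimes>\<^bsub>B\<^esub> series_inverse B f (n - j)))"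

context cring begin

lemma series_ring_cring: "cring (series_ring R)"
proof (rule cringI)
  show "abelian_group (series_ring R)"
  proof (rule abelian_groupI)
    fix f assume "f \<in> carrier (series_ring R)"
    then show "\<exists>g\<in>carrier (series_ring R). g \<oplus>\<^bsub>series_ring R\<^esub> f = \<zero>\<^bsub>series_ring R\<^esub>"
      by (intro bexI[of _ "\<lambda>i. \<ominus> f i"]) (auto simp: l_neg)
  qed (auto simp: a_ac)
  show "comm_monoid (series_ring R)"
  proof (rule comm_monoidI)
    fix f g h assume f: "f \<in> carrier (series_ring R)" and g: "g \<in> carrier (series_ring R)"
    show "f \<otimes>\<^bsub>series_ring R\<^esub> g \<in> carrier (series_ring R)" using f g by simp
    show "f \<otimes>\<^bsub>series_ring R\<^esub> g = g \<otimes>\<^bsub>series_ring R\<^esub> f"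
    proof
      fix n
      have "(\<Oplus>j\<in>{..n}. f j \<otimes> g (n - j)) = (\<Oplus>j\<in>{..n}. f (n - j) \<otimes> g (n - (n - j)))"
        using finsum_reverse[of "\<lambda>j. f j \<otimes> g (n - j)" n] f g by simp
      also have "\<dots> = (\<Oplus>j\<in>{..n}. g j \<otimes> f (n - j))" using f g by (intro finsum_cong') (auto simp: m_comm)
      finally show "(f \<otimes>\<^bsub>series_ring R\<^esub> g) n = (g \<otimes>\<^bsub>series_ring R\<^esub> f) n" by simp
    qed
    assume h: "h \<in> carrier (series_ring R)"
    show "f \<otimes>\<^bsub>series_ring R\<^esub> g \<otimes>\<^bsub>series_ring R\<^esub> h = f \<otimes>\<^bsub>series_ring R\<^esub> (g \<otimes>\<^bsub>series_ring R\<^esub> h)"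
    proof
      fix n
      have "(f \<otimes>\<^bsub>series_ring R\<^esub> g \<otimes>\<^bsub>series_ring R\<^esub> h) n
        = (\<Oplus>k\<in>{..n}. \<Oplus>i\<in>{..k}. f i \<otimes> g (k - i) \<otimes> h (n - (i + (k - i))))"
        using f g h by (auto simp: finsum_ldistr intro!: finsum_cong')
      also have "\<dots> = (\<Oplus>i\<in>{..n}. \<Oplus>j\<in>{..n - i}. f i \<otimes> g j \<otimes> h (n - (i + j)))"
        using f g h by (intro finsum_triangle[of "\<lambda>i j. f i \<otimes> g j \<otimes> h (n - (i + j))"]) auto
      also have "\<dots> = (f \<otimes>\<^bsub>series_ring R\<^esub> (g \<otimes>\<^bsub>series_ring R\<^esub> h)) n"
        using f g h by (auto simp: finsum_rdistr m_assoc diff_diff_add intro!: finsum_cong')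
      finally show "(f \<otimes>\<^bsub>series_ring R\<^esub> g \<otimes>\<^bsub>series_ring R\<^esub> h) n = (f \<otimes>\<^bsub>series_ring R\<^esub> (g \<otimes>\<^bsub>series_ring R\<^esub> h)) n" .
    qed
  next
    fix f assume f: "f \<in> carrier (series_ring R)"
    show "\<one>\<^bsub>series_ring R\<^esub> \<otimes>\<^bsub>series_ring R\<^esub> f = f"
    proof
      fix n
      have "(\<Oplus>j\<in>{..n}. (if j = 0 then \<one> else \<zero>) \<otimes> f (n - j)) = f n"
      proof (cases n)
        case (Suc m)
        have "(\<Oplus>j\<in>{..Suc m}. (if j = 0 then \<one> else \<zero>) \<otimes> f (Suc m - j))
          = (\<Oplus>j\<in>{..m}. (if Suc j = 0 then \<one> else \<zero>) \<otimes> f (Suc m - Suc j)) \<oplus> (if (0::nat) = 0 then \<one> else \<zero>) \<otimes> f (Suc m - 0)"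
          using f by (intro finsum_Suc2) auto
        also have "\<dots> = f (Suc m)" using f by (simp add: finsum_zero)
        finally show ?thesis using Suc by simp
      qed (use f in simp)
      then show "(\<one>\<^bsub>series_ring R\<^esub> \<otimes>\<^bsub>series_ring R\<^esub> f) n = f n" by simp
    qed
  qed simp
  fix f g h assume "f \<in> carrier (series_ring R)" "g \<in> carrier (series_ring R)" "h \<in> carrier (series_ring R)"
  then show "(f \<oplus>\<^bsub>series_ring R\<^esub> g) \<otimes>\<^bsub>series_ring R\<^esub> h
    = f \<otimes>\<^bsub>series_ring R\<^esub> h \<oplus>\<^bsub>series_ring R\<^esub> g \<otimes>\<^bsub>series_ring R\<^esub> h" by (intro ext) (simp add: l_distr finsum_addf)
qed

lemma series_unit:
  assumes f: "\<And>i. f i \<in> carrier R" and f0: "f 0 \<in> Units R"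
  shows "f \<in> Units (series_ring R)"
proof -
  let ?g = "series_inverse R f"
  interpret S: cring "series_ring R" by (rule series_ring_cring)
  have g: "?g n \<in> carrier R" for n
  proof (induction n rule: less_induct)
    case (less n)
    show ?case
    proof (cases n)
      case (Suc m)
      have "(\<Oplus>j\<in>{..m}. f (Suc j) \<otimes> ?g (m - j)) \<in> carrier R" using less Suc f by (intro finsum_closed) auto
      then show ?thesis using Suc f0 by simp
    qed (use f0 in simp)
  qed
  have "f \<otimes>\<^bsub>series_ring R\<^esub> ?g = \<one>\<^bsub>series_ring R\<^esub>"
  proof
    fix n
    show "(f \<otimes>\<^bsub>series_ring R\<^esub> ?g) n = \<one>\<^bsub>series_ring R\<^esub> n"
    proof (cases n)
      case 0 then show ?thesis using f f0 by simp
    next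
      case (Suc m)
      let ?s = "\<Oplus>j\<in>{..m}. f (Suc j) \<otimes> ?g (m - j)"
      have s: "?s \<in> carrier R" using f g by simp
      have "(\<Oplus>j\<in>{..Suc m}. f j \<otimes> ?g (Suc m - j)) = (\<Oplus>j\<in>{..m}. f (Suc j) \<otimes> ?g (Suc m - Suc j)) \<oplus> f 0 \<otimes> ?g (Suc m - 0)"
        using f g by (intro finsum_Suc2) (auto simp del: series_inverse.simps)
      also have "\<dots> = ?s \<oplus> f 0 \<otimes> (\<ominus> (inv (f 0) \<otimes> ?s))" by simp
      also have "f 0 \<otimes> (\<ominus> (inv (f 0) \<otimes> ?s)) = \<ominus> ?s" using f[of 0] f0 s by (simp add: r_minus m_assoc[symmetric])
      also have "?s \<oplus> \<ominus> ?s = \<zero>" using s by (simp add: r_neg)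
      finally show ?thesis using Suc by simp
    qed
  qed
  moreover have "f \<in> carrier (series_ring R)" "?g \<in> carrier (series_ring R)" using f g by auto
  ultimately show ?thesis unfolding Units_def using S.m_comm[of f ?g] by auto
qed

end

section \<open>Modules of integrable derivations\<close>

locale kalg =
  fixes k :: "('c, 'd) ring_scheme" and B :: "('c, 'b, 'e) module_scheme" (structure)
  assumes is_algebra: "algebra k B"

sublocale kalg \<subseteq> cring B
  using is_algebra by (rule algebra.M_cring)

context kalg begin

abbreviation DerV where "DerV \<equiv> Der_module k B"

lemma smult_carr [simp]: "c \<in> carrier k \<Longrightarrow> x \<in> carrier B \<Longrightarrow> c \<odot> x \<in> carrier B"
proof -
  interpret A: algebra k B by (rule is_algebra)
  show "c \<in> carrier k \<Longrightarrow> x \<in> carrier B \<Longrightarrow> c \<odot> x \<in> carrier B" by (rule A.smult_closed)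
qed

lemma smult_simps:
  "c \<in> carrier k \<Longrightarrow> x \<in> carrier B \<Longrightarrow> y \<in> carrier B \<Longrightarrow> c \<odot> (x \<oplus> y) = c \<odot> x \<oplus> c \<odot> y"
  "c \<in> carrier k \<Longrightarrow> c \<odot> \<zero> = \<zero>"
  "c \<in> carrier k \<Longrightarrow> x \<in> carrier B \<Longrightarrow> y \<in> carrier B \<Longrightarrow> c \<odot> (x \<otimes> y) = x \<otimes> (c \<odot> y)"
proof -
  interpret A: algebra k B by (rule is_algebra)
  show "c \<in> carrier k \<Longrightarrow> x \<in> carrier B \<Longrightarrow> y \<in> carrier B \<Longrightarrow> c \<odot> (x \<oplus> y) = c \<odot> x \<oplus> c \<odot> y" by (rule A.smult_r_distr)
  show "c \<in> carrier k \<Longrightarrow> c \<odot> \<zero> = \<zero>" by simp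
  assume c: "c \<in> carrier k" "x \<in> carrier B" "y \<in> carrier B"
  have "c \<odot> (x \<otimes> y) = c \<odot> (y \<otimes> x)" using c m_comm by simp
  also have "\<dots> = (c \<odot> y) \<otimes> x" using A.smult_assoc2[OF c(1,3,2)] by simp
  also have "\<dots> = x \<otimes> (c \<odot> y)" using c m_comm[of "c \<odot> y" x] by simp
  finally show "c \<odot> (x \<otimes> y) = x \<otimes> (c \<odot> y)" .
qed

lemma linear_endosI:
  assumes "\<And>x. x \<in> carrier B \<Longrightarrow> f x \<in> carrier B"
    "\<And>x y. x \<in> carrier B \<Longrightarrow> y \<in> carrier B \<Longrightarrow> f (x \<oplus> y) = f x \<oplus> f y"
    "\<And>c x. c \<in> carrier k \<Longrightarrow> x \<in> carrier B \<Longrightarrow> f (c \<odot> x) = c \<odot> f x"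
  shows "(\<lambda>x\<in>carrier B. f x) \<in> linear_endos k B"
  unfolding linear_endos_def module_hom_def using assms by simp

lemma linear_endosD:
  assumes "f \<in> linear_endos k B"
  shows "\<And>x. x \<in> carrier B \<Longrightarrow> f x \<in> carrier B"
    "\<And>x y. x \<in> carrier B \<Longrightarrow> y \<in> carrier B \<Longrightarrow> f (x \<oplus> y) = f x \<oplus> f y"
    "\<And>c x. c \<in> carrier k \<Longrightarrow> x \<in> carrier B \<Longrightarrow> f (c \<odot> x) = c \<odot> f x"
    "f \<in> extensional (carrier B)" "f \<zero> = \<zero>"
proof -
  show 1: "\<And>x. x \<in> carrier B \<Longrightarrow> f x \<in> carrier B"
    and 2: "\<And>x y. x \<in> carrier B \<Longrightarrow> y \<in> carrier B \<Longrightarrow> f (x \<oplus> y) = f x \<oplus> f y"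
    and "\<And>c x. c \<in> carrier k \<Longrightarrow> x \<in> carrier B \<Longrightarrow> f (c \<odot> x) = c \<odot> f x" "f \<in> extensional (carrier B)"
    using assms unfolding linear_endos_def module_hom_def by auto
  have "f \<zero> \<oplus> f \<zero> = f \<zero> \<oplus> \<zero>" using 2[of \<zero> \<zero>] 1[of \<zero>] by simp
  then show "f \<zero> = \<zero>" using 1[of \<zero>] by simp
qed

lemma linear_endos_finsum:
  assumes f: "f \<in> linear_endos k B" and "finite A" and g: "\<And>i. i \<in> A \<Longrightarrow> g i \<in> carrier B"
  shows "f (\<Oplus>i\<in>A. g i) = (\<Oplus>i\<in>A. f (g i))"
  using assms(2) g
proof (induction A rule: finite_induct)
  case empty then show ?case using linear_endosD(5)[OF f] by simp
next
  case (insert a A)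
  then show ?case using linear_endosD(1,2)[OF f] by (simp add: Pi_def)
qed

lemma DerI:
  assumes "f \<in> linear_endos k B"
    "\<And>x y. x \<in> carrier B \<Longrightarrow> y \<in> carrier B \<Longrightarrow> f (x \<otimes> y) = x \<otimes> f y \<oplus> y \<otimes> f x"
  shows "f \<in> Der k B" using assms by (simp add: Der_def)

lemma DerD:
  assumes "f \<in> Der k B"
  shows "f \<in> linear_endos k B" "\<And>x y. x \<in> carrier B \<Longrightarrow> y \<in> carrier B \<Longrightarrow> f (x \<otimes> y) = x \<otimes> f y \<oplus> y \<otimes> f x"
    "\<And>x. x \<in> carrier B \<Longrightarrow> f x \<in> carrier B" "f \<one> = \<zero>"
proof -
  show 1: "f \<in> linear_endos k B" and 2: "\<And>x y. x \<in> carrier B \<Longrightarrow> y \<in> carrier B \<Longrightarrow> f (x \<otimes> y) = x \<otimes> f y \<oplus> y \<otimes> f x"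
    using assms by (auto simp: Der_def)
  show 3: "\<And>x. x \<in> carrier B \<Longrightarrow> f x \<in> carrier B" using linear_endosD(1)[OF 1] .
  have "f \<one> \<oplus> f \<one> = f \<one> \<oplus> \<zero>" using 2[of \<one> \<one>] 3[of \<one>] by simp
  then show "f \<one> = \<zero>" using 3[of \<one>] by simp
qed

lemma Der_eqI:
  assumes "f \<in> Der k B" "g \<in> Der k B" "\<And>x. x \<in> carrier B \<Longrightarrow> f x = g x" shows "f = g"
  using assms linear_endosD(4)[OF DerD(1)] by (intro extensionalityI[of f "carrier B" g]) auto

lemma DerV_simps:
  "carrier DerV = Der k B" "f \<oplus>\<^bsub>DerV\<^esub> g = (\<lambda>x\<in>carrier B. f x \<oplus> g x)"
  "\<zero>\<^bsub>DerV\<^esub> = (\<lambda>x\<in>carrier B. \<zero>)" "a \<odot>\<^bsub>DerV\<^esub> f = (\<lambda>x\<in>carrier B. a \<otimes> f x)"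
  by (simp_all add: Der_module_def func_space_def)

lemma Der_zero: "(\<lambda>x\<in>carrier B. \<zero>) \<in> Der k B"
  by (rule DerI, rule linear_endosI) (auto simp: smult_simps)

lemma Der_add: assumes f: "f \<in> Der k B" and g: "g \<in> Der k B" shows "(\<lambda>x\<in>carrier B. f x \<oplus> g x) \<in> Der k B"
proof (rule DerI)
  note df = DerD[OF f] and dg = DerD[OF g]
  note lf = linear_endosD[OF df(1)] and lg = linear_endosD[OF dg(1)]
  show "(\<lambda>x\<in>carrier B. f x \<oplus> g x) \<in> linear_endos k B"
    by (rule linear_endosI) (simp_all add: lf lg a_ac smult_simps)
  fix x y assume "x \<in> carrier B" "y \<in> carrier B"
  then show "(\<lambda>x\<in>carrier B. f x \<oplus> g x) (x \<otimes> y) = x \<otimes> (\<lambda>x\<in>carrier B. f x \<oplus> g x) y \<oplus> y \<otimes> (\<lambda>x\<in>carrier B. f x \<oplus> g x) x"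
    by (simp add: df dg r_distr a_ac)
qed

lemma Der_smult: assumes f: "f \<in> Der k B" and a: "a \<in> carrier B" shows "(\<lambda>x\<in>carrier B. a \<otimes> f x) \<in> Der k B"
proof (rule DerI)
  note df = DerD[OF f]
  note lf = linear_endosD[OF df(1)]
  show "(\<lambda>x\<in>carrier B. a \<otimes> f x) \<in> linear_endos k B"
    by (rule linear_endosI) (simp_all add: lf a r_distr smult_simps)
  fix x y assume "x \<in> carrier B" "y \<in> carrier B"
  then show "(\<lambda>x\<in>carrier B. a \<otimes> f x) (x \<otimes> y) = x \<otimes> (\<lambda>x\<in>carrier B. a \<otimes> f x) y \<oplus> y \<otimes> (\<lambda>x\<in>carrier B. a \<otimes> f x) x"
    by (simp add: df a r_distr m_ac)
qed

lemma DerV_module: "module B DerV"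
proof -
  interpret F: module B "func_space (carrier B)" by (rule func_space_is_module)
  have "LinearCombinations.submodule B (Der k B) (func_space (carrier B))"
  proof (rule LinearCombinations.submodule.intro)
    show "module B (func_space (carrier B))" by (rule F.module_axioms)
    show "Der k B \<subseteq> carrier (func_space (carrier B))"
    proof
      fix f assume "f \<in> Der k B"
      then show "f \<in> carrier (func_space (carrier B))"
        using DerD(3) linear_endosD(4)[OF DerD(1)] by (auto simp: func_space_def PiE_def)
    qed
  qed (use Der_zero Der_add Der_smult in \<open>auto simp: func_space_def\<close>)
  then show ?thesis unfolding Der_module_def by (rule F.submodule_is_module)
qed

text \<open>The maps \<open>D i\<close> with \<open>i > m\<close> are unconstrained and may be replaced by zero. Once all of them are
  linear, every sum formed from them stays inside the carrier.\<close>

definition total_hs :: "enat \<Rightarrow> (nat \<Rightarrow> 'b \<Rightarrow> 'b) \<Rightarrow> bool" where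
  "total_hs m D \<longleftrightarrow> hasse_schmidt k B m D \<and> (\<forall>i. D i \<in> linear_endos k B)"

lemma total_hsI:
  assumes "\<And>x. x \<in> carrier B \<Longrightarrow> D 0 x = x" "\<And>i. D i \<in> linear_endos k B"
    "\<And>i x y. enat i \<le> m \<Longrightarrow> x \<in> carrier B \<Longrightarrow> y \<in> carrier B \<Longrightarrow> D i (x \<otimes> y) = (\<Oplus>j\<in>{..i}. D j x \<otimes> D (i - j) y)"
  shows "total_hs m D"
proof -
  have "D 0 = (\<lambda>x\<in>carrier B. x)"
    using assms(1) linear_endosD(4)[OF assms(2)[of 0]] by (intro extensionalityI[of _ "carrier B"]) auto
  then show ?thesis using assms unfolding total_hs_def hasse_schmidt_def by blast
qed

lemma total_hsD:
  assumes "total_hs m D"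
  shows "\<And>x. x \<in> carrier B \<Longrightarrow> D 0 x = x" "\<And>i. D i \<in> linear_endos k B"
    "\<And>i x. x \<in> carrier B \<Longrightarrow> D i x \<in> carrier B"
    "\<And>i x y. enat i \<le> m \<Longrightarrow> x \<in> carrier B \<Longrightarrow> y \<in> carrier B \<Longrightarrow> D i (x \<otimes> y) = (\<Oplus>j\<in>{..i}. D j x \<otimes> D (i - j) y)"
  using assms linear_endosD(1) unfolding total_hs_def hasse_schmidt_def by auto

text \<open>Truncating a Hasse-Schmidt derivation beyond \<open>m\<close> changes neither its first term nor the product
  rules up to \<open>m\<close>.\<close>

lemma IDer_iff_total:
  assumes m: "1 \<le> m"
  shows "\<delta> \<in> IDer k B m \<longleftrightarrow> \<delta> \<in> Der k B \<and> (\<exists>D. total_hs m D \<and> D 1 = \<delta>)"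
proof
  assume "\<delta> \<in> IDer k B m"
  then obtain D where d: "\<delta> \<in> Der k B" and D: "hasse_schmidt k B m D" "D 1 = \<delta>" by (auto simp: IDer_def)
  define D' where "D' i = (if enat i \<le> m then D i else (\<lambda>x\<in>carrier B. \<zero>))" for i
  have D'D: "D' j = D j" if "enat i \<le> m" "j \<le> i" for i j
  proof -
    have "enat j \<le> enat i" using that by simp
    then have "enat j \<le> m" using that(1) by (rule order_trans)
    then show ?thesis by (simp add: D'_def)
  qed
  have "total_hs m D'"
  proof (rule total_hsI)
    have "enat 0 \<le> m" by (simp add: zero_enat_def[symmetric])
    then show "D' 0 x = x" if "x \<in> carrier B" for x using D that by (simp add: D'_def hasse_schmidt_def)
    show "D' i \<in> linear_endos k B" for i using D DerD(1)[OF Der_zero] by (auto simp: D'_def hasse_schmidt_def)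
    fix i x y assume i: "enat i \<le> m" and xy: "x \<in> carrier B" "y \<in> carrier B"
    have "D i (x \<otimes> y) = (\<Oplus>j\<in>{..i}. D j x \<otimes> D (i - j) y)" using D i xy by (simp add: hasse_schmidt_def)
    also have "\<dots> = (\<Oplus>j\<in>{..i}. D' j x \<otimes> D' (i - j) y)"
    proof (rule finsum_cong')
      have "D' j \<in> linear_endos k B" for j using D DerD(1)[OF Der_zero] by (auto simp: D'_def hasse_schmidt_def)
      then show "(\<lambda>j. D' j x \<otimes> D' (i - j) y) \<in> {..i} \<rightarrow> carrier B" using xy linear_endosD(1) by auto
    qed (use D'D[OF i] in auto)
    finally show "D' i (x \<otimes> y) = (\<Oplus>j\<in>{..i}. D' j x \<otimes> D' (i - j) y)" using D'D[OF i, of i] by simp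
  qed
  moreover have "D' 1 = \<delta>" using m D by (simp add: D'_def one_enat_def)
  ultimately show "\<delta> \<in> Der k B \<and> (\<exists>D. total_hs m D \<and> D 1 = \<delta>)" using d by blast
qed (auto simp: IDer_def total_hs_def)

lemma IDer_sub_Der: "IDer k B m \<subseteq> Der k B" by (auto simp: IDer_def)

lemma IDer_antimono: "m \<le> m' \<Longrightarrow> IDer k B m' \<subseteq> IDer k B m"
  unfolding IDer_def hasse_schmidt_def using order_trans by blast

lemma IDer_zero: assumes "1 \<le> m" shows "(\<lambda>x\<in>carrier B. \<zero>) \<in> IDer k B m"
proof -
  define D where "D i = (if i = (0::nat) then (\<lambda>x\<in>carrier B. x) else (\<lambda>x\<in>carrier B. \<zero>))" for i
  have "total_hs m D"
  proof (rule total_hsI)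
    show "D i \<in> linear_endos k B" for i
      unfolding D_def using DerD(1)[OF Der_zero] linear_endosI[of "\<lambda>x. x"] by simp
    fix i x y assume xy: "x \<in> carrier B" "y \<in> carrier B"
    show "D i (x \<otimes> y) = (\<Oplus>j\<in>{..i}. D j x \<otimes> D (i - j) y)"
    proof (cases i)
      case (Suc n)
      have "(\<Oplus>j\<in>{..Suc n}. D j x \<otimes> D (Suc n - j) y) = (\<Oplus>j\<in>{..n}. D (Suc j) x \<otimes> D (Suc n - Suc j) y) \<oplus> D 0 x \<otimes> D (Suc n - 0) y"
        using xy by (intro finsum_Suc2) (auto simp: D_def)
      also have "\<dots> = (\<Oplus>j\<in>{..n}. \<zero>) \<oplus> \<zero>"
        using xy by (intro arg_cong2[where f = "(\<oplus>)"] finsum_cong') (auto simp: D_def)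
      finally show ?thesis using xy Suc by (simp add: D_def finsum_zero)
    qed (use xy in \<open>simp add: D_def\<close>)
  qed (simp add: D_def)
  moreover have "D 1 = (\<lambda>x\<in>carrier B. \<zero>)" by (simp add: D_def)
  ultimately show ?thesis using IDer_iff_total[OF assms] Der_zero by blast
qed

text \<open>Composition in the group of Hasse--Schmidt derivations adds the first-order terms.\<close>

lemma IDer_add:
  assumes m: "1 \<le> m" and d: "\<delta> \<in> IDer k B m" and e: "\<epsilon> \<in> IDer k B m"
  shows "(\<lambda>x\<in>carrier B. \<delta> x \<oplus> \<epsilon> x) \<in> IDer k B m"
proof -
  obtain D E where D: "total_hs m D" "D 1 = \<delta>" and E: "total_hs m E" "E 1 = \<epsilon>"
    using d e IDer_iff_total[OF m] by blast
  note dD = total_hsD[OF D(1)] and dE = total_hsD[OF E(1)]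
  note lD = linear_endosD[OF dD(2)] and lE = linear_endosD[OF dE(2)]
  define F where "F i = (\<lambda>x\<in>carrier B. \<Oplus>j\<in>{..i}. D j (E (i - j) x))" for i
  have FB: "F i x \<in> carrier B" if "x \<in> carrier B" for i x using that dD dE by (simp add: F_def)
  have "total_hs m F"
  proof (rule total_hsI)
    show "F 0 x = x" if "x \<in> carrier B" for x using that dD(1) dE(1) by (simp add: F_def)
    show "F i \<in> linear_endos k B" for i
      unfolding F_def
    proof (rule linear_endosI)
      fix c x assume c: "c \<in> carrier k" and x: "x \<in> carrier B"
      have lin: "(\<lambda>y\<in>carrier B. c \<odot> y) \<in> linear_endos k B"
      proof (rule linear_endosI)
        interpret A: algebra k B by (rule is_algebra)
        fix e y assume e: "e \<in> carrier k" and y: "y \<in> carrier B"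
        show "c \<odot> (e \<odot> y) = e \<odot> (c \<odot> y)"
          using A.smult_assoc1[OF c e y] A.smult_assoc1[OF e c y] A.R.m_comm[OF c e] by simp
      qed (use c in \<open>auto simp: smult_simps\<close>)
      have "(\<Oplus>j\<in>{..i}. D j (E (i - j) (c \<odot> x))) = (\<Oplus>j\<in>{..i}. (\<lambda>y\<in>carrier B. c \<odot> y) (D j (E (i - j) x)))"
        using c x lD lE by (intro finsum_cong') auto
      also have "\<dots> = (\<lambda>y\<in>carrier B. c \<odot> y) (\<Oplus>j\<in>{..i}. D j (E (i - j) x))"
        using linear_endos_finsum[OF lin, of "{..i}" "\<lambda>j. D j (E (i - j) x)"] x lD lE by simp
      finally show "(\<Oplus>j\<in>{..i}. D j (E (i - j) (c \<odot> x))) = c \<odot> (\<Oplus>j\<in>{..i}. D j (E (i - j) x))"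
        using x lD lE by simp
    qed (use lD lE in \<open>simp_all add: finsum_addf\<close>)
    fix n x y assume n: "enat n \<le> m" and x: "x \<in> carrier B" and y: "y \<in> carrier B"
    have le: "enat i \<le> m" if "i \<le> n" for i using that n by (meson enat_ord_simps(1) order_trans)
    define h where "h d a e = D d (E a x) \<otimes> D e (E (n - d - a - e) y)" for d a e
    have hB: "h d a e \<in> carrier B" for d a e using lD lE x y by (simp add: h_def)
    have "F n (x \<otimes> y) = (\<Oplus>c\<in>{..n}. \<Oplus>a\<in>{..n - c}. \<Oplus>d\<in>{..c}. h d a (c - d))"
      unfolding F_def using x y
    proof (simp, intro finsum_cong')
      fix c assume c: "c \<in> {..n}"
      have "D c (E (n - c) (x \<otimes> y)) = D c (\<Oplus>a\<in>{..n - c}. E a x \<otimes> E (n - c - a) y)"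
        using dE(4)[OF le x y, of "n - c"] by simp
      also have "\<dots> = (\<Oplus>a\<in>{..n - c}. D c (E a x \<otimes> E (n - c - a) y))"
        using lE x y by (intro linear_endos_finsum[OF dD(2)]) auto
      also have "\<dots> = (\<Oplus>a\<in>{..n - c}. \<Oplus>d\<in>{..c}. h d a (c - d))"
      proof (intro finsum_cong')
        fix a assume a: "a \<in> {..n - c}"
        have "D c (E a x \<otimes> E (n - c - a) y) = (\<Oplus>d\<in>{..c}. D d (E a x) \<otimes> D (c - d) (E (n - c - a) y))"
          using dD(4)[OF le, of c "E a x" "E (n - c - a) y"] c lE x y by simp
        also have "\<dots> = (\<Oplus>d\<in>{..c}. h d a (c - d))"
          using lD lE x y by (intro finsum_cong') (auto simp: h_def add.commute)
        finally show "D c (E a x \<otimes> E (n - c - a) y) = \<dots>" .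
      qed (use hB in auto)
      finally show "D c (E (n - c) (x \<otimes> y)) = (\<Oplus>a\<in>{..n - c}. \<Oplus>d\<in>{..c}. h d a (c - d))" .
    qed (use hB in auto)
    also have "\<dots> = (\<Oplus>a\<in>{..n}. \<Oplus>c\<in>{..n - a}. \<Oplus>d\<in>{..c}. h d a (c - d))"
      by (rule finsum_triangle_swap) (use hB in simp)
    also have "\<dots> = (\<Oplus>a\<in>{..n}. \<Oplus>d\<in>{..n - a}. \<Oplus>e\<in>{..n - a - d}. h d a e)"
      using hB by (intro finsum_cong' refl finsum_triangle) auto
    also have "\<dots> = (\<Oplus>d\<in>{..n}. \<Oplus>a\<in>{..n - d}. \<Oplus>e\<in>{..n - a - d}. h d a e)"
      by (rule finsum_triangle_swap) (use hB in simp)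
    also have "\<dots> = (\<Oplus>i\<in>{..n}. \<Oplus>d\<in>{..i}. \<Oplus>e\<in>{..n - (i - d) - d}. h d (i - d) e)"
      using hB by (intro finsum_triangle[of "\<lambda>d a. \<Oplus>e\<in>{..n - a - d}. h d a e" n, symmetric]) auto
    also have "\<dots> = (\<Oplus>i\<in>{..n}. F i x \<otimes> F (n - i) y)"
    proof (intro finsum_cong')
      fix i assume i: "i \<in> {..n}"
      have "F i x \<otimes> F (n - i) y = (\<Oplus>d\<in>{..i}. D d (E (i - d) x) \<otimes> (\<Oplus>e\<in>{..n - i}. D e (E (n - i - e) y)))"
        using x y lD lE by (simp add: F_def finsum_ldistr)
      also have "\<dots> = (\<Oplus>d\<in>{..i}. \<Oplus>e\<in>{..n - (i - d) - d}. h d (i - d) e)"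
      proof (intro finsum_cong')
        fix d assume d: "d \<in> {..i}"
        have eq: "n - (i - d) - d = n - i" "n - d - (i - d) = n - i" using d i by auto
        show "D d (E (i - d) x) \<otimes> (\<Oplus>e\<in>{..n - i}. D e (E (n - i - e) y)) = (\<Oplus>e\<in>{..n - (i - d) - d}. h d (i - d) e)"
          unfolding eq(1) h_def eq(2) using x y lD lE by (simp add: finsum_rdistr)
      qed (use hB in auto)
      finally show "(\<Oplus>d\<in>{..i}. \<Oplus>e\<in>{..n - (i - d) - d}. h d (i - d) e) = F i x \<otimes> F (n - i) y" by simp
    qed (use FB x y in auto)
    finally show "F n (x \<otimes> y) = (\<Oplus>i\<in>{..n}. F i x \<otimes> F (n - i) y)" .
  qed
  moreover have "F 1 = (\<lambda>x\<in>carrier B. \<delta> x \<oplus> \<epsilon> x)"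
  proof (rule extensionalityI[of _ "carrier B"])
    fix x assume x: "x \<in> carrier B"
    have "F 1 x = (\<Oplus>j\<in>{..Suc 0}. D j (E (Suc 0 - j) x))" using x by (simp add: F_def)
    also have "\<dots> = D 1 (E 0 x) \<oplus> D 0 (E 1 x)" using x lD lE by (simp add: finsum_Suc)
    also have "\<dots> = \<delta> x \<oplus> \<epsilon> x" using x dD(1) dE(1) D E lE(1)[OF x, of 1] by simp
    finally show "F 1 x = (\<lambda>x\<in>carrier B. \<delta> x \<oplus> \<epsilon> x) x" using x by simp
  qed (simp_all add: F_def)
  moreover have "(\<lambda>x\<in>carrier B. \<delta> x \<oplus> \<epsilon> x) \<in> Der k B" using Der_add d e IDer_sub_Der by blast
  ultimately show ?thesis using IDer_iff_total[OF m] by blast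
qed

text \<open>Replace \<open>D i\<close> by \<open>a\<^sup>i D i\<close>.\<close>

lemma IDer_smult:
  assumes m: "1 \<le> m" and d: "\<delta> \<in> IDer k B m" and a: "a \<in> carrier B"
  shows "(\<lambda>x\<in>carrier B. a \<otimes> \<delta> x) \<in> IDer k B m"
proof -
  obtain D where D: "total_hs m D" "D 1 = \<delta>" using d IDer_iff_total[OF m] by blast
  note dD = total_hsD[OF D(1)]
  note lD = linear_endosD[OF dD(2)]
  define F where "F i = (\<lambda>x\<in>carrier B. a [^] i \<otimes> D i x)" for i :: nat
  have "total_hs m F"
  proof (rule total_hsI)
    show "F 0 x = x" if "x \<in> carrier B" for x using that dD(1) by (simp add: F_def)
    show "F i \<in> linear_endos k B" for i
      unfolding F_def by (rule linear_endosI) (use a lD in \<open>simp_all add: r_distr smult_simps\<close>)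
    fix n x y assume n: "enat n \<le> m" and x: "x \<in> carrier B" and y: "y \<in> carrier B"
    have "F n (x \<otimes> y) = a [^] n \<otimes> (\<Oplus>j\<in>{..n}. D j x \<otimes> D (n - j) y)"
      using x y dD(4)[OF n x y] by (simp add: F_def)
    also have "\<dots> = (\<Oplus>j\<in>{..n}. a [^] n \<otimes> (D j x \<otimes> D (n - j) y))" using a x y lD by (simp add: finsum_rdistr)
    also have "\<dots> = (\<Oplus>j\<in>{..n}. F j x \<otimes> F (n - j) y)"
    proof (rule finsum_cong')
      fix j assume j: "j \<in> {..n}"
      then have "a [^] n = a [^] j \<otimes> a [^] (n - j)" using a by (simp add: nat_pow_mult)
      then show "a [^] n \<otimes> (D j x \<otimes> D (n - j) y) = F j x \<otimes> F (n - j) y" using a x y lD by (simp add: F_def m_ac)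
    qed (use a x y lD in \<open>auto simp: F_def\<close>)
    finally show "F n (x \<otimes> y) = (\<Oplus>j\<in>{..n}. F j x \<otimes> F (n - j) y)" .
  qed
  moreover have "F 1 = (\<lambda>x\<in>carrier B. a \<otimes> \<delta> x)" using a D by (simp add: F_def)
  moreover have "(\<lambda>x\<in>carrier B. a \<otimes> \<delta> x) \<in> Der k B" using Der_smult d a IDer_sub_Der by blast
  ultimately show ?thesis using IDer_iff_total[OF m] by blast
qed

text \<open>The coefficients of a ring homomorphism \<open>B \<rightarrow> B[[t]]\<close> that is the identity modulo \<open>t\<close> satisfy the
  product rules: they form a Hasse-Schmidt derivation of infinite length.\<close>

lemma IDer_of_series_hom:
  assumes \<Psi>: "\<Psi> \<in> Ring.ring_hom B (series_ring B)" and \<Psi>0: "\<And>b. b \<in> carrier B \<Longrightarrow> \<Psi> b 0 = b"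
    and lin: "\<And>c b i. c \<in> carrier k \<Longrightarrow> b \<in> carrier B \<Longrightarrow> \<Psi> (c \<odot> b) i = c \<odot> \<Psi> b i"
    and \<delta>: "\<delta> \<in> Der k B" "\<And>b. b \<in> carrier B \<Longrightarrow> \<Psi> b 1 = \<delta> b"
  shows "\<delta> \<in> IDer k B \<infinity>"
proof -
  define D where "D i = (\<lambda>b\<in>carrier B. \<Psi> b i)" for i
  have \<Psi>B: "\<Psi> b i \<in> carrier B" if "b \<in> carrier B" for b i using ring_hom_closed[OF \<Psi> that] by simp
  have "total_hs \<infinity> D"
  proof (rule total_hsI)
    show "D i \<in> linear_endos k B" for i
      unfolding D_def by (rule linear_endosI) (simp_all add: \<Psi>B lin ring_hom_add[OF \<Psi>])
    fix i x y assume xy: "x \<in> carrier B" "y \<in> carrier B"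
    then show "D i (x \<otimes> y) = (\<Oplus>j\<in>{..i}. D j x \<otimes> D (i - j) y)" by (simp add: D_def ring_hom_mult[OF \<Psi>])
  qed (simp add: D_def \<Psi>0)
  moreover have "D 1 = \<delta>"
    using \<delta> linear_endosD(4)[OF DerD(1)[OF \<delta>(1)]] by (intro extensionalityI[of _ "carrier B"]) (auto simp: D_def)
  ultimately show ?thesis using \<delta>(1) IDer_iff_total[of \<infinity>] by auto
qed

end

section \<open>Finite generation\<close>

lemma (in module) a_minus_add_cancel:
  "v \<in> carrier M \<Longrightarrow> y \<in> carrier M \<Longrightarrow> u \<in> carrier M \<Longrightarrow> v \<ominus>\<^bsub>M\<^esub> (y \<oplus>\<^bsub>M\<^esub> u) = (v \<ominus>\<^bsub>M\<^esub> y) \<ominus>\<^bsub>M\<^esub> u"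
  by (simp add: a_minus_def M.minus_add M.a_assoc)

definition (in module) closed_submodule :: "'c set \<Rightarrow> bool" where
  "closed_submodule N \<longleftrightarrow> N \<subseteq> carrier M \<and> \<zero>\<^bsub>M\<^esub> \<in> N \<and> (\<forall>v\<in>N. \<forall>w\<in>N. v \<oplus>\<^bsub>M\<^esub> w \<in> N) \<and>
     (\<forall>a\<in>carrier R. \<forall>v\<in>N. a \<odot>\<^bsub>M\<^esub> v \<in> N)"

lemma (in module) closed_submoduleD:
  assumes "closed_submodule N"
  shows "N \<subseteq> carrier M" "\<zero>\<^bsub>M\<^esub> \<in> N" "\<And>v w. v \<in> N \<Longrightarrow> w \<in> N \<Longrightarrow> v \<oplus>\<^bsub>M\<^esub> w \<in> N"
    "\<And>a v. a \<in> carrier R \<Longrightarrow> v \<in> N \<Longrightarrow> a \<odot>\<^bsub>M\<^esub> v \<in> N" using assms unfolding closed_submodule_def by blast+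

text \<open>The functions \<open>\<phi> j\<close> embed the module into a finite free one. The submodules of elements whose
  first \<open>m\<close> coordinates vanish have successive quotients isomorphic to ideals.\<close>

lemma (in module) finitely_generated_of_coordinates:
  fixes \<phi> :: "nat \<Rightarrow> 'c \<Rightarrow> 'a" and n :: nat
  assumes noeth: "noetherian_ring R"
    and \<phi>: "\<And>j v. v \<in> carrier M \<Longrightarrow> \<phi> j v \<in> carrier R"
      "\<And>j v w. v \<in> carrier M \<Longrightarrow> w \<in> carrier M \<Longrightarrow> \<phi> j (v \<oplus>\<^bsub>M\<^esub> w) = \<phi> j v \<oplus> \<phi> j w"
      "\<And>j a v. a \<in> carrier R \<Longrightarrow> v \<in> carrier M \<Longrightarrow> \<phi> j (a \<odot>\<^bsub>M\<^esub> v) = a \<otimes> \<phi> j v"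
    and inj: "\<And>v. v \<in> carrier M \<Longrightarrow> (\<And>j. j < n \<Longrightarrow> \<phi> j v = \<zero>) \<Longrightarrow> v = \<zero>\<^bsub>M\<^esub>"
  shows "\<exists>G. finite G \<and> G \<subseteq> carrier M \<and> (\<forall>N. closed_submodule N \<longrightarrow> G \<subseteq> N \<longrightarrow> N = carrier M)"
proof -
  define K where "K m = {v \<in> carrier M. \<forall>j<m. \<phi> j v = \<zero>}" for m :: nat
  have \<phi>0: "\<phi> j \<zero>\<^bsub>M\<^esub> = \<zero>" for j using \<phi>(3)[of \<zero> "\<zero>\<^bsub>M\<^esub>" j] \<phi>(1)[of "\<zero>\<^bsub>M\<^esub>" j] by simp
  have \<phi>m: "\<phi> j (v \<ominus>\<^bsub>M\<^esub> w) = \<phi> j v \<ominus> \<phi> j w" if "v \<in> carrier M" "w \<in> carrier M" for j v w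
  proof -
    have "\<ominus>\<^bsub>M\<^esub> w = (\<ominus> \<one>) \<odot>\<^bsub>M\<^esub> w" using that smult_l_minus[of \<one> w] by simp
    then have "\<phi> j (\<ominus>\<^bsub>M\<^esub> w) = \<ominus> \<phi> j w" using \<phi>(3)[of "\<ominus> \<one>" w j] \<phi>(1)[of w j] that by (simp add: R.l_minus)
    then show ?thesis using that \<phi>(2)[of v "\<ominus>\<^bsub>M\<^esub> w" j] by (simp add: a_minus_def)
  qed
  have K: "closed_submodule (K m)" for m unfolding closed_submodule_def K_def using \<phi> \<phi>0 by auto
  have "\<exists>G. finite G \<and> G \<subseteq> carrier M \<and>
    (\<forall>N. closed_submodule N \<longrightarrow> G \<subseteq> N \<longrightarrow> (\<forall>v\<in>carrier M. \<exists>y\<in>N. v \<ominus>\<^bsub>M\<^esub> y \<in> K m))" for m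
  proof (induction m)
    case 0
    have "v \<ominus>\<^bsub>M\<^esub> \<zero>\<^bsub>M\<^esub> \<in> K 0" if "v \<in> carrier M" for v using that by (simp add: K_def)
    then show ?case by (intro exI[of _ "{}"]) (auto dest: closed_submoduleD(2))
  next
    case (Suc m)
    then obtain G where G0: "finite G \<and> G \<subseteq> carrier M \<and>
      (\<forall>N. closed_submodule N \<longrightarrow> G \<subseteq> N \<longrightarrow> (\<forall>v\<in>carrier M. \<exists>y\<in>N. v \<ominus>\<^bsub>M\<^esub> y \<in> K m))" by (rule exE)
    have G: "finite G" "G \<subseteq> carrier M"
      "\<And>N v. closed_submodule N \<Longrightarrow> G \<subseteq> N \<Longrightarrow> v \<in> carrier M \<Longrightarrow> \<exists>y\<in>N. v \<ominus>\<^bsub>M\<^esub> y \<in> K m" using G0 by simp_all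
    have im_ideal: "ideal (\<phi> m ` N) R" if N: "closed_submodule N" for N
    proof (rule R.ideal_of_closed)
      note d = closed_submoduleD[OF N]
      show "\<phi> m ` N \<subseteq> carrier R" using \<phi>(1) d(1) by auto
      show "\<zero> \<in> \<phi> m ` N" using \<phi>0[of m] d(2) by (metis image_eqI)
      show "a \<otimes> x \<in> \<phi> m ` N" if a: "a \<in> carrier R" and x: "x \<in> \<phi> m ` N" for a x
      proof -
        obtain v where v: "v \<in> N" "x = \<phi> m v" using x by blast
        then have "\<phi> m (a \<odot>\<^bsub>M\<^esub> v) = a \<otimes> x" using \<phi>(3) a d(1) by blast
        then show ?thesis using d(4)[OF a v(1)] by (metis image_eqI)
      qed
      fix x y assume "x \<in> \<phi> m ` N" "y \<in> \<phi> m ` N"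
      then obtain v w where vw: "v \<in> N" "x = \<phi> m v" "w \<in> N" "y = \<phi> m w" by blast
      then have "\<phi> m (v \<oplus>\<^bsub>M\<^esub> w) = x \<oplus> y" using \<phi>(2) d(1) by blast
      then show "x \<oplus> y \<in> \<phi> m ` N" using d(3)[OF vw(1,3)] by (metis image_eqI)
    qed
    obtain Y where Y: "Y \<subseteq> carrier R" "finite Y" "\<phi> m ` K m = Idl Y"
      using noetherian_ring.finetely_gen[OF noeth im_ideal[OF K]] by blast
    have "Y \<subseteq> \<phi> m ` K m" using R.genideal_self[OF Y(1)] Y(3) by simp
    then obtain G' where G': "G' \<subseteq> K m" "finite G'" "\<phi> m ` G' = Y"
      using finite_subset_image[OF Y(2), of "\<phi> m" "K m"] by metis
    show ?case
    proof (intro exI[of _ "G \<union> G'"] conjI allI impI ballI)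
      show "finite (G \<union> G')" using G G' by simp
      show "G \<union> G' \<subseteq> carrier M" using G G' by (auto simp: K_def)
      fix N v assume N: "closed_submodule N" and sub: "G \<union> G' \<subseteq> N" and v: "v \<in> carrier M"
      note d = closed_submoduleD[OF N] and dK = closed_submoduleD[OF K[of m]]
      obtain y where y: "y \<in> N" "v \<ominus>\<^bsub>M\<^esub> y \<in> K m" using G(3)[OF N _ v] sub by auto
      have NK: "closed_submodule (N \<inter> K m)" unfolding closed_submodule_def using d dK by (simp add: le_infI1)
      have "Y \<subseteq> \<phi> m ` (N \<inter> K m)" using G' sub by blast
      then have "Idl Y \<subseteq> \<phi> m ` (N \<inter> K m)" by (rule R.genideal_minimal[OF im_ideal[OF NK]])
      then obtain u where u: "u \<in> N" "u \<in> K m" "\<phi> m (v \<ominus>\<^bsub>M\<^esub> y) = \<phi> m u" using y(2) Y(3) by blast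
      have R: "y \<in> carrier M" "u \<in> carrier M" "v \<ominus>\<^bsub>M\<^esub> y \<in> carrier M" using y u d(1) dK(1) by auto
      have "v \<ominus>\<^bsub>M\<^esub> (y \<oplus>\<^bsub>M\<^esub> u) = (v \<ominus>\<^bsub>M\<^esub> y) \<ominus>\<^bsub>M\<^esub> u" using a_minus_add_cancel v R by simp
      moreover have "\<phi> j ((v \<ominus>\<^bsub>M\<^esub> y) \<ominus>\<^bsub>M\<^esub> u) = \<zero>" if "j < Suc m" for j
        using that u y(2) R \<phi>(1)[OF R(2)] unfolding \<phi>m[OF R(3,2)] by (auto simp: K_def less_Suc_eq a_minus_def R.r_neg)
      ultimately have "v \<ominus>\<^bsub>M\<^esub> (y \<oplus>\<^bsub>M\<^esub> u) \<in> K (Suc m)" using v R by (simp add: K_def)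
      then show "\<exists>y\<in>N. v \<ominus>\<^bsub>M\<^esub> y \<in> K (Suc m)" using d(3) y u by blast
    qed
  qed
  from this[of n] obtain G where G0: "finite G \<and> G \<subseteq> carrier M \<and>
    (\<forall>N. closed_submodule N \<longrightarrow> G \<subseteq> N \<longrightarrow> (\<forall>v\<in>carrier M. \<exists>y\<in>N. v \<ominus>\<^bsub>M\<^esub> y \<in> K n))" by (rule exE)
  have G: "finite G" "G \<subseteq> carrier M"
    "\<And>N v. closed_submodule N \<Longrightarrow> G \<subseteq> N \<Longrightarrow> v \<in> carrier M \<Longrightarrow> \<exists>y\<in>N. v \<ominus>\<^bsub>M\<^esub> y \<in> K n" using G0 by simp_all
  have "N = carrier M" if N: "closed_submodule N" "G \<subseteq> N" for N
  proof
    show "N \<subseteq> carrier M" using closed_submoduleD(1)[OF N(1)] .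
    show "carrier M \<subseteq> N"
    proof
      fix v assume v: "v \<in> carrier M"
      obtain y where y: "y \<in> N" "v \<ominus>\<^bsub>M\<^esub> y \<in> K n" using G(3)[OF N v] by blast
      have yM: "y \<in> carrier M" using y closed_submoduleD(1)[OF N(1)] by blast
      have "v \<ominus>\<^bsub>M\<^esub> y = \<zero>\<^bsub>M\<^esub>" using y(2) inj[of "v \<ominus>\<^bsub>M\<^esub> y"] by (simp add: K_def)
      then have "v = y" using M.minus_equality[of v "\<ominus>\<^bsub>M\<^esub> y"] v yM by (simp add: a_minus_def)
      then show "v \<in> N" using y by simp
    qed
  qed
  then show ?thesis using G by blast
qed

section \<open>Derivations of a localized quotient of a polynomial ring\<close>

text \<open>\<open>B\<close> is the local ring at \<open>P\<close> of the quotient of the polynomial ring by \<open>I\<close>, as a \<open>k\<close>-algebra.\<close>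

locale local_quotient =
  fixes n :: nat and I P :: "'k::comm_ring_1 mpoly set" and B :: "('k, 'b, 'e) module_scheme" (structure)
    and \<theta> :: "'k mpoly \<Rightarrow> 'b"
  assumes noetherian_R: "noetherian_subring (mpolys n :: 'k mpoly set)"
    and fraction_map: "prime_fraction_map (mpolys.ring_of n) B I P \<theta>"
    and algebra_B: "algebra (class_ring :: 'k ring) B"
    and smult_B: "\<And>c b. b \<in> carrier B \<Longrightarrow> c \<odot> b = \<theta> (cst c) \<otimes> b"
    and I_idl: "mpolys.idl n I"

sublocale local_quotient \<subseteq> kalg "class_ring :: 'k ring" B
  by (rule kalg.intro[OF algebra_B])

sublocale local_quotient \<subseteq> F: prime_fraction_map "mpolys.ring_of n" B I P \<theta>
  by (rule fraction_map)

sublocale local_quotient \<subseteq> N: noetherian_subring "mpolys n :: 'k mpoly set"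
  by (rule noetherian_R)

context local_quotient begin

abbreviation R :: "'k mpoly set" where "R \<equiv> mpolys n"

lemma \<theta>_closed [simp]: "f \<in> R \<Longrightarrow> \<theta> f \<in> carrier B" using F.hom_closed[of f] by simp

lemma \<theta>_simps:
  "f \<in> R \<Longrightarrow> g \<in> R \<Longrightarrow> \<theta> (f * g) = \<theta> f \<otimes> \<theta> g" "f \<in> R \<Longrightarrow> g \<in> R \<Longrightarrow> \<theta> (f + g) = \<theta> f \<oplus> \<theta> g"
  "\<theta> 1 = \<one>" "\<theta> 0 = \<zero>" using F.hom_simps(1)[of f g] F.hom_simps(2)[of f g] F.hom_simps(3,4) by simp_all

lemma \<theta>_sum: "finite S \<Longrightarrow> (\<And>i. i \<in> S \<Longrightarrow> f i \<in> R) \<Longrightarrow> \<theta> (\<Sum>i\<in>S. f i) = (\<Oplus>i\<in>S. \<theta> (f i))"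
proof (induction S rule: finite_induct)
  case (insert i S)
  have "(\<Sum>i\<in>S. f i) \<in> R" using insert.prems by (intro mpolys.sum_mem) auto
  then show ?case using insert by (simp add: \<theta>_simps Pi_def)
qed (simp add: \<theta>_simps)

lemma \<theta>_surj:
  assumes "b \<in> carrier B" obtains a s where "a \<in> R" "s \<in> R - P" "\<theta> s \<otimes> b = \<theta> a"
  using F.surj[OF assms] by auto

lemma \<theta>_kernel: "f \<in> R \<Longrightarrow> \<theta> f = \<zero> \<longleftrightarrow> (\<exists>s\<in>R - P. s * f \<in> I)"
  using F.kernel[of f] by simp

lemma \<theta>_unit: "s \<in> R - P \<Longrightarrow> \<theta> s \<in> Units B" using F.units[of s] by simp

lemma P_prm: "mpolys.prm n P" using F.P.primeideal_axioms by (simp add: mpolys.prm_iff_primeideal)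

lemma Der_cst: assumes "\<delta> \<in> Der class_ring B" shows "\<delta> (\<theta> (cst c)) = \<zero>"
proof -
  have "\<theta> (cst c) = c \<odot> \<one>" using smult_B[of \<one> c] by simp
  then have "\<delta> (\<theta> (cst c)) = c \<odot> \<delta> \<one>" using linear_endosD(3)[OF DerD(1)[OF assms], of c \<one>] by simp
  then show ?thesis using DerD(4)[OF assms] smult_simps(2)[of c] by simp
qed

lemma Der_determined:
  assumes \<delta>: "\<delta> \<in> Der class_ring B" and \<epsilon>: "\<epsilon> \<in> Der class_ring B" and eq: "\<And>j. j < n \<Longrightarrow> \<delta> (\<theta> (Xvar j)) = \<epsilon> (\<theta> (Xvar j))"
  shows "\<delta> = \<epsilon>"
proof (rule Der_eqI[OF \<delta> \<epsilon>])
  note d = DerD[OF \<delta>] and e = DerD[OF \<epsilon>]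
  have poly: "\<delta> (\<theta> f) = \<epsilon> (\<theta> f)" if "f \<in> R" for f using that
  proof (induction f rule: mpoly_induct_in)
    case (cst c) then show ?case using Der_cst[OF \<delta>] Der_cst[OF \<epsilon>] by simp
  next
    case (Xvar j) then show ?case using eq by simp
  next
    case (add f g)
    then show ?case using linear_endosD(2)[OF d(1)] linear_endosD(2)[OF e(1)] by (simp add: \<theta>_simps)
  next
    case (mult f g) then show ?case using d(2) e(2) by (simp add: \<theta>_simps)
  qed
  fix b assume b: "b \<in> carrier B"
  obtain a s where a: "a \<in> R" "s \<in> R - P" "\<theta> s \<otimes> b = \<theta> a" using \<theta>_surj[OF b] .
  have sB: "\<theta> s \<in> carrier B" using a by simp
  have "\<theta> s \<otimes> \<delta> b \<oplus> b \<otimes> \<delta> (\<theta> s) = \<theta> s \<otimes> \<epsilon> b \<oplus> b \<otimes> \<delta> (\<theta> s)"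
    using d(2)[OF sB b] e(2)[OF sB b] poly[of s] poly[of a] a by simp
  then have "\<theta> s \<otimes> \<delta> b = \<theta> s \<otimes> \<epsilon> b" using a b sB d(3) e(3) by simp
  then show "\<delta> b = \<epsilon> b" using Units_l_cancel[OF \<theta>_unit[OF a(2)] d(3)[OF b] e(3)[OF b]] by simp
qed

lemma Der_finitely_generated:
  "\<exists>G. finite G \<and> G \<subseteq> carrier DerV \<and> (\<forall>N. module.closed_submodule B DerV N \<longrightarrow> G \<subseteq> N \<longrightarrow> N = carrier DerV)"
proof -
  interpret V: module B DerV by (rule DerV_module)
  show ?thesis
  proof (rule V.finitely_generated_of_coordinates[of "\<lambda>j v. if j < n then v (\<theta> (Xvar j)) else \<zero>" n])
    show "noetherian_ring B" by (rule F.noetherian_fractions[OF N.noetherian])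
    fix v assume v: "v \<in> carrier DerV" and z: "\<And>j. j < n \<Longrightarrow> (if j < n then v (\<theta> (Xvar j)) else \<zero>) = \<zero>"
    show "v = \<zero>\<^bsub>DerV\<^esub>" by (rule Der_determined) (use v z V.zero_closed Der_zero in \<open>auto simp: DerV_simps\<close>)
  qed (auto simp: DerV_simps DerD(3))
qed

text \<open>A common denominator makes the values on the variables polynomial. The resulting derivation of
  the polynomial ring sends each of the finitely many generators of \<open>I\<close> to an element that
  vanishes in \<open>B\<close>; a further denominator brings these values into \<open>I\<close>.\<close>

lemma clear_denominators:
  assumes \<delta>: "\<delta> \<in> Der class_ring B"
  shows "\<exists>s d. s \<in> R - P \<and> (\<forall>j. d j \<in> R) \<and> (\<forall>j<n. \<theta> s \<otimes> \<delta> (\<theta> (Xvar j)) = \<theta> (d j)) \<and>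
    (\<forall>f\<in>I. (\<Sum>j<n. d j * mpoly_pderiv j f) \<in> I)"
proof -
  note dd = DerD[OF \<delta>] and dI = mpolys.idlD[OF I_idl]
  have "\<exists>s d. s \<in> R - P \<and> (\<forall>j<m. d j \<in> R \<and> \<theta> s \<otimes> \<delta> (\<theta> (Xvar j)) = \<theta> (d j))" if "m \<le> n" for m using that
  proof (induction m)
    case 0 then show ?case using mpolys.prm_one_compl[OF P_prm] by blast
  next
    case (Suc m)
    then obtain s d where s: "s \<in> R - P" "\<And>j. j < m \<Longrightarrow> d j \<in> R" "\<And>j. j < m \<Longrightarrow> \<theta> s \<otimes> \<delta> (\<theta> (Xvar j)) = \<theta> (d j)"
      by auto
    have xm: "\<delta> (\<theta> (Xvar m)) \<in> carrier B" using dd(3) Suc.prems by simp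
    obtain a t where a: "a \<in> R" "t \<in> R - P" "\<theta> t \<otimes> \<delta> (\<theta> (Xvar m)) = \<theta> a" using \<theta>_surj[OF xm] .
    define d' where "d' j = (if j = m then s * a else t * d j)" for j
    have "\<theta> (s * t) \<otimes> \<delta> (\<theta> (Xvar j)) = \<theta> (d' j)" "d' j \<in> R" if "j < Suc m" for j
    proof -
      have xj: "\<delta> (\<theta> (Xvar j)) \<in> carrier B" using dd(3) Suc.prems that by simp
      show "d' j \<in> R" using s a that by (auto simp: d'_def)
      show "\<theta> (s * t) \<otimes> \<delta> (\<theta> (Xvar j)) = \<theta> (d' j)"
      proof (cases "j = m")
        case True
        have "\<theta> (s * t) \<otimes> \<delta> (\<theta> (Xvar m)) = \<theta> s \<otimes> (\<theta> t \<otimes> \<delta> (\<theta> (Xvar m)))"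
          using s(1) a(1,2) xm by (simp add: \<theta>_simps m_assoc)
        then show ?thesis using True a s(1) by (simp add: d'_def \<theta>_simps)
      next
        case False
        have "\<theta> (s * t) \<otimes> \<delta> (\<theta> (Xvar j)) = \<theta> t \<otimes> (\<theta> s \<otimes> \<delta> (\<theta> (Xvar j)))"
          using s(1) a(1,2) xj by (simp add: \<theta>_simps m_ac)
        then show ?thesis using False that s a by (simp add: d'_def \<theta>_simps)
      qed
    qed
    then show ?case using mpolys.prm_mult_compl[OF P_prm s(1) a(2)] by blast
  qed
  from this[of n] obtain s d0 where s: "s \<in> R - P" "\<And>j. j < n \<Longrightarrow> d0 j \<in> R"
    "\<And>j. j < n \<Longrightarrow> \<theta> s \<otimes> \<delta> (\<theta> (Xvar j)) = \<theta> (d0 j)" by auto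
  define D where "D f = (\<Sum>j<n. d0 j * mpoly_pderiv j f)" for f
  have DR: "D f \<in> R" if "f \<in> R" for f
    unfolding D_def using s(2) that by (intro mpolys.sum_mem mpolys.mult_mem pderiv_mem) auto
  have D_add: "D (f + g) = D f + D g" for f g by (simp add: D_def pderiv_add distrib_left sum.distrib)
  have D_mult: "D (f * g) = f * D g + g * D f" for f g
    by (simp add: D_def pderiv_mult distrib_left sum.distrib sum_distrib_left mult_ac)
  have sB: "\<theta> s \<in> carrier B" using s by simp
  have D_\<delta>: "\<theta> s \<otimes> \<delta> (\<theta> f) = \<theta> (D f)" if "f \<in> R" for f using that
  proof (induction f rule: mpoly_induct_in)
    case (cst c) then show ?case using Der_cst[OF \<delta>] sB by (simp add: D_def \<theta>_simps)
  next
    case (Xvar j)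
    have "D (Xvar j) = (\<Sum>i<n. if i = j then d0 i else 0)"
      unfolding D_def by (intro sum.cong) (auto simp: pderiv_Xvar)
    then show ?case using Xvar s(3) by simp
  next
    case (add f g)
    then show ?case using linear_endosD(2)[OF dd(1)] DR sB dd(3) by (simp add: \<theta>_simps D_add r_distr)
  next
    case (mult f g)
    have "\<theta> s \<otimes> \<delta> (\<theta> (f * g)) = \<theta> f \<otimes> (\<theta> s \<otimes> \<delta> (\<theta> g)) \<oplus> \<theta> g \<otimes> (\<theta> s \<otimes> \<delta> (\<theta> f))"
      using mult.hyps sB dd by (simp add: \<theta>_simps r_distr m_lcomm)
    then show ?case unfolding mult.IH D_mult using mult.hyps DR by (simp add: \<theta>_simps)
  qed
  obtain X where X: "X \<subseteq> R" "finite X" "I = mpolys.gen n X"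
    using N.noetherian mpolys.noetherian_iff I_idl by blast
  have XI: "X \<subseteq> I" using mpolys.gen_upper X(3) by blast
  have "\<exists>t\<in>R - P. \<forall>f\<in>Y. t * D f \<in> I" if "finite Y" "Y \<subseteq> I" for Y using that
  proof (induction Y rule: finite_induct)
    case empty then show ?case using mpolys.prm_one_compl[OF P_prm] by blast
  next
    case (insert f Y)
    then obtain t where t: "t \<in> R - P" "\<And>f. f \<in> Y \<Longrightarrow> t * D f \<in> I" by auto
    have f: "f \<in> I" "f \<in> R" using insert.prems dI(3) by auto
    have "1 * f \<in> I" using f by simp
    then have "\<theta> f = \<zero>" using \<theta>_kernel[OF f(2)] mpolys.prm_one_compl[OF P_prm] by blast
    then have "\<theta> (D f) = \<zero>" using D_\<delta>[OF f(2)] linear_endosD(5)[OF dd(1)] sB by simp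
    then obtain w where w: "w \<in> R - P" "w * D f \<in> I" using \<theta>_kernel[OF DR[OF f(2)]] by blast
    have "(t * w) * D h \<in> I" if h: "h \<in> insert f Y" for h
    proof (cases "h = f")
      case True then show ?thesis using dI(5)[of t "w * D f"] t w by (simp add: mult.assoc)
    next
      case False
      then have "w * (t * D h) \<in> I" using dI(5)[of w "t * D h"] t w h by blast
      then show ?thesis by (simp add: mult_ac)
    qed
    then show ?case using mpolys.prm_mult_compl[OF P_prm t(1) w(1)] by blast
  qed
  from this[of X] obtain t where t: "t \<in> R - P" "\<And>f. f \<in> X \<Longrightarrow> t * D f \<in> I" using X XI by blast
  have "mpolys.idl n {f \<in> I. t * D f \<in> I}" unfolding mpolys.idl_def
  proof (intro conjI ballI)
    show "{f \<in> I. t * D f \<in> I} \<subseteq> R" using dI(3) by blast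
    have "D 0 = 0" by (simp add: D_def)
    then show "0 \<in> {f \<in> I. t * D f \<in> I}" using dI(2) by simp
    show "f + g \<in> {f \<in> I. t * D f \<in> I}" if "f \<in> {f \<in> I. t * D f \<in> I}" "g \<in> {f \<in> I. t * D f \<in> I}" for f g
      using that dI(4) by (simp add: D_add distrib_left)
    fix r f assume r: "r \<in> R" and f: "f \<in> {f \<in> I. t * D f \<in> I}"
    have "t * D (r * f) = r * (t * D f) + (t * D r) * f" by (simp add: D_mult algebra_simps)
    also have "\<dots> \<in> I" using dI(4)[OF dI(5)[OF r] dI(5)] r f t DR[OF r] by auto
    finally show "r * f \<in> {f \<in> I. t * D f \<in> I}" using f r dI(5) by simp
  qed
  then have "I \<subseteq> {f \<in> I. t * D f \<in> I}" using t(2) XI X(3) mpolys.gen_least[of n _ X] by blast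
  then have tD: "t * D f \<in> I" if "f \<in> I" for f using that by blast
  define d where "d j = (if j < n then t * d0 j else 0)" for j
  have "(\<Sum>j<n. d j * mpoly_pderiv j f) = t * D f" for f by (simp add: d_def D_def sum_distrib_left mult.assoc)
  moreover have "\<theta> (t * s) \<otimes> \<delta> (\<theta> (Xvar j)) = \<theta> (d j)" if "j < n" for j
  proof -
    have "\<theta> (t * s) \<otimes> \<delta> (\<theta> (Xvar j)) = \<theta> t \<otimes> (\<theta> s \<otimes> \<delta> (\<theta> (Xvar j)))"
      using t(1) s(1) that dd(3) by (simp add: \<theta>_simps m_assoc)
    then show ?thesis using that s(2,3) t(1) by (simp add: d_def \<theta>_simps)
  qed
  moreover have "d j \<in> R" for j using s(2) t(1) by (simp add: d_def)
  ultimately show ?thesis using tD mpolys.prm_mult_compl[OF P_prm t(1) s(1)]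
    by (intro exI[of _ "t * s"] exI[of _ d]) simp
qed

text \<open>The substitution followed by \<open>\<theta>\<close> kills \<open>I\<close> and sends elements outside \<open>P\<close> to units of \<open>B[[t]]\<close>,
  so it factors through \<open>B\<close>.\<close>

lemma integrable_of_lift:
  fixes u :: "nat \<Rightarrow> 'k mpoly fps"
  assumes \<delta>: "\<delta> \<in> Der class_ring B"
    and uR: "\<And>f. f \<in> R \<Longrightarrow> shift_eval u f \<in> coeffs_in R" "\<And>f. f \<in> R \<Longrightarrow> fps_nth (shift_eval u f) 0 = f"
    and uI: "\<And>f. f \<in> I \<Longrightarrow> shift_eval u f \<in> coeffs_in I"
    and u1: "\<And>j. j < n \<Longrightarrow> \<theta> (fps_nth (shift_eval u (Xvar j)) 1) = \<delta> (\<theta> (Xvar j))"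
  shows "\<delta> \<in> IDer class_ring B \<infinity>"
proof -
  define \<Theta> where "\<Theta> f i = \<theta> (fps_nth (shift_eval u f) i)" for f i
  have cR: "fps_nth (shift_eval u f) i \<in> R" if "f \<in> R" for f i using uR(1)[OF that] by (simp add: coeffs_in_def)
  interpret S: cring "series_ring B" by (rule series_ring_cring)
  have \<Theta>: "\<Theta> \<in> Ring.ring_hom (mpolys.ring_of n) (series_ring B)"
  proof (rule ring_hom_memI)
    fix f g :: "'k mpoly" assume f: "f \<in> carrier (mpolys.ring_of n)" and g: "g \<in> carrier (mpolys.ring_of n)"
    show "\<Theta> f \<in> carrier (series_ring B)" using f cR by (simp add: \<Theta>_def)
    show "\<Theta> (f \<otimes>\<^bsub>mpolys.ring_of n\<^esub> g) = \<Theta> f \<otimes>\<^bsub>series_ring B\<^esub> \<Theta> g"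
    proof
      fix i
      have "\<Theta> (f * g) i = \<theta> (\<Sum>j\<in>{..i}. fps_nth (shift_eval u f) j * fps_nth (shift_eval u g) (i - j))"
        by (simp add: \<Theta>_def shift_eval_simps fps_mult_nth atLeast0AtMost)
      also have "\<dots> = (\<Oplus>j\<in>{..i}. \<theta> (fps_nth (shift_eval u f) j * fps_nth (shift_eval u g) (i - j)))"
        using f g cR by (intro \<theta>_sum) auto
      also have "\<dots> = (\<Theta> f \<otimes>\<^bsub>series_ring B\<^esub> \<Theta> g) i"
        using f g cR by (auto simp: \<Theta>_def \<theta>_simps intro!: finsum_cong')
      finally show "\<Theta> (f \<otimes>\<^bsub>mpolys.ring_of n\<^esub> g) i = (\<Theta> f \<otimes>\<^bsub>series_ring B\<^esub> \<Theta> g) i" by simp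
    qed
    show "\<Theta> (f \<oplus>\<^bsub>mpolys.ring_of n\<^esub> g) = \<Theta> f \<oplus>\<^bsub>series_ring B\<^esub> \<Theta> g"
      using f g cR by (intro ext) (simp add: \<Theta>_def shift_eval_simps \<theta>_simps)
  next
    show "\<Theta> \<one>\<^bsub>mpolys.ring_of n\<^esub> = \<one>\<^bsub>series_ring B\<^esub>" by (intro ext) (simp add: \<Theta>_def \<theta>_simps)
  qed
  have \<theta>I: "\<theta> f = \<zero>" if "f \<in> I" for f
  proof -
    have "1 * f \<in> I" "f \<in> R" using that mpolys.idlD(3)[OF I_idl] by auto
    then show ?thesis using \<theta>_kernel mpolys.prm_one_compl[OF P_prm] by blast
  qed
  have "\<exists>\<Psi>\<in>Ring.ring_hom B (series_ring B). \<forall>a\<in>carrier (mpolys.ring_of n). \<Psi> (\<theta> a) = \<Theta> a"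
  proof (rule F.universal_property[OF S.is_cring \<Theta>])
    show "\<Theta> a = \<zero>\<^bsub>series_ring B\<^esub>" if "a \<in> I" for a
      using uI[OF that] \<theta>I by (intro ext) (simp add: \<Theta>_def coeffs_in_def)
    fix s :: "'k mpoly" assume s: "s \<in> carrier (mpolys.ring_of n) - P"
    have "\<Theta> s 0 \<in> Units B" using \<theta>_unit[of s] s uR(2)[of s] by (simp add: \<Theta>_def)
    then show "\<Theta> s \<in> Units (series_ring B)" using s cR by (intro series_unit) (auto simp: \<Theta>_def)
  qed
  then obtain \<Psi> where \<Psi>: "\<Psi> \<in> Ring.ring_hom B (series_ring B)" and \<Psi>\<theta>: "\<And>a. a \<in> R \<Longrightarrow> \<Psi> (\<theta> a) = \<Theta> a" by auto
  have \<Psi>B: "\<Psi> b i \<in> carrier B" if "b \<in> carrier B" for b i using ring_hom_closed[OF \<Psi> that] by simp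
  have \<Psi>0: "\<Psi> b 0 = b" if b: "b \<in> carrier B" for b
  proof -
    obtain a s where a: "a \<in> R" "s \<in> R - P" "\<theta> s \<otimes> b = \<theta> a" using \<theta>_surj[OF b] .
    have "\<Psi> (\<theta> s) \<otimes>\<^bsub>series_ring B\<^esub> \<Psi> b = \<Psi> (\<theta> a)" using ring_hom_mult[OF \<Psi>, of "\<theta> s" b] a b by simp
    then have "(\<Psi> (\<theta> s) \<otimes>\<^bsub>series_ring B\<^esub> \<Psi> b) 0 = \<Psi> (\<theta> a) 0" by simp
    then have "\<theta> s \<otimes> \<Psi> b 0 = \<theta> s \<otimes> b" using a \<Psi>\<theta> uR(2) \<Psi>B[OF b] by (simp add: \<Theta>_def)
    then show ?thesis using Units_l_cancel[OF \<theta>_unit[OF a(2)] \<Psi>B[OF b] b] by simp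
  qed
  have cst_series: "shift_eval u (cst c) = fps_const (cst c)" for c by (rule shift_eval_simps)
  have lin: "\<Psi> (c \<odot> b) i = c \<odot> \<Psi> b i" if b: "b \<in> carrier B" for c b i
  proof -
    have "\<Psi> (c \<odot> b) = \<Theta> (cst c) \<otimes>\<^bsub>series_ring B\<^esub> \<Psi> b"
      unfolding smult_B[OF b] using ring_hom_mult[OF \<Psi>, of "\<theta> (cst c)" b] b \<Psi>\<theta>[of "cst c"] by simp
    then have "\<Psi> (c \<odot> b) i = (\<Oplus>j\<in>{..i}. \<Theta> (cst c) j \<otimes> \<Psi> b (i - j))" by simp
    also have "\<dots> = \<theta> (cst c) \<otimes> \<Psi> b i"
    proof (cases i)
      case 0 then show ?thesis using \<Psi>B[OF b] by (simp add: \<Theta>_def cst_series)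
    next
      case (Suc m)
      have "(\<Oplus>j\<in>{..Suc m}. \<Theta> (cst c) j \<otimes> \<Psi> b (Suc m - j))
        = (\<Oplus>j\<in>{..m}. \<Theta> (cst c) (Suc j) \<otimes> \<Psi> b (Suc m - Suc j)) \<oplus> \<Theta> (cst c) 0 \<otimes> \<Psi> b (Suc m - 0)"
        using \<Psi>B[OF b] cR by (intro finsum_Suc2) (auto simp: \<Theta>_def)
      also have "(\<Oplus>j\<in>{..m}. \<Theta> (cst c) (Suc j) \<otimes> \<Psi> b (Suc m - Suc j)) = (\<Oplus>j\<in>{..m}. \<zero>)"
        using \<Psi>B[OF b] by (intro finsum_cong') (auto simp: \<Theta>_def cst_series \<theta>_simps)
      finally show ?thesis using Suc \<Psi>B[OF b] by (simp add: \<Theta>_def cst_series finsum_zero)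
    qed
    also have "\<dots> = c \<odot> \<Psi> b i" using smult_B[OF \<Psi>B[OF b]] by simp
    finally show ?thesis .
  qed
  define D1 where "D1 = (\<lambda>b\<in>carrier B. \<Psi> b 1)"
  have D1: "D1 \<in> Der class_ring B"
  proof (rule DerI)
    show "D1 \<in> linear_endos class_ring B"
      unfolding D1_def by (rule linear_endosI) (simp_all add: \<Psi>B lin ring_hom_add[OF \<Psi>])
    fix x y assume xy: "x \<in> carrier B" "y \<in> carrier B"
    have "\<Psi> (x \<otimes> y) 1 = (\<Oplus>j\<in>{..Suc 0}. \<Psi> x j \<otimes> \<Psi> y (Suc 0 - j))" using ring_hom_mult[OF \<Psi> xy] by simp
    also have "\<dots> = \<Psi> x 1 \<otimes> y \<oplus> x \<otimes> \<Psi> y 1" using xy \<Psi>B by (simp add: finsum_Suc \<Psi>0)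
    finally show "D1 (x \<otimes> y) = x \<otimes> D1 y \<oplus> y \<otimes> D1 x"
      using xy \<Psi>B[OF xy(1), of 1] \<Psi>B[OF xy(2), of 1] by (simp add: D1_def m_comm a_comm)
  qed
  have "D1 = \<delta>" by (rule Der_determined[OF D1 \<delta>]) (use u1 \<Psi>\<theta> in \<open>simp add: D1_def \<Theta>_def\<close>)
  then show ?thesis using IDer_of_series_hom[OF \<Psi> \<Psi>0 _ \<delta>] lin by (auto simp: D1_def)
qed

text \<open>Lift the derivation to a vector field on the polynomial ring after clearing a denominator \<open>s\<close>,
  which is a unit of \<open>B\<close>, and integrate with \<open>integrate_multiple\<close>.\<close>

lemma minor_power_integrates:
  fixes g :: "nat \<Rightarrow> 'k mpoly"
  assumes g: "\<And>i. i < r \<Longrightarrow> g i \<in> I" and c: "\<And>l. l < r \<Longrightarrow> c l < n"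
    and \<Delta>: "\<Delta> = det (mat r r (\<lambda>(i, l). mpoly_pderiv (c l) (g i)))"
    and conormal: "\<And>f. f \<in> I \<Longrightarrow> \<Delta> ^ N * f \<in> mpolys.gen n (g ` {..<r} \<union> {a * b |a b. a \<in> I \<and> b \<in> I})"
  shows "\<exists>e. \<forall>\<delta>\<in>Der class_ring B. (\<lambda>x\<in>carrier B. \<theta> (\<Delta> ^ e) \<otimes> \<delta> x) \<in> IDer class_ring B \<infinity>"
proof -
  note dI = mpolys.idlD[OF I_idl]
  have \<Delta>R: "\<Delta> \<in> R" unfolding \<Delta> by (rule mpolys.det_mem) (use g dI(3) pderiv_mem in blast)
  \<comment> \<open>ascending chain condition: a single power of \<open>\<Delta>\<close> kills all the \<open>\<Delta>\<close>-torsion modulo \<open>I\<close>\<close>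
  define J where "J m = {f \<in> R. \<Delta> ^ m * f \<in> I}" for m :: nat
  have J_mono: "J m \<subseteq> J m'" if "m \<le> m'" for m m'
  proof
    fix f assume f: "f \<in> J m"
    have "\<Delta> ^ m' * f = \<Delta> ^ (m' - m) * (\<Delta> ^ m * f)" using that by (simp add: mult.assoc[symmetric] flip: power_add)
    then show "f \<in> J m'" using f dI(5)[of "\<Delta> ^ (m' - m)"] \<Delta>R by (auto simp: J_def)
  qed
  have "\<exists>M\<in>range J. \<forall>I\<in>range J. M \<subseteq> I \<longrightarrow> I = M"
  proof (rule N.idl_family_has_maximal)
    fix K assume "K \<in> range J"
    then obtain m where m: "K = J m" by blast
    show "mpolys.idl n K" unfolding m mpolys.idl_def J_def using dI by (auto simp: distrib_left mult.left_commute)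
  qed simp
  then obtain e0 where e0: "\<And>m. J e0 \<subseteq> J m \<Longrightarrow> J m = J e0" by auto
  \<comment> \<open>\<open>integrate_multiple\<close> needs an exponent that is positive and at least \<open>N\<close>, besides the torsion bound \<open>e0\<close>\<close>
  define e where "e = Suc (e0 + N)"
  have tors: "\<Delta> ^ e * f \<in> I" if "f \<in> R" "\<Delta> ^ m * f \<in> I" for f m
  proof -
    have "f \<in> J (max m e0)" using J_mono[of m "max m e0"] that by (auto simp: J_def)
    then have "f \<in> J e0" using e0[of "max m e0"] J_mono[of e0 "max m e0"] by auto
    then have "f \<in> J e" using J_mono[of e0 e] by (auto simp: e_def)
    then show ?thesis by (simp add: J_def)
  qed
  have "(\<lambda>x\<in>carrier B. \<theta> (\<Delta> ^ (2 * e)) \<otimes> \<delta> x) \<in> IDer class_ring B \<infinity>" if \<delta>: "\<delta> \<in> Der class_ring B" for \<delta>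
  proof -
    obtain s d where s: "s \<in> R - P" and dR: "\<And>j. d j \<in> R"
      and ds: "\<And>j. j < n \<Longrightarrow> \<theta> s \<otimes> \<delta> (\<theta> (Xvar j)) = \<theta> (d j)"
      and log: "\<And>f. f \<in> I \<Longrightarrow> (\<Sum>j<n. d j * mpoly_pderiv j f) \<in> I"
      using clear_denominators[OF \<delta>] by blast
    have "\<exists>u. (\<forall>f\<in>R. shift_eval u f \<in> coeffs_in R \<and> fps_nth (shift_eval u f) 0 = f) \<and>
      (\<forall>f\<in>I. shift_eval u f \<in> coeffs_in I) \<and> (\<forall>j. fps_nth (shift_eval u (Xvar j)) 1 = \<Delta> ^ (2 * e) * d j)"
      by (rule integrate_multiple[OF I_idl g c dR log \<Delta> conormal _ _ tors]) (auto simp: e_def)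
    then obtain u where u: "\<And>f. f \<in> R \<Longrightarrow> shift_eval u f \<in> coeffs_in R" "\<And>f. f \<in> R \<Longrightarrow> fps_nth (shift_eval u f) 0 = f"
      "\<And>f. f \<in> I \<Longrightarrow> shift_eval u f \<in> coeffs_in I" "\<And>j. fps_nth (shift_eval u (Xvar j)) 1 = \<Delta> ^ (2 * e) * d j" by blast
    let ?a = "\<theta> (\<Delta> ^ (2 * e))"
    have aB: "?a \<in> carrier B" using \<Delta>R by simp
    have sB: "\<theta> s \<in> Units B" "\<theta> s \<in> carrier B" using \<theta>_unit[OF s] s by auto
    define \<eta> where "\<eta> = (\<lambda>x\<in>carrier B. (?a \<otimes> \<theta> s) \<otimes> \<delta> x)"
    have "\<eta> \<in> IDer class_ring B \<infinity>"
    proof (rule integrable_of_lift[OF _ u(1,2,3)])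
      show "\<eta> \<in> Der class_ring B" unfolding \<eta>_def using Der_smult[OF \<delta>] aB sB by simp
      fix j assume j: "j < n"
      show "\<theta> (fps_nth (shift_eval u (Xvar j)) 1) = \<eta> (\<theta> (Xvar j))"
        unfolding u(4) using j aB sB \<Delta>R dR ds[OF j, symmetric] DerD(3)[OF \<delta>]
        by (simp add: \<eta>_def \<theta>_simps m_assoc)
    qed
    then have "(\<lambda>x\<in>carrier B. inv (\<theta> s) \<otimes> \<eta> x) \<in> IDer class_ring B \<infinity>" using sB by (intro IDer_smult) auto
    moreover have "(\<lambda>x\<in>carrier B. inv (\<theta> s) \<otimes> \<eta> x) = (\<lambda>x\<in>carrier B. ?a \<otimes> \<delta> x)"
    proof (rule restrict_ext)
      fix x assume x: "x \<in> carrier B"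
      have dx: "\<delta> x \<in> carrier B" using DerD(3)[OF \<delta> x] .
      have iB: "inv (\<theta> s) \<in> carrier B" using sB by simp
      have "inv (\<theta> s) \<otimes> \<eta> x = (inv (\<theta> s) \<otimes> \<theta> s) \<otimes> (?a \<otimes> \<delta> x)"
        unfolding \<eta>_def restrict_apply'[OF x] using dx aB sB(2) iB m_ac m_closed by presburger
      then show "inv (\<theta> s) \<otimes> \<eta> x = ?a \<otimes> \<delta> x" using sB aB dx by simp
    qed
    ultimately show ?thesis by simp
  qed
  then show ?thesis by blast
qed

definition integrating_ideal :: "'b set" where
  "integrating_ideal = {b \<in> carrier B. \<forall>\<delta>\<in>Der class_ring B. (\<lambda>x\<in>carrier B. b \<otimes> \<delta> x) \<in> IDer class_ring B \<infinity>}"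

lemma integrating_ideal: "ideal integrating_ideal B"
proof (rule ideal_of_closed)
  show "integrating_ideal \<subseteq> carrier B" by (auto simp: integrating_ideal_def)
  show "b \<oplus> c \<in> integrating_ideal" if b: "b \<in> integrating_ideal" and c: "c \<in> integrating_ideal" for b c
  proof -
    have R: "b \<in> carrier B" "c \<in> carrier B" using b c by (auto simp: integrating_ideal_def)
    have hb: "(\<lambda>x\<in>carrier B. b \<otimes> \<delta> x) \<in> IDer class_ring B \<infinity>" if "\<delta> \<in> Der class_ring B" for \<delta>
      using b that unfolding integrating_ideal_def by blast
    have hc: "(\<lambda>x\<in>carrier B. c \<otimes> \<delta> x) \<in> IDer class_ring B \<infinity>" if "\<delta> \<in> Der class_ring B" for \<delta>
      using c that unfolding integrating_ideal_def by blast
    have "(\<lambda>x\<in>carrier B. (b \<oplus> c) \<otimes> \<delta> x) \<in> IDer class_ring B \<infinity>" if \<delta>: "\<delta> \<in> Der class_ring B" for \<delta>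
    proof -
      have "(\<lambda>x\<in>carrier B. (\<lambda>x\<in>carrier B. b \<otimes> \<delta> x) x \<oplus> (\<lambda>x\<in>carrier B. c \<otimes> \<delta> x) x) \<in> IDer class_ring B \<infinity>"
        using IDer_add[OF _ hb[OF \<delta>] hc[OF \<delta>]] by simp
      moreover have "(\<lambda>x\<in>carrier B. (\<lambda>x\<in>carrier B. b \<otimes> \<delta> x) x \<oplus> (\<lambda>x\<in>carrier B. c \<otimes> \<delta> x) x) = (\<lambda>x\<in>carrier B. (b \<oplus> c) \<otimes> \<delta> x)"
        using R DerD(3)[OF \<delta>] by (intro restrict_ext) (simp add: l_distr)
      ultimately show ?thesis by simp
    qed
    then show ?thesis using R by (simp add: integrating_ideal_def)
  qed
  show "a \<otimes> b \<in> integrating_ideal" if a: "a \<in> carrier B" and b: "b \<in> integrating_ideal" for a b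
  proof -
    have bR: "b \<in> carrier B" using b by (simp add: integrating_ideal_def)
    have hb: "(\<lambda>x\<in>carrier B. b \<otimes> \<delta> x) \<in> IDer class_ring B \<infinity>" if "\<delta> \<in> Der class_ring B" for \<delta>
      using b that unfolding integrating_ideal_def by blast
    have "(\<lambda>x\<in>carrier B. (a \<otimes> b) \<otimes> \<delta> x) \<in> IDer class_ring B \<infinity>" if \<delta>: "\<delta> \<in> Der class_ring B" for \<delta>
    proof -
      have "(\<lambda>x\<in>carrier B. a \<otimes> (\<lambda>x\<in>carrier B. b \<otimes> \<delta> x) x) \<in> IDer class_ring B \<infinity>"
        using IDer_smult[OF _ hb[OF \<delta>] a] by simp
      moreover have "(\<lambda>x\<in>carrier B. a \<otimes> (\<lambda>x\<in>carrier B. b \<otimes> \<delta> x) x) = (\<lambda>x\<in>carrier B. (a \<otimes> b) \<otimes> \<delta> x)"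
        using bR a DerD(3)[OF \<delta>] by (intro restrict_ext) (simp add: m_assoc)
      ultimately show ?thesis by simp
    qed
    then show ?thesis using a bR by (simp add: integrating_ideal_def)
  qed
  have "(\<lambda>x\<in>carrier B. \<zero> \<otimes> \<delta> x) = (\<lambda>x\<in>carrier B. \<zero>)" if "\<delta> \<in> Der class_ring B" for \<delta>
    using DerD(3)[OF that] by (intro restrict_ext) simp
  then show "\<zero> \<in> integrating_ideal" using IDer_zero[of \<infinity>] by (simp add: integrating_ideal_def)
qed

end

section \<open>Powers of the maximal ideal of a local ring\<close>

context cring begin

abbreviation ideal_power :: "'a set \<Rightarrow> nat \<Rightarrow> 'a set" where
  "ideal_power Q m \<equiv> Q [^]\<^bsub>ideals_set R\<^esub> m"

lemma ideal_power_simps: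
  "ideal_power Q 0 = carrier R" "ideal_power Q (Suc m) = ideal_prod R (ideal_power Q m) Q"
  "\<one>\<^bsub>ideals_set R\<^esub> = carrier R" "X \<otimes>\<^bsub>ideals_set R\<^esub> Y = ideal_prod R X Y"
  by (simp_all add: nat_pow_def ideals_set_def)

lemma ideal_power_ideal: assumes "ideal Q R" shows "ideal (ideal_power Q m) R"
  by (induction m) (simp_all add: ideal_power_simps oneideal ideal_prod_is_ideal assms)

lemma ideal_power_sub: assumes "ideal Q R" shows "ideal_power Q (Suc m) \<subseteq> ideal_power Q m" "ideal_power Q (Suc m) \<subseteq> Q"
  unfolding ideal_power_simps(2) using ideal_prod_inter[OF ideal_power_ideal[OF assms] assms] by blast+

end

locale local_module = module_at_prime +
  assumes units: "\<And>b. b \<in> carrier R \<Longrightarrow> b \<notin> Q \<Longrightarrow> b \<in> Units R"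
begin

lemma local_submodule_of_closed: assumes "closed_submodule N" shows "local_submodule N"
proof -
  note d = closed_submoduleD[OF assms]
  have sat: "v \<in> N" if s: "s \<in> carrier R - Q" and v: "v \<in> carrier M" and sv: "s \<odot>\<^bsub>M\<^esub> v \<in> N" for s v
  proof -
    have u: "s \<in> Units R" using units s by blast
    then have "inv s \<odot>\<^bsub>M\<^esub> (s \<odot>\<^bsub>M\<^esub> v) = v" using s v by (simp add: smult_assoc1[symmetric])
    then show ?thesis using d(4)[OF _ sv, of "inv s"] u by simp
  qed
  show ?thesis unfolding local_submodule_def by (intro conjI ballI impI) ((rule d; assumption) | (rule sat; assumption))+
qed

text \<open>Each multiplication by an element of \<open>Q\<close> descends one layer.\<close>

lemma ideal_power_smult_comp_series:
  assumes cs: "comp_series L l W w" and a: "a \<in> R.ideal_power Q i" and "v \<in> W i" "i \<le> l"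
  shows "a \<odot>\<^bsub>M\<^esub> v \<in> L"
  using assms(2-)
proof (induction i arbitrary: a v)
  case 0
  then show ?case using cs local_submoduleD(4)[of L a v] by (simp add: comp_series_def R.ideal_power_simps)
next
  case (Suc i)
  have i: "i < l" using Suc.prems by simp
  note dW = local_submoduleD[OF comp_series_submodule[OF cs, of i]]
  note dL = local_submoduleD[of L]
  have L: "local_submodule L" and wi: "w i \<in> carrier M" "\<And>q. q \<in> Q \<Longrightarrow> q \<odot>\<^bsub>M\<^esub> w i \<in> W i"
    and WS: "W (Suc i) = local_adjoin (W i) (w i)" using cs i by (auto simp: comp_series_def)
  obtain s y b where v: "v \<in> carrier M" "s \<in> carrier R - Q" "y \<in> W i" "b \<in> carrier R"
    "s \<odot>\<^bsub>M\<^esub> v = y \<oplus>\<^bsub>M\<^esub> b \<odot>\<^bsub>M\<^esub> w i" using Suc.prems(2) unfolding WS local_adjoin_def by blast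
  have qv: "q \<odot>\<^bsub>M\<^esub> v \<in> W i" if q: "q \<in> Q" for q
  proof -
    have qR: "q \<in> carrier R" and yM: "y \<in> carrier M" using q Q.Icarr v(3) dW(1) i by auto
    have "s \<odot>\<^bsub>M\<^esub> (q \<odot>\<^bsub>M\<^esub> v) = q \<odot>\<^bsub>M\<^esub> (s \<odot>\<^bsub>M\<^esub> v)" using qR v(1,2) by (simp add: smult_assoc1[symmetric] R.m_comm)
    also have "\<dots> = q \<odot>\<^bsub>M\<^esub> y \<oplus>\<^bsub>M\<^esub> b \<odot>\<^bsub>M\<^esub> (q \<odot>\<^bsub>M\<^esub> w i)"
      unfolding v(5) using qR yM v(4) wi(1) by (simp add: smult_r_distr smult_assoc1[symmetric] R.m_comm)
    also have "\<dots> \<in> W i" using dW(3)[OF _ dW(4)[OF _ qR v(3)] dW(4)[OF _ v(4) wi(2)[OF q]]] i by simp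
    finally show ?thesis using dW(5)[OF _ v(2), of "q \<odot>\<^bsub>M\<^esub> v"] qR v(1) i by simp
  qed
  have "a \<in> carrier R \<and> a \<odot>\<^bsub>M\<^esub> v \<in> L" using Suc.prems(1) unfolding R.ideal_power_simps(2)
  proof (induction a rule: ideal_prod.induct)
    case (prod c q)
    have c: "c \<in> carrier R" "q \<in> carrier R"
      using prod Q.Icarr ideal.Icarr[OF R.ideal_power_ideal[OF Q.is_ideal]] by blast+
    have "c \<odot>\<^bsub>M\<^esub> (q \<odot>\<^bsub>M\<^esub> v) \<in> L" using Suc.IH[OF prod(1) qv[OF prod(2)]] i by simp
    then show ?case using c v(1) by (simp add: smult_assoc1)
  next
    case (sum a b) then show ?case using dL(3)[OF L] v(1) by (simp add: smult_l_distr)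
  qed
  then show ?case by blast
qed

end

text \<open>Every element of \<open>Q\<close> has a power in \<open>J\<close>, so the ring has finite length over \<open>J\<close>; with \<open>l\<close>
  layers, \<open>Q\<^sup>l \<subseteq> J\<close>.\<close>

lemma (in noetherian_cring) ideal_power_sub_of_unique_prime:
  assumes Q: "primeideal Q R" and units: "\<And>b. b \<in> carrier R \<Longrightarrow> b \<notin> Q \<Longrightarrow> b \<in> Units R"
    and J: "ideal J R" and only: "\<And>P. primeideal P R \<Longrightarrow> J \<subseteq> P \<Longrightarrow> P = Q"
  shows "\<exists>m>0. ideal_power Q m \<subseteq> J"
proof -
  interpret Q: primeideal Q R by fact
  interpret J: ideal J R by fact
  let ?M = "algebra_of_hom (\<lambda>x. x) R :: ('a, 'a) module"
  interpret self: algebra R ?M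
    by (rule algebra_algebra_of_hom[OF is_cring is_cring]) (auto simp: Ring.ring_hom_def)
  interpret self: local_module R ?M Q
    unfolding local_module_def module_at_prime_def local_module_axioms_def
    using self.module_axioms Q units by simp
  have L: "self.local_submodule J" by (rule self.local_submodule_of_closed)
      (use J.I_l_closed J.a_closed J.zero_closed J.a_subset in \<open>simp add: self.closed_submodule_def\<close>)
  have "\<exists>V. self.finite_length_over J V \<and> {\<one>} \<subseteq> V"
  proof (rule self.finite_length_over_reach_finite[OF noetherian_ring_axioms L])
    fix q v assume q: "q \<in> Q" and v: "v \<in> carrier ?M"
    obtain m :: nat where "q [^] m \<in> J" using power_mem_of_mem_all_primes[OF J Q.Icarr[OF q]] only q by blast
    then show "\<exists>m::nat. q [^] m \<odot>\<^bsub>?M\<^esub> v \<in> J" using J.I_r_closed v by auto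
  qed simp_all
  then obtain l W w where cs: "self.comp_series J l W w" and one: "\<one> \<in> W l"
    unfolding self.finite_length_over_def by blast
  have "a \<in> J" if a: "a \<in> ideal_power Q l" for a
  proof -
    have "a \<in> carrier R" using a ideal.Icarr[OF ideal_power_ideal[OF Q.is_ideal]] by blast
    then show ?thesis using self.ideal_power_smult_comp_series[OF cs a one] by simp
  qed
  \<comment> \<open>the exponent is raised by one because \<open>l\<close> is zero if \<open>J\<close> is the whole ring\<close>
  then show ?thesis using ideal_power_sub(1)[OF Q.is_ideal, of l] by (intro exI[of _ "Suc l"]) blast
qed

section \<open>Vector spaces over a coefficient field\<close>

lemma (in module) submodule_of_closed: "closed_submodule N \<Longrightarrow> LinearCombinations.submodule R N M"
  using module_axioms by (simp add: closed_submodule_def LinearCombinations.submodule_def subset_iff)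

locale quotient_module = module + J: ideal J R for J
begin

abbreviation N where "N \<equiv> ideal_smult R J M"

abbreviation cls where "cls v \<equiv> N +>\<^bsub>M\<^esub> v"

lemma ideal_smult_generators: "{a \<odot>\<^bsub>M\<^esub> v |a v. a \<in> J \<and> v \<in> carrier M} \<subseteq> carrier M"
  using J.Icarr by auto

lemma smult_mem: "a \<in> J \<Longrightarrow> v \<in> carrier M \<Longrightarrow> a \<odot>\<^bsub>M\<^esub> v \<in> N"
  using in_own_span[OF ideal_smult_generators] unfolding ideal_smult_def by blast

lemma ideal_smult_closed: "closed_submodule N"
  using span_is_submodule[OF ideal_smult_generators] span_is_subset2[OF ideal_smult_generators]
  unfolding ideal_smult_def closed_submodule_def LinearCombinations.submodule_def by blast

lemma ideal_smult_least:
  assumes "closed_submodule N'" "\<And>a v. a \<in> J \<Longrightarrow> v \<in> carrier M \<Longrightarrow> a \<odot>\<^bsub>M\<^esub> v \<in> N'"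
  shows "N \<subseteq> N'"
  unfolding ideal_smult_def by (rule span_is_subset[OF _ submodule_of_closed[OF assms(1)]]) (use assms(2) in blast)

lemmas Nd = closed_submoduleD[OF ideal_smult_closed]

sublocale N: abelian_subgroup N M
proof (rule abelian_subgroupI3[OF additive_subgroup.intro M.abelian_group_axioms])
  show "subgroup N (add_monoid M)"
  proof (rule group.subgroupI[OF M.a_group])
    fix v assume v: "v \<in> N"
    then have "(\<ominus> \<one>) \<odot>\<^bsub>M\<^esub> v = \<ominus>\<^bsub>M\<^esub> v" using Nd(1) smult_l_minus[of \<one> v] by (auto simp: subset_iff)
    then show "inv\<^bsub>add_monoid M\<^esub> v \<in> N" using Nd(4)[OF _ v, of "\<ominus> \<one>"] by (simp add: a_inv_def[symmetric])
  qed (use Nd in auto)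
qed

lemma cls_eq_iff: assumes "v \<in> carrier M" "w \<in> carrier M" shows "cls v = cls w \<longleftrightarrow> v \<ominus>\<^bsub>M\<^esub> w \<in> N"
proof
  assume "cls v = cls w"
  then show "v \<ominus>\<^bsub>M\<^esub> w \<in> N" using N.a_rcos_self[OF assms(1)] N.a_rcos_module[OF assms(2,1)] by (simp add: a_minus_def)
next
  assume "v \<ominus>\<^bsub>M\<^esub> w \<in> N"
  then have "v \<in> cls w" using N.a_rcos_module[OF assms(2,1)] by (simp add: a_minus_def)
  then show "cls v = cls w" using M.a_repr_independence[OF _ assms(2) N.a_subgroup] by simp
qed

abbreviation V where "V \<equiv> quot_module R J M"

lemma V_simps: "carrier V = cls ` carrier M" "\<zero>\<^bsub>V\<^esub> = N" "X \<oplus>\<^bsub>V\<^esub> Y = X <+>\<^bsub>M\<^esub> Y"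
  by (auto simp: quot_module_def Let_def A_RCOSETS_def')

lemma V_add: "v \<in> carrier M \<Longrightarrow> w \<in> carrier M \<Longrightarrow> cls v \<oplus>\<^bsub>V\<^esub> cls w = cls (v \<oplus>\<^bsub>M\<^esub> w)"
  by (simp add: V_simps N.a_rcos_sum)

lemma V_zero: "\<zero>\<^bsub>V\<^esub> = cls \<zero>\<^bsub>M\<^esub>" "v \<in> N \<Longrightarrow> cls v = \<zero>\<^bsub>V\<^esub>"
proof -
  show "\<zero>\<^bsub>V\<^esub> = cls \<zero>\<^bsub>M\<^esub>" using Nd(1) by (simp add: V_simps)
  assume "v \<in> N"
  then show "cls v = \<zero>\<^bsub>V\<^esub>" using M.a_coset_join2[OF _ N.a_subgroup] Nd(1) by (auto simp: V_simps)
qed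

lemma V_smult:
  assumes a: "a \<in> carrier R" and v: "v \<in> carrier M"
  shows "(J +> a) \<odot>\<^bsub>V\<^esub> cls v = cls (a \<odot>\<^bsub>M\<^esub> v)"
proof -
  have "cls (a' \<odot>\<^bsub>M\<^esub> v') = cls (a \<odot>\<^bsub>M\<^esub> v)" if a': "a' \<in> J +> a" and v': "v' \<in> cls v" for a' v'
  proof -
    have R: "a' \<in> carrier R" "v' \<in> carrier M"
      using a' v' J.a_elemrcos_carrier[OF a] N.a_elemrcos_carrier[OF v] by blast+
    have d: "a' \<ominus> a \<in> J" "v' \<ominus>\<^bsub>M\<^esub> v \<in> N"
      using a' v' J.a_rcos_module[OF a R(1)] N.a_rcos_module[OF v R(2)] by (simp_all add: a_minus_def)
    have "a' \<odot>\<^bsub>M\<^esub> v' \<ominus>\<^bsub>M\<^esub> a \<odot>\<^bsub>M\<^esub> v = a' \<odot>\<^bsub>M\<^esub> (v' \<ominus>\<^bsub>M\<^esub> v) \<oplus>\<^bsub>M\<^esub> (a' \<ominus> a) \<odot>\<^bsub>M\<^esub> v"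
    proof -
      have "a' \<odot>\<^bsub>M\<^esub> (v' \<ominus>\<^bsub>M\<^esub> v) \<oplus>\<^bsub>M\<^esub> (a' \<ominus> a) \<odot>\<^bsub>M\<^esub> v
        = (a' \<odot>\<^bsub>M\<^esub> v' \<oplus>\<^bsub>M\<^esub> \<ominus>\<^bsub>M\<^esub> (a' \<odot>\<^bsub>M\<^esub> v)) \<oplus>\<^bsub>M\<^esub> (a' \<odot>\<^bsub>M\<^esub> v \<oplus>\<^bsub>M\<^esub> \<ominus>\<^bsub>M\<^esub> (a \<odot>\<^bsub>M\<^esub> v))"
        using R a v by (simp add: a_minus_def smult_r_distr smult_l_distr smult_r_minus smult_l_minus)
      also have "\<dots> = a' \<odot>\<^bsub>M\<^esub> v' \<oplus>\<^bsub>M\<^esub> (\<ominus>\<^bsub>M\<^esub> (a' \<odot>\<^bsub>M\<^esub> v) \<oplus>\<^bsub>M\<^esub> a' \<odot>\<^bsub>M\<^esub> v) \<oplus>\<^bsub>M\<^esub> \<ominus>\<^bsub>M\<^esub> (a \<odot>\<^bsub>M\<^esub> v)"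
        using R a v by (simp add: M.a_assoc)
      finally show ?thesis using R a v by (simp add: a_minus_def M.l_neg)
    qed
    moreover have "a' \<odot>\<^bsub>M\<^esub> (v' \<ominus>\<^bsub>M\<^esub> v) \<oplus>\<^bsub>M\<^esub> (a' \<ominus> a) \<odot>\<^bsub>M\<^esub> v \<in> N"
      by (rule Nd(3)[OF Nd(4)[OF R(1) d(2)] smult_mem[OF d(1) v]])
    ultimately show ?thesis using R a v by (simp add: cls_eq_iff)
  qed
  then have "(\<Union>a'\<in>J +> a. \<Union>v'\<in>cls v. cls (a' \<odot>\<^bsub>M\<^esub> v')) = cls (a \<odot>\<^bsub>M\<^esub> v)"
    using J.a_rcos_self[OF a] N.a_rcos_self[OF v] by blast
  then show ?thesis by (simp add: quot_module_def Let_def)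
qed

lemma quot_vectorspace:
  assumes L: "subfield L (R Quot J)"
  shows "vectorspace ((R Quot J)\<lparr>carrier := L\<rparr>) V"
proof -
  let ?K = "(R Quot J)\<lparr>carrier := L\<rparr>"
  interpret QJ: ring "R Quot J" by (rule J.quotient_is_ring)
  interpret K: field ?K by (rule QJ.subfield_iff(2)[OF L])
  have LJ: "\<exists>a. a \<in> carrier R \<and> X = J +> a" if "X \<in> carrier ?K" for X
    using that subfieldE(3)[OF L] by (auto simp: FactRing_def A_RCOSETS_def')
  have VM: "\<exists>v. v \<in> carrier M \<and> X = cls v" if "X \<in> carrier V" for X using that by (auto simp: V_simps(1))
  have "module ?K V"
  proof (rule module_criteria)
    show "cring ?K" by (rule K.is_cring)
    show "\<zero>\<^bsub>V\<^esub> \<in> carrier V" unfolding V_zero by (auto simp: V_simps)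
    show "\<forall>v w. v \<in> carrier V \<and> w \<in> carrier V \<longrightarrow> v \<oplus>\<^bsub>V\<^esub> w \<in> carrier V" using V_add by (auto simp: V_simps(1))
    show "\<forall>v\<in>carrier V. \<exists>neg_v\<in>carrier V. v \<oplus>\<^bsub>V\<^esub> neg_v = \<zero>\<^bsub>V\<^esub>"
    proof
      fix X assume "X \<in> carrier V"
      then obtain v where v: "v \<in> carrier M" "X = cls v" by (auto simp: V_simps)
      then have "X \<oplus>\<^bsub>V\<^esub> cls (\<ominus>\<^bsub>M\<^esub> v) = \<zero>\<^bsub>V\<^esub>" by (simp add: V_add V_zero(1) M.r_neg)
      then show "\<exists>Y\<in>carrier V. X \<oplus>\<^bsub>V\<^esub> Y = \<zero>\<^bsub>V\<^esub>" using v by (auto simp: V_simps(1))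
    qed
    show "\<forall>c v. c \<in> carrier ?K \<and> v \<in> carrier V \<longrightarrow> c \<odot>\<^bsub>V\<^esub> v \<in> carrier V"
    proof (intro allI impI)
      fix c X assume "c \<in> carrier ?K \<and> X \<in> carrier V"
      then obtain a v where "a \<in> carrier R" "c = J +> a" "v \<in> carrier M" "X = cls v"
        using LJ[of c] VM[of X] by blast
      then show "c \<odot>\<^bsub>V\<^esub> X \<in> carrier V" by (simp add: V_smult V_simps(1))
    qed
    show "\<forall>v w. v \<in> carrier V \<and> w \<in> carrier V \<longrightarrow> v \<oplus>\<^bsub>V\<^esub> w = w \<oplus>\<^bsub>V\<^esub> v" by (auto simp: V_simps(1) V_add M.a_comm)
    show "\<forall>v w x. v \<in> carrier V \<and> w \<in> carrier V \<and> x \<in> carrier V \<longrightarrow> (v \<oplus>\<^bsub>V\<^esub> w) \<oplus>\<^bsub>V\<^esub> x = v \<oplus>\<^bsub>V\<^esub> (w \<oplus>\<^bsub>V\<^esub> x)"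
      by (auto simp: V_simps(1) V_add M.a_assoc)
    show "\<forall>v\<in>carrier V. v \<oplus>\<^bsub>V\<^esub> \<zero>\<^bsub>V\<^esub> = v" unfolding V_zero by (auto simp: V_simps(1) V_add)
    show "\<forall>a b v. a \<in> carrier ?K \<and> b \<in> carrier ?K \<and> v \<in> carrier V \<longrightarrow> (a \<otimes>\<^bsub>?K\<^esub> b) \<odot>\<^bsub>V\<^esub> v = a \<odot>\<^bsub>V\<^esub> (b \<odot>\<^bsub>V\<^esub> v)"
    proof (intro allI impI)
      fix X Y Z assume "X \<in> carrier ?K \<and> Y \<in> carrier ?K \<and> Z \<in> carrier V"
      then obtain a b v where "a \<in> carrier R" "X = J +> a" "b \<in> carrier R" "Y = J +> b" "v \<in> carrier M" "Z = cls v"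
        using LJ[of X] LJ[of Y] VM[of Z] by blast
      then show "(X \<otimes>\<^bsub>?K\<^esub> Y) \<odot>\<^bsub>V\<^esub> Z = X \<odot>\<^bsub>V\<^esub> (Y \<odot>\<^bsub>V\<^esub> Z)"
        by (simp add: FactRing_def J.rcoset_mult_add V_smult smult_assoc1)
    qed
    show "\<forall>v\<in>carrier V. \<one>\<^bsub>?K\<^esub> \<odot>\<^bsub>V\<^esub> v = v" by (auto simp: FactRing_def V_simps(1) V_smult)
    show "\<forall>a b v. a \<in> carrier ?K \<and> b \<in> carrier ?K \<and> v \<in> carrier V \<longrightarrow>
        (a \<oplus>\<^bsub>?K\<^esub> b) \<odot>\<^bsub>V\<^esub> v = (a \<odot>\<^bsub>V\<^esub> v) \<oplus>\<^bsub>V\<^esub> (b \<odot>\<^bsub>V\<^esub> v)"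
    proof (intro allI impI)
      fix X Y Z assume "X \<in> carrier ?K \<and> Y \<in> carrier ?K \<and> Z \<in> carrier V"
      then obtain a b v where "a \<in> carrier R" "X = J +> a" "b \<in> carrier R" "Y = J +> b" "v \<in> carrier M" "Z = cls v"
        using LJ[of X] LJ[of Y] VM[of Z] by blast
      then show "(X \<oplus>\<^bsub>?K\<^esub> Y) \<odot>\<^bsub>V\<^esub> Z = (X \<odot>\<^bsub>V\<^esub> Z) \<oplus>\<^bsub>V\<^esub> (Y \<odot>\<^bsub>V\<^esub> Z)"
        by (simp add: FactRing_def J.a_rcos_sum V_smult V_add smult_l_distr)
    qed
    show "\<forall>a v w. a \<in> carrier ?K \<and> v \<in> carrier V \<and> w \<in> carrier V \<longrightarrow>
        a \<odot>\<^bsub>V\<^esub> (v \<oplus>\<^bsub>V\<^esub> w) = (a \<odot>\<^bsub>V\<^esub> v) \<oplus>\<^bsub>V\<^esub> (a \<odot>\<^bsub>V\<^esub> w)"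
    proof (intro allI impI)
      fix X Y Z assume "X \<in> carrier ?K \<and> Y \<in> carrier V \<and> Z \<in> carrier V"
      then obtain a v w where "a \<in> carrier R" "X = J +> a" "w \<in> carrier M" "Y = cls w" "v \<in> carrier M" "Z = cls v"
        using LJ[of X] VM[of Y] VM[of Z] by blast
      then show "X \<odot>\<^bsub>V\<^esub> (Y \<oplus>\<^bsub>V\<^esub> Z) = (X \<odot>\<^bsub>V\<^esub> Y) \<oplus>\<^bsub>V\<^esub> (X \<odot>\<^bsub>V\<^esub> Z)" by (simp add: V_smult V_add smult_r_distr)
    qed
  qed
  then show ?thesis unfolding vectorspace_def using K.field_axioms by blast
qed

text \<open>Choose at each jump \<open>s\<close> an element of \<open>\<Phi> (s - 1)\<close> outside \<open>\<Phi> s\<close>. The classes of these elements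
  are linearly independent: added in the order of decreasing \<open>s\<close>, each one lies outside the image
  of \<open>\<Phi> s\<close>, which contains the span of those before.\<close>

lemma card_jumps_le_dim:
  fixes \<Phi> :: "nat \<Rightarrow> 'c set"
  assumes L: "subfield L (R Quot J)"
    and fd: "vectorspace.fin_dim ((R Quot J)\<lparr>carrier := L\<rparr>) V"
    and \<Phi>: "\<And>s. s \<in> T \<Longrightarrow> closed_submodule (\<Phi> s)" "\<And>s. s \<in> T \<Longrightarrow> N \<subseteq> \<Phi> s"
    and anti: "\<And>s t. s \<in> T \<Longrightarrow> t \<in> T \<Longrightarrow> s < t \<Longrightarrow> \<Phi> (t - 1) \<subseteq> \<Phi> s"
    and jump: "\<And>s. s \<in> T \<Longrightarrow> \<Phi> s \<subset> \<Phi> (s - 1)" and \<Phi>M: "\<And>s. s \<in> T \<Longrightarrow> \<Phi> (s - 1) \<subseteq> carrier M"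
    and T: "finite T"
  shows "card T \<le> vectorspace.dim ((R Quot J)\<lparr>carrier := L\<rparr>) V"
proof -
  let ?K = "(R Quot J)\<lparr>carrier := L\<rparr>"
  interpret V: vectorspace ?K V by (rule quot_vectorspace[OF L])
  have "\<forall>s\<in>T. \<exists>v. v \<in> \<Phi> (s - 1) \<and> v \<notin> \<Phi> s" using jump by blast
  then obtain x where x: "\<And>s. s \<in> T \<Longrightarrow> x s \<in> \<Phi> (s - 1) \<and> x s \<notin> \<Phi> s" using bchoice[of T] by metis
  have xM: "x s \<in> carrier M" if "s \<in> T" for s using x \<Phi>M that by blast
  have image: "LinearCombinations.submodule ?K (cls ` \<Phi> s) V" if s: "s \<in> T" for s
  proof (rule V.submodule_of_closed)
    note d = closed_submoduleD[OF \<Phi>(1)[OF s]]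
    show "V.closed_submodule (cls ` \<Phi> s)" unfolding V.closed_submodule_def
    proof (intro conjI ballI)
      show "cls ` \<Phi> s \<subseteq> carrier V" using d(1) by (auto simp: V_simps(1))
      show "\<zero>\<^bsub>V\<^esub> \<in> cls ` \<Phi> s" unfolding V_zero using d(2) by blast
      fix X assume "X \<in> cls ` \<Phi> s"
      then obtain v where v: "v \<in> \<Phi> s" "X = cls v" by blast
      have vM: "v \<in> carrier M" using v d(1) by blast
      show "X \<oplus>\<^bsub>V\<^esub> Y \<in> cls ` \<Phi> s" if Y: "Y \<in> cls ` \<Phi> s" for Y
      proof -
        obtain w where w: "w \<in> \<Phi> s" "Y = cls w" using Y by blast
        have "w \<in> carrier M" using w d(1) by blast
        then have "X \<oplus>\<^bsub>V\<^esub> Y = cls (v \<oplus>\<^bsub>M\<^esub> w)" using v w vM V_add by simp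
        then show ?thesis using d(3)[OF v(1) w(1)] by blast
      qed
    next
      fix Y X assume Y: "Y \<in> carrier ?K" and "X \<in> cls ` \<Phi> s"
      then obtain v where v: "v \<in> \<Phi> s" "X = cls v" by blast
      have vM: "v \<in> carrier M" using v d(1) by blast
      obtain a where a: "a \<in> carrier R" "Y = J +> a"
        using Y subfieldE(3)[OF L] by (auto simp: FactRing_def A_RCOSETS_def')
      then have "Y \<odot>\<^bsub>V\<^esub> X = cls (a \<odot>\<^bsub>M\<^esub> v)" using v vM V_smult by simp
      then show "Y \<odot>\<^bsub>V\<^esub> X \<in> cls ` \<Phi> s" using d(4)[OF a(1) v(1)] by blast
    qed
  qed
  have notin: "cls (x s) \<notin> cls ` \<Phi> s" if s: "s \<in> T" for s
  proof
    assume "cls (x s) \<in> cls ` \<Phi> s"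
    then obtain v where v: "v \<in> \<Phi> s" "cls (x s) = cls v" by blast
    note d = closed_submoduleD[OF \<Phi>(1)[OF s]]
    have vM: "v \<in> carrier M" using v d(1) by blast
    have "x s \<ominus>\<^bsub>M\<^esub> v \<in> \<Phi> s" using v(2) cls_eq_iff[OF xM[OF s] vM] \<Phi>(2)[OF s] by blast
    then have "(x s \<ominus>\<^bsub>M\<^esub> v) \<oplus>\<^bsub>M\<^esub> v \<in> \<Phi> s" using d(3) v(1) by blast
    then have "x s \<in> \<Phi> s" using xM[OF s] vM by (simp add: a_minus_def M.a_assoc M.l_neg)
    then show False using x[OF s] by blast
  qed
  have "S \<subseteq> T \<Longrightarrow> V.lin_indpt ((\<lambda>s. cls (x s)) ` S) \<and> card ((\<lambda>s. cls (x s)) ` S) = card S"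
    if "finite S" for S using that
  proof (induction S rule: finite_linorder_min_induct)
    case empty show ?case by (simp add: V.lin_dep_def)
  next
    case (insert s S)
    let ?X = "(\<lambda>s. cls (x s)) ` S"
    have s: "s \<in> T" and ST: "S \<subseteq> T" using insert.prems by auto
    \<comment> \<open>\<open>s\<close> is the least index, so the elements chosen at the other jumps all lie in \<open>\<Phi> s\<close>\<close>
    have "?X \<subseteq> cls ` \<Phi> s"
    proof
      fix X assume "X \<in> ?X"
      then obtain t where t: "t \<in> S" "X = cls (x t)" by blast
      have "x t \<in> \<Phi> s" using x[of t] anti[OF s, of t] insert.hyps t ST by blast
      then show "X \<in> cls ` \<Phi> s" using t by blast
    qed
    then have "V.span ?X \<subseteq> cls ` \<Phi> s" by (rule V.span_is_subset[OF _ image[OF s]])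
    then have ns: "cls (x s) \<notin> V.span ?X" using notin[OF s] by blast
    have XV: "?X \<subseteq> carrier V" "cls (x s) \<in> carrier V" using xM s ST by (auto simp: V_simps(1))
    have nX: "cls (x s) \<notin> ?X" using ns V.in_own_span[OF XV(1)] by blast
    have li: "V.lin_indpt ?X" "card ?X = card S" using insert.IH ST by blast+
    have "V.lin_indpt (?X \<union> {cls (x s)})" using V.lin_dep_iff_in_span[OF XV(1) li(1) XV(2) nX] ns by blast
    moreover have "s \<notin> S" using insert.hyps by blast
    ultimately show ?case using nX li(2) insert.hyps(1) by simp
  qed
  from this[OF T] have "V.lin_indpt ((\<lambda>s. cls (x s)) ` T)" "card ((\<lambda>s. cls (x s)) ` T) = card T" by auto
  moreover have "(\<lambda>s. cls (x s)) ` T \<subseteq> carrier V" using xM by (auto simp: V_simps(1))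
  ultimately show ?thesis using V.li_le_dim(2)[OF fd] by metis
qed

end

text \<open>The classes of the generators \<open>w i\<close> of the layers span. A coefficient \<open>b\<close> is \<open>q + c\<close> with \<open>q \<in>
  Q\<close> and \<open>c\<close> in the coefficient field, and \<open>q (w i)\<close> belongs to the lower layers.\<close>

lemma (in local_module) fin_dim_of_comp_series:
  assumes J: "ideal J R" "J \<subseteq> Q" and L: "coefficient_field R Q J L"
    and cs: "comp_series (ideal_smult R J M) l W w" and top: "W l = carrier M"
  shows "vectorspace.fin_dim ((R Quot J)\<lparr>carrier := L\<rparr>) (quot_module R J M)"
proof -
  interpret Q: quotient_module R M J by (intro quotient_module.intro module_axioms J(1))
  have sub: "subfield L (R Quot J)" and bij: "bij_betw (\<lambda>X. Q <+> X) L (carrier (R Quot Q))"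
    using L by (auto simp: coefficient_field_def)
  let ?K = "(R Quot J)\<lparr>carrier := L\<rparr>"
  interpret V: vectorspace ?K Q.V by (rule Q.quot_vectorspace[OF sub])
  have rep: "\<exists>c\<in>carrier R. \<exists>q\<in>Q. b = q \<oplus> c \<and> J +> c \<in> L" if b: "b \<in> carrier R" for b
  proof -
    have "Q +> b \<in> carrier (R Quot Q)" using b by (auto simp: FactRing_def A_RCOSETS_def')
    then obtain X where X: "X \<in> L" "Q +> b = Q <+> X" using bij by (auto simp: bij_betw_def)
    obtain c where c: "c \<in> carrier R" "X = J +> c"
      using X(1) subfieldE(3)[OF sub] by (auto simp: FactRing_def A_RCOSETS_def')
    have "b \<in> Q <+> X" using Q.a_rcos_self[OF b] X(2) by simp
    then obtain q j where q: "q \<in> Q" "j \<in> J" "b = q \<oplus> (j \<oplus> c)"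
      unfolding c(2) set_add_def' a_r_coset_def' by blast
    have "j \<in> Q" using q J(2) by blast
    then have "b = (q \<oplus> j) \<oplus> c" "q \<oplus> j \<in> Q" using q(1,3) c(1) Q.Icarr Q.a_closed by (simp_all add: R.a_assoc)
    then show ?thesis using c X(1) by blast
  qed
  have wM: "w i \<in> carrier M" if "i < l" for i using cs that by (simp add: comp_series_def)
  define S where "S = (\<lambda>i. Q.cls (w i)) ` {..<l}"
  have SV: "S \<subseteq> carrier Q.V" using wM by (auto simp: S_def Q.V_simps(1))
  have span: "LinearCombinations.submodule ?K (V.span S) Q.V" by (rule V.span_is_submodule[OF SV])
  have "i \<le> l \<Longrightarrow> v \<in> W i \<Longrightarrow> Q.cls v \<in> V.span S" for i v
  proof (induction i arbitrary: v)
    case 0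
    then have "v \<in> Q.N" using cs by (simp add: comp_series_def)
    then show ?case using Q.V_zero(2) submodule.zero_closed[OF span] by simp
  next
    case (Suc i)
    then have i: "i < l" by simp
    note W = comp_series_submodule[OF cs, of i]
    note dW = local_submoduleD[OF W]
    have qw: "\<And>q. q \<in> Q \<Longrightarrow> q \<odot>\<^bsub>M\<^esub> w i \<in> W i" and WS: "W (Suc i) = local_adjoin (W i) (w i)"
      using cs i by (auto simp: comp_series_def)
    obtain s y b where v: "v \<in> carrier M" "s \<in> carrier R - Q" "y \<in> W i" "b \<in> carrier R"
      "s \<odot>\<^bsub>M\<^esub> v = y \<oplus>\<^bsub>M\<^esub> b \<odot>\<^bsub>M\<^esub> w i" using Suc.prems(2) unfolding WS local_adjoin_def by blast
    have yM: "y \<in> carrier M" using v(3) dW(1) i by auto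
    have s: "s \<in> Units R" "inv s \<in> carrier R" "s \<in> carrier R" using units v(2) by auto
    obtain c q where c: "c \<in> carrier R" "q \<in> Q" "inv s \<otimes> b = q \<oplus> c" "J +> c \<in> L"
      using rep[of "inv s \<otimes> b"] s v(4) by auto
    have qR: "q \<in> carrier R" using c(2) Q.Icarr by blast
    have "v = inv s \<odot>\<^bsub>M\<^esub> (s \<odot>\<^bsub>M\<^esub> v)" using s v(1) by (simp add: smult_assoc1[symmetric])
    also have "\<dots> = inv s \<odot>\<^bsub>M\<^esub> y \<oplus>\<^bsub>M\<^esub> (inv s \<otimes> b) \<odot>\<^bsub>M\<^esub> w i"
      unfolding v(5) using s v(4) yM wM[OF i] by (simp add: smult_r_distr smult_assoc1)
    also have "\<dots> = (inv s \<odot>\<^bsub>M\<^esub> y \<oplus>\<^bsub>M\<^esub> q \<odot>\<^bsub>M\<^esub> w i) \<oplus>\<^bsub>M\<^esub> c \<odot>\<^bsub>M\<^esub> w i"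
      unfolding c(3) using s yM wM[OF i] c(1) qR by (simp add: smult_l_distr M.a_assoc)
    finally have eq: "v = (inv s \<odot>\<^bsub>M\<^esub> y \<oplus>\<^bsub>M\<^esub> q \<odot>\<^bsub>M\<^esub> w i) \<oplus>\<^bsub>M\<^esub> c \<odot>\<^bsub>M\<^esub> w i" .
    let ?y = "inv s \<odot>\<^bsub>M\<^esub> y \<oplus>\<^bsub>M\<^esub> q \<odot>\<^bsub>M\<^esub> w i"
    have y': "?y \<in> W i" using dW(3)[OF _ dW(4)[OF _ s(2) v(3)] qw[OF c(2)]] i by simp
    have "Q.cls v = Q.cls ?y \<oplus>\<^bsub>Q.V\<^esub> (J +> c) \<odot>\<^bsub>Q.V\<^esub> Q.cls (w i)"
      using s(2) yM qR wM[OF i] c(1) by (subst eq) (simp add: Q.V_smult Q.V_add)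
    moreover have "Q.cls ?y \<in> V.span S" using Suc.IH[OF _ y'] i by simp
    moreover have "Q.cls (w i) \<in> V.span S" using V.in_own_span[OF SV] i by (auto simp: S_def)
    then have "(J +> c) \<odot>\<^bsub>Q.V\<^esub> Q.cls (w i) \<in> V.span S" using submodule.smult_closed[OF span] c(4) by simp
    ultimately show ?case using submodule.m_closed[OF span] by simp
  qed
  then have "carrier Q.V \<subseteq> V.span S" using top by (auto simp: Q.V_simps(1))
  moreover have "V.span S \<subseteq> carrier Q.V" by (rule V.span_is_subset2[OF SV])
  ultimately show ?thesis unfolding V.fin_dim_def using SV by (intro exI[of _ S]) (auto simp: S_def)
qed

text \<open>Along the jumps the number of layers that \<open>\<Phi> (s - 1)\<close> meets decreases strictly, by
  \<open>leading_determines\<close>.\<close>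

lemma (in module_at_prime) finite_jumps:
  fixes \<Phi> :: "nat \<Rightarrow> 'c set"
  assumes cs: "comp_series L l W w" and top: "W l = carrier M"
    and \<Phi>: "\<And>s. s \<in> T \<Longrightarrow> local_submodule (\<Phi> s)" "\<And>s. s \<in> T \<Longrightarrow> local_submodule (\<Phi> (s - 1))"
      "\<And>s. s \<in> T \<Longrightarrow> L \<subseteq> \<Phi> s"
    and anti: "\<And>s t. s \<in> T \<Longrightarrow> t \<in> T \<Longrightarrow> s < t \<Longrightarrow> \<Phi> (t - 1) \<subseteq> \<Phi> s"
    and jump: "\<And>s. s \<in> T \<Longrightarrow> \<Phi> s \<subset> \<Phi> (s - 1)"
  shows "finite (T :: nat set)"
proof -
  let ?f = "\<lambda>s. card (leading l W (\<Phi> (s - 1)))"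
  have less: "?f t < ?f s" if st: "s \<in> T" "t \<in> T" "s < t" for s t
  proof -
    have "leading l W (\<Phi> s) \<subseteq> leading l W (\<Phi> (s - 1))" using jump[OF st(1)] by (intro leading_mono) blast
    moreover have "leading l W (\<Phi> (s - 1)) \<noteq> leading l W (\<Phi> s)"
      using leading_determines[OF cs \<Phi>(1,3)[OF st(1)] \<Phi>(2)[OF st(1)]] jump[OF st(1)]
        local_submoduleD(1)[OF \<Phi>(2)[OF st(1)]] top by blast
    ultimately have "card (leading l W (\<Phi> s)) < ?f s" by (intro psubset_card_mono) auto
    moreover have "?f t \<le> card (leading l W (\<Phi> s))" using anti[OF st] by (intro card_mono leading_mono) auto
    ultimately show ?thesis by simp
  qed
  have "inj_on ?f T" by (rule linorder_inj_onI') (use less in \<open>metis less_irrefl\<close>)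
  moreover have "?f ` T \<subseteq> {..l}" using card_leading by auto
  ultimately show ?thesis by (rule inj_on_finite) simp
qed

section \<open>Leaps of a localized quotient\<close>

lemma (in cring) power_mem_ideal_power:
  assumes "ideal Q R" "q \<in> Q" shows "q [^] (m::nat) \<in> ideal_power Q m"
proof (induction m)
  case (Suc m)
  then show ?case using ideal_prod.prod[of "q [^] m" "ideal_power Q m" q Q R] assms(2)
    by (simp add: ideal_power_simps)
qed (simp add: ideal_power_simps)

lemma (in kalg) IDer_closed:
  assumes "1 \<le> m" shows "module.closed_submodule B DerV (IDer k B m)"
proof -
  interpret V: module B DerV by (rule DerV_module)
  show ?thesis unfolding V.closed_submodule_def DerV_simps
    using IDer_sub_Der IDer_zero[OF assms] IDer_add[OF assms] IDer_smult[OF assms] by simp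
qed

context local_quotient begin

abbreviation pDer where "pDer M \<equiv> ideal_smult B (ideal_power F.\<mm> M) DerV"

text \<open>Between \<open>p\<^sup>M Der(B)\<close> and \<open>Der(B)\<close> there is a composition series, because powers of each element
  of the maximal ideal carry derivations into \<open>p\<^sup>M Der(B)\<close> and \<open>Der(B)\<close> is finitely generated. The
  chain of the \<open>IDer(B; s)\<close> is then bounded by \<open>finite_jumps\<close> and \<open>card_jumps_le_dim\<close>.\<close>

lemma leaps_bound:
  assumes only: "\<And>Q. primeideal Q B \<Longrightarrow> integrating_ideal \<subseteq> Q \<Longrightarrow> Q = F.\<mm>"
  shows "\<exists>M. 0 < M \<and> pDer M \<subseteq> IDer class_ring B \<infinity> \<and>
    (\<forall>M'. 0 < M' \<and> pDer M' \<subseteq> IDer class_ring B \<infinity> \<longrightarrow> M \<le> M') \<and> finite (Leaps class_ring B) \<and>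
    (\<forall>L. coefficient_field B F.\<mm> (ideal_power F.\<mm> M) L \<longrightarrow>
      vectorspace.fin_dim ((B Quot ideal_power F.\<mm> M)\<lparr>carrier := L\<rparr>) (quot_module B (ideal_power F.\<mm> M) DerV) \<and>
      card (Leaps class_ring B)
        \<le> vectorspace.dim ((B Quot ideal_power F.\<mm> M)\<lparr>carrier := L\<rparr>) (quot_module B (ideal_power F.\<mm> M) DerV))"
proof -
  have noeth: "noetherian_ring B" by (rule F.noetherian_fractions[OF N.noetherian])
  interpret NB: noetherian_cring B by (intro noetherian_cring.intro noeth is_cring)
  interpret V: module B DerV by (rule DerV_module)
  interpret mm: primeideal F.\<mm> B by (rule F.mm_prime)
  interpret V: local_module B DerV F.\<mm>
    unfolding local_module_def module_at_prime_def local_module_axioms_def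
    using V.module_axioms F.mm_prime F.unit_of_not_mm by blast
  let ?P = "\<lambda>M. 0 < M \<and> pDer M \<subseteq> IDer class_ring B \<infinity>"
  obtain M0 where M0: "M0 > 0" "ideal_power F.\<mm> M0 \<subseteq> integrating_ideal"
    using NB.ideal_power_sub_of_unique_prime[OF F.mm_prime F.unit_of_not_mm integrating_ideal only] by blast
  have "pDer M0 \<subseteq> IDer class_ring B \<infinity>"
  proof -
    interpret Q: quotient_module B DerV "ideal_power F.\<mm> M0"
      by (intro quotient_module.intro V.module_axioms ideal_power_ideal F.mm_ideal)
    show ?thesis
    proof (rule Q.ideal_smult_least[OF IDer_closed])
      fix a v assume "a \<in> ideal_power F.\<mm> M0" "v \<in> carrier DerV"
      then show "a \<odot>\<^bsub>DerV\<^esub> v \<in> IDer class_ring B \<infinity>"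
        using M0(2) unfolding integrating_ideal_def DerV_simps by blast
    qed simp
  qed
  then have "?P M0" using M0(1) by blast
  define M where "M = (LEAST M. ?P M)"
  have M: "?P M" unfolding M_def by (rule LeastI) (rule \<open>?P M0\<close>)
  have least: "M \<le> M'" if "?P M'" for M' unfolding M_def by (rule Least_le) (rule that)
  let ?J = "ideal_power F.\<mm> M"
  have J: "ideal ?J B" by (rule ideal_power_ideal[OF F.mm_ideal])
  obtain m where m: "M = Suc m" using M by (cases M) auto
  have Jm: "?J \<subseteq> F.\<mm>" using ideal_power_sub(2)[OF F.mm_ideal, of m] unfolding m .
  interpret Q: quotient_module B DerV ?J by (intro quotient_module.intro V.module_axioms J)
  obtain G where G: "finite G" "G \<subseteq> carrier DerV" "\<And>N. V.closed_submodule N \<Longrightarrow> G \<subseteq> N \<Longrightarrow> N = carrier DerV"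
    using Der_finitely_generated by (elim exE conjE) (rule that, auto)
  have "\<exists>W. V.finite_length_over (pDer M) W \<and> G \<subseteq> W"
  proof (rule V.finite_length_over_reach_finite[OF noeth V.local_submodule_of_closed[OF Q.ideal_smult_closed] _ G(1,2)])
    fix q v assume "q \<in> F.\<mm>" "v \<in> carrier DerV"
    then show "\<exists>i::nat. q [^] i \<odot>\<^bsub>DerV\<^esub> v \<in> pDer M"
      using Q.smult_mem[OF power_mem_ideal_power[OF F.mm_ideal]] by blast
  qed
  then obtain l W w where cs: "V.comp_series (pDer M) l W w" and GW: "G \<subseteq> W l"
    unfolding V.finite_length_over_def by blast
  have "V.closed_submodule (W l)"
    using V.comp_series_submodule[OF cs, of l] unfolding V.local_submodule_def V.closed_submodule_def by simp
  then have top: "W l = carrier DerV" using G(3) GW by blast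
  let ?T = "Leaps class_ring B"
  let ?\<Phi> = "\<lambda>s::nat. IDer class_ring B (enat s)"
  have T: "s \<in> ?T \<Longrightarrow> 1 < s \<and> ?\<Phi> s \<subset> ?\<Phi> (s - 1)" for s by (simp add: Leaps_def)
  have closed: "V.closed_submodule (?\<Phi> s)" if "1 \<le> s" for s
    using that by (intro IDer_closed) (simp add: one_enat_def)
  have \<Phi>1: "V.closed_submodule (?\<Phi> s)" "V.closed_submodule (?\<Phi> (s - 1))" if "s \<in> ?T" for s
  proof -
    have "1 \<le> s" "1 \<le> s - 1" using T[OF that] by linarith+
    then show "V.closed_submodule (?\<Phi> s)" "V.closed_submodule (?\<Phi> (s - 1))" using closed by blast+
  qed
  have \<Phi>2: "pDer M \<subseteq> ?\<Phi> s" for s using M IDer_antimono[of "enat s" \<infinity>] by auto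
  have anti: "?\<Phi> (t - 1) \<subseteq> ?\<Phi> s" if "s < t" for s t using that by (intro IDer_antimono) auto
  have fin: "finite ?T" by (rule V.finite_jumps[where \<Phi> = "?\<Phi>", OF cs top])
      (use V.local_submodule_of_closed \<Phi>1 \<Phi>2 anti T in blast)+
  have "vectorspace.fin_dim ((B Quot ?J)\<lparr>carrier := L\<rparr>) (quot_module B ?J DerV) \<and>
    card ?T \<le> vectorspace.dim ((B Quot ?J)\<lparr>carrier := L\<rparr>) (quot_module B ?J DerV)"
    if L: "coefficient_field B F.\<mm> ?J L" for L
  proof -
    have fd: "vectorspace.fin_dim ((B Quot ?J)\<lparr>carrier := L\<rparr>) (quot_module B ?J DerV)"
      by (rule V.fin_dim_of_comp_series[OF J Jm L cs top])
    have sub: "subfield L (B Quot ?J)" using L by (simp add: coefficient_field_def)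
    have "?\<Phi> (s - 1) \<subseteq> carrier DerV" for s unfolding DerV_simps by (rule IDer_sub_Der)
    then show ?thesis
      using Q.card_jumps_le_dim[where \<Phi> = "?\<Phi>" and T = ?T, OF sub fd \<Phi>1(1) \<Phi>2 anti _ _ fin] T fd by blast
  qed
  then show ?thesis using M least fin by (intro exI[of _ M]) blast
qed

end

section \<open>The localization as a local quotient of the polynomial ring\<close>

lemma (in prime_fraction_map) fraction_map_algebra_of_hom:
  "prime_fraction_map A (algebra_of_hom \<chi> B) I P \<theta>"
proof -
  have U: "Units (algebra_of_hom \<chi> B) = Units B" by (simp add: Units_def)
  have h: "\<theta> \<in> Ring.ring_hom A (algebra_of_hom \<chi> B)" using hom by (simp add: Ring.ring_hom_def)
  show ?thesis by (intro prime_fraction_map.intro fraction_map.intro A.is_cring cring_algebra_of_hom B.is_cring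
        fraction_map_axioms.intro h P.primeideal_axioms prime_fraction_map_axioms.intro I_sub)
      (use S_sub units surj kernel S_mult S_one U in auto)
qed

lemma prime_fraction_map_of_quotient:
  assumes R: "cring R" and \<pi>: "\<pi> \<in> Ring.ring_hom R A" and \<pi>_surj: "\<pi> ` carrier R = carrier A"
    and \<pi>_ker: "\<And>f. f \<in> carrier R \<Longrightarrow> \<pi> f = \<zero>\<^bsub>A\<^esub> \<longleftrightarrow> f \<in> I" and I: "I \<subseteq> carrier R"
    and \<psi>: "prime_fraction_map A B {\<zero>\<^bsub>A\<^esub>} p \<psi>"
  shows "prime_fraction_map R B I {f \<in> carrier R. \<pi> f \<in> p} (\<lambda>f. \<psi> (\<pi> f))"
proof -
  interpret F: prime_fraction_map A B "{\<zero>\<^bsub>A\<^esub>}" p \<psi> by (rule \<psi>)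
  \<comment> \<open>with \<open>S\<close> the complement of a prime this rule reduces membership in the carrier to itself\<close>
  note F.S_carr [simp del]
  interpret R: cring R by (rule R)
  interpret \<pi>: ring_hom_ring R A \<pi> by (intro ring_hom_ringI2 R.ring_axioms F.A.ring_axioms \<pi>)
  let ?P = "{f \<in> carrier R. \<pi> f \<in> p}"
  have P: "primeideal ?P R" by (rule \<pi>.primeideal_vimage[OF R F.P.primeideal_axioms])
  interpret P: primeideal ?P R by (rule P)
  have lift: "\<exists>f\<in>carrier R. a = \<pi> f" if "a \<in> carrier A" for a using that \<pi>_surj by blast
  have ax: "fraction_map_axioms R B I (carrier R - ?P) (\<lambda>f. \<psi> (\<pi> f))"
  proof
    show "(\<lambda>f. \<psi> (\<pi> f)) \<in> Ring.ring_hom R B"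
    proof (rule ring_hom_memI)
      fix f g assume "f \<in> carrier R" "g \<in> carrier R"
      then have fg: "\<pi> f \<in> carrier A" "\<pi> g \<in> carrier A" "\<pi> (f \<otimes>\<^bsub>R\<^esub> g) = \<pi> f \<otimes>\<^bsub>A\<^esub> \<pi> g"
        "\<pi> (f \<oplus>\<^bsub>R\<^esub> g) = \<pi> f \<oplus>\<^bsub>A\<^esub> \<pi> g" using \<pi>.hom_closed \<pi>.hom_mult \<pi>.hom_add by blast+
      show "\<psi> (\<pi> f) \<in> carrier B" by (rule F.hom_closed[OF fg(1)])
      show "\<psi> (\<pi> (f \<otimes>\<^bsub>R\<^esub> g)) = \<psi> (\<pi> f) \<otimes>\<^bsub>B\<^esub> \<psi> (\<pi> g)"
        unfolding fg(3) by (rule F.hom_simps(1)[OF fg(1,2)])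
      show "\<psi> (\<pi> (f \<oplus>\<^bsub>R\<^esub> g)) = \<psi> (\<pi> f) \<oplus>\<^bsub>B\<^esub> \<psi> (\<pi> g)"
        unfolding fg(4) by (rule F.hom_simps(2)[OF fg(1,2)])
    qed (simp add: F.hom_simps(3))
    show "\<psi> (\<pi> s) \<in> Units B" if s: "s \<in> carrier R - ?P" for s
    proof (rule F.units)
      show "\<pi> s \<in> carrier A - p" using s \<pi>.hom_closed by blast
    qed
    show "\<exists>a\<in>carrier R. \<exists>s\<in>carrier R - ?P. \<psi> (\<pi> s) \<otimes>\<^bsub>B\<^esub> b = \<psi> (\<pi> a)" if b: "b \<in> carrier B" for b
    proof -
      obtain a s where a: "a \<in> carrier A" "s \<in> carrier A - p" "\<psi> s \<otimes>\<^bsub>B\<^esub> b = \<psi> a" using F.surj[OF b] by blast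
      obtain a' where a': "a' \<in> carrier R" "a = \<pi> a'" using lift[OF a(1)] by blast
      have "s \<in> carrier A" using a(2) by (rule DiffD1)
      then obtain s' where s': "s' \<in> carrier R" "s = \<pi> s'" using lift by metis
      have "s' \<in> carrier R - ?P" using a(2) s' by blast
      then show ?thesis using a(3) a' s'(2) by blast
    qed
    show "\<psi> (\<pi> f) = \<zero>\<^bsub>B\<^esub> \<longleftrightarrow> (\<exists>s\<in>carrier R - ?P. s \<otimes>\<^bsub>R\<^esub> f \<in> I)" if f: "f \<in> carrier R" for f
    proof -
      have "s \<otimes>\<^bsub>R\<^esub> f \<in> I \<longleftrightarrow> \<pi> s \<otimes>\<^bsub>A\<^esub> \<pi> f = \<zero>\<^bsub>A\<^esub>" if "s \<in> carrier R" for s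
        using \<pi>_ker[OF R.m_closed[OF that f]] unfolding \<pi>.hom_mult[OF that f] by blast
      moreover have "\<psi> (\<pi> f) = \<zero>\<^bsub>B\<^esub> \<longleftrightarrow> (\<exists>s\<in>carrier A - p. s \<otimes>\<^bsub>A\<^esub> \<pi> f = \<zero>\<^bsub>A\<^esub>)"
        using F.kernel[OF \<pi>.hom_closed[OF f]] by blast
      moreover have "(\<exists>s\<in>carrier A - p. s \<otimes>\<^bsub>A\<^esub> \<pi> f = \<zero>\<^bsub>A\<^esub>) \<longleftrightarrow> (\<exists>s\<in>carrier R - ?P. \<pi> s \<otimes>\<^bsub>A\<^esub> \<pi> f = \<zero>\<^bsub>A\<^esub>)"
        using lift \<pi>.hom_closed by blast
      ultimately show ?thesis by blast
    qed
    show "s \<otimes>\<^bsub>R\<^esub> t \<in> carrier R - ?P" if "s \<in> carrier R - ?P" "t \<in> carrier R - ?P" for s t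
      using that P.I_prime[of s t] R.m_closed[of s t] by blast
    show "\<one>\<^bsub>R\<^esub> \<in> carrier R - ?P" unfolding Diff_iff mem_Collect_eq \<pi>.hom_one using F.S_one R.one_closed by blast
  qed (rule Diff_subset)
  have "I \<subseteq> ?P"
  proof
    fix f assume f: "f \<in> I"
    then have "f \<in> carrier R" "\<pi> f = \<zero>\<^bsub>A\<^esub>" using I \<pi>_ker by blast+
    then show "f \<in> ?P" using F.I_sub unfolding mem_Collect_eq by blast
  qed
  then show ?thesis
    by (intro prime_fraction_map.intro fraction_map.intro R F.B.is_cring ax P prime_fraction_map_axioms.intro)
qed

lemma loc_algebra_local_quotient:
  fixes n :: nat and I :: "'k::comm_ring_1 mpoly set"
  assumes k: "noetherian_ring (class_ring :: 'k ring)" and I: "ideal I (mpoly_ring n)"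
    and p: "primeideal p (mpoly_quot_algebra n I)"
  defines "A \<equiv> mpoly_quot_algebra n I" and "\<pi> \<equiv> \<lambda>f. I +>\<^bsub>mpoly_ring n\<^esub> f"
  defines "\<psi> \<equiv> \<lambda>a. fraction A (carrier A - p) a \<one>\<^bsub>A\<^esub>"
  shows "prime_fraction_map A (loc_algebra A p) {\<zero>\<^bsub>A\<^esub>} p \<psi>"
    and "local_quotient n I {f \<in> mpolys n. \<pi> f \<in> p} (loc_algebra A p) (\<lambda>f. \<psi> (\<pi> f))"
    and "\<pi> ` mpolys n = carrier A"
    and "fraction_map.extend (loc_algebra A p)
      (mpolys n - {f \<in> mpolys n. \<pi> f \<in> p}) (\<lambda>f. \<psi> (\<pi> f)) {f \<in> mpolys n. \<pi> f \<in> p} = loc_max_ideal A p"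
proof -
  let ?R = "mpolys.ring_of n :: 'k mpoly ring" and ?P = "{f \<in> mpolys n. \<pi> f \<in> p}"
  interpret p: primeideal p A using p by (simp add: A_def)
  have R: "cring ?R" by (rule mpolys.ring_of_cring)
  interpret R: cring ?R by (rule R)
  interpret I: ideal I ?R using I by (simp add: mpoly_ring_eq)
  have ops: "carrier A = carrier (?R Quot I)" "mult A = mult (?R Quot I)" "add A = add (?R Quot I)"
    "\<one>\<^bsub>A\<^esub> = \<one>\<^bsub>?R Quot I\<^esub>" "\<zero>\<^bsub>A\<^esub> = \<zero>\<^bsub>?R Quot I\<^esub>" by (simp_all add: A_def mpoly_quot_algebra_def mpoly_ring_eq)
  have \<pi>_def': "\<pi> = (\<lambda>f. I +>\<^bsub>?R\<^esub> f)" by (simp add: \<pi>_def mpoly_ring_eq)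
  have \<pi>: "\<pi> \<in> Ring.ring_hom ?R A" using I.rcos_ring_hom unfolding \<pi>_def' by (simp add: Ring.ring_hom_def ops)
  show surj: "\<pi> ` mpolys n = carrier A" by (auto simp: ops \<pi>_def' FactRing_def A_RCOSETS_def')
  have ker: "\<pi> f = \<zero>\<^bsub>A\<^esub> \<longleftrightarrow> f \<in> I" if f: "f \<in> carrier ?R" for f
  proof -
    have "\<pi> f = \<zero>\<^bsub>A\<^esub> \<longleftrightarrow> I +>\<^bsub>?R\<^esub> f = I" by (simp add: ops \<pi>_def' FactRing_def)
    also have "\<dots> \<longleftrightarrow> f \<in> I" using R.a_coset_join1[OF _ f I.a_subgroup] R.a_coset_join2[OF f I.a_subgroup] by blast
    finally show ?thesis .
  qed
  let ?L = "localization A (carrier A - p)"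
  let ?\<chi> = "\<lambda>c. fraction A (carrier A - p) (c \<odot>\<^bsub>A\<^esub> \<one>\<^bsub>A\<^esub>) \<one>\<^bsub>A\<^esub>"
  interpret S: multiplicative_set A "carrier A - p" by (rule multiplicative_set_compl[OF p.primeideal_axioms])
  interpret F0: prime_fraction_map A ?L "{\<zero>\<^bsub>A\<^esub>}" p \<psi>
    unfolding \<psi>_def by (rule localization_prime_fraction_map[OF p.primeideal_axioms])
  let ?B = "loc_algebra A p"
  have B: "?B = algebra_of_hom ?\<chi> ?L" by (simp add: loc_algebra_def)
  show F1: "prime_fraction_map A ?B {\<zero>\<^bsub>A\<^esub>} p \<psi>" unfolding B by (rule F0.fraction_map_algebra_of_hom)
  interpret F1: prime_fraction_map A ?B "{\<zero>\<^bsub>A\<^esub>}" p \<psi> by (rule F1)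
  have F: "prime_fraction_map ?R ?B I ?P (\<lambda>f. \<psi> (\<pi> f))"
    using prime_fraction_map_of_quotient[OF R \<pi> _ ker I.a_subset F1] surj by simp
  interpret F: prime_fraction_map ?R ?B I ?P "\<lambda>f. \<psi> (\<pi> f)" by (rule F)
  have cst_A: "c \<odot>\<^bsub>A\<^esub> \<one>\<^bsub>A\<^esub> = \<pi> (cst c)" for c
  proof -
    have "\<pi> (cst c) \<in> carrier A" using surj by auto
    moreover have "c \<odot>\<^bsub>A\<^esub> \<one>\<^bsub>A\<^esub> = \<pi> (cst c) \<otimes>\<^bsub>A\<^esub> \<one>\<^bsub>A\<^esub>" by (simp add: A_def mpoly_quot_algebra_def \<pi>_def)
    ultimately show ?thesis by simp
  qed
  have \<chi>: "?\<chi> c = \<psi> (\<pi> (cst c))" for c unfolding cst_A by (simp add: \<psi>_def)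
  show "local_quotient n I ?P ?B (\<lambda>f. \<psi> (\<pi> f))"
  proof (rule local_quotient.intro)
    show "noetherian_subring (mpolys n :: 'k mpoly set)" by (rule noetherian_mpolys[OF k])
    show "prime_fraction_map ?R ?B I ?P (\<lambda>f. \<psi> (\<pi> f))" by (rule F)
    show "mpolys.idl n I" using I.ideal_axioms by (simp add: mpolys.idl_iff_ideal)
    show "c \<odot>\<^bsub>?B\<^esub> b = \<psi> (\<pi> (cst c)) \<otimes>\<^bsub>?B\<^esub> b" for c b by (simp only: B algebra_of_hom_simps \<chi>)
    have "(\<lambda>c. \<psi> (\<pi> (cst c))) \<in> Ring.ring_hom (class_ring :: 'k ring) ?L"
    proof (rule ring_hom_memI)
      fix c d :: 'k
      have h: "\<psi> (\<pi> (f * g)) = \<psi> (\<pi> f) \<otimes>\<^bsub>?L\<^esub> \<psi> (\<pi> g)" "\<psi> (\<pi> (f + g)) = \<psi> (\<pi> f) \<oplus>\<^bsub>?L\<^esub> \<psi> (\<pi> g)"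
        if "f \<in> mpolys n" "g \<in> mpolys n" for f g using F.hom_simps(1,2)[of f g] that by (simp_all add: B)
      show "\<psi> (\<pi> (cst c)) \<in> carrier ?L" using F.hom_closed[of "cst c"] by (simp add: B)
      show "\<psi> (\<pi> (cst (c \<otimes>\<^bsub>class_ring\<^esub> d))) = \<psi> (\<pi> (cst c)) \<otimes>\<^bsub>?L\<^esub> \<psi> (\<pi> (cst d))"
        using h(1)[of "cst c" "cst d"] by (simp add: mult_single)
      show "\<psi> (\<pi> (cst (c \<oplus>\<^bsub>class_ring\<^esub> d))) = \<psi> (\<pi> (cst c)) \<oplus>\<^bsub>?L\<^esub> \<psi> (\<pi> (cst d))"
        using h(2)[of "cst c" "cst d"] by (simp add: single_add)
      show "\<psi> (\<pi> (cst \<one>\<^bsub>class_ring\<^esub>)) = \<one>\<^bsub>?L\<^esub>" using F.hom_simps(3) by (simp add: B)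
    qed
    then show "algebra (class_ring :: 'k ring) ?B"
      unfolding B \<chi>
      by (intro algebra_algebra_of_hom F0.B.is_cring) (use subring_set.ring_of_cring[of "UNIV :: 'k set"] in
        \<open>auto simp: subring_set_def\<close>)
  qed
  have "F.extend ?P = loc_max_ideal A p"
  proof (intro equalityI subsetI)
    have mm: "\<psi> s \<otimes>\<^bsub>?B\<^esub> fraction A (carrier A - p) a s = \<psi> a" "fraction A (carrier A - p) a s \<in> carrier ?B"
      if "a \<in> carrier A" "s \<in> carrier A - p" for a s
    proof -
      have "\<psi> s \<otimes>\<^bsub>?L\<^esub> fraction A (carrier A - p) a s = fraction A (carrier A - p) (s \<otimes>\<^bsub>A\<^esub> a) (\<one>\<^bsub>A\<^esub> \<otimes>\<^bsub>A\<^esub> s)"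
        unfolding \<psi>_def using that F0.S_one by (intro S.L_mult) auto
      also have "\<dots> = \<psi> a" unfolding \<psi>_def using that F0.S_one by (intro S.fraction_eqI) (auto simp: p.m_ac)
      finally show "\<psi> s \<otimes>\<^bsub>?B\<^esub> fraction A (carrier A - p) a s = \<psi> a" by (simp add: B)
      show "fraction A (carrier A - p) a s \<in> carrier ?B" using that by (simp add: B)
    qed
    have iff: "fraction A (carrier A - p) a s \<in> F.extend ?P \<longleftrightarrow> a \<in> p" if as: "a \<in> carrier A" "s \<in> carrier A - p" for a s
    proof -
      have "a \<in> \<pi> ` mpolys n" "s \<in> \<pi> ` mpolys n" unfolding surj using as by simp_all
      then obtain a' s' where "a' \<in> mpolys n" "a = \<pi> a'" "s' \<in> mpolys n" "s = \<pi> s'" by (elim imageE)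
      then show ?thesis using F.mm_iff[of "fraction A (carrier A - p) a s" s' a'] mm[OF as] as by simp
    qed
    fix b
    show "b \<in> loc_max_ideal A p" if b: "b \<in> F.extend ?P"
    proof -
      have "b \<in> carrier ?L" using b unfolding F.extend_def by (simp add: B)
      then obtain a s where "a \<in> carrier A" "s \<in> carrier A - p" "b = fraction A (carrier A - p) a s"
        using S.L_carrier by blast
      then show ?thesis using iff b by (auto simp: loc_max_ideal_def)
    qed
    show "b \<in> F.extend ?P" if "b \<in> loc_max_ideal A p" using that iff p.Icarr by (auto simp: loc_max_ideal_def)
  qed
  then show "fraction_map.extend ?B (mpolys n - ?P) (\<lambda>f. \<psi> (\<pi> f)) ?P = loc_max_ideal A p" by simp
qed

section \<open>Finiteness of the set of leaps\<close>

lemma conormal_minor_power: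
  fixes n r :: nat and I :: "'k::comm_ring_1 mpoly set" and g :: "nat \<Rightarrow> 'k mpoly"
  assumes k: "noetherian_ring (class_ring :: 'k ring)" and I: "ideal I (mpoly_ring n)"
    and cases: "(\<exists>f. (\<forall>i<r. f i \<in> carrier (mpoly_ring n)) \<and> I = Idl\<^bsub>mpoly_ring n\<^esub> (f ` {..<r})) \<or>
       (regular_ring (class_ring :: 'k ring) \<and> enat r = Max (height (mpoly_ring n) ` min_primes (mpoly_ring n) I))"
    and g: "\<And>i. i < r \<Longrightarrow> g i \<in> I"
    and \<Delta>: "\<Delta> = det (mat r r (\<lambda>(i, l). mpoly_pderiv (c l) (g i)))"
  shows "\<exists>N. \<forall>h\<in>I. \<Delta> ^ N * h \<in> mpolys.gen n (g ` {..<r} \<union> {a * b |a b. a \<in> I \<and> b \<in> I})"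
  using cases
proof (elim disjE exE conjE)
  fix f assume f: "\<forall>i<r. f i \<in> carrier (mpoly_ring n)" and If: "I = Idl\<^bsub>mpoly_ring n\<^esub> (f ` {..<r})"
  have fR: "f i \<in> mpolys n" if "i < r" for i using f that by (simp add: mpoly_ring_eq)
  have "I = mpolys.gen n (f ` {..<r})"
    using mpolys.gen_eq_genideal[of "f ` {..<r}" n] fR If by (auto simp: mpoly_ring_eq)
  then show ?thesis using conormal_complete_intersection[OF fR _ g _ \<Delta>] by (intro exI[of _ 1]) simp
next
  assume reg: "regular_ring (class_ring :: 'k ring)" and ht: "enat r = Max (height (mpoly_ring n) ` min_primes (mpoly_ring n) I)"
  interpret U: noetherian_subring "UNIV :: 'k set" by (rule noetherian_subring_UNIV[OF k])
  interpret N: noetherian_subring "mpolys n :: 'k mpoly set" by (rule noetherian_mpolys[OF k])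
  interpret NR: noetherian_cring "mpoly_ring n :: 'k mpoly ring"
    using N.noetherian_cring_ring_of by (simp add: mpoly_ring_eq)
  have ring_of_UNIV: "(class_ring :: 'k ring)\<lparr>carrier := UNIV\<rparr> = class_ring" by simp
  have "U.regular_at q" if q: "U.prm q" for q using U.regular_at_of_regular_localization[OF q] reg q
    unfolding regular_ring_def U.prm_iff_primeideal ring_of_UNIV by simp
  then have "noetherian_subring.regular_at (mpolys n) Q" if "mpolys.prm n Q" for Q :: "'k mpoly set"
    using regular_mpolys[OF k _ that] by blast
  moreover have "height (mpoly_ring n) P \<le> enat r" if "P \<in> min_primes (mpoly_ring n) I" for P
    unfolding ht using that NR.finite_min_primes[OF I] by (intro Max_ge) auto
  moreover have "mpolys.idl n I" using I by (simp add: mpolys.idl_iff_ideal mpoly_ring_eq)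
  ultimately show ?thesis using conormal_regular[OF N.noetherian_subring_axioms _ _ _ g \<Delta>] by blast
qed

theorem theorem6p1:
  fixes n r :: nat
    and I F :: "'k::comm_ring_1 mpoly set"
    and p :: "'k mpoly set set"
  defines "k \<equiv> class_ring :: 'k ring"
    and "R \<equiv> mpoly_ring n :: 'k mpoly ring"
    and "A \<equiv> mpoly_quot_algebra n I"
  defines "Ap \<equiv> loc_algebra A p"
    and "\<pp> \<equiv> loc_max_ideal A p"
  defines "\<pp>pow \<equiv> \<lambda>M::nat. \<pp> [^]\<^bsub>ideals_set Ap\<^esub> M"
  defines "pDer \<equiv> \<lambda>M. ideal_smult Ap (\<pp>pow M) (Der_module k Ap)"
    and "V \<equiv> \<lambda>M. quot_module Ap (\<pp>pow M) (Der_module k Ap)"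
    and "K \<equiv> \<lambda>M L. (Ap Quot (\<pp>pow M))\<lparr>carrier := L\<rparr>"
  assumes k_noetherian: "noetherian_ring k"
    and k_contains_field: "\<exists>k\<^sub>0. subfield k\<^sub>0 k"
    and I_ideal: "ideal I R"
    and F_generates: "F \<subseteq> carrier R" "I = Idl\<^bsub>R\<^esub> F"
    and p_minimal: "p \<in> min_primes A (jacobian_ideal n r I F)"
    and cases:
      "(\<exists>f. (\<forall>i<r. f i \<in> carrier R) \<and> I = Idl\<^bsub>R\<^esub> (f ` {..<r})) \<or>
       (regular_ring k \<and> radical_ideal I R \<and> enat r = Max (height R ` min_primes R I))"
  shows "\<exists>M. 0 < M \<and> pDer M \<subseteq> IDer k Ap \<infinity> \<and>
           (\<forall>M'. 0 < M' \<and> pDer M' \<subseteq> IDer k Ap \<infinity> \<longrightarrow> M \<le> M') \<and>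
           finite (Leaps k Ap) \<and>
           (\<forall>L. coefficient_field Ap \<pp> (\<pp>pow M) L \<longrightarrow>
              vectorspace.fin_dim (K M L) (V M) \<and>
              card (Leaps k Ap) \<le> vectorspace.dim (K M L) (V M))"
proof -
  note k_noeth = k_noetherian[unfolded k_def] and I_id = I_ideal[unfolded R_def]
  have p: "primeideal p (mpoly_quot_algebra n I)" using p_minimal by (simp add: min_primes_def A_def)
  define \<pi> where "\<pi> = (\<lambda>f. I +>\<^bsub>mpoly_ring n\<^esub> f)"
  define \<psi> where "\<psi> = (\<lambda>a. fraction A (carrier A - p) a \<one>\<^bsub>A\<^esub>)"
  let ?P = "{f \<in> mpolys n. \<pi> f \<in> p}" and ?\<theta> = "\<lambda>f. \<psi> (\<pi> f)"
  have l: "prime_fraction_map A Ap {\<zero>\<^bsub>A\<^esub>} p \<psi>" "local_quotient n I ?P Ap ?\<theta>" "\<pi> ` mpolys n = carrier A"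
    "fraction_map.extend Ap (mpolys n - ?P) ?\<theta> ?P = \<pp>"
    unfolding \<pi>_def \<psi>_def \<pp>_def Ap_def A_def by (rule loc_algebra_local_quotient[OF k_noeth I_id p])+
  interpret F1: prime_fraction_map A Ap "{\<zero>\<^bsub>A\<^esub>}" p \<psi> by (rule l(1))
  interpret local_quotient n I ?P Ap ?\<theta> by (rule l(2))
  have mm: "F.\<mm> = \<pp>" using l(4) by simp
  have FR: "F \<subseteq> mpolys n" using F_generates(1) by (simp add: R_def mpoly_ring_eq)
  have I_gen: "I = mpolys.gen n F"
    using mpolys.gen_eq_genideal[OF FR] F_generates(2) by (simp add: R_def mpoly_ring_eq)
  have FI: "F \<subseteq> I" using mpolys.gen_upper I_gen by blast
  have minor: "\<exists>e. ?\<theta> (\<Delta> ^ e) \<in> integrating_ideal" if minor: "\<Delta> \<in> jacobian_minors n r F" for \<Delta>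
  proof -
    obtain g c where \<Delta>: "\<Delta> = det (mat r r (\<lambda>(i, j). mpoly_pderiv (c j) (g i)))"
      and g: "g ` {..<r} \<subseteq> F" and c: "c ` {..<r} \<subseteq> {..<n}" using minor by (auto simp: jacobian_minors_def)
    have gI: "g i \<in> I" if "i < r" for i using g FI that by blast
    have cn: "c j < n" if "j < r" for j using c that by blast
    have \<Delta>R: "\<Delta> \<in> mpolys n" unfolding \<Delta>
      by (rule mpolys.det_mem) (use gI mpolys.idlD(3)[OF I_idl] pderiv_mem in blast)
    obtain N where "\<forall>h\<in>I. \<Delta> ^ N * h \<in> mpolys.gen n (g ` {..<r} \<union> {a * b |a b. a \<in> I \<and> b \<in> I})"
      using conormal_minor_power[OF k_noeth I_id _ gI \<Delta>] cases unfolding k_def R_def by blast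
    then obtain e where "\<forall>\<delta>\<in>Der class_ring Ap. (\<lambda>x\<in>carrier Ap. ?\<theta> (\<Delta> ^ e) \<otimes>\<^bsub>Ap\<^esub> \<delta> x) \<in> IDer class_ring Ap \<infinity>"
      using minor_power_integrates[OF gI cn \<Delta>] by blast
    then show ?thesis using \<theta>_closed[of "\<Delta> ^ e"] \<Delta>R by (auto simp: integrating_ideal_def)
  qed
  \<comment> \<open>a prime above the integrating ideal contains all minors, hence contracts to \<open>p\<close> by minimality\<close>
  have "Q = \<pp>" if Q: "primeideal Q Ap" and sub: "integrating_ideal \<subseteq> Q" for Q
  proof -
    interpret Q: primeideal Q Ap by (rule Q)
    have Qm: "Q \<subseteq> \<pp>" using F.prime_sub_mm[OF Q] mm by simp
    define q where "q = F1.contract Q"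
    have q: "primeideal q A" unfolding q_def by (rule F1.contract_prime(1)[OF Q])
    have qp: "q \<subseteq> p" using F1.prime_sub_mm[OF Q] F1.mm_hom_iff unfolding q_def F1.contract_def by blast
    have \<Delta>q: "\<pi> \<Delta> \<in> q" if \<Delta>: "\<Delta> \<in> jacobian_minors n r F" for \<Delta>
    proof -
      have \<Delta>R: "\<Delta> \<in> mpolys n" using \<Delta> FR by (auto simp: jacobian_minors_def intro!: mpolys.det_mem pderiv_mem)
      obtain e where "?\<theta> (\<Delta> ^ e) \<in> Q" using minor[OF \<Delta>] sub by blast
      then have "?\<theta> \<Delta> \<in> Q"
      proof (induction e)
        case 0
        then show ?case using Q.I_notcarr Q.one_imp_carrier by (simp add: \<theta>_simps)
      next
        case (Suc e)
        then show ?case using Q.I_prime[of "?\<theta> \<Delta>" "?\<theta> (\<Delta> ^ e)"] \<theta>_closed \<Delta>R by (auto simp: \<theta>_simps)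
      qed
      moreover have "\<pi> \<Delta> \<in> carrier A" using l(3) \<Delta>R by blast
      ultimately show ?thesis by (simp add: q_def F1.contract_def)
    qed
    have "jacobian_ideal n r I F \<subseteq> q"
    proof -
      interpret R: cring "mpoly_ring n :: 'k mpoly ring" using mpolys.ring_of_cring by (simp add: mpoly_ring_eq)
      interpret I: ideal I "mpoly_ring n" by (rule I_id)
      interpret RI: cring "mpoly_ring n Quot I" by (rule I.quotient_is_cring[OF R.is_cring])
      have h: "\<psi> \<in> Ring.ring_hom (mpoly_ring n Quot I) Ap"
        using F1.hom by (simp add: Ring.ring_hom_def A_def mpoly_quot_algebra_def)
      interpret h: ring_hom_ring "mpoly_ring n Quot I" Ap \<psi>
        by (intro ring_hom_ringI2 RI.ring_axioms F1.B.ring_axioms h)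
      have "q = {a \<in> carrier (mpoly_ring n Quot I). \<psi> a \<in> Q}"
        unfolding q_def F1.contract_def by (simp add: A_def mpoly_quot_algebra_def)
      then have "ideal q (mpoly_ring n Quot I)" using h.ideal_vimage[OF Q.is_ideal] by simp
      then show ?thesis unfolding jacobian_ideal_def
        by (rule RI.genideal_minimal) (use \<Delta>q in \<open>auto simp: \<pi>_def\<close>)
    qed
    then have "q = p" using p_minimal q qp unfolding min_primes_def by blast
    then have "F1.contract F1.\<mm> \<subseteq> F1.contract Q" using F1.mm_hom_iff unfolding q_def F1.contract_def by blast
    moreover have "F.\<mm> \<subseteq> F1.\<mm>" by (rule F1.ideal_sub_mm[OF F.mm_ideal F.one_not_mm])
    ultimately show "Q = \<pp>" using F1.contract_inj[OF F1.mm_ideal Q.is_ideal] Qm mm by blast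
  qed
  then show ?thesis using leaps_bound unfolding mm pDer_def V_def K_def \<pp>pow_def k_def by blast
qed

end
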